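(* Let $H$ and $K$ be finite-dimensional Hopf algebras over a field $\Bbbk$ with a Hopf pairing $\sigma:K^\ast\otimes H\to\Bbbk$. Suppose that the Hopf algebra map $\sigma_r:H\to K$, $h\mapsto\sigma(-,h)$, is surjective. Then there exist tensor equivalences $$\mathcal{Z}_{\mathsf{Rep}(K)}(\mathsf{Rep}(H))\approx\mathsf{Rep}(K^{\ast\mathrm{cop}}\bowtie_\sigma H)\approx{}_H\mathfrak{YD}^K.$$
   Context: Conventions. Vector spaces are over $\Bbbk$, $\otimes=\otimes_\Bbbk$; $\langle-,-\rangle$ is evaluation; $S$ denotes antipodes, $\varepsilon$ counits (also unit elements of dual Hopf algebras). Identify $(K^\ast)^\ast=K$. Sweedler notation refers to the coproducts of $H,K,H^\ast,K^\ast$ themselves. $\mathsf{Rep}(A)$ is the tensor category of finite-dimensional left $A$-modules. Hopf pairing: $\sigma(aa',h)=\sum\sigma(a,h_{(1)})\sigma(a',h_{(2)})$, $\sigma(a,hh')=\sum\sigma(a_{(1)},h)\sigma(a_{(2)},h')$, $\sigma(1,h)=\varepsilon(h)$, $\sigma(a,1)=\varepsilon(a)$. Relative center. Let $\mathcal D$ be a tensor subcategory of a finite tensor category $\mathcal C$ (associativity constraints suppressed). Objects of $\mathcal Z_{\mathcal D}(\mathcal C)$ are pairs $(X,c)$ with $X\in\mathcal C$ and $c$ a natural family of isomorphisms $c_Y:X\otimes Y\to Y\otimes X$ $(Y\in\mathcal D)$ such that $(\mathrm{id}_Y\otimes c_{Y'})\circ(c_Y\otimes\mathrm{id}_{Y'})=c_{Y\otimes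 Y'}$ for all $Y,Y'\in\mathcal D$; morphisms $(X,c)\to(X',c')$ are $f\in\mathrm{Hom}_{\mathcal C}(X,X')$ with $(\mathrm{id}_Y\otimes f)c_Y=c'_Y(f\otimes\mathrm{id}_Y)$ for all $Y\in\mathcal D$; the tensor product is $(X,c)\otimes(X',c')=(X\otimes X',\tilde c)$ with $\tilde c_Y=(c_Y\otimes\mathrm{id}_{X'})(\mathrm{id}_X\otimes c'_Y)$. When $\sigma_r$ is surjective, $\mathsf{Rep}(K)$ is identified with a tensor subcategory of $\mathsf{Rep}(H)$ by restriction along $\sigma_r$. Quantum double: with $\overline\sigma=\sigma\circ(\mathrm{id}\otimes S_H^{-1})$, $K^{\ast\mathrm{cop}}\bowtie_\sigma H$ is the Hopf algebra on $K^{\ast\mathrm{cop}}\otimes H$ with product $(k^\ast\bowtie h)(k'^\ast\bowtie h')=\sum\sigma(k'^\ast_{(3)},h_{(1)})k^\ast k'^\ast_{(2)}\bowtie h_{(2)}h'\overline\sigma(k'^\ast_{(1)},h_{(3)})$, unit $\varepsilon\bowtie1$, coproduct $\Delta(k^\ast\bowtie h)=\sum(k^\ast_{(2)}\bowtie h_{(1)})\otimes(k^\ast_{(1)}\bowtie h_{(2)})$, counit $k^\ast\bowtie h\mapsto\langle k^\ast,1\rangle\varepsilon(h)$. ${}_H\mathfrak{YD}^K$: finite-dimensional left $H$-modules and right $K$-comodules $V$ ($v\mapsto\sum v_{\langle0\rangle}\otimes v_{\langle1\rangle}$) with $\sum(hv)_{\langle0\rangle}\otimes(hv)_{\langle1\rangle}=\sum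 h_{(2)}v_{\langle0\rangle}\otimes\sigma_r(h_{(3)})v_{\langle1\rangle}S^{-1}(\sigma_r(h_{(1)}))$. Tensor product: $V\otimes W$ with $h(v\otimes w)=\sum h_{(1)}v\otimes h_{(2)}w$ and $v\otimes w\mapsto\sum(v_{\langle0\rangle}\otimes w_{\langle0\rangle})\otimes w_{\langle1\rangle}v_{\langle1\rangle}$. *)

theory Defs
  imports "Jordan_Normal_Form.VS_Connect" "HOL-Library.FuncSet"
begin

section \<open>Vector spaces and tensor products\<close>

text \<open>Vector spaces over the field \<open>'k\<close> are the library's
  \<^term>\<open>vectorspace class_ring V\<close>. The fields \<^const>\<open>mult\<close> and \<^const>\<open>one\<close> of the underlying
  record carry no meaning unless the space is an algebra.\<close>

abbreviation fdvs :: "('k::field, 'v, 'm) module_scheme \<Rightarrow> bool" where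
  "fdvs V \<equiv> vectorspace class_ring V \<and> vectorspace.fin_dim class_ring V"

abbreviation lin :: "('k::field, 'v, 'm) module_scheme \<Rightarrow> ('k, 'w, 'n) module_scheme \<Rightarrow> ('v \<Rightarrow> 'w) set" where
  "lin V W \<equiv> LinearCombinations.module_hom class_ring V W"

definition bilin :: "('k::field, 'v, 'm) module_scheme \<Rightarrow> ('k, 'w, 'n) module_scheme
    \<Rightarrow> ('k, 'z, 'l) module_scheme \<Rightarrow> ('v \<Rightarrow> 'w \<Rightarrow> 'z) \<Rightarrow> bool" where
  "bilin V W Z f \<longleftrightarrow>
     (\<forall>v\<in>carrier V. f v \<in> lin W Z) \<and> (\<forall>w\<in>carrier W. (\<lambda>v. f v w) \<in> lin V Z)"

definition ground :: "('k::field, 'k) module" where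
  "ground = \<lparr>carrier = UNIV, mult = (*), one = 1, zero = 0, add = (+), smult = (*)\<rparr>"

text \<open>A list of pairs \<open>[(v\<^sub>1,w\<^sub>1), \<dots>, (v\<^sub>n,w\<^sub>n)]\<close> stands for the formal sum
  \<open>v\<^sub>1 \<otimes> w\<^sub>1 + \<dots> + v\<^sub>n \<otimes> w\<^sub>n\<close>. The relation \<open>tensor_eq\<close> is the congruence generated by the
  defining relations of the tensor product. Elements of the tensor product are chosen
  representatives of the congruence classes (rather than the classes themselves), so that the
  construction can be iterated inside one type, see the type \<open>univ\<close> below.\<close>

inductive tensor_eq :: "('k::field, 'v, 'm) module_scheme \<Rightarrow> ('k, 'w, 'n) module_scheme
    \<Rightarrow> ('v \<times> 'w) list \<Rightarrow> ('v \<times> 'w) list \<Rightarrow> bool" for V W where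
  refl: "t \<in> lists (carrier V \<times> carrier W) \<Longrightarrow> tensor_eq V W t t"
| sym: "tensor_eq V W s t \<Longrightarrow> tensor_eq V W t s"
| trans: "tensor_eq V W r s \<Longrightarrow> tensor_eq V W s t \<Longrightarrow> tensor_eq V W r t"
| append: "tensor_eq V W s s' \<Longrightarrow> tensor_eq V W t t' \<Longrightarrow> tensor_eq V W (s @ t) (s' @ t')"
| swap: "s \<in> lists (carrier V \<times> carrier W) \<Longrightarrow> t \<in> lists (carrier V \<times> carrier W)
    \<Longrightarrow> tensor_eq V W (s @ t) (t @ s)"
| zero: "w \<in> carrier W \<Longrightarrow> tensor_eq V W [(\<zero>\<^bsub>V\<^esub>, w)] []"
| add_left: "v \<in> carrier V \<Longrightarrow> v' \<in> carrier V \<Longrightarrow> w \<in> carrier W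
    \<Longrightarrow> tensor_eq V W [(v \<oplus>\<^bsub>V\<^esub> v', w)] [(v, w), (v', w)]"
| add_right: "v \<in> carrier V \<Longrightarrow> w \<in> carrier W \<Longrightarrow> w' \<in> carrier W
    \<Longrightarrow> tensor_eq V W [(v, w \<oplus>\<^bsub>W\<^esub> w')] [(v, w), (v, w')]"
| balanced: "v \<in> carrier V \<Longrightarrow> w \<in> carrier W
    \<Longrightarrow> tensor_eq V W [(c \<odot>\<^bsub>V\<^esub> v, w)] [(v, c \<odot>\<^bsub>W\<^esub> w)]"

definition tensor_rep :: "('k::field, 'v, 'm) module_scheme \<Rightarrow> ('k, 'w, 'n) module_scheme
    \<Rightarrow> ('v \<times> 'w) list \<Rightarrow> ('v \<times> 'w) list" where
  "tensor_rep V W t = (SOME s. tensor_eq V W s t)"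

definition tensor :: "('k::field, 'v, 'm) module_scheme \<Rightarrow> ('k, 'w, 'n) module_scheme
    \<Rightarrow> ('k, ('v \<times> 'w) list) module" where
  "tensor V W = \<lparr>carrier = tensor_rep V W ` lists (carrier V \<times> carrier W),
     mult = undefined, one = undefined,
     zero = tensor_rep V W [],
     add = \<lambda>s t. tensor_rep V W (s @ t),
     smult = \<lambda>c t. tensor_rep V W (map (\<lambda>(v, w). (c \<odot>\<^bsub>V\<^esub> v, w)) t)\<rparr>"

definition pure :: "('k::field, 'v, 'm) module_scheme \<Rightarrow> ('k, 'w, 'n) module_scheme
    \<Rightarrow> 'v \<Rightarrow> 'w \<Rightarrow> ('v \<times> 'w) list" where
  "pure V W v w = tensor_rep V W [(v, w)]"

text \<open>\<open>tlift Z f\<close> is the linear map \<open>V \<otimes> W \<rightarrow> Z\<close> induced by a bilinear \<open>f\<close>. In particular, with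
  \<open>t = \<Delta>(h)\<close>, it is the Sweedler sum \<open>\<Sum> f(h\<^sub>(\<^sub>1\<^sub>), h\<^sub>(\<^sub>2\<^sub>))\<close>.\<close>

definition tlift :: "('k::field, 'z, 'l) module_scheme \<Rightarrow> ('v \<Rightarrow> 'w \<Rightarrow> 'z) \<Rightarrow> ('v \<times> 'w) list \<Rightarrow> 'z" where
  "tlift Z f t = foldr (\<lambda>(v, w) z. f v w \<oplus>\<^bsub>Z\<^esub> z) t \<zero>\<^bsub>Z\<^esub>"


section \<open>Hopf algebras\<close>

record ('k, 'a) bialg = "('k, 'a) module" +
  comult :: "'a \<Rightarrow> ('a \<times> 'a) list"
  counit :: "'a \<Rightarrow> 'k"

record ('k, 'a) hopf = "('k, 'a) bialg" +
  antipode :: "'a \<Rightarrow> 'a"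

definition sweedler2 :: "('k::field, 'a, 'm) bialg_scheme \<Rightarrow> ('k, 'z, 'l) module_scheme
    \<Rightarrow> ('a \<Rightarrow> 'a \<Rightarrow> 'z) \<Rightarrow> 'a \<Rightarrow> 'z" where
  "sweedler2 A Z f a = tlift Z f (comult A a)"

definition sweedler3 :: "('k::field, 'a, 'm) bialg_scheme \<Rightarrow> ('k, 'z, 'l) module_scheme
    \<Rightarrow> ('a \<Rightarrow> 'a \<Rightarrow> 'a \<Rightarrow> 'z) \<Rightarrow> 'a \<Rightarrow> 'z" where
  "sweedler3 A Z f a = sweedler2 A Z (\<lambda>b a3. sweedler2 A Z (\<lambda>a1 a2. f a1 a2 a3) b) a"

locale fd_hopf_algebra =
  fixes A :: "('k::field, 'a) hopf" (structure)
  assumes ring: "ring A"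
    and vectorspace: "vectorspace class_ring A"
    and fin_dim: "vectorspace.fin_dim class_ring A"
    and mult_bilin: "bilin A A A (\<lambda>a b. a \<otimes> b)"
    and comult_lin: "comult A \<in> lin A (tensor A A)"
    and counit_lin: "counit A \<in> lin A ground"
    and antipode_lin: "antipode A \<in> lin A A"
    and coassoc: "a \<in> carrier A \<Longrightarrow>
      sweedler2 A (tensor A (tensor A A)) (\<lambda>a1 a2. sweedler2 A (tensor A (tensor A A))
          (\<lambda>a11 a12. pure A (tensor A A) a11 (pure A A a12 a2)) a1) a
      = sweedler2 A (tensor A (tensor A A)) (\<lambda>a1 a2. pure A (tensor A A) a1 (comult A a2)) a"
    and counit_left: "a \<in> carrier A \<Longrightarrow> sweedler2 A A (\<lambda>a1 a2. counit A a1 \<odot> a2) a = a"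
    and counit_right: "a \<in> carrier A \<Longrightarrow> sweedler2 A A (\<lambda>a1 a2. counit A a2 \<odot> a1) a = a"
    and comult_mult: "a \<in> carrier A \<Longrightarrow> b \<in> carrier A \<Longrightarrow> comult A (a \<otimes> b)
      = sweedler2 A (tensor A A) (\<lambda>a1 a2. sweedler2 A (tensor A A)
          (\<lambda>b1 b2. pure A A (a1 \<otimes> b1) (a2 \<otimes> b2)) b) a"
    and comult_one: "comult A \<one> = pure A A \<one> \<one>"
    and counit_mult: "a \<in> carrier A \<Longrightarrow> b \<in> carrier A \<Longrightarrow> counit A (a \<otimes> b) = counit A a * counit A b"
    and counit_one: "counit A \<one> = 1"
    and antipode_left: "a \<in> carrier A \<Longrightarrow>
      sweedler2 A A (\<lambda>a1 a2. antipode A a1 \<otimes> a2) a = counit A a \<odot> \<one>"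
    and antipode_right: "a \<in> carrier A \<Longrightarrow>
      sweedler2 A A (\<lambda>a1 a2. a1 \<otimes> antipode A a2) a = counit A a \<odot> \<one>"

definition antipode_inv :: "('k::field, 'a, 'm) hopf_scheme \<Rightarrow> 'a \<Rightarrow> 'a" where
  "antipode_inv A = inv_into (carrier A) (antipode A)"

definition dual_space :: "('k::field, 'a, 'm) module_scheme \<Rightarrow> ('k, 'a \<Rightarrow> 'k) module" where
  "dual_space V = \<lparr>carrier = lin V ground \<inter> extensional (carrier V),
     mult = undefined, one = undefined,
     zero = (\<lambda>v\<in>carrier V. 0),
     add = \<lambda>f g. \<lambda>v\<in>carrier V. f v + g v,
     smult = \<lambda>c f. \<lambda>v\<in>carrier V. c * f v\<rparr>"

text \<open>Conventions: \<open>\<langle>f g, x\<rangle> = \<Sum> \<langle>f, x\<^sub>(\<^sub>1\<^sub>)\<rangle> \<langle>g, x\<^sub>(\<^sub>2\<^sub>)\<rangle>\<close> and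
  \<open>\<Sum> \<langle>f\<^sub>(\<^sub>1\<^sub>), x\<rangle> \<langle>f\<^sub>(\<^sub>2\<^sub>), y\<rangle> = \<langle>f, x y\<rangle>\<close>. These make the evaluation \<open>K\<^sup>* \<otimes> K \<rightarrow> k\<close> a Hopf pairing.\<close>

definition dual_hopf :: "('k::field, 'a) hopf \<Rightarrow> ('k, 'a \<Rightarrow> 'k) hopf" where
  "dual_hopf K = \<lparr>carrier = carrier (dual_space K),
     mult = \<lambda>f g. \<lambda>x\<in>carrier K. sweedler2 K ground (\<lambda>x1 x2. f x1 * g x2) x,
     one = restrict (counit K) (carrier K),
     zero = zero (dual_space K),
     add = add (dual_space K),
     smult = smult (dual_space K),
     comult = \<lambda>f. THE t. t \<in> carrier (tensor (dual_space K) (dual_space K)) \<and>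
       (\<forall>x\<in>carrier K. \<forall>y\<in>carrier K. tlift ground (\<lambda>f1 f2. f1 x * f2 y) t = f (x \<otimes>\<^bsub>K\<^esub> y)),
     counit = \<lambda>f. f \<one>\<^bsub>K\<^esub>,
     antipode = \<lambda>f. \<lambda>x\<in>carrier K. f (antipode K x)\<rparr>"

definition hopf_pairing :: "('k::field, 'a) hopf \<Rightarrow> ('k, 'h) hopf \<Rightarrow> ('a \<Rightarrow> 'h \<Rightarrow> 'k) \<Rightarrow> bool" where
  "hopf_pairing A H \<sigma> \<longleftrightarrow> bilin A H ground \<sigma> \<and>
     (\<forall>a\<in>carrier A. \<forall>a'\<in>carrier A. \<forall>h\<in>carrier H.
        \<sigma> (a \<otimes>\<^bsub>A\<^esub> a') h = sweedler2 H ground (\<lambda>h1 h2. \<sigma> a h1 * \<sigma> a' h2) h) \<and>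
     (\<forall>a\<in>carrier A. \<forall>h\<in>carrier H. \<forall>h'\<in>carrier H.
        \<sigma> a (h \<otimes>\<^bsub>H\<^esub> h') = sweedler2 A ground (\<lambda>a1 a2. \<sigma> a1 h * \<sigma> a2 h') a) \<and>
     (\<forall>h\<in>carrier H. \<sigma> \<one>\<^bsub>A\<^esub> h = counit H h) \<and>
     (\<forall>a\<in>carrier A. \<sigma> a \<one>\<^bsub>H\<^esub> = counit A a)"

text \<open>\<open>\<sigma>\<^sub>r(h) = \<sigma>(-, h) \<in> K\<^sup>*\<^sup>*\<close>, read as an element of \<open>K\<close> through the evaluation isomorphism
  \<open>K \<cong> K\<^sup>*\<^sup>*\<close>.\<close>

definition sigma_r :: "('k::field, 'b) hopf \<Rightarrow> (('b \<Rightarrow> 'k) \<Rightarrow> 'h \<Rightarrow> 'k) \<Rightarrow> 'h \<Rightarrow> 'b" where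
  "sigma_r K \<sigma> h = (THE x. x \<in> carrier K \<and> (\<forall>f\<in>carrier (dual_hopf K). f x = \<sigma> f h))"

text \<open>\<open>K\<^sup>*\<^sup>c\<^sup>o\<^sup>p \<bowtie>\<^sub>\<sigma> H\<close>. Only the bialgebra structure is recorded, since the antipode does not enter
  the category of modules with its tensor product.\<close>

definition quantum_double :: "('k::field, 'h) hopf \<Rightarrow> ('k, 'b) hopf \<Rightarrow> (('b \<Rightarrow> 'k) \<Rightarrow> 'h \<Rightarrow> 'k)
    \<Rightarrow> ('k, (('b \<Rightarrow> 'k) \<times> 'h) list) bialg" where
  "quantum_double H K \<sigma> =
    (let Ks = dual_hopf K; D = tensor Ks H in
     \<lparr>carrier = carrier D,
      mult = \<lambda>s t. tlift D (\<lambda>k h. tlift D (\<lambda>k' h'.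
          sweedler3 Ks D (\<lambda>k'1 k'2 k'3. sweedler3 H D (\<lambda>h1 h2 h3.
            (\<sigma> k'3 h1 * \<sigma> k'1 (antipode_inv H h3)) \<odot>\<^bsub>D\<^esub>
              pure Ks H (k \<otimes>\<^bsub>Ks\<^esub> k'2) (h2 \<otimes>\<^bsub>H\<^esub> h')) h) k') t) s,
      one = pure Ks H \<one>\<^bsub>Ks\<^esub> \<one>\<^bsub>H\<^esub>,
      zero = zero D, add = add D, smult = smult D,
      comult = \<lambda>t. tlift (tensor D D) (\<lambda>k h.
          sweedler2 Ks (tensor D D) (\<lambda>k1 k2. sweedler2 H (tensor D D) (\<lambda>h1 h2.
            pure D D (pure Ks H k2 h1) (pure Ks H k1 h2)) h) k) t,
      counit = \<lambda>t. tlift ground (\<lambda>k h. k \<one>\<^bsub>K\<^esub> * counit H h) t\<rparr>)"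


section \<open>Linear monoidal categories and tensor equivalences\<close>

text \<open>A tensor equivalence is a linear strong monoidal functor that is an equivalence of
  categories. Abelianness and rigidity are properties and not data, and every such functor
  preserves them; they are therefore not part of the structure.\<close>

record ('k, 'o, 'm) tcat =
  Obj :: "'o set"
  Arr :: "'m set"
  Dom :: "'m \<Rightarrow> 'o"
  Cod :: "'m \<Rightarrow> 'o"
  Id :: "'o \<Rightarrow> 'm"
  Comp :: "'m \<Rightarrow> 'm \<Rightarrow> 'm" (infixr \<open>\<cdot>\<index>\<close> 55)
  Zero :: "'o \<Rightarrow> 'o \<Rightarrow> 'm"
  Add :: "'m \<Rightarrow> 'm \<Rightarrow> 'm"
  Scale :: "'k \<Rightarrow> 'm \<Rightarrow> 'm"
  TenO :: "'o \<Rightarrow> 'o \<Rightarrow> 'o" (infixr \<open>\<boxtimes>\<index>\<close> 70)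
  TenA :: "'m \<Rightarrow> 'm \<Rightarrow> 'm" (infixr \<open>\<boxdot>\<index>\<close> 70)
  Unit :: "'o"
  Assoc :: "'o \<Rightarrow> 'o \<Rightarrow> 'o \<Rightarrow> 'm"
  LUnit :: "'o \<Rightarrow> 'm"
  RUnit :: "'o \<Rightarrow> 'm"

definition Hom :: "('k, 'o, 'm) tcat \<Rightarrow> 'o \<Rightarrow> 'o \<Rightarrow> 'm set" where
  "Hom C X Y = {f \<in> Arr C. Dom C f = X \<and> Cod C f = Y}"

definition Hom_space :: "('k, 'o, 'm) tcat \<Rightarrow> 'o \<Rightarrow> 'o \<Rightarrow> ('k, 'm) module" where
  "Hom_space C X Y = \<lparr>carrier = Hom C X Y, mult = undefined, one = undefined,
     zero = Zero C X Y, add = Add C, smult = Scale C\<rparr>"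

definition inverse_arr :: "('k, 'o, 'm) tcat \<Rightarrow> 'm \<Rightarrow> 'm \<Rightarrow> bool" where
  "inverse_arr C f g \<longleftrightarrow> f \<in> Arr C \<and> g \<in> Hom C (Cod C f) (Dom C f) \<and>
     g \<cdot>\<^bsub>C\<^esub> f = Id C (Dom C f) \<and> f \<cdot>\<^bsub>C\<^esub> g = Id C (Cod C f)"

definition iso_arr :: "('k, 'o, 'm) tcat \<Rightarrow> 'm \<Rightarrow> bool" where
  "iso_arr C f \<longleftrightarrow> (\<exists>g. inverse_arr C f g)"

definition inv_arr :: "('k, 'o, 'm) tcat \<Rightarrow> 'm \<Rightarrow> 'm" where
  "inv_arr C f = (THE g. inverse_arr C f g)"

locale linear_monoidal_category =
  fixes C :: "('k::field, 'o, 'm) tcat" (structure)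
  assumes arr_obj: "f \<in> Arr C \<Longrightarrow> Dom C f \<in> Obj C \<and> Cod C f \<in> Obj C"
    and id_hom: "X \<in> Obj C \<Longrightarrow> Id C X \<in> Hom C X X"
    and comp_hom: "f \<in> Hom C X Y \<Longrightarrow> g \<in> Hom C Y Z \<Longrightarrow> g \<cdot> f \<in> Hom C X Z"
    and comp_id: "f \<in> Hom C X Y \<Longrightarrow> f \<cdot> Id C X = f \<and> Id C Y \<cdot> f = f"
    and comp_assoc: "f \<in> Hom C X Y \<Longrightarrow> g \<in> Hom C Y Z \<Longrightarrow> h \<in> Hom C Z W
      \<Longrightarrow> (h \<cdot> g) \<cdot> f = h \<cdot> (g \<cdot> f)"
    and hom_vectorspace: "X \<in> Obj C \<Longrightarrow> Y \<in> Obj C \<Longrightarrow> vectorspace class_ring (Hom_space C X Y)"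
    and comp_bilin: "X \<in> Obj C \<Longrightarrow> Y \<in> Obj C \<Longrightarrow> Z \<in> Obj C
      \<Longrightarrow> bilin (Hom_space C Y Z) (Hom_space C X Y) (Hom_space C X Z) (\<lambda>g f. g \<cdot> f)"
    and ten_obj: "X \<in> Obj C \<Longrightarrow> Y \<in> Obj C \<Longrightarrow> X \<boxtimes> Y \<in> Obj C"
    and ten_bilin: "X \<in> Obj C \<Longrightarrow> Y \<in> Obj C \<Longrightarrow> X' \<in> Obj C \<Longrightarrow> Y' \<in> Obj C
      \<Longrightarrow> bilin (Hom_space C X Y) (Hom_space C X' Y') (Hom_space C (X \<boxtimes> X') (Y \<boxtimes> Y'))
            (\<lambda>f f'. f \<boxdot> f')"
    and ten_id: "X \<in> Obj C \<Longrightarrow> Y \<in> Obj C \<Longrightarrow> Id C X \<boxdot> Id C Y = Id C (X \<boxtimes> Y)"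
    and ten_comp: "f \<in> Hom C X Y \<Longrightarrow> g \<in> Hom C Y Z \<Longrightarrow> f' \<in> Hom C X' Y' \<Longrightarrow> g' \<in> Hom C Y' Z'
      \<Longrightarrow> (g \<cdot> f) \<boxdot> (g' \<cdot> f') = (g \<boxdot> g') \<cdot> (f \<boxdot> f')"
    and unit_obj: "Unit C \<in> Obj C"
    and assoc_iso: "X \<in> Obj C \<Longrightarrow> Y \<in> Obj C \<Longrightarrow> Z \<in> Obj C \<Longrightarrow>
      Assoc C X Y Z \<in> Hom C ((X \<boxtimes> Y) \<boxtimes> Z) (X \<boxtimes> (Y \<boxtimes> Z)) \<and> iso_arr C (Assoc C X Y Z)"
    and assoc_natural: "f \<in> Hom C X X' \<Longrightarrow> g \<in> Hom C Y Y' \<Longrightarrow> h \<in> Hom C Z Z' \<Longrightarrow>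
      Assoc C X' Y' Z' \<cdot> ((f \<boxdot> g) \<boxdot> h) = (f \<boxdot> (g \<boxdot> h)) \<cdot> Assoc C X Y Z"
    and lunit_iso: "X \<in> Obj C \<Longrightarrow> LUnit C X \<in> Hom C (Unit C \<boxtimes> X) X \<and> iso_arr C (LUnit C X)"
    and lunit_natural: "f \<in> Hom C X Y \<Longrightarrow> LUnit C Y \<cdot> (Id C (Unit C) \<boxdot> f) = f \<cdot> LUnit C X"
    and runit_iso: "X \<in> Obj C \<Longrightarrow> RUnit C X \<in> Hom C (X \<boxtimes> Unit C) X \<and> iso_arr C (RUnit C X)"
    and runit_natural: "f \<in> Hom C X Y \<Longrightarrow> RUnit C Y \<cdot> (f \<boxdot> Id C (Unit C)) = f \<cdot> RUnit C X"
    and pentagon: "X \<in> Obj C \<Longrightarrow> Y \<in> Obj C \<Longrightarrow> Z \<in> Obj C \<Longrightarrow> W \<in> Obj C \<Longrightarrow>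
      Assoc C X Y (Z \<boxtimes> W) \<cdot> Assoc C (X \<boxtimes> Y) Z W
      = (Id C X \<boxdot> Assoc C Y Z W) \<cdot> Assoc C X (Y \<boxtimes> Z) W \<cdot> (Assoc C X Y Z \<boxdot> Id C W)"
    and triangle: "X \<in> Obj C \<Longrightarrow> Y \<in> Obj C \<Longrightarrow>
      (Id C X \<boxdot> LUnit C Y) \<cdot> Assoc C X (Unit C) Y = RUnit C X \<boxdot> Id C Y"

definition is_functor :: "('k, 'o, 'm) tcat \<Rightarrow> ('k, 'p, 'n) tcat \<Rightarrow> ('o \<Rightarrow> 'p) \<Rightarrow> ('m \<Rightarrow> 'n) \<Rightarrow> bool" where
  "is_functor C D Fo Fa \<longleftrightarrow>
     (\<forall>X\<in>Obj C. Fo X \<in> Obj D \<and> Fa (Id C X) = Id D (Fo X)) \<and>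
     (\<forall>f\<in>Arr C. Fa f \<in> Hom D (Fo (Dom C f)) (Fo (Cod C f))) \<and>
     (\<forall>f\<in>Arr C. \<forall>g\<in>Arr C. Cod C f = Dom C g \<longrightarrow> Fa (g \<cdot>\<^bsub>C\<^esub> f) = Fa g \<cdot>\<^bsub>D\<^esub> Fa f)"

definition natural_iso :: "('k, 'o, 'm) tcat \<Rightarrow> ('k, 'p, 'n) tcat \<Rightarrow> ('o \<Rightarrow> 'p) \<Rightarrow> ('m \<Rightarrow> 'n)
    \<Rightarrow> ('o \<Rightarrow> 'p) \<Rightarrow> ('m \<Rightarrow> 'n) \<Rightarrow> ('o \<Rightarrow> 'n) \<Rightarrow> bool" where
  "natural_iso C D Fo Fa Go Ga \<eta> \<longleftrightarrow>
     (\<forall>X\<in>Obj C. \<eta> X \<in> Hom D (Fo X) (Go X) \<and> iso_arr D (\<eta> X)) \<and>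
     (\<forall>f\<in>Arr C. \<eta> (Cod C f) \<cdot>\<^bsub>D\<^esub> Fa f = Ga f \<cdot>\<^bsub>D\<^esub> \<eta> (Dom C f))"

definition is_equivalence :: "('k, 'o, 'm) tcat \<Rightarrow> ('k, 'p, 'n) tcat \<Rightarrow> ('o \<Rightarrow> 'p) \<Rightarrow> ('m \<Rightarrow> 'n) \<Rightarrow> bool" where
  "is_equivalence C D Fo Fa \<longleftrightarrow> is_functor C D Fo Fa \<and>
     (\<exists>Go Ga \<eta> \<epsilon>. is_functor D C Go Ga \<and>
        natural_iso C C (\<lambda>X. X) (\<lambda>f. f) (Go \<circ> Fo) (Ga \<circ> Fa) \<eta> \<and>
        natural_iso D D (Fo \<circ> Go) (Fa \<circ> Ga) (\<lambda>X. X) (\<lambda>f. f) \<epsilon>)"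

locale linear_monoidal_functor =
  C: linear_monoidal_category C + D: linear_monoidal_category D
  for C :: "('k::field, 'o, 'm) tcat" and D :: "('k, 'p, 'n) tcat" +
  fixes Fo :: "'o \<Rightarrow> 'p" and Fa :: "'m \<Rightarrow> 'n" and J :: "'o \<Rightarrow> 'o \<Rightarrow> 'n" and \<phi> :: 'n
  assumes is_functor: "is_functor C D Fo Fa"
    and linear: "X \<in> Obj C \<Longrightarrow> Y \<in> Obj C
      \<Longrightarrow> Fa \<in> lin (Hom_space C X Y) (Hom_space D (Fo X) (Fo Y))"
    and J_iso: "X \<in> Obj C \<Longrightarrow> Y \<in> Obj C
      \<Longrightarrow> J X Y \<in> Hom D (Fo X \<boxtimes>\<^bsub>D\<^esub> Fo Y) (Fo (X \<boxtimes>\<^bsub>C\<^esub> Y)) \<and> iso_arr D (J X Y)"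
    and J_natural: "f \<in> Hom C X X' \<Longrightarrow> g \<in> Hom C Y Y'
      \<Longrightarrow> J X' Y' \<cdot>\<^bsub>D\<^esub> (Fa f \<boxdot>\<^bsub>D\<^esub> Fa g) = Fa (f \<boxdot>\<^bsub>C\<^esub> g) \<cdot>\<^bsub>D\<^esub> J X Y"
    and phi_iso: "\<phi> \<in> Hom D (Unit D) (Fo (Unit C)) \<and> iso_arr D \<phi>"
    and J_assoc: "X \<in> Obj C \<Longrightarrow> Y \<in> Obj C \<Longrightarrow> Z \<in> Obj C \<Longrightarrow>
      Fa (Assoc C X Y Z) \<cdot>\<^bsub>D\<^esub> J (X \<boxtimes>\<^bsub>C\<^esub> Y) Z \<cdot>\<^bsub>D\<^esub> (J X Y \<boxdot>\<^bsub>D\<^esub> Id D (Fo Z))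
      = J X (Y \<boxtimes>\<^bsub>C\<^esub> Z) \<cdot>\<^bsub>D\<^esub> (Id D (Fo X) \<boxdot>\<^bsub>D\<^esub> J Y Z) \<cdot>\<^bsub>D\<^esub> Assoc D (Fo X) (Fo Y) (Fo Z)"
    and J_lunit: "X \<in> Obj C \<Longrightarrow>
      LUnit D (Fo X) = Fa (LUnit C X) \<cdot>\<^bsub>D\<^esub> J (Unit C) X \<cdot>\<^bsub>D\<^esub> (\<phi> \<boxdot>\<^bsub>D\<^esub> Id D (Fo X))"
    and J_runit: "X \<in> Obj C \<Longrightarrow>
      RUnit D (Fo X) = Fa (RUnit C X) \<cdot>\<^bsub>D\<^esub> J X (Unit C) \<cdot>\<^bsub>D\<^esub> (Id D (Fo X) \<boxdot>\<^bsub>D\<^esub> \<phi>)"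

definition tensor_equivalent :: "('k::field, 'o, 'm) tcat \<Rightarrow> ('k, 'p, 'n) tcat \<Rightarrow> bool" where
  "tensor_equivalent C D \<longleftrightarrow>
     (\<exists>Fo Fa J \<phi>. linear_monoidal_functor C D Fo Fa J \<phi> \<and> is_equivalence C D Fo Fa)"


section \<open>The relative center\<close>

text \<open>A tensor subcategory \<open>D\<close> of \<open>C\<close> is given as a \<open>tcat\<close> of which only the objects and arrows
  matter; all operations are those of \<open>C\<close>. The associativity constraints are written out. Half
  braidings are indexed by the objects of \<open>D\<close> only, whence \<^const>\<open>extensional\<close>.\<close>

definition half_braiding :: "('k, 'o, 'm) tcat \<Rightarrow> ('k, 'o, 'm) tcat \<Rightarrow> 'o \<Rightarrow> ('o \<Rightarrow> 'm) \<Rightarrow> bool" where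
  "half_braiding C D X c \<longleftrightarrow> c \<in> extensional (Obj D) \<and>
     (\<forall>Y\<in>Obj D. c Y \<in> Hom C (X \<boxtimes>\<^bsub>C\<^esub> Y) (Y \<boxtimes>\<^bsub>C\<^esub> X) \<and> iso_arr C (c Y)) \<and>
     (\<forall>g\<in>Arr D. (g \<boxdot>\<^bsub>C\<^esub> Id C X) \<cdot>\<^bsub>C\<^esub> c (Dom C g) = c (Cod C g) \<cdot>\<^bsub>C\<^esub> (Id C X \<boxdot>\<^bsub>C\<^esub> g)) \<and>
     (\<forall>Y\<in>Obj D. \<forall>Y'\<in>Obj D.
        (Id C Y \<boxdot>\<^bsub>C\<^esub> c Y') \<cdot>\<^bsub>C\<^esub> Assoc C Y X Y' \<cdot>\<^bsub>C\<^esub> (c Y \<boxdot>\<^bsub>C\<^esub> Id C Y')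
        = Assoc C Y Y' X \<cdot>\<^bsub>C\<^esub> c (Y \<boxtimes>\<^bsub>C\<^esub> Y') \<cdot>\<^bsub>C\<^esub> Assoc C X Y Y')"

definition center_tensor :: "('k, 'o, 'm) tcat \<Rightarrow> ('k, 'o, 'm) tcat
    \<Rightarrow> 'o \<times> ('o \<Rightarrow> 'm) \<Rightarrow> 'o \<times> ('o \<Rightarrow> 'm) \<Rightarrow> 'o \<times> ('o \<Rightarrow> 'm)" where
  "center_tensor C D = (\<lambda>(X, c) (X', c'). (X \<boxtimes>\<^bsub>C\<^esub> X', \<lambda>Y\<in>Obj D.
     Assoc C Y X X' \<cdot>\<^bsub>C\<^esub> (c Y \<boxdot>\<^bsub>C\<^esub> Id C X') \<cdot>\<^bsub>C\<^esub> inv_arr C (Assoc C X Y X') \<cdot>\<^bsub>C\<^esub>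
       (Id C X \<boxdot>\<^bsub>C\<^esub> c' Y) \<cdot>\<^bsub>C\<^esub> Assoc C X X' Y))"

definition center_unit :: "('k, 'o, 'm) tcat \<Rightarrow> ('k, 'o, 'm) tcat \<Rightarrow> 'o \<times> ('o \<Rightarrow> 'm)" where
  "center_unit C D = (Unit C, \<lambda>Y\<in>Obj D. inv_arr C (RUnit C Y) \<cdot>\<^bsub>C\<^esub> LUnit C Y)"

definition relative_center :: "('k, 'o, 'm) tcat \<Rightarrow> ('k, 'o, 'm) tcat
    \<Rightarrow> ('k, 'o \<times> ('o \<Rightarrow> 'm), ('o \<times> ('o \<Rightarrow> 'm)) \<times> 'm \<times> ('o \<times> ('o \<Rightarrow> 'm))) tcat" where
  "relative_center C D =
    (let objs = {(X, c). X \<in> Obj C \<and> half_braiding C D X c}; ten = center_tensor C D;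
         unit = center_unit C D in
     \<lparr>Obj = objs,
      Arr = {((X, c), f, (X', c')) | X c f X' c'.
               (X, c) \<in> objs \<and> (X', c') \<in> objs \<and> f \<in> Hom C X X' \<and>
               (\<forall>Y\<in>Obj D. (Id C Y \<boxdot>\<^bsub>C\<^esub> f) \<cdot>\<^bsub>C\<^esub> c Y = c' Y \<cdot>\<^bsub>C\<^esub> (f \<boxdot>\<^bsub>C\<^esub> Id C Y))},
      Dom = \<lambda>(P, f, Q). P,
      Cod = \<lambda>(P, f, Q). Q,
      Id = \<lambda>P. (P, Id C (fst P), P),
      Comp = \<lambda>(_, g, R) (P, f, _). (P, g \<cdot>\<^bsub>C\<^esub> f, R),
      Zero = \<lambda>P Q. (P, Zero C (fst P) (fst Q), Q),
      Add = \<lambda>(P, f, Q) (_, g, _). (P, Add C f g, Q),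
      Scale = \<lambda>a (P, f, Q). (P, Scale C a f, Q),
      TenO = ten,
      TenA = \<lambda>(P, f, Q) (P', f', Q'). (ten P P', f \<boxdot>\<^bsub>C\<^esub> f', ten Q Q'),
      Unit = unit,
      Assoc = \<lambda>P Q R. (ten (ten P Q) R, Assoc C (fst P) (fst Q) (fst R), ten P (ten Q R)),
      LUnit = \<lambda>P. (ten unit P, LUnit C (fst P), P),
      RUnit = \<lambda>P. (ten P unit, RUnit C (fst P), P)\<rparr>)"


section \<open>Categories of finite-dimensional vector spaces with additional structure\<close>

text \<open>The vectors of the objects of our categories are taken from a type that is closed under
  scalars and tensor products and contains an arbitrary type \<open>'u\<close>; so every finite-dimensional
  vector space whose underlying set is a set of elements of some type is covered.\<close>

datatype ('k, 'u) univ =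
    Atom 'u
  | Scalar (scalar_of: 'k)
  | Tensor (tensor_of: "(('k, 'u) univ \<times> ('k, 'u) univ) list")

type_synonym ('k, 'u) space = "('k, ('k, 'u) univ) module"

definition uscalars :: "('k::field, 'u) space" where
  "uscalars = \<lparr>carrier = range Scalar, mult = undefined, one = undefined,
     zero = Scalar 0,
     add = \<lambda>a b. Scalar (scalar_of a + scalar_of b),
     smult = \<lambda>c a. Scalar (c * scalar_of a)\<rparr>"

definition utensor :: "('k::field, 'u) space \<Rightarrow> ('k, 'u) space \<Rightarrow> ('k, 'u) space" where
  "utensor V W = \<lparr>carrier = Tensor ` carrier (tensor V W), mult = undefined, one = undefined,
     zero = Tensor \<zero>\<^bsub>tensor V W\<^esub>,
     add = \<lambda>s t. Tensor (tensor_of s \<oplus>\<^bsub>tensor V W\<^esub> tensor_of t),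
     smult = \<lambda>c t. Tensor (c \<odot>\<^bsub>tensor V W\<^esub> tensor_of t)\<rparr>"

definition upure :: "('k::field, 'u) space \<Rightarrow> ('k, 'u) space
    \<Rightarrow> ('k, 'u) univ \<Rightarrow> ('k, 'u) univ \<Rightarrow> ('k, 'u) univ" where
  "upure V W v w = Tensor (pure V W v w)"

definition ulift :: "('k::field, 'z, 'l) module_scheme \<Rightarrow> (('k, 'u) univ \<Rightarrow> ('k, 'u) univ \<Rightarrow> 'z)
    \<Rightarrow> ('k, 'u) univ \<Rightarrow> 'z" where
  "ulift Z f t = tlift Z f (tensor_of t)"

text \<open>The category with objects \<open>objs\<close>, where \<open>X\<close> has underlying vector space \<open>sp X\<close>, and with the
  linear maps satisfying \<open>P\<close> as arrows. The tensor product of arrows and the constraints are those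
  of vector spaces; so \<open>sp (ten X Y)\<close> and \<open>sp unit\<close> have to be \<open>utensor (sp X) (sp Y)\<close>
  and \<open>uscalars\<close>.\<close>

definition linear_tcat :: "'o set \<Rightarrow> ('o \<Rightarrow> ('k::field, 'u) space)
    \<Rightarrow> ('o \<Rightarrow> 'o \<Rightarrow> (('k, 'u) univ \<Rightarrow> ('k, 'u) univ) \<Rightarrow> bool) \<Rightarrow> ('o \<Rightarrow> 'o \<Rightarrow> 'o) \<Rightarrow> 'o
    \<Rightarrow> ('k, 'o, 'o \<times> (('k, 'u) univ \<Rightarrow> ('k, 'u) univ) \<times> 'o) tcat" where
  "linear_tcat objs sp P ten unit =
     \<lparr>Obj = objs,
      Arr = {(X, f, Y). X \<in> objs \<and> Y \<in> objs \<and>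
               f \<in> lin (sp X) (sp Y) \<inter> extensional (carrier (sp X)) \<and> P X Y f},
      Dom = \<lambda>(X, f, Y). X,
      Cod = \<lambda>(X, f, Y). Y,
      Id = \<lambda>X. (X, \<lambda>v\<in>carrier (sp X). v, X),
      Comp = \<lambda>(_, g, Z) (X, f, _). (X, compose (carrier (sp X)) g f, Z),
      Zero = \<lambda>X Y. (X, \<lambda>v\<in>carrier (sp X). \<zero>\<^bsub>sp Y\<^esub>, Y),
      Add = \<lambda>(X, f, Y) (_, g, _). (X, \<lambda>v\<in>carrier (sp X). f v \<oplus>\<^bsub>sp Y\<^esub> g v, Y),
      Scale = \<lambda>a (X, f, Y). (X, \<lambda>v\<in>carrier (sp X). a \<odot>\<^bsub>sp Y\<^esub> f v, Y),
      TenO = ten,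
      TenA = \<lambda>(X, f, Y) (X', f', Y').
        (ten X X',
         \<lambda>t\<in>carrier (utensor (sp X) (sp X')).
           ulift (utensor (sp Y) (sp Y')) (\<lambda>v w. upure (sp Y) (sp Y') (f v) (f' w)) t,
         ten Y Y'),
      Unit = unit,
      Assoc = \<lambda>X Y Z.
        (ten (ten X Y) Z,
         \<lambda>t\<in>carrier (utensor (utensor (sp X) (sp Y)) (sp Z)).
           ulift (utensor (sp X) (utensor (sp Y) (sp Z))) (\<lambda>s z.
             ulift (utensor (sp X) (utensor (sp Y) (sp Z))) (\<lambda>x y.
               upure (sp X) (utensor (sp Y) (sp Z)) x (upure (sp Y) (sp Z) y z)) s) t,
         ten X (ten Y Z)),
      LUnit = \<lambda>X.
        (ten unit X,
         \<lambda>t\<in>carrier (utensor uscalars (sp X)). ulift (sp X) (\<lambda>a v. scalar_of a \<odot>\<^bsub>sp X\<^esub> v) t,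
         X),
      RUnit = \<lambda>X.
        (ten X unit,
         \<lambda>t\<in>carrier (utensor (sp X) uscalars). ulift (sp X) (\<lambda>v a. scalar_of a \<odot>\<^bsub>sp X\<^esub> v) t,
         X)\<rparr>"


subsection \<open>Modules\<close>

text \<open>Actions (and below coactions) are undefined off the carriers, so that two objects are equal
  as soon as they agree on the carriers. In particular restriction along a coalgebra map commutes
  with tensor products on the nose.\<close>

record ('k, 'a, 'u) lmod =
  space :: "('k, 'u) space"
  act :: "'a \<Rightarrow> ('k, 'u) univ \<Rightarrow> ('k, 'u) univ"

definition fd_lmodule :: "('k::field, 'a, 'm) bialg_scheme \<Rightarrow> ('k, 'a, 'u, 'l) lmod_scheme \<Rightarrow> bool" where
  "fd_lmodule A X \<longleftrightarrow> fdvs (space X) \<and>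
     act X \<in> carrier A \<rightarrow>\<^sub>E (carrier (space X) \<rightarrow>\<^sub>E carrier (space X)) \<and>
     bilin A (space X) (space X) (act X) \<and>
     (\<forall>v\<in>carrier (space X). act X \<one>\<^bsub>A\<^esub> v = v) \<and>
     (\<forall>a\<in>carrier A. \<forall>b\<in>carrier A. \<forall>v\<in>carrier (space X). act X (a \<otimes>\<^bsub>A\<^esub> b) v = act X a (act X b v))"

definition module_map :: "('k::field, 'a, 'm) bialg_scheme \<Rightarrow> ('k, 'a, 'u, 'l) lmod_scheme
    \<Rightarrow> ('k, 'a, 'u, 'l) lmod_scheme \<Rightarrow> (('k, 'u) univ \<Rightarrow> ('k, 'u) univ) \<Rightarrow> bool" where
  "module_map A X Y f \<longleftrightarrow>
     (\<forall>a\<in>carrier A. \<forall>v\<in>carrier (space X). f (act X a v) = act Y a (f v))"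

definition lmod_tensor :: "('k::field, 'a, 'm) bialg_scheme \<Rightarrow> ('k, 'a, 'u, 'l) lmod_scheme
    \<Rightarrow> ('k, 'a, 'u, 'l) lmod_scheme \<Rightarrow> ('k, 'a, 'u) lmod" where
  "lmod_tensor A X Y = (let T = utensor (space X) (space Y) in
     \<lparr>space = T,
      act = \<lambda>a\<in>carrier A. \<lambda>t\<in>carrier T. sweedler2 A T (\<lambda>a1 a2.
        ulift T (\<lambda>v w. upure (space X) (space Y) (act X a1 v) (act Y a2 w)) t) a\<rparr>)"

definition lmod_unit :: "('k::field, 'a, 'm) bialg_scheme \<Rightarrow> ('k, 'a, 'u) lmod" where
  "lmod_unit A = \<lparr>space = uscalars,
     act = \<lambda>a\<in>carrier A. \<lambda>v\<in>carrier uscalars. counit A a \<odot>\<^bsub>uscalars\<^esub> v\<rparr>"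

type_synonym ('k, 'a, 'u) rep_arr =
  "('k, 'a, 'u) lmod \<times> (('k, 'u) univ \<Rightarrow> ('k, 'u) univ) \<times> ('k, 'a, 'u) lmod"

definition Rep :: "'u itself \<Rightarrow> ('k::field, 'a, 'm) bialg_scheme
    \<Rightarrow> ('k, ('k, 'a, 'u) lmod, ('k, 'a, 'u) rep_arr) tcat" where
  "Rep U A = linear_tcat {X. fd_lmodule A X} space (module_map A) (lmod_tensor A) (lmod_unit A)"

text \<open>The image of the restriction functor \<open>Rep(K) \<rightarrow> Rep(H)\<close> along a map \<open>p\<close> from \<open>H\<close> to \<open>K\<close>.\<close>

definition restrict_mod :: "('k::field, 'h, 'm) bialg_scheme \<Rightarrow> ('h \<Rightarrow> 'b) \<Rightarrow> ('k, 'b, 'u) lmod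
    \<Rightarrow> ('k, 'h, 'u) lmod" where
  "restrict_mod H p Y = \<lparr>space = space Y, act = \<lambda>h\<in>carrier H. act Y (p h)\<rparr>"

definition Rep_restricted :: "'u itself \<Rightarrow> ('k::field, 'h, 'm) bialg_scheme \<Rightarrow> ('k, 'b, 'n) bialg_scheme
    \<Rightarrow> ('h \<Rightarrow> 'b) \<Rightarrow> ('k, ('k, 'h, 'u) lmod, ('k, 'h, 'u) rep_arr) tcat" where
  "Rep_restricted U H K p = (Rep U H)
     \<lparr>Obj := restrict_mod H p ` Obj (Rep U K),
      Arr := (\<lambda>(X, f, Y). (restrict_mod H p X, f, restrict_mod H p Y)) ` Arr (Rep U K)\<rparr>"


subsection \<open>Yetter-Drinfeld modules\<close>

record ('k, 'h, 'b, 'u) ydmod = "('k, 'h, 'u) lmod" +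
  coact :: "('k, 'u) univ \<Rightarrow> (('k, 'u) univ \<times> 'b) list"

definition rcomodule :: "('k::field, 'b) hopf \<Rightarrow> ('k, 'h, 'b, 'u) ydmod \<Rightarrow> bool" where
  "rcomodule K X \<longleftrightarrow> (let V = space X; VKK = tensor V (tensor K K) in
     coact X \<in> lin V (tensor V K) \<inter> extensional (carrier V) \<and>
     (\<forall>v\<in>carrier V. tlift V (\<lambda>v0 x. counit K x \<odot>\<^bsub>V\<^esub> v0) (coact X v) = v) \<and>
     (\<forall>v\<in>carrier V.
        tlift VKK (\<lambda>v0 x. tlift VKK (\<lambda>v00 y. pure V (tensor K K) v00 (pure K K y x)) (coact X v0)) (coact X v)
        = tlift VKK (\<lambda>v0 x. pure V (tensor K K) v0 (comult K x)) (coact X v)))"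

definition yd_condition :: "('k::field, 'h) hopf \<Rightarrow> ('k, 'b) hopf \<Rightarrow> (('b \<Rightarrow> 'k) \<Rightarrow> 'h \<Rightarrow> 'k)
    \<Rightarrow> ('k, 'h, 'b, 'u) ydmod \<Rightarrow> bool" where
  "yd_condition H K \<sigma> X \<longleftrightarrow> (let V = space X; VK = tensor V K in
     \<forall>h\<in>carrier H. \<forall>v\<in>carrier V. coact X (act X h v) =
       sweedler3 H VK (\<lambda>h1 h2 h3. tlift VK (\<lambda>v0 v1.
         pure V K (act X h2 v0)
           ((sigma_r K \<sigma> h3 \<otimes>\<^bsub>K\<^esub> v1) \<otimes>\<^bsub>K\<^esub> antipode_inv K (sigma_r K \<sigma> h1))) (coact X v)) h)"

definition comodule_map :: "('k::field, 'b) hopf \<Rightarrow> ('k, 'h, 'b, 'u) ydmod \<Rightarrow> ('k, 'h, 'b, 'u) ydmod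
    \<Rightarrow> (('k, 'u) univ \<Rightarrow> ('k, 'u) univ) \<Rightarrow> bool" where
  "comodule_map K X Y f \<longleftrightarrow> (\<forall>v\<in>carrier (space X).
     coact Y (f v) = tlift (tensor (space Y) K) (\<lambda>v0 x. pure (space Y) K (f v0) x) (coact X v))"

definition yd_tensor :: "('k::field, 'h) hopf \<Rightarrow> ('k, 'b) hopf \<Rightarrow> ('k, 'h, 'b, 'u) ydmod
    \<Rightarrow> ('k, 'h, 'b, 'u) ydmod \<Rightarrow> ('k, 'h, 'b, 'u) ydmod" where
  "yd_tensor H K X Y = (let T = utensor (space X) (space Y); TK = tensor T K in
     \<lparr>space = T,
      act = act (lmod_tensor H X Y),
      coact = \<lambda>t\<in>carrier T. ulift TK (\<lambda>v w. tlift TK (\<lambda>v0 v1. tlift TK (\<lambda>w0 w1.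
        pure T K (upure (space X) (space Y) v0 w0) (w1 \<otimes>\<^bsub>K\<^esub> v1)) (coact Y w)) (coact X v)) t\<rparr>)"

definition yd_unit :: "('k::field, 'h) hopf \<Rightarrow> ('k, 'b) hopf \<Rightarrow> ('k, 'h, 'b, 'u) ydmod" where
  "yd_unit H K = \<lparr>space = uscalars, act = act (lmod_unit H),
     coact = \<lambda>v\<in>carrier uscalars. pure uscalars K v \<one>\<^bsub>K\<^esub>\<rparr>"

type_synonym ('k, 'h, 'b, 'u) yd_arr =
  "('k, 'h, 'b, 'u) ydmod \<times> (('k, 'u) univ \<Rightarrow> ('k, 'u) univ) \<times> ('k, 'h, 'b, 'u) ydmod"

definition YD :: "'u itself \<Rightarrow> ('k::field, 'h) hopf \<Rightarrow> ('k, 'b) hopf \<Rightarrow> (('b \<Rightarrow> 'k) \<Rightarrow> 'h \<Rightarrow> 'k)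
    \<Rightarrow> ('k, ('k, 'h, 'b, 'u) ydmod, ('k, 'h, 'b, 'u) yd_arr) tcat" where
  "YD U H K \<sigma> = linear_tcat
     {X. fd_lmodule H X \<and> rcomodule K X \<and> yd_condition H K \<sigma> X} space
     (\<lambda>X Y f. module_map H X Y f \<and> comodule_map K X Y f)
     (yd_tensor H K) (yd_unit H K)"

end

theory Submission
imports Defs
begin

text \<open>
  Write \<open>p\<close> for the surjection \<open>\<sigma>\<^sub>r\<close> from \<open>H\<close> to \<open>K\<close>. The three categories are not only equivalent:
  an object of each is an \<open>H\<close>-module with one further structure on the same vector space, the three
  kinds of structure determine each other, and the translations respect tensor products and
  constraints on the nose. So the Yetter-Drinfeld category is strictly isomorphic to the other two.

  A right \<open>K\<close>-coaction is the same as a left action of \<open>K\<^sup>*\<close>, namely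
  \<open>f \<cdot> v = \<Sum> \<langle>f, v\<^sub>1\<rangle> v\<^sub>0\<close>. Under this translation the cross relation of the quantum double is an
  equivalent form (\<open>yd_twisted\<close>) of the Yetter-Drinfeld condition, which gives \<open>yd_iso_double\<close>.

  A Yetter-Drinfeld module \<open>X\<close> has the half braiding whose inverse is \<open>y \<otimes> x \<mapsto> \<Sum> x\<^sub>0 \<otimes> x\<^sub>1 y\<close>. That
  this inverse is \<open>H\<close>-linear is another form (\<open>yd_braided\<close>) of the condition, and its
  hexagon is coassociativity. Conversely, a half braiding is natural for the maps from the
  regular \<open>K\<close>-module, hence is determined by its value on the unit of \<open>K\<close>; this value is a
  coaction (\<open>Xh_comodule\<close>), which gives \<open>yd_iso_center\<close>. It suffices to prove the monoidal axioms for
  Yetter-Drinfeld modules, since they carry over along strict isomorphisms (\<open>D_monoidal\<close>).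

  Equalities of vectors are tested on functionals. A Sweedler sum then is the scalar \<open>tsum\<close>, in
  which nested sums can be interchanged and rewritten under binders.
\<close>

section \<open>Vector spaces with carriers\<close>

abbreviation vsp :: "('k::field, 'v, 'm) module_scheme => bool" where
 "vsp V \<equiv> vectorspace class_ring V"

abbreviation (input) el where "el \<equiv> carrier"

named_theorems closed
named_theorems linear

lemma vsI:
 fixes V :: "('k::field, 'v, 'm) module_scheme"
 assumes "\<zero>\<^bsub>V\<^esub> : el V"
  and "\<And>v w. v : el V ==> w : el V ==> v \<oplus>\<^bsub>V\<^esub> w : el V"
  and "\<And>c v. v : el V ==> c \<odot>\<^bsub>V\<^esub> v : el V"
  and "\<And>u v w. u : el V ==> v : el V ==> w : el V ==> (u \<oplus>\<^bsub>V\<^esub> v) \<oplus>\<^bsub>V\<^esub> w = u \<oplus>\<^bsub>V\<^esub> (v \<oplus>\<^bsub>V\<^esub> w)"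
  and "\<And>v w. v : el V ==> w : el V ==> v \<oplus>\<^bsub>V\<^esub> w = w \<oplus>\<^bsub>V\<^esub> v"
  and "\<And>v. v : el V ==> \<zero>\<^bsub>V\<^esub> \<oplus>\<^bsub>V\<^esub> v = v"
  and "\<And>v. v : el V ==> (- 1) \<odot>\<^bsub>V\<^esub> v \<oplus>\<^bsub>V\<^esub> v = \<zero>\<^bsub>V\<^esub>"
  and "\<And>a b v. v : el V ==> (a + b) \<odot>\<^bsub>V\<^esub> v = a \<odot>\<^bsub>V\<^esub> v \<oplus>\<^bsub>V\<^esub> b \<odot>\<^bsub>V\<^esub> v"
  and "\<And>a v w. v : el V ==> w : el V ==> a \<odot>\<^bsub>V\<^esub> (v \<oplus>\<^bsub>V\<^esub> w) = a \<odot>\<^bsub>V\<^esub> v \<oplus>\<^bsub>V\<^esub> a \<odot>\<^bsub>V\<^esub> w"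
  and "\<And>a b v. v : el V ==> (a * b) \<odot>\<^bsub>V\<^esub> v = a \<odot>\<^bsub>V\<^esub> (b \<odot>\<^bsub>V\<^esub> v)"
  and "\<And>v. v : el V ==> 1 \<odot>\<^bsub>V\<^esub> v = v"
 shows "vsp V"
proof -
 have "abelian_group V"
  by (rule abelian_groupI) (use assms in blast)+
 moreover have "cring (class_ring :: 'k ring)" "field (class_ring :: 'k ring)"
  by unfold_locales
 ultimately show ?thesis
  unfolding vectorspace_def Module.module_def Module.module_axioms_def
  using assms by simp
qed

lemma
 fixes V :: "('k::field, 'v, 'm) module_scheme"
 assumes V: "vsp V"
 shows vs_zero_closed [simp, closed]: "\<zero>\<^bsub>V\<^esub> : el V"
  and vs_add_closed [simp, closed]: "v : el V ==> w : el V ==> v \<oplus>\<^bsub>V\<^esub> w : el V"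
  and vs_smult_closed [simp, closed]: "v : el V ==> c \<odot>\<^bsub>V\<^esub> v : el V"
  and vs_add_assoc: "u : el V ==> v : el V ==> w : el V ==> (u \<oplus>\<^bsub>V\<^esub> v) \<oplus>\<^bsub>V\<^esub> w = u \<oplus>\<^bsub>V\<^esub> (v \<oplus>\<^bsub>V\<^esub> w)"
  and vs_add_comm: "v : el V ==> w : el V ==> v \<oplus>\<^bsub>V\<^esub> w = w \<oplus>\<^bsub>V\<^esub> v"
  and vs_add_left_comm: "u : el V ==> v : el V ==> w : el V ==> u \<oplus>\<^bsub>V\<^esub> (v \<oplus>\<^bsub>V\<^esub> w) = v \<oplus>\<^bsub>V\<^esub> (u \<oplus>\<^bsub>V\<^esub> w)"
  and vs_zero_left [simp]: "v : el V ==> \<zero>\<^bsub>V\<^esub> \<oplus>\<^bsub>V\<^esub> v = v"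
  and vs_zero_right [simp]: "v : el V ==> v \<oplus>\<^bsub>V\<^esub> \<zero>\<^bsub>V\<^esub> = v"
  and vs_smult_add: "v : el V ==> (a + b) \<odot>\<^bsub>V\<^esub> v = a \<odot>\<^bsub>V\<^esub> v \<oplus>\<^bsub>V\<^esub> b \<odot>\<^bsub>V\<^esub> v"
  and vs_smult_distr: "v : el V ==> w : el V ==> a \<odot>\<^bsub>V\<^esub> (v \<oplus>\<^bsub>V\<^esub> w) = a \<odot>\<^bsub>V\<^esub> v \<oplus>\<^bsub>V\<^esub> a \<odot>\<^bsub>V\<^esub> w"
  and vs_smult_mult: "v : el V ==> (a * b) \<odot>\<^bsub>V\<^esub> v = a \<odot>\<^bsub>V\<^esub> (b \<odot>\<^bsub>V\<^esub> v)"
  and vs_smult_one [simp]: "v : el V ==> 1 \<odot>\<^bsub>V\<^esub> v = v"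
  and vs_smult_zero [simp]: "v : el V ==> 0 \<odot>\<^bsub>V\<^esub> v = \<zero>\<^bsub>V\<^esub>"
  and vs_smult_zero_vec [simp]: "c \<odot>\<^bsub>V\<^esub> \<zero>\<^bsub>V\<^esub> = \<zero>\<^bsub>V\<^esub>"
  and vs_neg: "v : el V ==> (- 1) \<odot>\<^bsub>V\<^esub> v \<oplus>\<^bsub>V\<^esub> v = \<zero>\<^bsub>V\<^esub>"
proof -
 interpret vectorspace class_ring V by (rule V)
 show "\<zero>\<^bsub>V\<^esub> : el V" by simp
 show "v : el V ==> w : el V ==> v \<oplus>\<^bsub>V\<^esub> w : el V" by simp
 show s: "v : el V ==> c \<odot>\<^bsub>V\<^esub> v : el V" for c v using smult_closed[of c v] by simp
 show "u : el V ==> v : el V ==> w : el V ==> (u \<oplus>\<^bsub>V\<^esub> v) \<oplus>\<^bsub>V\<^esub> w = u \<oplus>\<^bsub>V\<^esub> (v \<oplus>\<^bsub>V\<^esub> w)" by (rule M.a_assoc)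
 show "v : el V ==> w : el V ==> v \<oplus>\<^bsub>V\<^esub> w = w \<oplus>\<^bsub>V\<^esub> v" by (rule M.a_comm)
 show "u : el V ==> v : el V ==> w : el V ==> u \<oplus>\<^bsub>V\<^esub> (v \<oplus>\<^bsub>V\<^esub> w) = v \<oplus>\<^bsub>V\<^esub> (u \<oplus>\<^bsub>V\<^esub> w)" by (rule M.a_lcomm)
 show "v : el V ==> \<zero>\<^bsub>V\<^esub> \<oplus>\<^bsub>V\<^esub> v = v" by simp
 show "v : el V ==> v \<oplus>\<^bsub>V\<^esub> \<zero>\<^bsub>V\<^esub> = v" by simp
 show l: "v : el V ==> (a + b) \<odot>\<^bsub>V\<^esub> v = a \<odot>\<^bsub>V\<^esub> v \<oplus>\<^bsub>V\<^esub> b \<odot>\<^bsub>V\<^esub> v" for a b v using smult_l_distr[of a b v] by simp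
 show "v : el V ==> w : el V ==> a \<odot>\<^bsub>V\<^esub> (v \<oplus>\<^bsub>V\<^esub> w) = a \<odot>\<^bsub>V\<^esub> v \<oplus>\<^bsub>V\<^esub> a \<odot>\<^bsub>V\<^esub> w" using smult_r_distr[of a v w] by simp
 show "v : el V ==> (a * b) \<odot>\<^bsub>V\<^esub> v = a \<odot>\<^bsub>V\<^esub> (b \<odot>\<^bsub>V\<^esub> v)" using smult_assoc1[of a b v] by simp
 show o: "v : el V ==> 1 \<odot>\<^bsub>V\<^esub> v = v" for v using smult_one[of v] by simp
 show z: "v : el V ==> 0 \<odot>\<^bsub>V\<^esub> v = \<zero>\<^bsub>V\<^esub>" for v using lmult_0[of v] by simp
 show "c \<odot>\<^bsub>V\<^esub> \<zero>\<^bsub>V\<^esub> = \<zero>\<^bsub>V\<^esub>" using rmult_0[of c] by simp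
 show "v : el V ==> (- 1) \<odot>\<^bsub>V\<^esub> v \<oplus>\<^bsub>V\<^esub> v = \<zero>\<^bsub>V\<^esub>" using l[of v "-1" 1] o z by simp
qed

lemma ground_simps [simp]: "el ground = UNIV" "\<zero>\<^bsub>ground\<^esub> = 0" "a \<oplus>\<^bsub>ground\<^esub> b = a + b"
 "c \<odot>\<^bsub>ground\<^esub> a = c * a"
 by (simp_all add: ground_def)

lemma vs_ground [simp]: "vsp ground"
 by (rule vsI) (auto simp: algebra_simps)

lemma linI:
 fixes V :: "('k::field, 'v, 'm) module_scheme"
 assumes "\<And>v. v : el V ==> f v : el W"
  and "\<And>v w. v : el V ==> w : el V ==> f (v \<oplus>\<^bsub>V\<^esub> w) = f v \<oplus>\<^bsub>W\<^esub> f w"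
  and "\<And>c v. v : el V ==> f (c \<odot>\<^bsub>V\<^esub> v) = c \<odot>\<^bsub>W\<^esub> f v"
 shows "f : lin V W"
 using assms unfolding LinearCombinations.module_hom_def by auto

lemma lin_closed: "f : lin V W ==> v : el V ==> f v : el W"
 unfolding LinearCombinations.module_hom_def by auto

lemma lin_add: "f : lin V W ==> v : el V ==> w : el V ==> f (v \<oplus>\<^bsub>V\<^esub> w) = f v \<oplus>\<^bsub>W\<^esub> f w"
 unfolding LinearCombinations.module_hom_def by auto

lemma lin_smult: "f : lin V W ==> v : el V ==> f (c \<odot>\<^bsub>V\<^esub> v) = c \<odot>\<^bsub>W\<^esub> f v"
 unfolding LinearCombinations.module_hom_def by auto

lemma lin_zero: "vsp V ==> vsp W ==> f : lin V W ==> f \<zero>\<^bsub>V\<^esub> = \<zero>\<^bsub>W\<^esub>"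
 by (metis lin_closed lin_smult vs_smult_zero vs_zero_closed)

lemma lin_cong: "(\<And>v. v : el V ==> f v = g v) ==> vsp V ==> f : lin V W \<longleftrightarrow> g : lin V W"
 unfolding LinearCombinations.module_hom_def Pi_def by auto

lemma lin_comp: "g : lin V W ==> f : lin U V ==> (%x. g (f x)) : lin U W"
 by (rule linI) (simp_all add: lin_closed[of f U V] lin_closed[of g V W] lin_add[of f U V] lin_add[of g V W]
   lin_smult[of f U V] lin_smult[of g V W])

lemma lin_restrict [simp]: "vsp V ==> restrict f (el V) : lin V W \<longleftrightarrow> f : lin V W"
 by (rule lin_cong) auto

lemma lin_id [linear]: "(%x. x) : lin V V"
 unfolding LinearCombinations.module_hom_def by auto

lemma lin_smult_rule [linear]: "vsp W ==> f : lin V W ==> (%x. c \<odot>\<^bsub>W\<^esub> f x) : lin V W"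
 by (rule linI) (auto simp: lin_closed lin_add lin_smult vs_smult_distr vs_smult_mult[symmetric] mult.commute)

lemma lin_coeff_rule [linear]: "vsp W ==> f : lin V ground ==> w : el W ==> (%x. f x \<odot>\<^bsub>W\<^esub> w) : lin V W"
 by (rule linI) (auto simp: lin_add lin_smult vs_smult_add vs_smult_mult)

lemma lin_add_rule [linear]: "vsp W ==> f : lin V W ==> g : lin V W ==> (%x. f x \<oplus>\<^bsub>W\<^esub> g x) : lin V W"
 by (rule linI) (auto simp: lin_closed lin_add lin_smult vs_smult_distr vs_add_assoc vs_add_left_comm vs_add_comm)

lemma lin_zero_rule [linear]: "vsp W ==> (%x. \<zero>\<^bsub>W\<^esub>) : lin V W"
 by (rule linI) auto

lemma lin_times [linear]: "f : lin V ground ==> (%x. c * f x) : lin V ground"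
 "f : lin V ground ==> (%x. f x * c) : lin V ground"
 unfolding LinearCombinations.module_hom_def by (auto simp: algebra_simps)

lemma bilinI:
 "(\<And>v. v : el V ==> (%w. f v w) : lin W Z) ==> (\<And>w. w : el W ==> (%v. f v w) : lin V Z)
  ==> bilin V W Z f"
 unfolding bilin_def by simp

lemma bilin_left: "bilin V W Z f ==> w : el W ==> g : lin U V ==> (%x. f (g x) w) : lin U Z"
 unfolding bilin_def by (rule lin_comp[of "%v. f v w"]) auto

lemma bilin_right: "bilin V W Z f ==> v : el V ==> g : lin U W ==> (%x. f v (g x)) : lin U Z"
 unfolding bilin_def by (rule lin_comp[of "%w. f v w"]) auto

lemma bilin_closed: "bilin V W Z f ==> v : el V ==> w : el W ==> f v w : el Z"
 unfolding bilin_def by (auto dest: lin_closed)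

lemma bilin_lin1: "bilin V W Z f ==> w : el W ==> (%x. f x w) : lin V Z"
 and bilin_lin2: "bilin V W Z f ==> v : el V ==> f v : lin W Z"
 unfolding bilin_def by auto

text \<open>A sum over a list needs neither finiteness nor distinctness side conditions, and \<open>tlift\<close>
 is one.\<close>

definition vsum :: "('k::field, 'v, 'm) module_scheme => ('i => 'v) => 'i list => 'v" where
 "vsum Z f xs = foldr (%x z. f x \<oplus>\<^bsub>Z\<^esub> z) xs \<zero>\<^bsub>Z\<^esub>"

lemma vsum_simps [simp]: "vsum Z f [] = \<zero>\<^bsub>Z\<^esub>" "vsum Z f (x # xs) = f x \<oplus>\<^bsub>Z\<^esub> vsum Z f xs"
 by (simp_all add: vsum_def)

lemma tlift_vsum: "tlift Z f t = vsum Z (%(v, w). f v w) t"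
 unfolding tlift_def vsum_def by (rule arg_cong[where f = "%g. foldr g t \<zero>\<^bsub>Z\<^esub>"]) auto

lemma vsum_cong: "(\<And>x. x : set xs ==> f x = g x) ==> vsum Z f xs = vsum Z g xs"
 by (induct xs) auto

lemma vsum_closed: "vsp Z ==> (\<And>x. x : set xs ==> f x : el Z) ==> vsum Z f xs : el Z"
 by (induct xs) auto

lemma vsum_append: "vsp Z ==> (\<And>x. x : set xs \<union> set ys ==> f x : el Z) ==>
  vsum Z f (xs @ ys) = vsum Z f xs \<oplus>\<^bsub>Z\<^esub> vsum Z f ys"
 by (induct xs) (auto simp: vsum_closed vs_add_assoc)

lemma vsum_lin: "vsp Z ==> vsp Z' ==> \<phi> : lin Z Z' ==> (\<And>x. x : set xs ==> f x : el Z) ==>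
  \<phi> (vsum Z f xs) = vsum Z' (%x. \<phi> (f x)) xs"
 by (induct xs) (auto simp: lin_zero lin_add vsum_closed)

lemma vsum_ground: "vsum ground f xs = sum_list (map f xs)"
 by (induct xs) auto

lemma lin_vsum [linear]: "vsp Z ==> (\<And>i. i : set xs ==> (%x. f x i) : lin V Z) ==> (%x. vsum Z (f x) xs) : lin V Z"
 by (induct xs) (auto intro!: lin_zero_rule lin_add_rule)

lemma lin_sum_list [linear]: "(\<And>i. i : set xs ==> (%x. f x i) : lin V ground) ==>
  (%x. sum_list (map (f x) xs)) : lin V ground"
 using lin_vsum[of ground xs f V] by (simp add: vsum_ground)

subsection \<open>Dual bases\<close>

definition dual_basis :: "('k::field, 'v, 'm) module_scheme => ('v \<times> ('v => 'k)) list => bool" where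
 "dual_basis V bs \<longleftrightarrow> set bs \<subseteq> el V \<times> lin V ground \<and>
   (\<forall>v\<in>el V. vsum V (%b. snd b v \<odot>\<^bsub>V\<^esub> fst b) bs = v)"

lemma finsum_as_vsum:
 assumes "vsp V" "distinct xs" "\<And>x. x : set xs ==> f x : el V"
 shows "finsum V f (set xs) = vsum V f xs"
proof -
 interpret vectorspace class_ring V by (rule assms)
 show ?thesis using assms(2,3)
  by (induct xs) (auto simp: finsum_insert)
qed

lemma dual_basis_exists:
 fixes V :: "('k::field, 'v, 'm) module_scheme"
 assumes "fdvs V" shows "\<exists>bs. dual_basis V bs"
proof -
 interpret vectorspace class_ring V using assms by blast
 obtain B where B: "finite B" "basis B" using finite_basis_exists assms by blast
 then have BV: "B \<subseteq> el V" by (simp add: basis_def)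
 obtain xs where xs: "set xs = B" "distinct xs" using finite_distinct_list[OF B(1)] by blast
 have lc: "lincomb a B = vsum V (%e. a e \<odot>\<^bsub>V\<^esub> e) xs" for a :: "'v => 'k"
  unfolding lincomb_def xs(1)[symmetric]
  by (rule finsum_as_vsum) (use assms xs BV in auto)
 have ex1: "\<exists>!a. a : B \<rightarrow>\<^sub>E (UNIV :: 'k set) \<and> vsum V (%e. a e \<odot>\<^bsub>V\<^esub> e) xs = v" if "v : el V" for v
  using basis_criterion[OF B(1) BV] B(2) that by (simp add: lc)
 define c where "c v = (THE a. a : B \<rightarrow>\<^sub>E (UNIV :: 'k set) \<and> vsum V (%e. a e \<odot>\<^bsub>V\<^esub> e) xs = v)" for v
 have c: "vsum V (%e. c v e \<odot>\<^bsub>V\<^esub> e) xs = v" if "v : el V" for v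
  using theI'[OF ex1[OF that]] by (simp add: c_def)
 have c_uniq: "c v e = a e" if "v : el V" "e : B" "vsum V (%e. a e \<odot>\<^bsub>V\<^esub> e) xs = v" for v a e
 proof -
  have "vsum V (%e. restrict a B e \<odot>\<^bsub>V\<^esub> e) xs = vsum V (%e. a e \<odot>\<^bsub>V\<^esub> e) xs"
   using xs by (intro vsum_cong) auto
  then have "vsum V (%e. restrict a B e \<odot>\<^bsub>V\<^esub> e) xs = v" by (simp add: that(3))
  then have "c v = restrict a B"
   unfolding c_def by (intro the1_equality[OF ex1[OF that(1)]]) auto
  then show ?thesis using that by simp
 qed
 have V: "vsp V" using assms by blast
 have m: "e : el V" if "e : set xs" for e using that xs BV by auto
 have "c (v \<oplus>\<^bsub>V\<^esub> w) e = c v e + c w e" if "v : el V" "w : el V" "e : B" for v w e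
 proof (rule c_uniq)
  have "vsum V (%e. (a e + b e) \<odot>\<^bsub>V\<^esub> e) ys = vsum V (%e. a e \<odot>\<^bsub>V\<^esub> e) ys \<oplus>\<^bsub>V\<^esub> vsum V (%e. b e \<odot>\<^bsub>V\<^esub> e) ys"
   if "set ys \<subseteq> B" for a b and ys :: "'v list"
   using that
  proof (induct ys)
   case (Cons y ys)
   have [simp]: "vsum V (%e. a e \<odot>\<^bsub>V\<^esub> e) ys : el V" for a :: "'v => 'k"
    using Cons.prems BV V by (intro vsum_closed) auto
   have [simp]: "y : el V" using Cons.prems BV by auto
   show ?case using Cons V
    by (simp add: vs_smult_add vs_add_assoc vs_add_left_comm)
  qed (use V in simp)
  then show "vsum V (%e. (c v e + c w e) \<odot>\<^bsub>V\<^esub> e) xs = v \<oplus>\<^bsub>V\<^esub> w"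
   using c that xs by simp
 qed (use that V in auto)
 moreover have "c (r \<odot>\<^bsub>V\<^esub> v) e = r * c v e" if "v : el V" "e : B" for r v e
 proof (rule c_uniq)
  have "vsum V (%e. (r * c v e) \<odot>\<^bsub>V\<^esub> e) xs = vsum V (%e. r \<odot>\<^bsub>V\<^esub> (c v e \<odot>\<^bsub>V\<^esub> e)) xs"
   using V m by (intro vsum_cong) (simp add: vs_smult_mult)
  also have "... = r \<odot>\<^bsub>V\<^esub> v"
   using vsum_lin[OF V V lin_smult_rule[OF V lin_id], of xs "%e. c v e \<odot>\<^bsub>V\<^esub> e" r] c that m V by simp
  finally show "vsum V (%e. (r * c v e) \<odot>\<^bsub>V\<^esub> e) xs = r \<odot>\<^bsub>V\<^esub> v" .
 qed (use that V in auto)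
 ultimately have lin: "(%v. c v e) : lin V ground" if "e : B" for e
  using that by (intro linI) auto
 have mp: "vsum V f (map g ys) = vsum V (%x. f (g x)) ys" for f g and ys :: "'v list"
  by (induct ys) auto
 have "dual_basis V (map (%e. (e, %v. c v e)) xs)"
  unfolding dual_basis_def using lin c m xs by (auto simp: mp)
 then show ?thesis by blast
qed

lemma fin_dimI:
 assumes V: "vsp V" and g: "g ` set is \<subseteq> el V"
  and span: "\<And>v. v : el V ==> \<exists>c. v = vsum V (%i. c i \<odot>\<^bsub>V\<^esub> g i) is"
 shows "vectorspace.fin_dim class_ring V"
proof -
 interpret vectorspace class_ring V by (rule V)
 let ?B = "g ` set is"
 have in_B: "g i : span ?B" if "i : set is" for i
  using in_own_span[of ?B] g that by auto
 have sub: "LinearCombinations.submodule class_ring (span ?B) V"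
  by (rule span_is_submodule[OF g])
 have "vsum V (%i. c i \<odot>\<^bsub>V\<^esub> g i) ys : span ?B" if "set ys \<subseteq> set is" for c ys
  using that
 proof (induct ys)
  case Nil
  show ?case using LinearCombinations.submodule.zero_closed[OF sub] by simp
 next
  case (Cons y ys)
  then have "g y : span ?B" using in_B by simp
  then have "c y \<odot>\<^bsub>V\<^esub> g y : span ?B"
   by (rule LinearCombinations.submodule.smult_closed[OF sub, rotated]) simp
  then show ?case
   using Cons LinearCombinations.submodule.m_closed[OF sub] by simp
 qed
 then have "el V \<subseteq> span ?B" using span by fastforce
 then have "span ?B = el V" using span_is_subset2[OF g] by auto
 then show ?thesis unfolding fin_dim_def using g by blast
qed

lemma dual_basis_fin_dim:
 assumes "vsp V" "dual_basis V bs"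
 shows "vectorspace.fin_dim class_ring V"
proof (rule fin_dimI[OF assms(1), of fst bs])
 show "fst ` set bs \<subseteq> el V" using assms(2) by (auto simp: dual_basis_def)
 show "\<exists>c. v = vsum V (%i. c i \<odot>\<^bsub>V\<^esub> fst i) bs" if "v : el V" for v
  using assms(2) that by (intro exI[of _ "%i. snd i v"]) (simp add: dual_basis_def case_prod_beta)
qed

lemma fdvs_image:
 assumes V: "fdvs V" and W: "vsp W" and f: "f : lin V W" and surj: "f ` el V = el W"
 shows "fdvs W"
proof -
 obtain bs where bs: "dual_basis V bs" using dual_basis_exists V by blast
 have "vectorspace.fin_dim class_ring W"
 proof (rule fin_dimI[OF W, of "%b. f (fst b)" bs])
  show "(%b. f (fst b)) ` set bs \<subseteq> el W"
   using bs f by (auto simp: dual_basis_def intro: lin_closed)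
  fix w assume "w : el W"
  then obtain v where v: "v : el V" "w = f v" using surj by blast
  have "w = f (vsum V (%b. snd b v \<odot>\<^bsub>V\<^esub> fst b) bs)"
   using bs v by (simp add: dual_basis_def case_prod_beta)
  also have "... = vsum W (%b. f (snd b v \<odot>\<^bsub>V\<^esub> fst b)) bs"
   using bs V by (intro vsum_lin[OF _ W f]) (auto simp: dual_basis_def)
  also have "... = vsum W (%b. snd b v \<odot>\<^bsub>W\<^esub> f (fst b)) bs"
   using bs by (intro vsum_cong lin_smult[OF f]) (auto simp: dual_basis_def)
  finally show "\<exists>c. w = vsum W (%b. c b \<odot>\<^bsub>W\<^esub> f (fst b)) bs" by (rule exI[of _ "%b. snd b v"])
 qed
 with W show ?thesis by blast
qed

lemma fdvs_ground [simp]: "fdvs ground"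
proof -
 have "dual_basis ground [(1, %x. x)]"
  unfolding dual_basis_def by (simp add: lin_id)
 then show ?thesis using dual_basis_fin_dim vs_ground by blast
qed

text \<open>Defaulting to zero makes \<open>ev V \<phi>\<close> linear for every \<open>\<phi>\<close>, so that separation by functionals
 has no linearity premise.\<close>

definition ev :: "('k::field, 'v, 'm) module_scheme => ('v => 'k) => 'v => 'k" where
 "ev V \<phi> = (if \<phi> : lin V ground then \<phi> else (%v. 0))"

lemma ev_lin [simp]: "ev V \<phi> : lin V ground"
 unfolding ev_def using lin_zero_rule[OF vs_ground] by auto

lemma ev_rule [linear]: "g : lin U V ==> (%x. ev V \<phi> (g x)) : lin U ground"
 by (rule lin_comp[OF ev_lin])

lemma ev_eqI:
 assumes "fdvs V" "v : el V" "w : el V" "\<And>\<phi>. ev V \<phi> v = ev V \<phi> w"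
 shows "v = w"
proof -
 obtain bs where bs: "dual_basis V bs" using dual_basis_exists assms(1) by blast
 have "snd b v = snd b w" if "b : set bs" for b
  using assms(4)[of "snd b"] that bs by (auto simp: dual_basis_def ev_def split: if_splits)
 then have "vsum V (%b. snd b v \<odot>\<^bsub>V\<^esub> fst b) bs = vsum V (%b. snd b w \<odot>\<^bsub>V\<^esub> fst b) bs"
  by (intro vsum_cong) (simp add: case_prod_beta)
 then show ?thesis using bs assms by (simp add: dual_basis_def)
qed

section \<open>Tensor products\<close>

lemma tensor_eq_lists:
 assumes "vsp V" "vsp W"
 shows "tensor_eq V W s t ==> s : lists (el V \<times> el W) \<and> t : lists (el V \<times> el W)"
 by (induct rule: tensor_eq.induct) (use assms in auto)

lemma tensor_rep_eq: "t : lists (el V \<times> el W) ==> tensor_eq V W (tensor_rep V W t) t"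
 unfolding tensor_rep_def by (rule someI[of _ t]) (rule tensor_eq.refl)

lemma tensor_rep_cong:
 assumes "tensor_eq V W s t" shows "tensor_rep V W s = tensor_rep V W t"
proof -
 have "tensor_eq V W x s \<longleftrightarrow> tensor_eq V W x t" for x
  using assms by (meson tensor_eq.sym tensor_eq.trans)
 then show ?thesis unfolding tensor_rep_def by simp
qed

lemma tensor_rep_lists: "vsp V ==> vsp W ==> t : lists (el V \<times> el W) ==>
  tensor_rep V W t : lists (el V \<times> el W)"
 using tensor_rep_eq tensor_eq_lists by blast

lemma tensor_rep_self: "vsp V ==> vsp W ==> t : el (tensor V W) ==> tensor_rep V W t = t"
 unfolding tensor_def using tensor_rep_eq tensor_rep_cong by fastforce

lemma tensor_carrier_lists: "vsp V ==> vsp W ==> t : el (tensor V W) ==> t : lists (el V \<times> el W)"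
 unfolding tensor_def using tensor_rep_lists by fastforce

lemma tensor_carrierI: "t : lists (el V \<times> el W) ==> tensor_rep V W t : el (tensor V W)"
 unfolding tensor_def by auto

definition scale_list :: "('k::field, 'v, 'm) module_scheme => 'k => ('v \<times> 'w) list => ('v \<times> 'w) list" where
 "scale_list V c t = map (%(v, w). (c \<odot>\<^bsub>V\<^esub> v, w)) t"

lemma scale_list_lists [simp]: "vsp V ==> t : lists (el V \<times> el W) ==>
  scale_list V c t : lists (el V \<times> el W)"
 unfolding scale_list_def by (induct t) auto

lemma scale_list_simps [simp]: "scale_list V c [] = []"
 "scale_list V c ((v, w) # t) = (c \<odot>\<^bsub>V\<^esub> v, w) # scale_list V c t"
 "scale_list V c (s @ t) = scale_list V c s @ scale_list V c t"
 by (simp_all add: scale_list_def)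

lemma tensor_ops:
 "\<zero>\<^bsub>tensor V W\<^esub> = tensor_rep V W []"
 "s \<oplus>\<^bsub>tensor V W\<^esub> t = tensor_rep V W (s @ t)"
 "c \<odot>\<^bsub>tensor V W\<^esub> t = tensor_rep V W (scale_list V c t)"
 "el (tensor V W) = tensor_rep V W ` lists (el V \<times> el W)"
 by (simp_all add: tensor_def scale_list_def)

lemma tensor_eq_scale:
 assumes V: "vsp V" "vsp W"
 shows "tensor_eq V W s t ==> tensor_eq V W (scale_list V c s) (scale_list V c t)"
proof (induct rule: tensor_eq.induct)
 case (refl t) then show ?case using V by (intro tensor_eq.refl) simp
next
 case sym then show ?case by (blast intro: tensor_eq.sym)
next
 case trans then show ?case by (blast intro: tensor_eq.trans)
next
 case append then show ?case by (simp add: tensor_eq.append)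
next
 case swap then show ?case using V by (simp add: tensor_eq.swap)
next
 case zero then show ?case using V by (simp add: tensor_eq.zero)
next
 case (add_left v v' w) then show ?case
  using V tensor_eq.add_left[of "c \<odot>\<^bsub>V\<^esub> v" V "c \<odot>\<^bsub>V\<^esub> v'" w W] by (simp add: vs_smult_distr)
next
 case (add_right v w w') then show ?case using V by (simp add: tensor_eq.add_right)
next
 case (balanced v w d)
 then show ?case using V tensor_eq.balanced[of "c \<odot>\<^bsub>V\<^esub> v" V w W d]
  by (simp add: vs_smult_mult[symmetric] mult.commute)
qed

lemma append_interchange:
 assumes "vsp V" "vsp W" "tensor_eq V W a (b @ c)" "tensor_eq V W a' (b' @ c')"
 shows "tensor_eq V W (a @ a') ((b @ b') @ (c @ c'))"
proof -
 have l: "x : lists (el V \<times> el W)" if "x : {b, b', c, c'}" for x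
  using that tensor_eq_lists[OF assms(1,2,3)] tensor_eq_lists[OF assms(1,2,4)] by auto
 have "tensor_eq V W (c @ b') (b' @ c)" using l by (intro tensor_eq.swap) auto
 then have "tensor_eq V W ((c @ b') @ c') ((b' @ c) @ c')"
  by (rule tensor_eq.append) (use l in \<open>auto intro: tensor_eq.refl\<close>)
 then have "tensor_eq V W (b @ (c @ b') @ c') (b @ (b' @ c) @ c')"
  using l tensor_eq.append[OF tensor_eq.refl[of b V W]] by blast
 moreover have "tensor_eq V W (a @ a') ((b @ c) @ (b' @ c'))"
  using assms by (intro tensor_eq.append)
 ultimately show ?thesis by (auto intro: tensor_eq.trans)
qed

lemma scale_list_add:
 assumes V: "vsp V" "vsp W" and t: "t : lists (el V \<times> el W)"
 shows "tensor_eq V W (scale_list V (a + b) t) (scale_list V a t @ scale_list V b t)"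
 using t
proof (induct t)
 case (Cons p t)
 obtain v w where p: "p = (v, w)" "v : el V" "w : el W" using Cons by auto
 have "tensor_eq V W [((a + b) \<odot>\<^bsub>V\<^esub> v, w)] ([(a \<odot>\<^bsub>V\<^esub> v, w)] @ [(b \<odot>\<^bsub>V\<^esub> v, w)])"
  using V p tensor_eq.add_left[of "a \<odot>\<^bsub>V\<^esub> v" V "b \<odot>\<^bsub>V\<^esub> v" w W] by (simp add: vs_smult_add)
 from append_interchange[OF V this Cons(3)] show ?case by (simp add: p)
qed (use V in \<open>simp add: tensor_eq.refl\<close>)

lemma scale_list_zero:
 assumes V: "vsp V" "vsp W" and t: "t : lists (el V \<times> el W)"
 shows "tensor_eq V W (scale_list V 0 t) []"
 using t
proof (induct t)
 case (Cons p t)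
 obtain v w where p: "p = (v, w)" "v : el V" "w : el W" using Cons by auto
 from tensor_eq.append[OF tensor_eq.zero[OF p(3)] Cons(3)] show ?case using V p by simp
qed (use V in \<open>simp add: tensor_eq.refl\<close>)

lemma scale_list_one: "vsp V ==> t : lists (el V \<times> el W) ==> scale_list V 1 t = t"
 by (induct t) auto

lemma scale_list_mult: "vsp V ==> t : lists (el V \<times> el W) ==>
  scale_list V a (scale_list V b t) = scale_list V (a * b) t"
 by (induct t) (auto simp: vs_smult_mult)

lemma tensor_add_rep:
 assumes "vsp V" "vsp W" "s : lists (el V \<times> el W)" "t : lists (el V \<times> el W)"
 shows "tensor_rep V W s \<oplus>\<^bsub>tensor V W\<^esub> tensor_rep V W t = tensor_rep V W (s @ t)"
 unfolding tensor_ops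
 by (intro tensor_rep_cong tensor_eq.append tensor_rep_eq assms)

lemma tensor_smult_rep:
 assumes "vsp V" "vsp W" "t : lists (el V \<times> el W)"
 shows "c \<odot>\<^bsub>tensor V W\<^esub> tensor_rep V W t = tensor_rep V W (scale_list V c t)"
 unfolding tensor_ops
 by (intro tensor_rep_cong tensor_eq_scale tensor_rep_eq assms)

lemma vs_tensor [simp, closed]:
 assumes V: "vsp V" "vsp W"
 shows "vsp (tensor V W)"
proof -
 let ?L = "lists (el V \<times> el W)"
 have in_lists: "\<And>s t. s : ?L ==> t : ?L ==> s @ t : ?L" by simp
 note rep = tensor_add_rep[OF V] tensor_smult_rep[OF V] in_lists scale_list_lists[OF V(1)]
 have z: "\<zero>\<^bsub>tensor V W\<^esub> = tensor_rep V W []" by (simp add: tensor_ops)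
 have c: "el (tensor V W) = tensor_rep V W ` ?L" by (simp add: tensor_ops)
 have nil: "[] : ?L" by simp
 show ?thesis
 proof (rule vsI)
  fix v assume "v : el (tensor V W)"
  then obtain t where t: "t : ?L" "v = tensor_rep V W t" by (auto simp: c)
  show "\<zero>\<^bsub>tensor V W\<^esub> \<oplus>\<^bsub>tensor V W\<^esub> v = v" using t by (simp only: z rep nil append_Nil)
  show "1 \<odot>\<^bsub>tensor V W\<^esub> v = v" using t by (simp only: rep scale_list_one[OF V(1) t(1)])
  show "c \<odot>\<^bsub>tensor V W\<^esub> v : el (tensor V W)" for c
   using t by (simp only: rep) (simp only: c rep imageI)
  show "(a * b) \<odot>\<^bsub>tensor V W\<^esub> v = a \<odot>\<^bsub>tensor V W\<^esub> (b \<odot>\<^bsub>tensor V W\<^esub> v)" for a b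
   using t by (simp only: rep scale_list_mult[OF V(1)])
  show *: "(a + b) \<odot>\<^bsub>tensor V W\<^esub> v = a \<odot>\<^bsub>tensor V W\<^esub> v \<oplus>\<^bsub>tensor V W\<^esub> b \<odot>\<^bsub>tensor V W\<^esub> v" for a b
   using t by (simp only: rep tensor_rep_cong[OF scale_list_add[OF V t(1)]])
  have "0 \<odot>\<^bsub>tensor V W\<^esub> v = \<zero>\<^bsub>tensor V W\<^esub>"
   using t by (simp only: rep z tensor_rep_cong[OF scale_list_zero[OF V t(1)]])
  then show "(- 1) \<odot>\<^bsub>tensor V W\<^esub> v \<oplus>\<^bsub>tensor V W\<^esub> v = \<zero>\<^bsub>tensor V W\<^esub>"
   using *[of "-1" 1] \<open>1 \<odot>\<^bsub>tensor V W\<^esub> v = v\<close> by simp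
 next
  fix v w assume "v : el (tensor V W)" "w : el (tensor V W)"
  then obtain s t where t: "s : ?L" "v = tensor_rep V W s" "t : ?L" "w = tensor_rep V W t" by (auto simp: c)
  show "v \<oplus>\<^bsub>tensor V W\<^esub> w : el (tensor V W)"
   using t by (simp only: rep) (simp only: c rep imageI)
  show "v \<oplus>\<^bsub>tensor V W\<^esub> w = w \<oplus>\<^bsub>tensor V W\<^esub> v"
   using t by (simp only: rep) (rule tensor_rep_cong[OF tensor_eq.swap[OF t(1,3)]])
  show "a \<odot>\<^bsub>tensor V W\<^esub> (v \<oplus>\<^bsub>tensor V W\<^esub> w) = a \<odot>\<^bsub>tensor V W\<^esub> v \<oplus>\<^bsub>tensor V W\<^esub> a \<odot>\<^bsub>tensor V W\<^esub> w" for a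
   using t by (simp only: rep scale_list_simps)
 next
  fix u v w assume "u : el (tensor V W)" "v : el (tensor V W)" "w : el (tensor V W)"
  then obtain r s t where t: "r : ?L" "u = tensor_rep V W r" "s : ?L" "v = tensor_rep V W s"
   "t : ?L" "w = tensor_rep V W t" by (auto simp: c)
  show "(u \<oplus>\<^bsub>tensor V W\<^esub> v) \<oplus>\<^bsub>tensor V W\<^esub> w = u \<oplus>\<^bsub>tensor V W\<^esub> (v \<oplus>\<^bsub>tensor V W\<^esub> w)"
   using t by (simp only: rep append_assoc)
 qed (simp only: z, simp only: c nil imageI)
qed

lemma bilin_pure:
 assumes V: "vsp V" "vsp W"
 shows "bilin V W (tensor V W) (pure V W)"
proof -
 have 1: "tensor_rep V W [(v, w)] \<oplus>\<^bsub>tensor V W\<^esub> tensor_rep V W [(v', w')] = tensor_rep V W [(v, w), (v', w')]"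
  if "v : el V" "w : el W" "v' : el V" "w' : el W" for v w v' w'
  using that V by (subst tensor_add_rep) auto
 have 2: "c \<odot>\<^bsub>tensor V W\<^esub> tensor_rep V W [(v, w)] = tensor_rep V W [(c \<odot>\<^bsub>V\<^esub> v, w)]"
  if "v : el V" "w : el W" for c v w
  using that V by (subst tensor_smult_rep) auto
 show ?thesis
  unfolding pure_def
  by (intro bilinI linI)
   (auto simp: 1 2 V intro!: tensor_carrierI tensor_rep_cong tensor_eq.add_left tensor_eq.add_right
    intro: tensor_eq.balanced tensor_eq.sym)
qed

lemma pure_closed [simp, closed]: "vsp V ==> vsp W ==> v : el V ==> w : el W ==>
  pure V W v w : el (tensor V W)"
 using bilin_closed[OF bilin_pure] .

lemma tlift_append:
 assumes "vsp Z" "bilin V W Z f" "s : lists (el V \<times> el W)" "t : lists (el V \<times> el W)"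
 shows "tlift Z f (s @ t) = tlift Z f s \<oplus>\<^bsub>Z\<^esub> tlift Z f t"
 unfolding tlift_vsum using assms by (intro vsum_append) (auto intro: bilin_closed)

lemma tlift_closed_list: "vsp Z ==> bilin V W Z f ==> t : lists (el V \<times> el W) ==> tlift Z f t : el Z"
 unfolding tlift_vsum by (intro vsum_closed) (auto intro: bilin_closed)

lemma tlift_eq:
 assumes V: "vsp V" "vsp W" "vsp Z" and f: "bilin V W Z f"
 shows "tensor_eq V W s t ==> tlift Z f s = tlift Z f t"
proof (induct rule: tensor_eq.induct)
 case (append s s' t t')
 then show ?case using tensor_eq_lists[OF V(1,2)] by (simp add: tlift_append[OF V(3) f])
next
 case (swap s t)
 then show ?case
  by (simp add: tlift_append[OF V(3) f] vs_add_comm[OF V(3)] tlift_closed_list[OF V(3) f])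
qed (use V f lin_zero[OF V(1,3) bilin_lin1[OF f]] lin_add[OF bilin_lin1[OF f]] lin_add[OF bilin_lin2[OF f]]
  lin_smult[OF bilin_lin1[OF f]] lin_smult[OF bilin_lin2[OF f]] in \<open>simp_all add: tlift_def bilin_closed[OF f] vs_add_assoc\<close>)

lemma tlift_rep:
 assumes "vsp V" "vsp W" "vsp Z" "bilin V W Z f" "t : lists (el V \<times> el W)"
 shows "tlift Z f (tensor_rep V W t) = tlift Z f t"
 using assms tensor_rep_eq tlift_eq by blast

lemma tlift_lin:
 assumes V: "vsp V" "vsp W" "vsp Z" and f: "bilin V W Z f"
 shows "tlift Z f : lin (tensor V W) Z"
proof -
 have sc: "tlift Z f (scale_list V c t) = c \<odot>\<^bsub>Z\<^esub> tlift Z f t" if "t : lists (el V \<times> el W)" for c t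
  using that
 proof (induct t)
  case (Cons p t)
  then show ?case using V f tlift_closed_list[OF V(3) f Cons(2)] lin_smult[OF bilin_lin1[OF f]]
   by (auto simp: tlift_def vs_smult_distr bilin_closed)
 qed (use V in \<open>simp add: tlift_def\<close>)
 have l: "s : el (tensor V W) ==> s : lists (el V \<times> el W)" for s
  using tensor_carrier_lists V by blast
 show ?thesis
 proof (rule linI)
  fix s t c assume s: "s : el (tensor V W)"
  show "tlift Z f s : el Z" using tlift_closed_list[OF V(3) f l[OF s]] .
  show "tlift Z f (c \<odot>\<^bsub>tensor V W\<^esub> s) = c \<odot>\<^bsub>Z\<^esub> tlift Z f s"
   using l[OF s] V by (simp add: tensor_ops tlift_rep[OF V f] sc)
  assume t: "t : el (tensor V W)"
  show "tlift Z f (s \<oplus>\<^bsub>tensor V W\<^esub> t) = tlift Z f s \<oplus>\<^bsub>Z\<^esub> tlift Z f t"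
   using l[OF s] l[OF t] V by (simp add: tensor_ops tlift_rep[OF V f] tlift_append[OF V(3) f])
 qed
qed

lemma tlift_pure:
 assumes "vsp V" "vsp W" "vsp Z" "bilin V W Z f" "v : el V" "w : el W"
 shows "tlift Z f (pure V W v w) = f v w"
 unfolding pure_def using assms bilin_closed[OF assms(4-6)]
 by (subst tlift_rep) (auto simp: tlift_def)

text \<open>Representatives are lists of pairs, so every element is a sum of pure tensors.\<close>

lemma tensor_induct [consumes 3, case_names zero add]:
 assumes V: "vsp V" "vsp W" and t: "t : el (tensor V W)"
  and z: "P \<zero>\<^bsub>tensor V W\<^esub>"
  and a: "\<And>v w t. v : el V ==> w : el W ==> t : el (tensor V W) ==> P t ==>
   P (pure V W v w \<oplus>\<^bsub>tensor V W\<^esub> t)"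
 shows "P t"
proof -
 have "P (tensor_rep V W s)" if "s : lists (el V \<times> el W)" for s
  using that
 proof (induct s)
  case Nil show ?case using z by (simp add: tensor_ops)
 next
  case (Cons p s)
  obtain v w where p: "p = (v, w)" "v : el V" "w : el W" using Cons by auto
  have "tensor_rep V W (p # s) = pure V W v w \<oplus>\<^bsub>tensor V W\<^esub> tensor_rep V W s"
   unfolding pure_def using p Cons V by (subst tensor_add_rep) auto
  then show ?case using a p Cons tensor_carrierI by metis
 qed
 then show ?thesis using tensor_rep_self[OF V t] tensor_carrier_lists[OF V t] by metis
qed

lemma tensor_ext:
 assumes V: "vsp V" "vsp W" "vsp Z" and f: "f : lin (tensor V W) Z" "g : lin (tensor V W) Z"
  and eq: "\<And>v w. v : el V ==> w : el W ==> f (pure V W v w) = g (pure V W v w)"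
  and t: "t : el (tensor V W)"
 shows "f t = g t"
 using V(1,2) t
 by (induct rule: tensor_induct) (use V f eq in \<open>auto simp: lin_zero lin_add\<close>)

lemma tlift_pure_id: "vsp V ==> vsp W ==> t : el (tensor V W) ==> tlift (tensor V W) (pure V W) t = t"
 using tensor_ext[of V W "tensor V W" "tlift (tensor V W) (pure V W)" "%x. x" t]
 by (simp add: tlift_lin tlift_pure bilin_pure lin_id)

subsection \<open>Scalar sums over tensors\<close>

text \<open>Entries outside the carriers are skipped. The summand therefore matters on the carriers only,
 whatever \<open>t\<close> is, and the congruence rule below makes the membership facts available to the
 simplifier.\<close>

definition tsum :: "('k::field, 'v, 'm) module_scheme => ('k, 'w, 'n) module_scheme => ('v \<times> 'w) list
  => ('v => 'w => 'k) => 'k" where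
 "tsum V W t F = (\<Sum>(a, b) \<leftarrow> filter (%(a, b). a : el V \<and> b : el W) t. F a b)"

lemma tsum_cong [cong]:
 "t = t' ==> (\<And>a b. a : el V ==> b : el W ==> F a b = G a b) ==> tsum V W t F = tsum V W t' G"
 unfolding tsum_def by (intro arg_cong[where f = sum_list] map_cong) auto

lemma sum_list_swap:
 fixes g :: "'i => 'j => 'z::comm_monoid_add"
 shows "(\<Sum>p\<leftarrow>ps. \<Sum>q\<leftarrow>qs. g p q) = (\<Sum>q\<leftarrow>qs. \<Sum>p\<leftarrow>ps. g p q)"
 by (induct ps) (simp_all add: sum_list_addf sum_list_0)

lemma tsum_swap: "tsum V W s (%a b. tsum V' W' t (%c d. F a b c d)) = tsum V' W' t (%c d. tsum V W s (%a b. F a b c d))"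
 unfolding tsum_def case_prod_unfold by (rule sum_list_swap)

lemma tsum_times:
 "tsum V W t (%a b. c * F a b) = c * tsum V W t F"
 "tsum V W t (%a b. F a b * c) = tsum V W t F * c"
 unfolding tsum_def case_prod_unfold by (simp_all add: sum_list_const_mult sum_list_mult_const)

lemma tsum_zero [simp]: "tsum V W t (%a b. 0) = 0"
 unfolding tsum_def case_prod_unfold by (simp add: sum_list_0)

lemma tsum_tlift: "t : lists (el V \<times> el W) ==> tsum V W t F = tlift ground F t"
 unfolding tsum_def tlift_vsum vsum_ground by (subst filter_True) auto

text \<open>The passage from vector-valued to scalar Sweedler sums: no bilinearity of \<open>F\<close> is assumed.\<close>

lemma tlift_push:
 assumes "vsp V" "vsp W" "vsp Z" "t : el (tensor V W)" "L : lin Z ground"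
  and "\<And>a b. a : el V ==> b : el W ==> F a b : el Z"
 shows "L (tlift Z F t) = tsum V W t (%a b. L (F a b))"
proof -
 have "t : lists (el V \<times> el W)" using tensor_carrier_lists assms by blast
 moreover have "L (tlift Z F t) = tlift ground (%a b. L (F a b)) t"
  unfolding tlift_vsum using assms calculation by (subst vsum_lin[of Z ground]) (auto simp: case_prod_unfold)
 ultimately show ?thesis by (simp add: tsum_tlift)
qed

lemma tsum_lin:
 assumes "vsp V" "vsp W" "bilin V W ground F"
 shows "(%t. tsum V W t F) : lin (tensor V W) ground"
proof -
 have "tsum V W t F = tlift ground F t" if "t : el (tensor V W)" for t
  using tsum_tlift tensor_carrier_lists that assms by blast
 then show ?thesis using tlift_lin[OF assms(1,2) vs_ground assms(3)] lin_cong[of "tensor V W"] assms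
  by (metis (no_types, lifting) vs_tensor)
qed

lemma tsum_rule [linear]:
 "vsp V ==> vsp W ==> T : lin U (tensor V W) ==> bilin V W ground F ==> (%x. tsum V W (T x) F) : lin U ground"
 by (rule lin_comp[OF tsum_lin])

lemma tsum_rule2 [linear]:
 "(\<And>a b. a : el V ==> b : el W ==> (%x. F x a b) : lin U ground) ==> (%x. tsum V W t (F x)) : lin U ground"
 unfolding tsum_def case_prod_unfold by (rule lin_sum_list) auto

lemma tsum_pure:
 "vsp V ==> vsp W ==> bilin V W ground F ==> v : el V ==> w : el W ==>
  tsum V W (pure V W v w) F = F v w"
 by (simp add: tsum_tlift[OF tensor_carrier_lists] tlift_pure)

lemma dual_basis_tensor:
 assumes V: "vsp V" "vsp W" and bs: "dual_basis V bs" and cs: "dual_basis W cs"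
 shows "dual_basis (tensor V W) [(pure V W (fst b) (fst c), %t. tsum V W t (%v w. snd b v * snd c w)). b \<leftarrow> bs, c \<leftarrow> cs]"
  (is "dual_basis ?T ?ts")
proof -
 have b: "fst b : el V" "snd b : lin V ground" if "b : set bs" for b using bs that by (auto simp: dual_basis_def)
 have c: "fst c : el W" "snd c : lin W ground" if "c : set cs" for c using cs that by (auto simp: dual_basis_def)
 have bil: "bilin V W ground (%v w. snd b v * snd c w)" if "b : set bs" "c : set cs" for b c
  using b(2)[OF that(1)] c(2)[OF that(2)] by (intro bilinI linear)
 have nest: "vsum ?T f [g b c. b \<leftarrow> xs, c \<leftarrow> ys] = vsum ?T (%b. vsum ?T (%c. f (g b c)) ys) xs"
  if "\<And>b c. b : set xs ==> c : set ys ==> f (g b c) : el ?T" for f g and xs :: "'x list" and ys :: "'y list"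
  using that
 proof (induct xs)
  case (Cons x xs)
  have m: "vsum ?T f (map h zs) = vsum ?T (%c. f (h c)) zs" for h and zs :: "'y list" by (induct zs) auto
  show ?case using Cons V by (simp add: m) (subst vsum_append, auto simp: m)
 qed simp
 show ?thesis
  unfolding dual_basis_def
 proof (intro conjI ballI)
  show "set ?ts \<subseteq> el ?T \<times> lin ?T ground"
   using V b(1) c(1) bil by (auto intro!: pure_closed tsum_lin)
  fix t assume t: "t : el ?T"
  have "vsum ?T (%b. snd b t \<odot>\<^bsub>?T\<^esub> fst b) ?ts
   = vsum ?T (%b. vsum ?T (%c. tsum V W t (%v w. snd b v * snd c w) \<odot>\<^bsub>?T\<^esub> pure V W (fst b) (fst c)) cs) bs"
   using V b(1) c(1) by (subst nest) auto
  also have "... = t"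
  proof (rule tensor_ext[OF V vs_tensor[OF V] _ lin_id _ t])
   show "(%t. vsum ?T (%b. vsum ?T (%c. tsum V W t (%v w. snd b v * snd c w) \<odot>\<^bsub>?T\<^esub> pure V W (fst b) (fst c)) cs) bs)
    : lin ?T ?T"
    using V bil b(1) c(1) by (intro linear vs_tensor tsum_lin pure_closed) auto
   fix v w assume vw: "v : el V" "w : el W"
   have "vsum ?T (%b. vsum ?T (%c. tsum V W (pure V W v w) (%v w. snd b v * snd c w) \<odot>\<^bsub>?T\<^esub> pure V W (fst b) (fst c)) cs) bs
    = vsum ?T (%b. vsum ?T (%c. pure V W (snd b v \<odot>\<^bsub>V\<^esub> fst b) (snd c w \<odot>\<^bsub>W\<^esub> fst c)) cs) bs"
   proof (intro vsum_cong)
    fix b' c' assume bc: "b' : set bs" "c' : set cs"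
    show "tsum V W (pure V W v w) (%v w. snd b' v * snd c' w) \<odot>\<^bsub>?T\<^esub> pure V W (fst b') (fst c')
     = pure V W (snd b' v \<odot>\<^bsub>V\<^esub> fst b') (snd c' w \<odot>\<^bsub>W\<^esub> fst c')"
     using V vw b[OF bc(1)] c[OF bc(2)] bil[OF bc] lin_smult[OF bilin_lin1[OF bilin_pure[OF V]]]
      lin_smult[OF bilin_lin2[OF bilin_pure[OF V]]]
     by (simp add: tsum_pure vs_smult_mult[symmetric] mult.commute)
   qed
   also have "... = vsum ?T (%b. pure V W (snd b v \<odot>\<^bsub>V\<^esub> fst b) w) bs"
   proof (intro vsum_cong)
    fix b' assume bb: "b' : set bs"
    show "vsum ?T (%c. pure V W (snd b' v \<odot>\<^bsub>V\<^esub> fst b') (snd c w \<odot>\<^bsub>W\<^esub> fst c)) cs = pure V W (snd b' v \<odot>\<^bsub>V\<^esub> fst b') w"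
     using V c(1) b(1)[OF bb] vsum_lin[OF V(2) vs_tensor[OF V] bilin_lin2[OF bilin_pure[OF V]], of "snd b' v \<odot>\<^bsub>V\<^esub> fst b'" cs "%c. snd c w \<odot>\<^bsub>W\<^esub> fst c"]
      cs vw by (simp add: dual_basis_def case_prod_beta)
   qed
   also have "... = pure V W v w"
    using V b(1) vsum_lin[OF V(1) vs_tensor[OF V] bilin_lin1[OF bilin_pure[OF V]], of w bs "%b. snd b v \<odot>\<^bsub>V\<^esub> fst b"]
     bs vw by (simp add: dual_basis_def case_prod_beta)
   finally show "vsum ?T (%b. vsum ?T (%c. tsum V W (pure V W v w) (%v w. snd b v * snd c w) \<odot>\<^bsub>?T\<^esub> pure V W (fst b) (fst c)) cs) bs
    = pure V W v w" .
  qed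
  finally show "vsum ?T (%b. snd b t \<odot>\<^bsub>?T\<^esub> fst b) ?ts = t" .
 qed
qed

lemma fdvs_tensor [simp]: "fdvs V ==> fdvs W ==> fdvs (tensor V W)"
 using dual_basis_exists[of V] dual_basis_exists[of W] dual_basis_tensor[of V W] dual_basis_fin_dim[of "tensor V W"]
 by (meson vs_tensor)

lemma tensor_eqI:
 assumes "vsp V" "vsp W" "dual_basis V bs" "dual_basis W cs"
  "s : el (tensor V W)" "t : el (tensor V W)"
  "\<And>b c. b : set bs ==> c : set cs ==> tsum V W s (%v w. snd b v * snd c w) = tsum V W t (%v w. snd b v * snd c w)"
 shows "s = t"
proof -
 have "vsum (tensor V W) (%b. snd b s \<odot>\<^bsub>tensor V W\<^esub> fst b) [(pure V W (fst b) (fst c), %t. tsum V W t (%v w. snd b v * snd c w)). b \<leftarrow> bs, c \<leftarrow> cs]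
  = vsum (tensor V W) (%b. snd b t \<odot>\<^bsub>tensor V W\<^esub> fst b) [(pure V W (fst b) (fst c), %t. tsum V W t (%v w. snd b v * snd c w)). b \<leftarrow> bs, c \<leftarrow> cs]"
  using assms(7) by (intro vsum_cong) fastforce
 then show ?thesis using dual_basis_tensor[OF assms(1-4)] assms(5,6) by (simp add: dual_basis_def)
qed

subsection \<open>Tensor products inside the universe of vectors\<close>

lemma utensor_simps:
 "el (utensor V W) = Tensor ` el (tensor V W)"
 "\<zero>\<^bsub>utensor V W\<^esub> = Tensor \<zero>\<^bsub>tensor V W\<^esub>"
 "s \<oplus>\<^bsub>utensor V W\<^esub> t = Tensor (tensor_of s \<oplus>\<^bsub>tensor V W\<^esub> tensor_of t)"
 "c \<odot>\<^bsub>utensor V W\<^esub> t = Tensor (c \<odot>\<^bsub>tensor V W\<^esub> tensor_of t)"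
 by (simp_all add: utensor_def)

lemma vs_neg_right: "vsp V ==> v : el V ==> v \<oplus>\<^bsub>V\<^esub> (- 1) \<odot>\<^bsub>V\<^esub> v = \<zero>\<^bsub>V\<^esub>"
 using vs_add_comm[of V v "(- 1) \<odot>\<^bsub>V\<^esub> v"] vs_neg[of V v] by simp

lemma vs_utensor [simp, closed]: "vsp V ==> vsp W ==> vsp (utensor V W)"
 using vs_tensor[of V W]
 by (intro vsI) (auto simp: utensor_simps vs_add_assoc vs_add_comm vs_smult_add vs_smult_distr vs_smult_mult vs_neg_right vs_add_left_comm)

lemma lin_Tensor: "Tensor : lin (tensor V W) (utensor V W)"
 by (rule linI) (auto simp: utensor_simps)

lemma lin_tensor_of: "vsp V ==> vsp W ==> tensor_of : lin (utensor V W) (tensor V W)"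
 by (rule linI) (auto simp: utensor_simps)

lemma fdvs_utensor [simp]: "fdvs V ==> fdvs W ==> fdvs (utensor V W)"
 by (rule fdvs_image[OF fdvs_tensor _ lin_Tensor]) (simp_all add: utensor_simps)

lemma vs_uscalars [simp, closed]: "vsp uscalars"
 by (rule vsI) (auto simp: uscalars_def algebra_simps)

lemma uscalars_simps [simp]:
 "a \<oplus>\<^bsub>uscalars\<^esub> b = Scalar (scalar_of a + scalar_of b)" "\<zero>\<^bsub>uscalars\<^esub> = Scalar 0"
 "c \<odot>\<^bsub>uscalars\<^esub> a = Scalar (c * scalar_of a)" "el uscalars = range Scalar"
 by (simp_all add: uscalars_def)

lemma fdvs_uscalars [simp]: "fdvs uscalars"
proof (rule fdvs_image[OF fdvs_ground vs_uscalars])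
 show "Scalar : lin ground uscalars" by (rule linI) auto
qed simp

lemma lin_scalar_of: "scalar_of : lin uscalars ground"
 by (rule linI) auto

lemma bilin_upure: "vsp V ==> vsp W ==> bilin V W (utensor V W) (upure V W)"
 unfolding upure_def
 by (intro bilinI lin_comp[OF lin_Tensor] bilin_lin1[OF bilin_pure] bilin_lin2[OF bilin_pure])

lemma upure_closed [simp, closed]: "vsp V ==> vsp W ==> v : el V ==> w : el W ==>
  upure V W v w : el (utensor V W)"
 using bilin_closed[OF bilin_upure] .

lemma ulift_lin: "vsp V ==> vsp W ==> vsp Z ==> bilin V W Z f ==> ulift Z f : lin (utensor V W) Z"
 using lin_comp[OF tlift_lin lin_tensor_of] unfolding ulift_def .

lemma ulift_upure:
 "vsp V ==> vsp W ==> vsp Z ==> bilin V W Z f ==> v : el V ==> w : el W ==>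
  ulift Z f (upure V W v w) = f v w"
 by (simp add: ulift_def upure_def tlift_pure)

lemma utensor_ext:
 assumes V: "vsp V" "vsp W" "vsp Z" and f: "f : lin (utensor V W) Z" "g : lin (utensor V W) Z"
  and eq: "\<And>v w. v : el V ==> w : el W ==> f (upure V W v w) = g (upure V W v w)"
  and t: "t : el (utensor V W)"
 shows "f t = g t"
proof -
 obtain s where s: "s : el (tensor V W)" "t = Tensor s" using t by (auto simp: utensor_simps)
 show ?thesis unfolding s(2)
  using V eq by (intro tensor_ext[OF V lin_comp[OF f(1) lin_Tensor] lin_comp[OF f(2) lin_Tensor] _ s(1)])
   (simp add: upure_def)
qed

lemma utensor_ext3:
 assumes V: "vsp U" "vsp V" "vsp W" "vsp Z" and f: "f : lin (utensor (utensor U V) W) Z" "g : lin (utensor (utensor U V) W) Z"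
  and eq: "\<And>u v w. u : el U ==> v : el V ==> w : el W ==>
   f (upure (utensor U V) W (upure U V u v) w) = g (upure (utensor U V) W (upure U V u v) w)"
  and t: "t : el (utensor (utensor U V) W)"
 shows "f t = g t"
proof (rule utensor_ext[OF vs_utensor[OF V(1,2)] V(3,4) f _ t])
 fix s w assume s: "s : el (utensor U V)" and w: "w : el W"
 have l: "(%s. upure (utensor U V) W s w) : lin (utensor U V) (utensor (utensor U V) W)"
  by (rule bilin_lin1[OF bilin_upure w]) (use V in simp_all)
 show "f (upure (utensor U V) W s w) = g (upure (utensor U V) W s w)"
  by (rule utensor_ext[OF V(1,2,4) lin_comp[OF f(1) l] lin_comp[OF f(2) l] eq[OF _ _ w] s])
qed

lemma utensor_ext3':
 assumes V: "vsp U" "vsp V" "vsp W" "vsp Z" and f: "f : lin (utensor U (utensor V W)) Z" "g : lin (utensor U (utensor V W)) Z"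
  and eq: "\<And>u v w. u : el U ==> v : el V ==> w : el W ==>
   f (upure U (utensor V W) u (upure V W v w)) = g (upure U (utensor V W) u (upure V W v w))"
  and t: "t : el (utensor U (utensor V W))"
 shows "f t = g t"
proof (rule utensor_ext[OF V(1) vs_utensor[OF V(2,3)] V(4) f _ t])
 fix s u assume s: "s : el (utensor V W)" and u: "u : el U"
 have l: "(%s. upure U (utensor V W) u s) : lin (utensor V W) (utensor U (utensor V W))"
  by (rule bilin_lin2[OF bilin_upure u]) (use V in simp_all)
 show "f (upure U (utensor V W) u s) = g (upure U (utensor V W) u s)"
  by (rule utensor_ext[OF V(2,3,4) lin_comp[OF f(1) l] lin_comp[OF f(2) l] eq[OF u] s])
qed

lemma utensor_ext4:
 assumes V: "vsp U" "vsp V" "vsp W" "vsp X" "vsp Z"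
  and f: "f : lin (utensor (utensor (utensor U V) W) X) Z" "g : lin (utensor (utensor (utensor U V) W) X) Z"
  and eq: "\<And>u v w x. u : el U ==> v : el V ==> w : el W ==> x : el X ==>
   f (upure (utensor (utensor U V) W) X (upure (utensor U V) W (upure U V u v) w) x)
   = g (upure (utensor (utensor U V) W) X (upure (utensor U V) W (upure U V u v) w) x)"
  and t: "t : el (utensor (utensor (utensor U V) W) X)"
 shows "f t = g t"
proof (rule utensor_ext[OF _ V(4,5) f _ t])
 fix s x assume s: "s : el (utensor (utensor U V) W)" and x: "x : el X"
 have l: "(%s. upure (utensor (utensor U V) W) X s x) : lin (utensor (utensor U V) W) (utensor (utensor (utensor U V) W) X)"
  by (rule bilin_lin1[OF bilin_upure x]) (use V in simp_all)
 show "f (upure (utensor (utensor U V) W) X s x) = g (upure (utensor (utensor U V) W) X s x)"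
  by (rule utensor_ext3[OF V(1,2,3,5) lin_comp[OF f(1) l] lin_comp[OF f(2) l] eq[OF _ _ _ x] s])
qed (use V in simp)

lemma pure_rule1 [linear]: "vsp V ==> vsp W ==> f : lin U V ==> w : el W ==> (%x. pure V W (f x) w) : lin U (tensor V W)"
 and pure_rule2 [linear]: "vsp V ==> vsp W ==> g : lin U W ==> v : el V ==> (%x. pure V W v (g x)) : lin U (tensor V W)"
 by (auto intro: bilin_left bilin_right bilin_pure)

lemma upure_rule1 [linear]: "vsp V ==> vsp W ==> f : lin U V ==> w : el W ==> (%x. upure V W (f x) w) : lin U (utensor V W)"
 and upure_rule2 [linear]: "vsp V ==> vsp W ==> g : lin U W ==> v : el V ==> (%x. upure V W v (g x)) : lin U (utensor V W)"
 by (auto intro: bilin_left bilin_right bilin_upure)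

section \<open>The monoidal category of vector spaces\<close>

definition tmap :: "('k::field, 'u) space => ('k, 'u) space => ('k, 'u) space => ('k, 'u) space
  => (('k, 'u) univ => ('k, 'u) univ) => (('k, 'u) univ => ('k, 'u) univ) => ('k, 'u) univ => ('k, 'u) univ" where
 "tmap V V' W W' f g = (\<lambda>t\<in>el (utensor V V'). ulift (utensor W W') (%v w. upure W W' (f v) (g w)) t)"

definition amap :: "('k::field, 'u) space => ('k, 'u) space => ('k, 'u) space => ('k, 'u) univ => ('k, 'u) univ" where
 "amap U V W = (\<lambda>t\<in>el (utensor (utensor U V) W). ulift (utensor U (utensor V W))
   (%s z. ulift (utensor U (utensor V W)) (%x y. upure U (utensor V W) x (upure V W y z)) s) t)"

definition ainv :: "('k::field, 'u) space => ('k, 'u) space => ('k, 'u) space => ('k, 'u) univ => ('k, 'u) univ" where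
 "ainv U V W = (\<lambda>t\<in>el (utensor U (utensor V W)). ulift (utensor (utensor U V) W)
   (%x s. ulift (utensor (utensor U V) W) (%y z. upure (utensor U V) W (upure U V x y) z) s) t)"

definition lmap :: "('k::field, 'u) space => ('k, 'u) univ => ('k, 'u) univ" where
 "lmap V = (\<lambda>t\<in>el (utensor uscalars V). ulift V (%a v. scalar_of a \<odot>\<^bsub>V\<^esub> v) t)"

definition rmap :: "('k::field, 'u) space => ('k, 'u) univ => ('k, 'u) univ" where
 "rmap V = (\<lambda>t\<in>el (utensor V uscalars). ulift V (%v a. scalar_of a \<odot>\<^bsub>V\<^esub> v) t)"

abbreviation elin :: "('k::field, 'v, 'm) module_scheme => ('k, 'w, 'n) module_scheme => ('v => 'w) set" where
 "elin V W \<equiv> lin V W \<inter> extensional (el V)"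

lemma ulift_rule [linear]:
 assumes V: "vsp V" "vsp W" "vsp Z" and 1: "\<And>x. x : el U ==> bilin V W Z (F x)"
  and 2: "\<And>a b. a : el V ==> b : el W ==> (%x. F x a b) : lin U Z"
  and s: "s : el (utensor V W)" and U: "vsp U"
 shows "(%x. ulift Z (F x) s) : lin U Z"
proof -
 have add: "bilin V W Z (%a b. F x a b \<oplus>\<^bsub>Z\<^esub> F y a b)" if "x : el U" "y : el U" for x y
  using 1[OF that(1)] 1[OF that(2)] V unfolding bilin_def by (auto intro!: lin_add_rule)
 have sm: "bilin V W Z (%a b. c \<odot>\<^bsub>Z\<^esub> F x a b)" if "x : el U" for x c
  using 1[OF that(1)] V unfolding bilin_def by (auto intro!: lin_smult_rule)
 show ?thesis
 proof (rule linI)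
  fix x y c assume x: "x : el U"
  show "ulift Z (F x) s : el Z" using lin_closed[OF ulift_lin[OF V 1[OF x]] s] .
  show "ulift Z (F (c \<odot>\<^bsub>U\<^esub> x)) s = c \<odot>\<^bsub>Z\<^esub> ulift Z (F x) s"
  proof (rule utensor_ext[OF V _ _ _ s])
   show "ulift Z (F (c \<odot>\<^bsub>U\<^esub> x)) : lin (utensor V W) Z" using 1 x U V by (intro ulift_lin) auto
   show "(%s. c \<odot>\<^bsub>Z\<^esub> ulift Z (F x) s) : lin (utensor V W) Z"
    using 1 x V by (intro lin_smult_rule ulift_lin) auto
  qed (use 1 x U V lin_smult[OF 2 x] in \<open>simp add: ulift_upure\<close>)
  assume y: "y : el U"
  show "ulift Z (F (x \<oplus>\<^bsub>U\<^esub> y)) s = ulift Z (F x) s \<oplus>\<^bsub>Z\<^esub> ulift Z (F y) s"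
  proof (rule utensor_ext[OF V _ _ _ s])
   show "ulift Z (F (x \<oplus>\<^bsub>U\<^esub> y)) : lin (utensor V W) Z" using 1 x y U V by (intro ulift_lin) auto
   show "(%s. ulift Z (F x) s \<oplus>\<^bsub>Z\<^esub> ulift Z (F y) s) : lin (utensor V W) Z"
    using 1 x y V by (intro lin_add_rule ulift_lin) auto
  qed (use 1 x y U V lin_add[OF 2 x y] in \<open>simp add: ulift_upure\<close>)
 qed
qed

context
 fixes V W V' W' :: "('k::field, 'u) space"
 assumes V: "vsp V" and W: "vsp W" and V': "vsp V'" and W': "vsp W'"
begin

lemma tmap_bilin: "f : lin V W ==> g : lin V' W' ==> bilin V V' (utensor W W') (%v w. upure W W' (f v) (g w))"
 using V W V' W' by (intro bilinI linear) (auto intro: lin_closed)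

lemma tmap_elin: "f : lin V W ==> g : lin V' W' ==> tmap V V' W W' f g : elin (utensor V V') (utensor W W')"
 unfolding tmap_def using tmap_bilin V V' W W' by (simp add: ulift_lin)

lemma tmap_pure [simp]: "f : lin V W ==> g : lin V' W' ==> v : el V ==> w : el V' ==>
  tmap V V' W W' f g (upure V V' v w) = upure W W' (f v) (g w)"
 unfolding tmap_def using tmap_bilin V V' W W' by (simp add: ulift_upure)

end

context
 fixes U V W :: "('k::field, 'u) space"
 assumes U: "vsp U" and V: "vsp V" and W: "vsp W"
begin

lemma amap_bilin1: "z : el W ==> bilin U V (utensor U (utensor V W)) (%x y. upure U (utensor V W) x (upure V W y z))"
 using U V W by (intro bilinI linear) auto

lemma amap_bilin2: "bilin (utensor U V) W (utensor U (utensor V W))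
   (%s z. ulift (utensor U (utensor V W)) (%x y. upure U (utensor V W) x (upure V W y z)) s)"
 using U V W by (intro bilinI ulift_lin ulift_rule amap_bilin1) (auto intro!: linear)

lemma amap_elin: "amap U V W : elin (utensor (utensor U V) W) (utensor U (utensor V W))"
 unfolding amap_def using amap_bilin2 U V W by (simp add: ulift_lin)

lemma amap_pure [simp]: "u : el U ==> v : el V ==> w : el W ==>
  amap U V W (upure (utensor U V) W (upure U V u v) w) = upure U (utensor V W) u (upure V W v w)"
 unfolding amap_def using amap_bilin2 amap_bilin1 U V W by (simp add: ulift_upure)

lemma ainv_bilin1: "x : el U ==> bilin V W (utensor (utensor U V) W) (%y z. upure (utensor U V) W (upure U V x y) z)"
 using U V W by (intro bilinI linear) auto

lemma ainv_bilin2: "bilin U (utensor V W) (utensor (utensor U V) W)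
   (%x s. ulift (utensor (utensor U V) W) (%y z. upure (utensor U V) W (upure U V x y) z) s)"
 using U V W by (intro bilinI ulift_lin ulift_rule ainv_bilin1) (auto intro!: linear)

lemma ainv_elin: "ainv U V W : elin (utensor U (utensor V W)) (utensor (utensor U V) W)"
 unfolding ainv_def using ainv_bilin2 U V W by (simp add: ulift_lin)

lemma ainv_pure [simp]: "u : el U ==> v : el V ==> w : el W ==>
  ainv U V W (upure U (utensor V W) u (upure V W v w)) = upure (utensor U V) W (upure U V u v) w"
 unfolding ainv_def using ainv_bilin2 ainv_bilin1 U V W by (simp add: ulift_upure)

end

context
 fixes V :: "('k::field, 'u) space"
 assumes V: "vsp V"
begin

lemma lmap_bilin: "bilin (uscalars :: ('k, 'u) space) V V (%a v. scalar_of a \<odot>\<^bsub>V\<^esub> v)"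
 using V by (intro bilinI linear) (auto intro: lin_scalar_of)

lemma rmap_bilin: "bilin V (uscalars :: ('k, 'u) space) V (%v a. scalar_of a \<odot>\<^bsub>V\<^esub> v)"
 using V by (intro bilinI linear) (auto intro: lin_scalar_of)

lemma lmap_elin: "lmap V : elin (utensor uscalars V) V"
 and rmap_elin: "rmap V : elin (utensor V uscalars) V"
 unfolding lmap_def rmap_def using lmap_bilin rmap_bilin V by (simp_all add: ulift_lin)

lemma lmap_pure [simp]: "v : el V ==> lmap V (upure uscalars V (Scalar a) v) = a \<odot>\<^bsub>V\<^esub> v"
 and rmap_pure [simp]: "v : el V ==> rmap V (upure V uscalars v (Scalar a)) = a \<odot>\<^bsub>V\<^esub> v"
 unfolding lmap_def rmap_def using lmap_bilin rmap_bilin V by (simp_all add: ulift_upure)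

end

lemmas tmap_lin [simp] = tmap_elin[THEN IntD1] and tmap_ext [simp] = tmap_elin[THEN IntD2]
lemmas amap_lin [simp] = amap_elin[THEN IntD1] and amap_ext [simp] = amap_elin[THEN IntD2]
lemmas ainv_lin [simp] = ainv_elin[THEN IntD1] and ainv_ext [simp] = ainv_elin[THEN IntD2]
lemmas lmap_lin [simp] = lmap_elin[THEN IntD1] and lmap_ext [simp] = lmap_elin[THEN IntD2]
lemmas rmap_lin [simp] = rmap_elin[THEN IntD1] and rmap_ext [simp] = rmap_elin[THEN IntD2]

lemma elin_lin: "f : elin V W ==> f : lin V W" by simp

lemma elin_closed: "f : elin V W ==> v : el V ==> f v : el W"
 by (auto dest: lin_closed)

lemma elin_eqI: "f : elin V W ==> g : elin V W ==> (\<And>v. v : el V ==> f v = g v) ==> f = g"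
 by (auto intro: extensionalityI)

lemma elin_compose: "vsp V ==> f : elin V W ==> g : elin W Z ==> compose (el V) g f : elin V Z"
 unfolding compose_def by (auto simp: lin_comp)

text \<open>For vector spaces with additional structure the constraints and all coherence laws are those of
 vector spaces; only the closure of the structure-preserving maps has to be checked.\<close>

locale structured_spaces =
 fixes objs :: "'o set" and sp :: "'o => ('k::field, 'u) space"
  and P :: "'o => 'o => (('k, 'u) univ => ('k, 'u) univ) => bool"
  and ten :: "'o => 'o => 'o" and unit :: 'o
 assumes sp [simp]: "X : objs ==> vsp (sp X)"
  and ten_obj [simp]: "X : objs ==> Y : objs ==> ten X Y : objs"
  and sp_ten [simp]: "sp (ten X Y) = utensor (sp X) (sp Y)"
  and unit_obj [simp]: "unit : objs"
  and sp_unit [simp]: "sp unit = uscalars"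
  and P_id: "X : objs ==> P X X (\<lambda>v\<in>el (sp X). v)"
  and P_comp: "X : objs ==> Y : objs ==> Z : objs ==> f : elin (sp X) (sp Y) ==> g : elin (sp Y) (sp Z) ==>
   P X Y f ==> P Y Z g ==> P X Z (compose (el (sp X)) g f)"
  and P_zero: "X : objs ==> Y : objs ==> P X Y (\<lambda>v\<in>el (sp X). \<zero>\<^bsub>sp Y\<^esub>)"
  and P_add: "X : objs ==> Y : objs ==> f : elin (sp X) (sp Y) ==> g : elin (sp X) (sp Y) ==>
   P X Y f ==> P X Y g ==> P X Y (\<lambda>v\<in>el (sp X). f v \<oplus>\<^bsub>sp Y\<^esub> g v)"
  and P_scale: "X : objs ==> Y : objs ==> f : elin (sp X) (sp Y) ==> P X Y f ==>
   P X Y (\<lambda>v\<in>el (sp X). a \<odot>\<^bsub>sp Y\<^esub> f v)"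
  and P_inv: "X : objs ==> Y : objs ==> f : elin (sp X) (sp Y) ==> g : elin (sp Y) (sp X) ==> P X Y f ==>
   (\<And>v. v : el (sp X) ==> g (f v) = v) ==> (\<And>w. w : el (sp Y) ==> f (g w) = w) ==> P Y X g"
  and P_ten: "X : objs ==> Y : objs ==> X' : objs ==> Y' : objs ==>
   f : elin (sp X) (sp Y) ==> g : elin (sp X') (sp Y') ==> P X Y f ==> P X' Y' g ==>
   P (ten X X') (ten Y Y') (tmap (sp X) (sp X') (sp Y) (sp Y') f g)"
  and P_assoc: "X : objs ==> Y : objs ==> Z : objs ==>
   P (ten (ten X Y) Z) (ten X (ten Y Z)) (amap (sp X) (sp Y) (sp Z))"
  and P_lunit: "X : objs ==> P (ten unit X) X (lmap (sp X))"
  and P_runit: "X : objs ==> P (ten X unit) X (rmap (sp X))"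
begin

definition C where "C = linear_tcat objs sp P ten unit"

lemma C_sel:
 "Obj C = objs"
 "Arr C = {(X, f, Y). X : objs \<and> Y : objs \<and> f : elin (sp X) (sp Y) \<and> P X Y f}"
 "Dom C = (%(X, f, Y). X)" "Cod C = (%(X, f, Y). Y)"
 "Id C X = (X, \<lambda>v\<in>el (sp X). v, X)"
 "Comp C (Y, g, Z) (X, f, Y') = (X, compose (el (sp X)) g f, Z)"
 "Zero C X Y = (X, \<lambda>v\<in>el (sp X). \<zero>\<^bsub>sp Y\<^esub>, Y)"
 "Add C (X, f, Y) (X', f', Y') = (X, \<lambda>v\<in>el (sp X). f v \<oplus>\<^bsub>sp Y\<^esub> f' v, Y)"
 "Scale C a (X, f, Y) = (X, \<lambda>v\<in>el (sp X). a \<odot>\<^bsub>sp Y\<^esub> f v, Y)"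
 "TenO C = ten"
 "TenA C (X, f, Y) (X', f', Y') = (ten X X', tmap (sp X) (sp X') (sp Y) (sp Y') f f', ten Y Y')"
 "Unit C = unit"
 "Assoc C X Y Z = (ten (ten X Y) Z, amap (sp X) (sp Y) (sp Z), ten X (ten Y Z))"
 "LUnit C X = (ten unit X, lmap (sp X), X)"
 "RUnit C X = (ten X unit, rmap (sp X), X)"
 by (simp_all add: C_def linear_tcat_def tmap_def amap_def lmap_def rmap_def)

lemma Hom_iff: "h : Hom C X Y \<longleftrightarrow> (\<exists>f. h = (X, f, Y) \<and> X : objs \<and> Y : objs \<and> f : elin (sp X) (sp Y) \<and> P X Y f)"
 by (auto simp: Hom_def C_sel)

lemma HomE: "h : Hom C X Y ==> (\<And>f. h = (X, f, Y) ==> X : objs ==> Y : objs ==> f : elin (sp X) (sp Y) ==> P X Y f ==> thesis) ==> thesis"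
 by (auto simp: Hom_iff)

lemma inverse_arrI:
 assumes "X : objs" "Y : objs" "f : elin (sp X) (sp Y)" "g : elin (sp Y) (sp X)" "P X Y f"
  "\<And>v. v : el (sp X) ==> g (f v) = v" "\<And>w. w : el (sp Y) ==> f (g w) = w"
 shows "inverse_arr C (X, f, Y) (Y, g, X)"
 using assms P_inv[OF assms]
 by (auto simp: inverse_arr_def Hom_def C_sel compose_def intro!: restrict_ext)

lemma inverse_arrE:
 assumes "inverse_arr C (X, f, Y) h"
 obtains g where "h = (Y, g, X)" "g : elin (sp Y) (sp X)" "P Y X g"
  "\<And>v. v : el (sp X) ==> g (f v) = v" "\<And>w. w : el (sp Y) ==> f (g w) = w"
proof -
 from assms obtain g where g: "h = (Y, g, X)" "g : elin (sp Y) (sp X)" "P Y X g"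
  "compose (el (sp X)) g f = (\<lambda>v\<in>el (sp X). v)" "compose (el (sp Y)) f g = (\<lambda>v\<in>el (sp Y). v)"
  by (cases h) (auto simp: inverse_arr_def Hom_def C_sel)
 show thesis
  by (rule that[OF g(1,2,3)]) (use g(4,5) in \<open>metis compose_eq restrict_apply'\<close>)+
qed

lemma inv_arr_eq:
 assumes "inverse_arr C h h'" shows "inv_arr C h = h'"
proof -
 obtain X f Y where h: "h = (X, f, Y)" by (cases h)
 obtain g where g: "h' = (Y, g, X)" "g : elin (sp Y) (sp X)"
  "\<And>v. v : el (sp X) ==> g (f v) = v" "\<And>w. w : el (sp Y) ==> f (g w) = w"
  by (rule inverse_arrE[OF assms[unfolded h]]) blast
 have "k = h'" if k: "inverse_arr C h k" for k
 proof -
  obtain g' where g': "k = (Y, g', X)" "g' : elin (sp Y) (sp X)"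
   "\<And>v. v : el (sp X) ==> g' (f v) = v"
   by (rule inverse_arrE[OF k[unfolded h]]) blast
  have "g' = g"
   by (rule elin_eqI[OF g'(2) g(2)]) (metis g(2,4) g'(3) elin_closed)
  then show ?thesis using g g' by simp
 qed
 then show ?thesis unfolding inv_arr_def using assms by (rule the_equality[rotated])
qed

lemma assoc_inverse: "X : objs ==> Y : objs ==> Z : objs ==>
  inverse_arr C (Assoc C X Y Z) (ten X (ten Y Z), ainv (sp X) (sp Y) (sp Z), ten (ten X Y) Z)"
 unfolding C_sel
proof (rule inverse_arrI)
 assume XYZ: "X : objs" "Y : objs" "Z : objs"
 show "ainv (sp X) (sp Y) (sp Z) (amap (sp X) (sp Y) (sp Z) v) = v" if "v : el (sp (ten (ten X Y) Z))" for v
  by (rule utensor_ext3[OF _ _ _ _ lin_comp[OF ainv_lin amap_lin] lin_id _ that[unfolded sp_ten]])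
   (use XYZ in simp_all)
 show "amap (sp X) (sp Y) (sp Z) (ainv (sp X) (sp Y) (sp Z) v) = v" if "v : el (sp (ten X (ten Y Z)))" for v
  by (rule utensor_ext3'[OF _ _ _ _ lin_comp[OF amap_lin ainv_lin] lin_id _ that[unfolded sp_ten]])
   (use XYZ in simp_all)
qed (simp_all add: P_assoc)

lemma iso_arrI: "inverse_arr C f g ==> iso_arr C f"
 unfolding iso_arr_def by blast

lemma lunit_inverse: "X : objs ==>
  inverse_arr C (LUnit C X) (X, \<lambda>v\<in>el (sp X). upure uscalars (sp X) (Scalar 1) v, ten unit X)"
 unfolding C_sel
proof (rule inverse_arrI)
 assume X: "X : objs"
 have l: "(\<lambda>v\<in>el (sp X). upure uscalars (sp X) (Scalar 1) v) : lin (sp X) (utensor uscalars (sp X))"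
  using X by (simp add: upure_rule2 lin_id)
 show "(\<lambda>v\<in>el (sp X). upure uscalars (sp X) (Scalar 1) v) : elin (sp X) (sp (ten unit X))"
  using l by simp
 show "(\<lambda>v\<in>el (sp X). upure uscalars (sp X) (Scalar 1) v) (lmap (sp X) v) = v" if "v : el (sp (ten unit X))" for v
 proof (rule utensor_ext[OF _ _ _ lin_comp[OF l lmap_lin] lin_id _ that[unfolded sp_ten sp_unit]])
  fix a v assume "a : el (uscalars :: ('k, 'u) space)" and v: "v : el (sp X)"
  then obtain c where a: "a = Scalar c" by auto
  have "upure uscalars (sp X) (Scalar 1) (c \<odot>\<^bsub>sp X\<^esub> v) = c \<odot>\<^bsub>utensor uscalars (sp X)\<^esub> upure uscalars (sp X) (Scalar 1) v"
   using lin_smult[OF bilin_lin2[OF bilin_upure, of uscalars "sp X" "Scalar 1"], of v c] X v by simp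
  also have "... = upure uscalars (sp X) a v"
   using lin_smult[OF bilin_lin1[OF bilin_upure, of uscalars "sp X" v], of "Scalar 1" c] X v by (simp add: a)
  finally show "(\<lambda>v\<in>el (sp X). upure uscalars (sp X) (Scalar 1) v) (lmap (sp X) (upure uscalars (sp X) a v))
   = upure uscalars (sp X) a v" using X v by (simp add: a)
 qed (use X in simp_all)
qed (simp_all add: P_lunit)

lemma runit_inverse: "X : objs ==>
  inverse_arr C (RUnit C X) (X, \<lambda>v\<in>el (sp X). upure (sp X) uscalars v (Scalar 1), ten X unit)"
 unfolding C_sel
proof (rule inverse_arrI)
 assume X: "X : objs"
 have l: "(\<lambda>v\<in>el (sp X). upure (sp X) uscalars v (Scalar 1)) : lin (sp X) (utensor (sp X) uscalars)"
  using X by (simp add: upure_rule1 lin_id)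
 show "(\<lambda>v\<in>el (sp X). upure (sp X) uscalars v (Scalar 1)) : elin (sp X) (sp (ten X unit))"
  using l by simp
 show "(\<lambda>v\<in>el (sp X). upure (sp X) uscalars v (Scalar 1)) (rmap (sp X) v) = v" if "v : el (sp (ten X unit))" for v
 proof (rule utensor_ext[OF _ _ _ lin_comp[OF l rmap_lin] lin_id _ that[unfolded sp_ten sp_unit]])
  fix a v assume "a : el (uscalars :: ('k, 'u) space)" and v: "v : el (sp X)"
  then obtain c where a: "a = Scalar c" by auto
  have "upure (sp X) uscalars (c \<odot>\<^bsub>sp X\<^esub> v) (Scalar 1) = c \<odot>\<^bsub>utensor (sp X) uscalars\<^esub> upure (sp X) uscalars v (Scalar 1)"
   using lin_smult[OF bilin_lin1[OF bilin_upure, of "sp X" uscalars "Scalar 1"], of v c] X v by simp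
  also have "... = upure (sp X) uscalars v a"
   using lin_smult[OF bilin_lin2[OF bilin_upure, of "sp X" uscalars v], of "Scalar 1" c] X v by (simp add: a)
  finally show "(\<lambda>v\<in>el (sp X). upure (sp X) uscalars v (Scalar 1)) (rmap (sp X) (upure (sp X) uscalars v a))
   = upure (sp X) uscalars v a" using X v by (simp add: a)
 qed (use X in simp_all)
qed (simp_all add: P_runit)

lemma hom_vs:
 assumes "X : objs" "Y : objs" shows "vsp (Hom_space C X Y)"
proof -
 have n: "(- 1) \<odot>\<^bsub>sp Y\<^esub> w \<oplus>\<^bsub>sp Y\<^esub> w = \<zero>\<^bsub>sp Y\<^esub>" if "w : el (sp Y)" for w
  using assms that by (simp add: vs_neg)
 show ?thesis
  unfolding Hom_space_def
 proof (rule vsI, simp_all only: partial_object.simps ring.simps module.simps monoid.simps)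
  show "Zero C X Y : Hom C X Y" using assms P_zero by (auto simp: Hom_iff C_sel intro: lin_zero_rule)
  fix f assume "f : Hom C X Y"
  then obtain f' where f: "f = (X, f', Y)" "f' : elin (sp X) (sp Y)" "P X Y f'" by (auto simp: Hom_iff)
  note fc = elin_closed[OF f(2)]
  show "Scale C a f : Hom C X Y" for a
   using f assms P_scale by (auto simp: Hom_iff C_sel intro!: lin_smult_rule)
  show "Add C (Zero C X Y) f = f"
   unfolding f C_sel using f assms fc by (auto intro!: extensionalityI[of _ "el (sp X)"])
  show "Add C (Scale C (- 1) f) f = Zero C X Y"
   unfolding f C_sel using f assms fc n by (auto intro!: restrict_ext)
  show "Scale C (a + b) f = Add C (Scale C a f) (Scale C b f)" for a b
   unfolding f C_sel using f assms fc by (auto intro!: restrict_ext simp: vs_smult_add)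
  show "Scale C (a * b) f = Scale C a (Scale C b f)" for a b
   unfolding f C_sel using f assms fc by (auto intro!: restrict_ext simp: vs_smult_mult)
  show "Scale C 1 f = f"
   unfolding f C_sel using f assms fc by (auto intro!: extensionalityI[of _ "el (sp X)"])
  fix g assume "g : Hom C X Y"
  then obtain g' where g: "g = (X, g', Y)" "g' : elin (sp X) (sp Y)" "P X Y g'" by (auto simp: Hom_iff)
  note gc = elin_closed[OF g(2)]
  show "Add C f g : Hom C X Y"
   using f g assms P_add by (auto simp: Hom_iff C_sel intro!: lin_add_rule)
  show "Add C f g = Add C g f"
   unfolding f g C_sel using assms fc gc by (auto intro!: restrict_ext simp: vs_add_comm)
  show "Scale C a (Add C f g) = Add C (Scale C a f) (Scale C a g)" for a
   unfolding f g C_sel using assms fc gc by (auto intro!: restrict_ext simp: vs_smult_distr)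
  fix h assume "h : Hom C X Y"
  then obtain h' where h: "h = (X, h', Y)" "h' : elin (sp X) (sp Y)" "P X Y h'" by (auto simp: Hom_iff)
  note hc = elin_closed[OF h(2)]
  show "Add C (Add C f g) h = Add C f (Add C g h)"
   unfolding f g h C_sel using assms fc gc hc by (auto intro!: restrict_ext simp: vs_add_assoc)
 qed
qed

lemma comp_in_Hom: "f : Hom C X Y ==> g : Hom C Y Z ==> Comp C g f : Hom C X Z"
 by (elim HomE) (auto simp: Hom_iff C_sel elin_compose P_comp simp del: Int_iff)

lemma ten_in_Hom: "f : Hom C X Y ==> g : Hom C X' Y' ==> TenA C f g : Hom C (ten X X') (ten Y Y')"
 by (elim HomE) (auto simp: Hom_iff C_sel P_ten)

lemma comp_bilin:
 assumes XYZ: "X : objs" "Y : objs" "Z : objs"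
 shows "bilin (Hom_space C Y Z) (Hom_space C X Y) (Hom_space C X Z) (Comp C)"
proof (intro bilinI linI; simp only: Hom_space_def partial_object.simps ring.simps module.simps)
 fix g assume "g : Hom C Y Z"
 then obtain g' where g: "g = (Y, g', Z)" "g' : elin (sp Y) (sp Z)" "P Y Z g'" by (auto simp: Hom_iff)
 note gc = elin_closed[OF g(2)]
 fix f assume "f : Hom C X Y"
 then obtain f' where f: "f = (X, f', Y)" "f' : elin (sp X) (sp Y)" "P X Y f'" by (auto simp: Hom_iff)
 note fc = elin_closed[OF f(2)]
 show c: "Comp C g f : Hom C X Z" by (rule comp_in_Hom) fact+
 show "Comp C g f : Hom C X Z" by (rule c)
 show "Comp C g (Scale C a f) = Scale C a (Comp C g f)" for a
  unfolding f g C_sel using XYZ f(2) g(2) fc gc lin_smult[of g' "sp Y" "sp Z"]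
  by (auto simp: compose_def intro!: restrict_ext)
 show "Comp C (Scale C a g) f = Scale C a (Comp C g f)" for a
  unfolding f g C_sel using XYZ f(2) g(2) fc gc by (auto simp: compose_def intro!: restrict_ext)
 { fix f2 assume "f2 : Hom C X Y"
  then obtain f2' where f2: "f2 = (X, f2', Y)" "f2' : elin (sp X) (sp Y)" "P X Y f2'" by (auto simp: Hom_iff)
  note f2c = elin_closed[OF f2(2)]
  show "Comp C g (Add C f f2) = Add C (Comp C g f) (Comp C g f2)"
   unfolding f f2 g C_sel using XYZ f(2) g(2) fc gc f2c lin_add[of g' "sp Y" "sp Z"]
   by (auto simp: compose_def intro!: restrict_ext) }
 { fix g2 assume "g2 : Hom C Y Z"
  then obtain g2' where g2: "g2 = (Y, g2', Z)" "g2' : elin (sp Y) (sp Z)" "P Y Z g2'" by (auto simp: Hom_iff)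
  note g2c = elin_closed[OF g2(2)]
  show "Comp C (Add C g g2) f = Add C (Comp C g f) (Comp C g2 f)"
   unfolding f g g2 C_sel using XYZ f(2) g(2) fc gc g2c by (auto simp: compose_def intro!: restrict_ext) }
qed

lemma tmap_restrictI:
 assumes "vsp V" "vsp V'" "vsp W" "vsp W'" "f : lin V W" "g : lin V' W'" "h : lin (utensor V V') (utensor W W')"
  "\<And>v v'. v : el V ==> v' : el V' ==> upure W W' (f v) (g v') = h (upure V V' v v')"
 shows "tmap V V' W W' f g = restrict h (el (utensor V V'))"
proof (rule extensionalityI[OF tmap_ext restrict_extensional])
 fix t assume t: "t : el (utensor V V')"
 have "tmap V V' W W' f g t = h t"
  by (rule utensor_ext[OF assms(1,2) _ tmap_lin assms(7) _ t]) (use assms in simp_all)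
 then show "tmap V V' W W' f g t = restrict h (el (utensor V V')) t" using t by simp
qed (use assms in simp_all)

lemma ten_bilin:
 assumes o: "X : objs" "Y : objs" "X' : objs" "Y' : objs"
 shows "bilin (Hom_space C X Y) (Hom_space C X' Y') (Hom_space C (ten X X') (ten Y Y')) (TenA C)"
proof (intro bilinI linI; simp only: Hom_space_def partial_object.simps ring.simps module.simps)
 fix g assume "g : Hom C X' Y'"
 then obtain g' where g: "g = (X', g', Y')" "g' : lin (sp X') (sp Y')" by (auto simp: Hom_iff)
 note gc = lin_closed[OF g(2)]
 fix f assume "f : Hom C X Y"
 then obtain f' where f: "f = (X, f', Y)" "f' : lin (sp X) (sp Y)" by (auto simp: Hom_iff)
 note fc = lin_closed[OF f(2)]
 note pu1 = bilin_lin1[OF bilin_upure, of "sp Y" "sp Y'"] and pu2 = bilin_lin2[OF bilin_upure, of "sp Y" "sp Y'"]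
 show c: "TenA C f g : Hom C (ten X X') (ten Y Y')" by (rule ten_in_Hom) fact+
 show "TenA C f g : Hom C (ten X X') (ten Y Y')" by (rule c)
 show "TenA C f (Scale C a g) = Scale C a (TenA C f g)" for a
  unfolding f g C_sel sp_ten prod.inject simp_thms
   by (rule tmap_restrictI)
    (use o f(2) g(2) fc gc lin_smult[OF pu2] in \<open>simp_all add: lin_smult_rule\<close>)
 show "TenA C (Scale C a f) g = Scale C a (TenA C f g)" for a
  unfolding f g C_sel sp_ten prod.inject simp_thms
   by (rule tmap_restrictI)
    (use o f(2) g(2) fc gc lin_smult[OF pu1] in \<open>simp_all add: lin_smult_rule\<close>)
 { fix f2 assume "f2 : Hom C X Y"
  then obtain f2' where f2: "f2 = (X, f2', Y)" "f2' : lin (sp X) (sp Y)" by (auto simp: Hom_iff)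
  note f2c = lin_closed[OF f2(2)]
  show "TenA C (Add C f f2) g = Add C (TenA C f g) (TenA C f2 g)"
   unfolding f f2 g C_sel sp_ten prod.inject simp_thms
   by (rule tmap_restrictI)
    (use o f(2) f2(2) g(2) fc gc f2c lin_add[OF pu1] in \<open>simp_all add: lin_add_rule\<close>) }
 { fix g2 assume "g2 : Hom C X' Y'"
  then obtain g2' where g2: "g2 = (X', g2', Y')" "g2' : lin (sp X') (sp Y')" by (auto simp: Hom_iff)
  note g2c = lin_closed[OF g2(2)]
  show "TenA C f (Add C g g2) = Add C (TenA C f g) (TenA C f g2)"
   unfolding f g g2 C_sel sp_ten prod.inject simp_thms
   by (rule tmap_restrictI)
    (use o f(2) g2(2) g(2) fc gc g2c lin_add[OF pu2] in \<open>simp_all add: lin_add_rule\<close>) }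
qed

end

lemma utensor_elin_eqI:
 assumes "vsp V" "vsp W" "vsp Z" "f : elin (utensor V W) Z" "g : elin (utensor V W) Z"
  "\<And>v w. v : el V ==> w : el W ==> f (upure V W v w) = g (upure V W v w)"
 shows "f = g"
 by (rule elin_eqI[OF assms(4,5)], rule utensor_ext[OF assms(1-3)]) (use assms in auto)

lemma utensor_elin_eqI3:
 assumes "vsp U" "vsp V" "vsp W" "vsp Z" "f : elin (utensor (utensor U V) W) Z" "g : elin (utensor (utensor U V) W) Z"
  "\<And>u v w. u : el U ==> v : el V ==> w : el W ==>
   f (upure (utensor U V) W (upure U V u v) w) = g (upure (utensor U V) W (upure U V u v) w)"
 shows "f = g"
 by (rule elin_eqI[OF assms(5,6)], rule utensor_ext3[OF assms(1-4)]) (use assms in auto)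

lemma utensor_elin_eqI4:
 assumes "vsp U" "vsp V" "vsp W" "vsp X" "vsp Z" "f : elin (utensor (utensor (utensor U V) W) X) Z" "g : elin (utensor (utensor (utensor U V) W) X) Z"
  "\<And>u v w x. u : el U ==> v : el V ==> w : el W ==> x : el X ==>
   f (upure (utensor (utensor U V) W) X (upure (utensor U V) W (upure U V u v) w) x)
   = g (upure (utensor (utensor U V) W) X (upure (utensor U V) W (upure U V u v) w) x)"
 shows "f = g"
 by (rule elin_eqI[OF assms(6,7)], rule utensor_ext4[OF assms(1-5)]) (use assms in auto)

lemma restrict_id_elin [simp]: "vsp V ==> (\<lambda>v\<in>el V. v) : lin V V"
 by (simp add: lin_id)

lemma compose_lin [simp]: "vsp V ==> f : lin V W ==> g : lin W Z ==> compose (el V) g f : lin V Z"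
 unfolding compose_def by (simp add: lin_comp)

context structured_spaces begin

lemma smult_upure:
 assumes "vsp V" "vsp W" "v : el V" "w : el W"
 shows "upure V W (a \<odot>\<^bsub>V\<^esub> v) w = a \<odot>\<^bsub>utensor V W\<^esub> upure V W v w"
  "upure V W v (a \<odot>\<^bsub>W\<^esub> w) = a \<odot>\<^bsub>utensor V W\<^esub> upure V W v w"
 using assms lin_smult[OF bilin_lin1[OF bilin_upure]] lin_smult[OF bilin_lin2[OF bilin_upure]] by blast+

theorem C_monoidal: "linear_monoidal_category C"
proof (rule linear_monoidal_category.intro, unfold C_sel(1,10,12))
 note lc = lin_closed[OF amap_lin] lin_closed[OF tmap_lin] lin_closed[OF lmap_lin] lin_closed[OF rmap_lin]
 show "Dom C f : objs \<and> Cod C f : objs" if "f : Arr C" for f using that by (auto simp: C_sel)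
 show "Id C X : Hom C X X" if "X : objs" for X using that P_id by (simp add: lin_id Hom_iff C_sel)
 show "Comp C g f : Hom C X Z" if "f : Hom C X Y" "g : Hom C Y Z" for f g X Y Z using that by (rule comp_in_Hom)
 show "Comp C f (Id C X) = f \<and> Comp C (Id C Y) f = f" if "f : Hom C X Y" for f X Y
  using that by (elim HomE) (auto simp: C_sel compose_def intro!: extensionalityI[of _ "el (sp X)"] dest: lin_closed)
 show "Comp C (Comp C h g) f = Comp C h (Comp C g f)" if "f : Hom C X Y" "g : Hom C Y Z" "h : Hom C Z W" for f g h X Y Z W
  using that by (elim HomE) (auto simp: C_sel compose_def dest: lin_closed intro!: restrict_ext)
 show "vsp (Hom_space C X Y)" if "X : objs" "Y : objs" for X Y using that by (rule hom_vs)
 show "bilin (Hom_space C Y Z) (Hom_space C X Y) (Hom_space C X Z) (%g f. Comp C g f)"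
  if "X : objs" "Y : objs" "Z : objs" for X Y Z using comp_bilin that by simp
 show "ten X Y : objs" if "X : objs" "Y : objs" for X Y using that by simp
 show "bilin (Hom_space C X Y) (Hom_space C X' Y') (Hom_space C (ten X X') (ten Y Y')) (%f g. TenA C f g)"
  if "X : objs" "Y : objs" "X' : objs" "Y' : objs" for X Y X' Y' using ten_bilin that by simp
 show "TenA C (Id C X) (Id C Y) = Id C (ten X Y)" if "X : objs" "Y : objs" for X Y
  unfolding C_sel sp_ten prod.inject simp_thms
  by (rule utensor_elin_eqI[where V = "sp X" and W = "sp Y" and Z = "utensor (sp X) (sp Y)"]) (use that in \<open>simp_all add: lin_id\<close>)
 show "TenA C (Comp C g f) (Comp C g' f') = Comp C (TenA C g g') (TenA C f f')"
  if "f : Hom C X Y" "g : Hom C Y Z" "f' : Hom C X' Y'" "g' : Hom C Y' Z'" for f g f' g' X Y Z X' Y' Z'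
  using that apply (elim HomE IntE)
  apply (simp only: C_sel sp_ten prod.inject simp_thms)
  apply (rule utensor_elin_eqI[where V = "sp X" and W = "sp X'" and Z = "utensor (sp Z) (sp Z')"])
  by (simp_all add: compose_eq lin_closed compose_lin[where W = "utensor (sp Y) (sp Y')"])
 show "unit : objs" by simp
 show "Assoc C X Y Z : Hom C (ten (ten X Y) Z) (ten X (ten Y Z)) \<and> iso_arr C (Assoc C X Y Z)"
  if "X : objs" "Y : objs" "Z : objs" for X Y Z
  using that iso_arrI[OF assoc_inverse[OF that]] P_assoc[OF that] by (simp add: Hom_iff C_sel)
 show "Comp C (Assoc C X' Y' Z') (TenA C (TenA C f g) h) = Comp C (TenA C f (TenA C g h)) (Assoc C X Y Z)"
  if "f : Hom C X X'" "g : Hom C Y Y'" "h : Hom C Z Z'" for f g h X X' Y Y' Z Z'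
  using that apply (elim HomE IntE)
  apply (simp only: C_sel sp_ten prod.inject simp_thms)
  apply (rule utensor_elin_eqI3[where U = "sp X" and V = "sp Y" and W = "sp Z" and Z = "utensor (sp X') (utensor (sp Y') (sp Z'))"])
  by (simp_all add: compose_eq lin_closed
   compose_lin[where W = "utensor (utensor (sp X') (sp Y')) (sp Z')"] compose_lin[where W = "utensor (sp X) (utensor (sp Y) (sp Z))"])
 show "LUnit C X : Hom C (ten unit X) X \<and> iso_arr C (LUnit C X)" if "X : objs" for X
  using that iso_arrI[OF lunit_inverse[OF that]] P_lunit[OF that] by (simp add: Hom_iff C_sel)
 show "RUnit C X : Hom C (ten X unit) X \<and> iso_arr C (RUnit C X)" if "X : objs" for X
  using that iso_arrI[OF runit_inverse[OF that]] P_runit[OF that] by (simp add: Hom_iff C_sel)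
 show "Comp C (LUnit C Y) (TenA C (Id C unit) f) = Comp C f (LUnit C X)" if "f : Hom C X Y" for f X Y
  using that apply (elim HomE IntE)
  apply (simp only: C_sel sp_ten sp_unit prod.inject simp_thms)
  apply (rule utensor_elin_eqI[where V = uscalars and W = "sp X" and Z = "sp Y"])
  by (auto simp add: compose_eq lin_closed lin_smult restrict_id_elin[OF vs_uscalars, unfolded uscalars_simps] compose_lin[where W = "utensor uscalars (sp Y)"] compose_lin[where W = "sp X"])
 show "Comp C (RUnit C Y) (TenA C f (Id C unit)) = Comp C f (RUnit C X)" if "f : Hom C X Y" for f X Y
  using that apply (elim HomE IntE)
  apply (simp only: C_sel sp_ten sp_unit prod.inject simp_thms)
  apply (rule utensor_elin_eqI[where V = "sp X" and W = uscalars and Z = "sp Y"])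
  by (auto simp add: compose_eq lin_closed lin_smult restrict_id_elin[OF vs_uscalars, unfolded uscalars_simps] compose_lin[where W = "utensor (sp Y) uscalars"] compose_lin[where W = "sp X"])
 show "Comp C (Assoc C X Y (ten Z W)) (Assoc C (ten X Y) Z W)
   = Comp C (TenA C (Id C X) (Assoc C Y Z W)) (Comp C (Assoc C X (ten Y Z) W) (TenA C (Assoc C X Y Z) (Id C W)))"
  if "X : objs" "Y : objs" "Z : objs" "W : objs" for X Y Z W
  apply (simp only: C_sel sp_ten prod.inject simp_thms)
  apply (rule utensor_elin_eqI4[where U = "sp X" and V = "sp Y" and W = "sp Z" and X = "sp W" and Z = "utensor (sp X) (utensor (sp Y) (utensor (sp Z) (sp W)))"])
  using that by (simp_all add: compose_eq lin_id
   compose_lin[where W = "utensor (utensor (sp X) (sp Y)) (utensor (sp Z) (sp W))"]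
   compose_lin[where W = "utensor (sp X) (utensor (utensor (sp Y) (sp Z)) (sp W))"]
   compose_lin[where W = "utensor (utensor (sp X) (utensor (sp Y) (sp Z))) (sp W)"])
 show "Comp C (TenA C (Id C X) (LUnit C Y)) (Assoc C X unit Y) = TenA C (RUnit C X) (Id C Y)"
  if "X : objs" "Y : objs" for X Y
  apply (simp only: C_sel sp_ten sp_unit prod.inject simp_thms)
  apply (rule utensor_elin_eqI3[where U = "sp X" and V = uscalars and W = "sp Y" and Z = "utensor (sp X) (sp Y)"])
  using that by (auto simp add: compose_eq smult_upure lin_id compose_lin[where W = "utensor (sp X) (utensor uscalars (sp Y))"])
qed

end

section \<open>Strict isomorphisms of monoidal categories\<close>

text \<open>A surjection that respects the operations carries the vector space laws along. Preservation of
 zero is assumed separately because the target is not yet known to be a vector space.\<close>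

lemma vs_transfer:
 assumes V: "vsp V" and f: "f : lin V W" "f ` el V = el W" and z: "f \<zero>\<^bsub>V\<^esub> = \<zero>\<^bsub>W\<^esub>"
 shows "vsp W"
proof -
 have e: "\<exists>v\<in>el V. w = f v" if "w : el W" for w using that f(2) by auto
 note l = lin_add[OF f(1), symmetric] lin_smult[OF f(1), symmetric] lin_closed[OF f(1)] z[symmetric]
 show ?thesis
  by (rule vsI) (use V in \<open>auto dest!: e simp: l vs_add_assoc vs_add_comm vs_add_left_comm vs_smult_add vs_smult_distr vs_smult_mult vs_neg_right\<close>)
qed

locale strict_iso =
 fixes C :: "('k::field, 'o, 'm) tcat" and D :: "('k, 'p, 'n) tcat" and Fo Fa
 assumes bij_obj: "bij_betw Fo (Obj C) (Obj D)" and bij_arr: "bij_betw Fa (Arr C) (Arr D)"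
  and dom: "f : Arr C ==> Dom D (Fa f) = Fo (Dom C f)"
  and cod: "f : Arr C ==> Cod D (Fa f) = Fo (Cod C f)"
  and id: "X : Obj C ==> Fa (Id C X) = Id D (Fo X)"
  and comp: "f : Hom C X Y ==> g : Hom C Y Z ==> Fa (Comp C g f) = Comp D (Fa g) (Fa f)"
  and zero: "X : Obj C ==> Y : Obj C ==> Fa (Zero C X Y) = Zero D (Fo X) (Fo Y)"
  and add: "f : Hom C X Y ==> g : Hom C X Y ==> Fa (Add C f g) = Add D (Fa f) (Fa g)"
  and scale: "f : Hom C X Y ==> Fa (Scale C a f) = Scale D a (Fa f)"
  and tenO: "X : Obj C ==> Y : Obj C ==> Fo (TenO C X Y) = TenO D (Fo X) (Fo Y)"
  and tenA: "f : Hom C X Y ==> g : Hom C X' Y' ==> Fa (TenA C f g) = TenA D (Fa f) (Fa g)"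
  and unit: "Fo (Unit C) = Unit D"
  and assoc: "X : Obj C ==> Y : Obj C ==> Z : Obj C ==> Fa (Assoc C X Y Z) = Assoc D (Fo X) (Fo Y) (Fo Z)"
  and lunit: "X : Obj C ==> Fa (LUnit C X) = LUnit D (Fo X)"
  and runit: "X : Obj C ==> Fa (RUnit C X) = RUnit D (Fo X)"
  and monoidal: "linear_monoidal_category C"
begin

sublocale C: linear_monoidal_category C by (rule monoidal)

lemma C_hom_obj: "f : Hom C X Y ==> X : Obj C \<and> Y : Obj C \<and> f : Arr C"
 using C.arr_obj unfolding Hom_def by auto

lemma obj_D: "X : Obj C ==> Fo X : Obj D" using bij_obj by (auto simp: bij_betw_def)

lemma objE: assumes "A : Obj D" obtains X where "X : Obj C" "A = Fo X"
 using bij_obj assms by (auto simp: bij_betw_def)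

lemma hom_D: "f : Hom C X Y ==> Fa f : Hom D (Fo X) (Fo Y)"
 using bij_arr dom cod unfolding Hom_def bij_betw_def by auto

lemma homE0:
 assumes "h : Hom D A B" obtains X Y f where "A = Fo X" "B = Fo Y" "X : Obj C" "Y : Obj C" "f : Hom C X Y" "h = Fa f"
proof -
 have "h : Arr D" "Dom D h = A" "Cod D h = B" using assms by (auto simp: Hom_def)
 moreover then obtain f where "f : Arr C" "h = Fa f" using bij_arr by (auto simp: bij_betw_def)
 ultimately show thesis using that[of "Dom C f" "Cod C f" f] C.arr_obj dom cod by (auto simp: Hom_def)
qed

lemma homE:
 assumes "h : Hom D (Fo X) (Fo Y)" "X : Obj C" "Y : Obj C" obtains f where "f : Hom C X Y" "h = Fa f"
proof -
 obtain X' Y' f where *: "Fo X = Fo X'" "Fo Y = Fo Y'" "X' : Obj C" "Y' : Obj C" "f : Hom C X' Y'" "h = Fa f"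
  using homE0[OF assms(1)] by metis
 have "X = X'" "Y = Y'" using * assms bij_obj by (auto simp: bij_betw_def inj_on_def)
 with * that show thesis by blast
qed

lemma hom_D_eq: "X : Obj C ==> Y : Obj C ==> Hom D (Fo X) (Fo Y) = Fa ` Hom C X Y"
 using hom_D by (auto elim: homE)

lemma iso_D: assumes "iso_arr C f" shows "iso_arr D (Fa f)"
proof -
 obtain g where g: "inverse_arr C f g" using assms by (auto simp: iso_arr_def)
 let ?X = "Dom C f" and ?Y = "Cod C f"
 have f: "f : Hom C ?X ?Y" and g': "g : Hom C ?Y ?X" using g by (auto simp: inverse_arr_def Hom_def)
 have "inverse_arr D (Fa f) (Fa g)"
  using g f g' hom_D[OF f] hom_D[OF g'] C_hom_obj[OF f] dom cod id comp[OF f g'] comp[OF g' f]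
  unfolding inverse_arr_def by (auto simp: Hom_def)
 then show ?thesis by (auto simp: iso_arr_def)
qed

lemma Hom_space_lin: "X : Obj C ==> Y : Obj C ==> Fa : lin (Hom_space C X Y) (Hom_space D (Fo X) (Fo Y))"
 by (rule linI) (simp_all add: Hom_space_def hom_D add scale)

lemma hom_closed:
 assumes "X : Obj C" "Y : Obj C"
 shows "Zero C X Y : Hom C X Y" "f : Hom C X Y ==> g : Hom C X Y ==> Add C f g : Hom C X Y"
  "f : Hom C X Y ==> Scale C a f : Hom C X Y"
proof -
 have v: "vsp (Hom_space C X Y)" using assms C.hom_vectorspace by simp
 show "Zero C X Y : Hom C X Y" using vs_zero_closed[OF v] by (simp add: Hom_space_def)
 show "f : Hom C X Y ==> g : Hom C X Y ==> Add C f g : Hom C X Y" using vs_add_closed[OF v] by (simp add: Hom_space_def)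
 show "f : Hom C X Y ==> Scale C a f : Hom C X Y" using vs_smult_closed[OF v] by (simp add: Hom_space_def)
qed

lemma ten_hom: "f : Hom C X Y ==> g : Hom C X' Y' ==> TenA C f g : Hom C (TenO C X X') (TenO C Y Y')"
 using bilin_closed[OF C.ten_bilin[of X Y X' Y']] C_hom_obj by (simp add: Hom_space_def)

lemma bilin_transfer:
 assumes b: "bilin V W Z b" and V': "f ` el V = el V'" and W': "g ` el W = el W'"
  and f: "f : lin V V'" and g: "g : lin W W'" and h: "h : lin Z Z'" and VW: "vsp V" "vsp W"
  and c: "\<And>v w. v : el V ==> w : el W ==> h (b v w) = b' (f v) (g w)"
 shows "bilin V' W' Z' b'"
proof -
 note c' = c[symmetric]
 note l = lin_add[OF f, symmetric] lin_smult[OF f, symmetric] lin_add[OF g, symmetric] lin_smult[OF g, symmetric]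
 note b1 = bilin_closed[OF b] lin_add[OF bilin_lin1[OF b]] lin_add[OF bilin_lin2[OF b]] lin_smult[OF bilin_lin1[OF b]] lin_smult[OF bilin_lin2[OF b]]
 show ?thesis
  by (intro bilinI linI)
   (use VW in \<open>auto simp: V'[symmetric] W'[symmetric] l c' b1 lin_closed[OF h] lin_add[OF h] lin_smult[OF h]\<close>)
qed

lemma comp_D: "f : Hom C X Y ==> g : Hom C Y Z ==> Comp D (Fa g) (Fa f) = Fa (Comp C g f)"
 by (simp add: comp)

lemma tenA_D: "f : Hom C X Y ==> g : Hom C X' Y' ==> TenA D (Fa f) (Fa g) = Fa (TenA C f g)"
 by (simp add: tenA)

lemma D_monoidal: "linear_monoidal_category D"
proof (rule linear_monoidal_category.intro)
 note o = obj_D C.ten_obj C.unit_obj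
 note obj = tenO[symmetric] unit[symmetric]
 note str = id[symmetric] assoc[symmetric] lunit[symmetric] runit[symmetric]
 show "Dom D f : Obj D \<and> Cod D f : Obj D" if "f : Arr D" for f
 proof -
  have "f : Hom D (Dom D f) (Cod D f)" using that by (simp add: Hom_def)
  then show ?thesis by (elim homE0) (simp add: obj_D)
 qed
 show "Id D A : Hom D A A" if "A : Obj D" for A
  using that by (elim objE) (auto simp: str intro!: hom_D C.id_hom)
 show "Comp D g f : Hom D A E" if f: "f : Hom D A B" and g: "g : Hom D B E" for f g A B E
  using f g by (elim homE0) (metis hom_D homE comp_D C.comp_hom f g)
 show "Comp D f (Id D A) = f \<and> Comp D (Id D B) f = f" if f: "f : Hom D A B" for f A B
  using f by (elim homE0) (use C.comp_id comp_D C.id_hom str in metis)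
 show "Comp D (Comp D h g) f = Comp D h (Comp D g f)" if f: "f : Hom D A B" "g : Hom D B E" "h : Hom D E G" for f g h A B E G
 proof -
  obtain X Y f' where 1: "A = Fo X" "B = Fo Y" "X : Obj C" "Y : Obj C" "f' : Hom C X Y" "f = Fa f'" using homE0[OF f(1)] by metis
  obtain Z W h' where 2: "E = Fo Z" "G = Fo W" "Z : Obj C" "W : Obj C" "h' : Hom C Z W" "h = Fa h'" using homE0[OF f(3)] by metis
  obtain g' where 3: "g' : Hom C Y Z" "g = Fa g'" using homE f(2) 1 2 by metis
  show ?thesis unfolding 1 2 3
   by (simp only: comp_D[OF 1(5) 3(1)] comp_D[OF 3(1) 2(5)] comp_D[OF C.comp_hom[OF 1(5) 3(1)] 2(5)]
    comp_D[OF 1(5) C.comp_hom[OF 3(1) 2(5)]] C.comp_assoc[OF 1(5) 3(1) 2(5)])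
 qed
 have hs: "Fa ` el (Hom_space C X Y) = el (Hom_space D (Fo X) (Fo Y))" if "X : Obj C" "Y : Obj C" for X Y
  using that by (simp add: Hom_space_def hom_D_eq)
 show "vsp (Hom_space D A B)" if AB: "A : Obj D" "B : Obj D" for A B
 proof -
  obtain X where X: "X : Obj C" "A = Fo X" using objE AB by metis
  obtain Y where Y: "Y : Obj C" "B = Fo Y" using objE AB by metis
  show ?thesis unfolding X Y using X Y
   by (intro vs_transfer[OF C.hom_vectorspace Hom_space_lin hs]) (auto simp: Hom_space_def zero)
 qed
 show "bilin (Hom_space D B E) (Hom_space D A B) (Hom_space D A E) (%g f. Comp D g f)"
  if AB: "A : Obj D" "B : Obj D" "E : Obj D" for A B E
 proof -
  obtain X where X: "X : Obj C" "A = Fo X" using objE AB by metis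
  obtain Y where Y: "Y : Obj C" "B = Fo Y" using objE AB by metis
  obtain Z where Z: "Z : Obj C" "E = Fo Z" using objE AB by metis
  show ?thesis unfolding X Y Z
   by (rule bilin_transfer[OF C.comp_bilin hs hs Hom_space_lin Hom_space_lin Hom_space_lin])
    (use X Y Z C.hom_vectorspace in \<open>auto simp: Hom_space_def comp\<close>)
 qed
 show "TenO D A B : Obj D" if "A : Obj D" "B : Obj D" for A B
  using that by (elim objE) (auto simp: obj intro!: o)
 show "bilin (Hom_space D A B) (Hom_space D A' B') (Hom_space D (TenO D A A') (TenO D B B')) (%f g. TenA D f g)"
  if AB: "A : Obj D" "B : Obj D" "A' : Obj D" "B' : Obj D" for A B A' B'
 proof -
  obtain X where X: "X : Obj C" "A = Fo X" using objE AB by metis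
  obtain Y where Y: "Y : Obj C" "B = Fo Y" using objE AB by metis
  obtain X' where X': "X' : Obj C" "A' = Fo X'" using objE AB by metis
  obtain Y' where Y': "Y' : Obj C" "B' = Fo Y'" using objE AB by metis
  show ?thesis unfolding X Y X' Y' tenO[OF X(1) X'(1), symmetric] tenO[OF Y(1) Y'(1), symmetric]
   by (rule bilin_transfer[OF C.ten_bilin hs hs Hom_space_lin Hom_space_lin Hom_space_lin])
    (use X Y X' Y' C.hom_vectorspace in \<open>auto simp: Hom_space_def tenA intro!: C.ten_obj\<close>)
 qed
 show "TenA D (Id D A) (Id D B) = Id D (TenO D A B)" if "A : Obj D" "B : Obj D" for A B
  using that by (elim objE) (simp add: id[symmetric] tenO[symmetric] C.ten_obj tenA_D[OF C.id_hom C.id_hom] C.ten_id)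
 show "TenA D (Comp D g f) (Comp D g' f') = Comp D (TenA D g g') (TenA D f f')"
  if f: "f : Hom D A B" "g : Hom D B E" "f' : Hom D A' B'" "g' : Hom D B' E'" for f g f' g' A B E A' B' E'
 proof -
  obtain X Y f1 where 1: "A = Fo X" "B = Fo Y" "X : Obj C" "Y : Obj C" "f1 : Hom C X Y" "f = Fa f1" using homE0[OF f(1)] by metis
  have "E : Obj D" using homE0[OF f(2)] obj_D by metis
  then obtain Z where 2: "E = Fo Z" "Z : Obj C" using objE by metis
  obtain g1 where 3: "g1 : Hom C Y Z" "g = Fa g1" using homE f(2) 1 2 by metis
  obtain X' Y' f1' where p1: "A' = Fo X'" "B' = Fo Y'" "X' : Obj C" "Y' : Obj C" "f1' : Hom C X' Y'" "f' = Fa f1'" using homE0[OF f(3)] by metis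
  have "E' : Obj D" using homE0[OF f(4)] obj_D by metis
  then obtain Z' where p2: "E' = Fo Z'" "Z' : Obj C" using objE by metis
  obtain g1' where p3: "g1' : Hom C Y' Z'" "g' = Fa g1'" using homE f(4) p1 p2 by metis
  show ?thesis unfolding 1 3 p1 p3 using C.ten_comp[OF 1(5) 3(1) p1(5) p3(1)]
   by (simp add: comp_D[OF 1(5) 3(1)] comp_D[OF p1(5) p3(1)] tenA_D[OF C.comp_hom[OF 1(5) 3(1)] C.comp_hom[OF p1(5) p3(1)]]
    tenA_D[OF 1(5) p1(5)] tenA_D[OF 3(1) p3(1)] comp_D[OF ten_hom[OF 1(5) p1(5)] ten_hom[OF 3(1) p3(1)]])
 qed
 show "Unit D : Obj D" unfolding obj by (intro o)
 show "Assoc D A B E : Hom D (TenO D (TenO D A B) E) (TenO D A (TenO D B E)) \<and> iso_arr D (Assoc D A B E)"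
  if "A : Obj D" "B : Obj D" "E : Obj D" for A B E
  using that by (elim objE) (simp add: assoc[symmetric] tenO[symmetric] C.ten_obj hom_D iso_D C.assoc_iso)
 show "Comp D (Assoc D A' B' E') (TenA D (TenA D f g) h) = Comp D (TenA D f (TenA D g h)) (Assoc D A B E)"
  if f: "f : Hom D A A'" "g : Hom D B B'" "h : Hom D E E'" for f g h A A' B B' E E'
 proof -
  obtain X X' f1 where 1: "A = Fo X" "A' = Fo X'" "X : Obj C" "X' : Obj C" "f1 : Hom C X X'" "f = Fa f1" using homE0[OF f(1)] by metis
  obtain Y Y' g1 where 2: "B = Fo Y" "B' = Fo Y'" "Y : Obj C" "Y' : Obj C" "g1 : Hom C Y Y'" "g = Fa g1" using homE0[OF f(2)] by metis
  obtain Z Z' h1 where 3: "E = Fo Z" "E' = Fo Z'" "Z : Obj C" "Z' : Obj C" "h1 : Hom C Z Z'" "h = Fa h1" using homE0[OF f(3)] by metis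
  have a: "Assoc C X Y Z : Hom C (TenO C (TenO C X Y) Z) (TenO C X (TenO C Y Z))"
    "Assoc C X' Y' Z' : Hom C (TenO C (TenO C X' Y') Z') (TenO C X' (TenO C Y' Z'))"
   using C.assoc_iso 1 2 3 by auto
  note t = ten_hom[OF ten_hom[OF 1(5) 2(5)] 3(5)] ten_hom[OF 1(5) ten_hom[OF 2(5) 3(5)]]
  show ?thesis unfolding 1 2 3 using C.assoc_natural[OF 1(5) 2(5) 3(5)] 1 2 3
   by (simp add: str tenA_D[OF 1(5) 2(5)] tenA_D[OF ten_hom[OF 1(5) 2(5)] 3(5)] tenA_D[OF 2(5) 3(5)]
    tenA_D[OF 1(5) ten_hom[OF 2(5) 3(5)]] comp_D[OF t(1) a(2)] comp_D[OF a(1) t(2)])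
 qed
 show "LUnit D A : Hom D (TenO D (Unit D) A) A \<and> iso_arr D (LUnit D A)" if "A : Obj D" for A
  using that by (elim objE) (simp add: lunit[symmetric] tenO[symmetric] unit[symmetric] C.unit_obj hom_D iso_D C.lunit_iso)
 show "RUnit D A : Hom D (TenO D A (Unit D)) A \<and> iso_arr D (RUnit D A)" if "A : Obj D" for A
  using that by (elim objE) (simp add: runit[symmetric] tenO[symmetric] unit[symmetric] C.unit_obj hom_D iso_D C.runit_iso)
 show "Comp D (LUnit D B) (TenA D (Id D (Unit D)) f) = Comp D f (LUnit D A)" if f: "f : Hom D A B" for f A B
 proof -
  obtain X Y f1 where 1: "A = Fo X" "B = Fo Y" "X : Obj C" "Y : Obj C" "f1 : Hom C X Y" "f = Fa f1" using homE0[OF f] by metis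
  have l: "LUnit C X : Hom C (TenO C (Unit C) X) X" "LUnit C Y : Hom C (TenO C (Unit C) Y) Y" using 1 C.lunit_iso by auto
  note i = C.id_hom[OF C.unit_obj]
  show ?thesis unfolding 1 using 1 C.unit_obj C.lunit_natural[OF 1(5)]
   by (simp add: str obj tenA_D[OF i 1(5)] comp_D[OF l(1) 1(5)] comp_D[OF ten_hom[OF i 1(5)] l(2)])
 qed
 show "Comp D (RUnit D B) (TenA D f (Id D (Unit D))) = Comp D f (RUnit D A)" if f: "f : Hom D A B" for f A B
 proof -
  obtain X Y f1 where 1: "A = Fo X" "B = Fo Y" "X : Obj C" "Y : Obj C" "f1 : Hom C X Y" "f = Fa f1" using homE0[OF f] by metis
  have l: "RUnit C X : Hom C (TenO C X (Unit C)) X" "RUnit C Y : Hom C (TenO C Y (Unit C)) Y" using 1 C.runit_iso by auto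
  note i = C.id_hom[OF C.unit_obj]
  show ?thesis unfolding 1 using 1 C.unit_obj C.runit_natural[OF 1(5)]
   by (simp add: str obj tenA_D[OF 1(5) i] comp_D[OF l(1) 1(5)] comp_D[OF ten_hom[OF 1(5) i] l(2)])
 qed
 show "Comp D (Assoc D A B (TenO D E G)) (Assoc D (TenO D A B) E G)
   = Comp D (TenA D (Id D A) (Assoc D B E G)) (Comp D (Assoc D A (TenO D B E) G) (TenA D (Assoc D A B E) (Id D G)))"
  if AB: "A : Obj D" "B : Obj D" "E : Obj D" "G : Obj D" for A B E G
 proof -
  obtain X where X: "X : Obj C" "A = Fo X" using objE AB by metis
  obtain Y where Y: "Y : Obj C" "B = Fo Y" using objE AB by metis
  obtain Z where Z: "Z : Obj C" "E = Fo Z" using objE AB by metis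
  obtain W where W: "W : Obj C" "G = Fo W" using objE AB by metis
  note o' = X(1) Y(1) Z(1) W(1) C.ten_obj
  note a = C.assoc_iso[THEN conjunct1]
  note t1 = ten_hom[OF C.id_hom[OF X(1)] a[OF Y(1) Z(1) W(1)]] and t2 = ten_hom[OF a[OF X(1) Y(1) Z(1)] C.id_hom[OF W(1)]]
  show ?thesis unfolding X Y Z W using C.pentagon[OF o'(1-4)] o'
   by (simp add: str obj tenA_D[OF C.id_hom a] tenA_D[OF a C.id_hom] comp_D[OF a a] comp_D[OF t2 a]
     comp_D[OF C.comp_hom[OF t2 a] t1])
 qed
 show "Comp D (TenA D (Id D A) (LUnit D B)) (Assoc D A (Unit D) B) = TenA D (RUnit D A) (Id D B)"
  if AB: "A : Obj D" "B : Obj D" for A B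
 proof -
  obtain X where X: "X : Obj C" "A = Fo X" using objE AB by metis
  obtain Y where Y: "Y : Obj C" "B = Fo Y" using objE AB by metis
  note a = C.assoc_iso[THEN conjunct1] and l = C.lunit_iso[THEN conjunct1] and r = C.runit_iso[THEN conjunct1]
  show ?thesis unfolding X Y using C.triangle[OF X(1) Y(1)] X(1) Y(1) C.unit_obj
   by (simp add: str obj tenA_D[OF C.id_hom l] tenA_D[OF r C.id_hom] comp_D[OF a ten_hom[OF C.id_hom l]])
 qed
qed

sublocale D: linear_monoidal_category D by (rule D_monoidal)

lemma inverse_arr_id: "X : Obj D ==> inverse_arr D (Id D X) (Id D X)"
 using D.id_hom[of X] D.comp_id[of "Id D X" X X] unfolding inverse_arr_def by (auto simp: Hom_def)

lemma iso_id: "X : Obj D ==> iso_arr D (Id D X)"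
 using inverse_arr_id unfolding iso_arr_def by blast

lemma is_functor: "is_functor C D Fo Fa"
 unfolding is_functor_def using obj_D id hom_D comp by (auto simp: Hom_def)

lemma monoidal_functor:
 "linear_monoidal_functor C D Fo Fa (%X Y. Id D (Fo (TenO C X Y))) (Id D (Unit D))"
proof (intro linear_monoidal_functor.intro linear_monoidal_functor_axioms.intro)
 note o = obj_D C.ten_obj C.unit_obj D.ten_obj D.unit_obj
 note obj = tenO[symmetric] unit[symmetric]
 note str = id assoc lunit runit
 fix X Y Z assume XYZ: "X : Obj C" "Y : Obj C" "Z : Obj C"
 note a = D.assoc_iso[THEN conjunct1, OF obj_D[OF XYZ(1)] obj_D[OF XYZ(2)] obj_D[OF XYZ(3)]]
 show "Comp D (Fa (Assoc C X Y Z)) (Comp D (Id D (Fo (TenO C (TenO C X Y) Z))) (TenA D (Id D (Fo (TenO C X Y))) (Id D (Fo Z))))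
  = Comp D (Id D (Fo (TenO C X (TenO C Y Z)))) (Comp D (TenA D (Id D (Fo X)) (Id D (Fo (TenO C Y Z)))) (Assoc D (Fo X) (Fo Y) (Fo Z)))"
  using XYZ a by (simp add: tenO assoc o D.ten_id D.comp_id D.comp_id[OF D.id_hom])
next
 note o = obj_D C.ten_obj C.unit_obj D.ten_obj D.unit_obj
 fix f X X' g Y Y' assume f: "f : Hom C X X'" and g: "g : Hom C Y Y'"
 show "Comp D (Id D (Fo (TenO C X' Y'))) (TenA D (Fa f) (Fa g)) = Comp D (Fa (TenA C f g)) (Id D (Fo (TenO C X Y)))"
  using hom_D[OF ten_hom[OF f g]] by (simp add: tenA_D[OF f g] D.comp_id)
next
 fix X assume X: "X : Obj C"
 note o = obj_D C.ten_obj C.unit_obj D.ten_obj D.unit_obj X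
 show "LUnit D (Fo X) = Comp D (Fa (LUnit C X)) (Comp D (Id D (Fo (TenO C (Unit C) X))) (TenA D (Id D (Unit D)) (Id D (Fo X))))"
  using D.lunit_iso[OF obj_D[OF X]] D.comp_id[OF D.lunit_iso[OF obj_D[OF X], THEN conjunct1]] by (simp add: tenO unit lunit o D.ten_id D.comp_id[OF D.id_hom] D.comp_id)
 show "RUnit D (Fo X) = Comp D (Fa (RUnit C X)) (Comp D (Id D (Fo (TenO C X (Unit C)))) (TenA D (Id D (Fo X)) (Id D (Unit D))))"
  using D.runit_iso[OF obj_D[OF X]] D.comp_id[OF D.runit_iso[OF obj_D[OF X], THEN conjunct1]] by (simp add: tenO unit runit o D.ten_id D.comp_id[OF D.id_hom] D.comp_id)
qed (simp_all add: is_functor C.linear_monoidal_category_axioms D.linear_monoidal_category_axioms Hom_space_lin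
   tenO[symmetric] unit D.id_hom iso_id obj_D C.ten_obj D.unit_obj)

end

lemma strict_iso_sym:
 assumes "strict_iso C D Fo Fa"
 shows "strict_iso D C (inv_into (Obj C) Fo) (inv_into (Arr C) Fa)"
proof -
 interpret strict_iso C D Fo Fa by (rule assms)
 let ?Go = "inv_into (Obj C) Fo" and ?Ga = "inv_into (Arr C) Fa"
 have Go [simp]: "?Go (Fo X) = X" if "X : Obj C" for X using that bij_obj by (simp add: bij_betw_def)
 have Ga: "?Ga (Fa f) = f" if "f : Arr C" for f using that bij_arr by (simp add: bij_betw_def)
 have Gh [simp]: "?Ga (Fa f) = f" if "f : Hom C X Y" for f X Y using that Ga by (simp add: Hom_def)
 have arrE: thesis if "h : Arr D" "\<And>f. f : Arr C ==> h = Fa f ==> thesis" for h thesis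
  using that bij_arr by (auto simp: bij_betw_def)
 show ?thesis
 proof
  show "bij_betw ?Go (Obj D) (Obj C)" "bij_betw ?Ga (Arr D) (Arr C)"
   using bij_obj bij_arr by (simp_all add: bij_betw_inv_into)
  show "Dom C (?Ga f) = ?Go (Dom D f)" "Cod C (?Ga f) = ?Go (Cod D f)" if "f : Arr D" for f
   using that by (auto elim!: arrE simp: Ga dom cod C.arr_obj)
  show "?Ga (Id D A) = Id C (?Go A)" "?Ga (LUnit D A) = LUnit C (?Go A)" "?Ga (RUnit D A) = RUnit C (?Go A)" if "A : Obj D" for A
   using that by (elim objE; simp add: id[symmetric] lunit[symmetric] runit[symmetric] Gh[OF C.id_hom]
    Gh[OF C.lunit_iso[THEN conjunct1]] Gh[OF C.runit_iso[THEN conjunct1]])+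
  show "?Ga (Comp D g f) = Comp C (?Ga g) (?Ga f)" if f: "f : Hom D A B" "g : Hom D B E" for f g A B E
  proof -
   obtain X Y f1 where 1: "A = Fo X" "B = Fo Y" "X : Obj C" "Y : Obj C" "f1 : Hom C X Y" "f = Fa f1" using homE0[OF f(1)] by metis
   have "E : Obj D" using homE0[OF f(2)] obj_D by metis
   then obtain Z where 2: "E = Fo Z" "Z : Obj C" using objE by metis
   obtain g1 where 3: "g1 : Hom C Y Z" "g = Fa g1" using homE f(2) 1 2 by metis
   show ?thesis using 1 2 3 C.comp_hom[OF 1(5) 3(1)] by (simp add: comp_D[OF 1(5) 3(1)] Gh[OF 1(5)] Gh[OF 3(1)] Gh)
  qed
  show "?Ga (TenA D f g) = TenA C (?Ga f) (?Ga g)" if f: "f : Hom D A B" "g : Hom D A' B'" for f g A B A' B'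
  proof -
   obtain X Y f1 where 1: "A = Fo X" "B = Fo Y" "X : Obj C" "Y : Obj C" "f1 : Hom C X Y" "f = Fa f1" using homE0[OF f(1)] by metis
   obtain X' Y' g1 where 2: "A' = Fo X'" "B' = Fo Y'" "X' : Obj C" "Y' : Obj C" "g1 : Hom C X' Y'" "g = Fa g1" using homE0[OF f(2)] by metis
   show ?thesis unfolding 1 2 by (simp add: tenA_D[OF 1(5) 2(5)] Gh[OF 1(5)] Gh[OF 2(5)] Gh[OF ten_hom[OF 1(5) 2(5)]])
  qed
  show "?Ga (Add D f g) = Add C (?Ga f) (?Ga g)" if f: "f : Hom D A B" "g : Hom D A B" for f g A B
  proof -
   obtain X Y f1 where 1: "A = Fo X" "B = Fo Y" "X : Obj C" "Y : Obj C" "f1 : Hom C X Y" "f = Fa f1" using homE0[OF f(1)] by metis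
   obtain g1 where 3: "g1 : Hom C X Y" "g = Fa g1" using homE f(2) 1 by metis
   show ?thesis unfolding 1 3
    by (simp add: add[OF 1(5) 3(1), symmetric] Gh[OF 1(5)] Gh[OF 3(1)] Gh[OF hom_closed(2)[OF 1(3,4,5) 3(1)]])
  qed
  show "?Ga (Scale D a f) = Scale C a (?Ga f)" if f: "f : Hom D A B" for f a A B
  proof -
   obtain X Y f1 where 1: "A = Fo X" "B = Fo Y" "X : Obj C" "Y : Obj C" "f1 : Hom C X Y" "f = Fa f1" using homE0[OF f] by metis
   show ?thesis unfolding 1
    by (simp add: scale[OF 1(5), symmetric] Gh[OF 1(5)] Gh[OF hom_closed(3)[OF 1(3,4,5)]])
  qed
  show "?Ga (Zero D A B) = Zero C (?Go A) (?Go B)" if "A : Obj D" "B : Obj D" for A B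
   using that by (elim objE) (simp add: zero[symmetric] Gh[OF hom_closed(1)])
  show "?Go (TenO D A B) = TenO C (?Go A) (?Go B)" if "A : Obj D" "B : Obj D" for A B
   using that by (elim objE) (simp add: tenO[symmetric] C.ten_obj)
  show "?Go (Unit D) = Unit C" by (simp add: unit[symmetric] C.unit_obj)
  show "?Ga (Assoc D A B E) = Assoc C (?Go A) (?Go B) (?Go E)" if "A : Obj D" "B : Obj D" "E : Obj D" for A B E
   using that by (elim objE) (simp add: assoc[symmetric] Gh[OF C.assoc_iso[THEN conjunct1]])
 qed
qed

lemma strict_iso_trans:
 assumes "strict_iso C D Fo Fa" "strict_iso D E Go Ga"
 shows "strict_iso C E (Go \<circ> Fo) (Ga \<circ> Fa)"
proof -
 interpret CD: strict_iso C D Fo Fa by (rule assms)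
 interpret DE: strict_iso D E Go Ga by (rule assms)
 have Fa: "Fa f : Arr D" if "f : Arr C" for f using that CD.bij_arr by (auto simp: bij_betw_def)
 show ?thesis
 proof
  show "bij_betw (Go \<circ> Fo) (Obj C) (Obj E)" "bij_betw (Ga \<circ> Fa) (Arr C) (Arr E)"
   using CD.bij_obj DE.bij_obj CD.bij_arr DE.bij_arr by (auto intro: bij_betw_trans)
  show "(Ga \<circ> Fa) (Comp C g f) = Comp E ((Ga \<circ> Fa) g) ((Ga \<circ> Fa) f)" if "f : Hom C X Y" "g : Hom C Y Z" for f g X Y Z
   using CD.comp[OF that] DE.comp[OF CD.hom_D[OF that(1)] CD.hom_D[OF that(2)]] by simp
  show "(Ga \<circ> Fa) (TenA C f g) = TenA E ((Ga \<circ> Fa) f) ((Ga \<circ> Fa) g)" if "f : Hom C X Y" "g : Hom C X' Y'" for f g X Y X' Y'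
   using CD.tenA[OF that] DE.tenA[OF CD.hom_D[OF that(1)] CD.hom_D[OF that(2)]] by simp
  show "(Ga \<circ> Fa) (Add C f g) = Add E ((Ga \<circ> Fa) f) ((Ga \<circ> Fa) g)" if "f : Hom C X Y" "g : Hom C X Y" for f g X Y
   using CD.add[OF that] DE.add[OF CD.hom_D[OF that(1)] CD.hom_D[OF that(2)]] by simp
  show "(Ga \<circ> Fa) (Scale C a f) = Scale E a ((Ga \<circ> Fa) f)" if "f : Hom C X Y" for f a X Y
   using CD.scale[OF that] DE.scale[OF CD.hom_D[OF that]] by simp
 qed (simp_all add: CD.dom CD.cod DE.dom DE.cod Fa CD.id DE.id CD.zero DE.zero CD.obj_D CD.tenO DE.tenO CD.unit DE.unit
   CD.assoc DE.assoc CD.lunit DE.lunit CD.runit DE.runit CD.monoidal)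
qed

theorem strict_iso_tensor_equivalent:
 assumes "strict_iso C D Fo Fa"
 shows "tensor_equivalent C D"
proof -
 interpret strict_iso C D Fo Fa by (rule assms)
 interpret inv: strict_iso D C "inv_into (Obj C) Fo" "inv_into (Arr C) Fa" by (rule strict_iso_sym[OF assms])
 have Go: "inv_into (Obj C) Fo (Fo X) = X" "X : Obj C ==> Fo X : Obj D" if "X : Obj C" for X
  using that bij_obj obj_D by (simp_all add: bij_betw_def)
 have Ga: "inv_into (Arr C) Fa (Fa f) = f" if "f : Arr C" for f using that bij_arr by (simp add: bij_betw_def)
 have Fo: "Fo (inv_into (Obj C) Fo A) = A" if "A : Obj D" for A using that bij_obj by (simp add: bij_betw_inv_into_right)
 have Fa: "Fa (inv_into (Arr C) Fa f) = f" if "f : Arr D" for f using that bij_arr by (simp add: bij_betw_inv_into_right)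
 have nC: "Comp C (Id C (Cod C f)) f = Comp C f (Id C (Dom C f))" if "f : Arr C" for f
  using C.comp_id[of f "Dom C f" "Cod C f"] that by (simp add: Hom_def)
 have nD: "Comp D (Id D (Cod D f)) f = Comp D f (Id D (Dom D f))" if "f : Arr D" for f
  using D.comp_id[of f "Dom D f" "Cod D f"] that by (simp add: Hom_def)
 have "natural_iso C C (%X. X) (%f. f) (inv_into (Obj C) Fo \<circ> Fo) (inv_into (Arr C) Fa \<circ> Fa) (Id C)"
  unfolding natural_iso_def using C.id_hom inv.iso_id nC by (auto simp: Go Ga)
 moreover have "natural_iso D D (Fo \<circ> inv_into (Obj C) Fo) (Fa \<circ> inv_into (Arr C) Fa) (%X. X) (%f. f) (Id D)"
  unfolding natural_iso_def using D.id_hom iso_id nD by (auto simp: Fo Fa)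
 ultimately have "is_equivalence C D Fo Fa"
  unfolding is_equivalence_def using is_functor inv.is_functor by blast
 then show ?thesis unfolding tensor_equivalent_def using monoidal_functor by blast
qed

section \<open>Fitting's lemma\<close>

text \<open>More unknowns than equations: Gaussian elimination of one unknown per step.\<close>

lemma homogeneous_system_solvable:
 fixes a :: "'i => 'j => 'k::field"
 assumes "finite J" "finite I" "card J < card I"
 shows "\<exists>c. (\<exists>i\<in>I. c i \<noteq> 0) \<and> (\<forall>j\<in>J. (\<Sum>i\<in>I. c i * a i j) = 0)"
 using assms
proof (induct J arbitrary: I a rule: finite_induct)
 case empty
 then obtain i where "i : I" by fastforce
 then show ?case by (intro exI[of _ "%_. 1"]) auto
next
 case (insert j J)
 show ?case
 proof (cases "\<forall>i\<in>I. a i j = 0")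
  case True
  obtain c where "\<exists>i\<in>I. c i \<noteq> 0" "\<forall>j\<in>J. (\<Sum>i\<in>I. c i * a i j) = 0"
   using insert.hyps(3)[of I a] insert.prems insert.hyps by (metis card_insert_disjoint Suc_lessD)
  then show ?thesis using True by (intro exI[of _ c]) simp
 next
  case False
  then obtain p where p: "p : I" "a p j \<noteq> 0" by blast
  let ?I = "I - {p}"
  have "card J < card ?I" using insert p by simp
  then obtain c where c: "\<exists>i\<in>?I. c i \<noteq> 0"
   "\<forall>k\<in>J. (\<Sum>i\<in>?I. c i * (a i k - a i j / a p j * a p k)) = 0"
   using insert.hyps(3)[of ?I "%i k. a i k - a i j / a p j * a p k"] insert.prems by auto
  define d where "d = c (p := - (\<Sum>i\<in>?I. c i * (a i j / a p j)))"
  have d: "(\<Sum>i\<in>I. d i * a i k) = (\<Sum>i\<in>?I. c i * (a i k - a i j / a p j * a p k))" for k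
  proof -
   have "(\<Sum>i\<in>I. d i * a i k) = d p * a p k + (\<Sum>i\<in>?I. d i * a i k)"
    using p insert.prems by (simp add: sum.remove)
   also have "(\<Sum>i\<in>?I. d i * a i k) = (\<Sum>i\<in>?I. c i * a i k)"
    by (rule sum.cong) (auto simp: d_def)
   also have "d p * a p k = - (\<Sum>i\<in>?I. c i * (a i j / a p j) * a p k)"
    by (simp add: d_def sum_distrib_right)
   finally show ?thesis by (simp add: sum_subtractf algebra_simps)
  qed
  have "(\<Sum>i\<in>I. d i * a i k) = 0" if "k : insert j J" for k
   unfolding d using that c(2) p by auto
  moreover have "\<exists>i\<in>I. d i \<noteq> 0" using c(1) by (auto simp: d_def)
  ultimately show ?thesis by blast
 qed
qed

fun poly_at :: "('k::field, 'v, 'm) module_scheme => ('v => 'v) => 'k list => 'v => 'v" where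
 "poly_at V T [] v = \<zero>\<^bsub>V\<^esub>"
| "poly_at V T (a # cs) v = a \<odot>\<^bsub>V\<^esub> v \<oplus>\<^bsub>V\<^esub> T (poly_at V T cs v)"

lemma poly_at_lin: "vsp V ==> T : lin V V ==> poly_at V T cs : lin V V"
proof (induct cs)
 case (Cons a cs)
 then have "poly_at V T cs : lin V V" by blast
 then have "(%v. a \<odot>\<^bsub>V\<^esub> v \<oplus>\<^bsub>V\<^esub> T (poly_at V T cs v)) : lin V V"
  by (intro lin_add_rule[OF Cons(2)] lin_smult_rule[OF Cons(2)] lin_id lin_comp[OF Cons(3)])
 then show ?case by simp
next
 case Nil
 have "(%v. \<zero>\<^bsub>V\<^esub>) : lin V V" using Nil by (intro lin_zero_rule)
 then show ?case by simp
qed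

lemma poly_at_commute: "vsp V ==> T : lin V V ==> v : el V ==> poly_at V T cs (T v) = T (poly_at V T cs v)"
proof (induct cs)
 case (Cons a cs)
 note T = Cons(3) and v = Cons(4)
 have c: "poly_at V T cs v : el V" "T (poly_at V T cs v) : el V" "a \<odot>\<^bsub>V\<^esub> v : el V"
  using lin_closed[OF poly_at_lin[OF Cons(2) T] v] lin_closed[OF T] v Cons(2) by auto
 show ?case unfolding poly_at.simps
  by (simp only: Cons(1)[OF Cons(2-4)] lin_add[OF T c(3,2)] lin_smult[OF T v])
qed (simp add: lin_zero[of V V T])

lemma funpow_lin: "T : lin V V ==> (T ^^ n) : lin V V"
proof (induct n)
 case 0 show ?case using lin_id by (simp add: id_def)
next
 case (Suc n) then show ?case using lin_comp[of T V V "T ^^ n" V] by (simp add: comp_def)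
qed

lemma poly_at_functional:
 assumes V: "vsp V" and T: "T : lin V V" and v: "v : el V"
 shows "\<phi> : lin V ground ==> \<phi> (poly_at V T cs v) = (\<Sum>i<length cs. cs ! i * \<phi> ((T ^^ i) v))"
proof (induct cs arbitrary: \<phi>)
 case (Cons a cs)
 note c = lin_closed[OF poly_at_lin[OF V T] v] lin_closed[OF T]
 have "\<phi> (T (poly_at V T cs v)) = (\<Sum>i<length cs. cs ! i * \<phi> (T ((T ^^ i) v)))"
  using Cons(1)[OF lin_comp[OF Cons(2) T]] .
 moreover have "\<phi> (poly_at V T (a # cs) v) = a * \<phi> v + \<phi> (T (poly_at V T cs v))"
  using c v V lin_add[OF Cons(2)] lin_smult[OF Cons(2)] by simp
 ultimately show ?case by (simp add: sum.lessThan_Suc_shift del: sum.lessThan_Suc)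
qed (use V lin_zero[OF V vs_ground] in simp)

lemma annihilating_polynomial:
 assumes V: "fdvs V" and T: "T : lin V V"
 shows "\<exists>cs. (\<exists>a\<in>set cs. a \<noteq> 0) \<and> (\<forall>v\<in>el V. poly_at V T cs v = \<zero>\<^bsub>V\<^esub>)"
proof -
 have V': "vsp V" using V by blast
 obtain bs where bs: "dual_basis V bs" using dual_basis_exists[OF V] by blast
 let ?J = "set bs \<times> set bs" and ?I = "{..<Suc (card (set bs \<times> set bs))}"
 obtain c where c: "\<exists>i\<in>?I. c i \<noteq> 0" "\<forall>j\<in>?J. (\<Sum>i\<in>?I. c i * snd (snd j) ((T ^^ i) (fst (fst j)))) = 0"
  using homogeneous_system_solvable[of ?J ?I "%i j. snd (snd j) ((T ^^ i) (fst (fst j)))"] by auto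
 define cs where "cs = map c [0..<Suc (card (set bs \<times> set bs))]"
 have b: "fst b : el V" "snd b : lin V ground" if "b : set bs" for b using bs that by (auto simp: dual_basis_def)
 have 0: "v = \<zero>\<^bsub>V\<^esub>" if v: "v : el V" and "\<And>b. b : set bs ==> snd b v = 0" for v
 proof -
  have "vsum V (%b. snd b v \<odot>\<^bsub>V\<^esub> fst b) bs = vsum V (%b. \<zero>\<^bsub>V\<^esub>) bs"
   using that b V' by (intro vsum_cong) simp
  moreover have "vsum V (%b. \<zero>\<^bsub>V\<^esub>) bs = \<zero>\<^bsub>V\<^esub>" using V' by (induct bs) auto
  ultimately show ?thesis using bs v by (simp add: dual_basis_def)
 qed
 note P = poly_at_lin[OF V' T, of cs]
 have z: "poly_at V T cs (fst b) = \<zero>\<^bsub>V\<^esub>" if "b : set bs" for b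
 proof (rule 0)
  fix b' assume b': "b' : set bs"
  have "snd b' (poly_at V T cs (fst b)) = (\<Sum>i\<in>?I. c i * snd b' ((T ^^ i) (fst b)))"
   using poly_at_functional[OF V' T b(1)[OF that] b(2)[OF b'], of cs] by (simp add: cs_def nth_append)
  then show "snd b' (poly_at V T cs (fst b)) = 0" using c(2) that b' by fastforce
 qed (use lin_closed[OF P] b(1)[OF that] in blast)
 have "poly_at V T cs v = \<zero>\<^bsub>V\<^esub>" if v: "v : el V" for v
 proof -
  have "poly_at V T cs v = poly_at V T cs (vsum V (%b. snd b v \<odot>\<^bsub>V\<^esub> fst b) bs)"
   using bs v by (simp add: dual_basis_def)
  also have "... = vsum V (%b. \<zero>\<^bsub>V\<^esub>) bs"
   using b V' z by (subst vsum_lin[OF V' V' P]) (auto intro!: vsum_cong simp: lin_smult[OF P])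
  also have "... = \<zero>\<^bsub>V\<^esub>" using V' by (induct bs) auto
  finally show ?thesis .
 qed
 moreover have "\<exists>a\<in>set cs. a \<noteq> 0" using c(1) unfolding cs_def set_map set_upt by (auto simp: atLeast0LessThan)
 ultimately show ?thesis by blast
qed

text \<open>Division of an annihilating polynomial by its lowest nonzero term expresses \<open>T\<^sup>n\<close> through
 \<open>T\<^sup>n\<^sup>+\<^sup>1\<close>.\<close>

lemma fitting_step:
 assumes V: "vsp V" and T: "T : lin V V"
 shows "\<exists>a\<in>set cs. a \<noteq> 0 ==> \<forall>v\<in>el V. (T ^^ k) (poly_at V T cs v) = \<zero>\<^bsub>V\<^esub> ==>
  \<exists>n r. r : lin V V \<and> (\<forall>v\<in>el V. r (T v) = T (r v)) \<and> (\<forall>v\<in>el V. (T ^^ n) v = (T ^^ n) (T (r v)))"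
proof (induct cs arbitrary: k)
 case (Cons a cs)
 note c = lin_closed[OF poly_at_lin[OF V T]] lin_closed[OF T]
 note Tk = funpow_lin[OF T, of k]
 show ?case
 proof (cases "a = 0")
  case True
  then have "\<forall>v\<in>el V. (T ^^ Suc k) (poly_at V T cs v) = \<zero>\<^bsub>V\<^esub>"
   using Cons(3) c V by (simp add: funpow_swap1)
  then show ?thesis using Cons(1)[of "Suc k"] Cons(2) True by auto
 next
  case False
  define r where "r v = (- 1 / a) \<odot>\<^bsub>V\<^esub> poly_at V T cs v" for v
  have r: "r : lin V V" unfolding r_def using poly_at_lin[OF V T] by (intro lin_smult_rule V) simp
  have "r (T v) = T (r v)" if "v : el V" for v
   unfolding r_def using that c by (simp add: poly_at_commute[OF V T] lin_smult[OF T])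
  moreover have "(T ^^ k) v = (T ^^ k) (T (r v))" if v: "v : el V" for v
  proof -
   let ?w = "T (poly_at V T cs v)"
   have w: "?w : el V" using c v by blast
   have "(T ^^ k) v = (T ^^ k) ((1 / a) \<odot>\<^bsub>V\<^esub> (a \<odot>\<^bsub>V\<^esub> v \<oplus>\<^bsub>V\<^esub> ?w) \<oplus>\<^bsub>V\<^esub> (- 1 / a) \<odot>\<^bsub>V\<^esub> ?w)"
    using V v w False vs_neg_right[OF V, of "(1 / a) \<odot>\<^bsub>V\<^esub> ?w"]
    by (simp add: vs_smult_distr vs_smult_mult[symmetric] vs_add_assoc)
   also have "... = (1 / a) \<odot>\<^bsub>V\<^esub> (T ^^ k) (a \<odot>\<^bsub>V\<^esub> v \<oplus>\<^bsub>V\<^esub> ?w) \<oplus>\<^bsub>V\<^esub> (T ^^ k) ((- 1 / a) \<odot>\<^bsub>V\<^esub> ?w)"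
    using V v w by (simp add: lin_add[OF Tk] lin_smult[OF Tk])
   also have "... = (T ^^ k) (T (r v))"
    using Cons(3) v V w lin_closed[OF Tk] c unfolding r_def by (simp add: lin_smult[OF T])
   finally show ?thesis .
  qed
  ultimately show ?thesis using r by blast
 qed
qed simp

text \<open>\<open>R T\<^sup>n\<close> is the projection onto the stable image of \<open>T\<close>, with \<open>R\<close> inverting \<open>T\<^sup>n\<close> there.\<close>

lemma fitting:
 assumes V: "fdvs V" and T: "T : lin V V"
 obtains n R where "n > 0" "R : lin V V" "\<And>v. v : el V ==> R ((T ^^ n) v) = (T ^^ n) (R v)"
  "\<And>v. v : el V ==> R ((T ^^ n) ((T ^^ n) v)) = (T ^^ n) v"
proof -
 have V': "vsp V" using V by blast
 note Tc = lin_closed[OF T] and Tnc = lin_closed[OF funpow_lin[OF T]]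
 obtain cs where cs: "\<exists>a\<in>set cs. a \<noteq> 0" "\<forall>v\<in>el V. poly_at V T cs v = \<zero>\<^bsub>V\<^esub>"
  using annihilating_polynomial[OF V T] by blast
 then obtain m r where r: "r : lin V V" "\<forall>v\<in>el V. r (T v) = T (r v)"
   "\<forall>v\<in>el V. (T ^^ m) v = (T ^^ m) (T (r v))"
  using fitting_step[OF V' T cs(1), of 0] by auto
 note rc = lin_closed[OF r(1)] and rnc = lin_closed[OF funpow_lin[OF r(1)]]
 let ?n = "Suc m"
 have r_n: "r ((T ^^ k) v) = (T ^^ k) (r v)" if "v : el V" for k v
  using that by (induct k) (simp_all add: r(2) Tnc)
 have R_n: "(r ^^ j) ((T ^^ k) v) = (T ^^ k) ((r ^^ j) v)" if "v : el V" for j k v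
  using that by (induct j) (simp_all add: r_n rnc)
 have "(T ^^ ?n) v = (T ^^ ?n) ((T ^^ j) ((r ^^ j) v))" if v: "v : el V" for j v
 proof (induct j)
  case (Suc j)
  let ?w = "(r ^^ j) v"
  have "(T ^^ ?n) ((T ^^ Suc j) ((r ^^ Suc j) v)) = (T ^^ Suc j) ((T ^^ m) (T (r ?w)))"
   by (simp add: funpow_add[symmetric, THEN fun_cong, unfolded comp_def] funpow_swap1 add_ac del: funpow.simps)
    (simp add: funpow_swap1 funpow_add add.commute)
  also have "... = (T ^^ Suc j) ((T ^^ m) ?w)" using r(3) rnc[OF v] by simp
  also have "... = (T ^^ ?n) ((T ^^ j) ?w)"
   by (metis add.commute add_Suc comp_apply funpow_add)
  finally show ?case using Suc by simp
 qed simp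
 from this[of _ ?n] have "(r ^^ ?n) ((T ^^ ?n) ((T ^^ ?n) v)) = (T ^^ ?n) v" if "v : el V" for v
  using that R_n Tnc by metis
 then show thesis
  using that[of ?n "r ^^ ?n"] funpow_lin[OF r(1)] R_n by blast
qed

section \<open>Sweedler calculus\<close>

definition trilin :: "('k::field, 'u, 'm) module_scheme => ('k, 'v, 'n) module_scheme => ('k, 'w, 'l) module_scheme
  => ('u => 'v => 'w => 'k) => bool" where
 "trilin U V W F \<longleftrightarrow> (\<forall>v\<in>el V. \<forall>w\<in>el W. (%u. F u v w) : lin U ground)
   \<and> (\<forall>u\<in>el U. \<forall>w\<in>el W. (%v. F u v w) : lin V ground)
   \<and> (\<forall>u\<in>el U. \<forall>v\<in>el V. (%w. F u v w) : lin W ground)"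

abbreviation (input) csum where "csum A a \<equiv> tsum A A (comult A a)"

lemma trilin_sum:
 assumes "vsp U" "vsp V" "vsp W" "trilin U V W F"
 shows "bilin U (tensor V W) ground (%u t. tsum V W t (F u))"
  and "u : el U ==> bilin V W ground (F u)"
 using assms by (auto intro!: bilinI linear simp: trilin_def)

lemma sweedler2_push:
 assumes "vsp A" "vsp Z" "comult A a : el (tensor A A)" "L : lin Z ground"
  and "\<And>x y. x : el A ==> y : el A ==> F x y : el Z"
 shows "L (sweedler2 A Z F a) = csum A a (%x y. L (F x y))"
 unfolding sweedler2_def by (rule tlift_push[OF assms(1,1,2-5)])

context fd_hopf_algebra begin

sublocale ring A by (rule ring)

lemma vsA [simp, closed]: "vsp A" by (rule vectorspace)
lemma fdA [simp]: "fdvs A" using vectorspace fin_dim by blast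

lemma mult_rule1 [linear]: "f : lin U A ==> b : el A ==> (%x. f x \<otimes> b) : lin U A"
 and mult_rule2 [linear]: "f : lin U A ==> a : el A ==> (%x. a \<otimes> f x) : lin U A"
 using bilin_left[OF mult_bilin] bilin_right[OF mult_bilin] by blast+

lemma antipode_closed [simp, closed]: "a : el A ==> antipode A a : el A"
 by (rule lin_closed[OF antipode_lin])

lemma comult_closed [simp, closed]: "a : el A ==> comult A a : el (tensor A A)"
 by (rule lin_closed[OF comult_lin])

lemma antipode_rule [linear]: "f : lin U A ==> (%x. antipode A (f x)) : lin U A"
 by (rule lin_comp[OF antipode_lin])

lemma counit_rule [linear]: "f : lin U A ==> (%x. counit A (f x)) : lin U ground"
 by (rule lin_comp[OF counit_lin])

lemma comult_rule [linear]: "f : lin U A ==> (%x. comult A (f x)) : lin U (tensor A A)"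
 by (rule lin_comp[OF comult_lin])

lemma sum_coassoc:
 assumes a: "a : el A" and F: "trilin A A A F"
 shows "csum A a (%x y. csum A x (%u v. F u v y))
  = csum A a (%x y. csum A y (%u v. F x u v))"
proof -
 let ?T = "tensor A (tensor A A)"
 define L where "L t = tsum A (tensor A A) t (%a s. tsum A A s (F a))" for t
 note b = trilin_sum[OF vsA vsA vsA F]
 have L: "L : lin ?T ground" unfolding L_def using b(1) by (intro tsum_lin) auto
 have p: "L (pure A (tensor A A) x s) = tsum A A s (F x)" if "x : el A" "s : el (tensor A A)" for x s
  unfolding L_def using that b(1) by (subst tsum_pure) auto
 have p2: "L (pure A (tensor A A) x (pure A A y z)) = F x y z" if "x : el A" "y : el A" "z : el A" for x y z
  using that b(2) by (simp add: p tsum_pure)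
 have c: "sweedler2 A ?T (%a11 a12. pure A (tensor A A) a11 (pure A A a12 y)) x : el ?T"
  if "x : el A" "y : el A" for x y
  unfolding sweedler2_def using that
  by (intro lin_closed[OF tlift_lin[of A A]]) (auto intro!: bilinI linear)
 have "L (sweedler2 A ?T (%a1 a2. sweedler2 A ?T (%a11 a12. pure A (tensor A A) a11 (pure A A a12 a2)) a1) a)
   = csum A a (%x y. csum A x (%u v. F u v y))"
  using a L c by (simp add: sweedler2_push[of A ?T _ L] p2)
 moreover have "L (sweedler2 A ?T (%a1 a2. pure A (tensor A A) a1 (comult A a2)) a)
   = csum A a (%x y. csum A y (%u v. F x u v))"
  using a L by (simp add: sweedler2_push[of A ?T _ L] p)
 ultimately show ?thesis using coassoc[OF a] by simp
qed

lemma sum_counit_left: "a : el A ==> L : lin A ground ==> csum A a (%x y. counit A x * L y) = L a"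
 using sweedler2_push[of A A a L "%a1 a2. counit A a1 \<odot> a2"] counit_left[of a] by (simp add: lin_smult)

lemma sum_counit_right: "a : el A ==> L : lin A ground ==> csum A a (%x y. counit A y * L x) = L a"
 using sweedler2_push[of A A a L "%a1 a2. counit A a2 \<odot> a1"] counit_right[of a] by (simp add: lin_smult)

lemma sum_antipode_left: "a : el A ==> L : lin A ground ==>
  csum A a (%x y. L (antipode A x \<otimes> y)) = counit A a * L \<one>"
 using sweedler2_push[of A A a L "%a1 a2. antipode A a1 \<otimes> a2"] antipode_left[of a] by (simp add: lin_smult)

lemma sum_antipode_right: "a : el A ==> L : lin A ground ==>
  csum A a (%x y. L (x \<otimes> antipode A y)) = counit A a * L \<one>"
 using sweedler2_push[of A A a L "%a1 a2. a1 \<otimes> antipode A a2"] antipode_right[of a] by (simp add: lin_smult)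

lemma sum_comult_one: "bilin A A ground F ==> csum A \<one> F = F \<one> \<one>"
 by (simp add: comult_one tsum_pure)

lemma sum_comult_mult:
 assumes a: "a : el A" "b : el A" and F: "bilin A A ground F"
 shows "csum A (a \<otimes> b) F
  = csum A a (%a1 a2. csum A b (%b1 b2. F (a1 \<otimes> b1) (a2 \<otimes> b2)))"
proof -
 let ?T = "tensor A A" and ?L = "%t. tsum A A t F"
 have L: "?L : lin ?T ground" using F by (intro tsum_lin) auto
 have c: "sweedler2 A ?T (%b1 b2. pure A A (x \<otimes> b1) (y \<otimes> b2)) b : el ?T"
  if "x : el A" "y : el A" for x y
  unfolding sweedler2_def using that a
  by (intro lin_closed[OF tlift_lin[of A A]]) (auto intro!: bilinI linear)
 show ?thesis unfolding comult_mult[OF a]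
  using a L c F by (simp add: sweedler2_push[of A ?T _ ?L] tsum_pure)
qed

lemma sum_antipode_right_mid: "a : el A ==> p : el A ==> q : el A ==>
  csum A a (%x y. ev A \<phi> (p \<otimes> (x \<otimes> (antipode A y \<otimes> q)))) = counit A a * ev A \<phi> (p \<otimes> q)"
 using sum_antipode_right[of a "%z. ev A \<phi> (p \<otimes> (z \<otimes> q))"] by (simp add: linear m_assoc)

lemma sum_antipode_left_mid: "a : el A ==> p : el A ==> q : el A ==>
  csum A a (%x y. ev A \<phi> (p \<otimes> (antipode A x \<otimes> (y \<otimes> q)))) = counit A a * ev A \<phi> (p \<otimes> q)"
 using sum_antipode_left[of a "%z. ev A \<phi> (p \<otimes> (z \<otimes> q))"] by (simp add: linear m_assoc)

text \<open>Both sides are convolution inverse to the multiplication of \<open>A\<close>; the sum is expanded with both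
 inverses present and collapsed in two ways.\<close>

lemma antipode_mult:
 assumes a: "a : el A" and b: "b : el A"
 shows "antipode A (a \<otimes> b) = antipode A b \<otimes> antipode A a"
proof (rule ev_eqI[OF fdA])
 fix \<phi>
 let ?f = "ev A \<phi>" and ?S = "antipode A"
 let ?D = "%x F. csum A x F"
 note [simp] = linear trilin_def bilin_def lin_id
 have e: "?D c (%c1 c2. ?D d (%d1 d2. ?f (x \<otimes> ((c1 \<otimes> d1) \<otimes> (?S d2 \<otimes> ?S c2)))))
   = counit A c * (counit A d * ?f x)" if x: "c : el A" "d : el A" "x : el A" for c d x
 proof -
  have "?D c (%c1 c2. ?D d (%d1 d2. ?f (x \<otimes> ((c1 \<otimes> d1) \<otimes> (?S d2 \<otimes> ?S c2)))))
   = ?D c (%c1 c2. ?D d (%d1 d2. ?f ((x \<otimes> c1) \<otimes> (d1 \<otimes> (?S d2 \<otimes> ?S c2)))))"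
   using x by (simp add: m_assoc)
  also have "... = ?D c (%c1 c2. counit A d * ?f ((x \<otimes> c1) \<otimes> ?S c2))"
   using x by (simp add: sum_antipode_right_mid)
  also have "... = counit A d * ?D c (%c1 c2. ?f (x \<otimes> (c1 \<otimes> (?S c2 \<otimes> \<one>))))"
   using x by (simp add: tsum_times m_assoc)
  also have "... = counit A c * (counit A d * ?f x)"
   using x by (subst sum_antipode_right_mid) (simp_all add: mult_ac)
  finally show ?thesis .
 qed
 have "?f (?S (a \<otimes> b)) = ?D a (%a1 a2. counit A a2 * ?f (?S (a1 \<otimes> b)))"
  by (simp add: sum_counit_right a b)
 also have "... = ?D a (%a1 a2. ?D b (%b1 b2. counit A b2 * (counit A a2 * ?f (?S (a1 \<otimes> b1)))))"
  by (simp add: sum_counit_right a b)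
 also have "... = ?D a (%a1 a2. ?D b (%b1 b2. ?D a2 (%c1 c2. ?D b2 (%d1 d2.
    ?f (?S (a1 \<otimes> b1) \<otimes> ((c1 \<otimes> d1) \<otimes> (?S d2 \<otimes> ?S c2)))))))"
  by (simp add: e a b mult_ac)
 also have "... = ?D a (%a1 a2. ?D a2 (%c1 c2. ?D b (%b1 b2. ?D b2 (%d1 d2.
    ?f (?S (a1 \<otimes> b1) \<otimes> ((c1 \<otimes> d1) \<otimes> (?S d2 \<otimes> ?S c2)))))))"
  by (rule tsum_cong[OF HOL.refl], rule tsum_swap)
 also have "... = ?D a (%a1 a2. ?D a1 (%c1 c2. ?D b (%b1 b2. ?D b2 (%d1 d2.
    ?f (?S (c1 \<otimes> b1) \<otimes> ((c2 \<otimes> d1) \<otimes> (?S d2 \<otimes> ?S a2)))))))"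
  by (rule sum_coassoc[symmetric]) (simp_all add: a b)
 also have "... = ?D a (%a1 a2. ?D a1 (%c1 c2. ?D b (%b1 b2. ?D b1 (%d1 d2.
    ?f (?S (c1 \<otimes> d1) \<otimes> ((c2 \<otimes> d2) \<otimes> (?S b2 \<otimes> ?S a2)))))))"
  by (rule tsum_cong, rule HOL.refl, rule tsum_cong, rule HOL.refl, rule sum_coassoc[symmetric]) (simp_all add: a b)
 also have "... = ?D a (%a1 a2. ?D b (%b1 b2. ?D a1 (%c1 c2. ?D b1 (%d1 d2.
    ?f (?S (c1 \<otimes> d1) \<otimes> ((c2 \<otimes> d2) \<otimes> (?S b2 \<otimes> ?S a2)))))))"
  by (rule tsum_cong[OF HOL.refl], rule tsum_swap)
 also have "... = ?D a (%a1 a2. ?D b (%b1 b2. ?D (a1 \<otimes> b1) (%x y. ?f (\<one> \<otimes> (?S x \<otimes> (y \<otimes> (?S b2 \<otimes> ?S a2)))))))"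
  by (simp add: sum_comult_mult a b m_assoc)
 also have "... = ?D a (%a1 a2. ?D b (%b1 b2. counit A (a1 \<otimes> b1) * ?f (\<one> \<otimes> (?S b2 \<otimes> ?S a2))))"
  by (simp only: sum_antipode_left_mid a b m_closed antipode_closed one_closed cong: tsum_cong)
 also have "... = ?D a (%a1 a2. ?D b (%b1 b2. counit A b1 * (counit A a1 * ?f (?S b2 \<otimes> ?S a2))))"
  by (simp add: counit_mult mult_ac)
 also have "... = ?D a (%a1 a2. counit A a1 * ?f (?S b \<otimes> ?S a2))"
  by (simp add: sum_counit_left a b)
 also have "... = ?f (?S b \<otimes> ?S a)"
  by (simp add: sum_counit_left a b)
 finally show "?f (?S (a \<otimes> b)) = ?f (?S b \<otimes> ?S a)" .
qed (use a b in simp_all)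

lemma antipode_one: "antipode A \<one> = \<one>"
proof (rule ev_eqI[OF fdA])
 fix \<phi>
 note [simp] = linear bilin_def lin_id
 have "ev A \<phi> (antipode A \<one>) = csum A \<one> (%x y. ev A \<phi> (antipode A x \<otimes> y))"
  by (subst sum_comult_one) simp_all
 also have "... = ev A \<phi> \<one>" by (subst sum_antipode_left) (simp_all add: counit_one)
 finally show "ev A \<phi> (antipode A \<one>) = ev A \<phi> \<one>" .
qed simp_all

text \<open>If an algebra map \<open>p\<close> fixes \<open>f\<close>, then it also fixes the convolution inverse \<open>g\<close> of \<open>f\<close>, since
 \<open>p \<circ> g\<close> is inverse to \<open>p \<circ> f = f\<close>. The multiplication \<open>m\<close> is a parameter because the opposite one is
 needed as well.\<close>

lemma convolution_inverse_fixed: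
 assumes m: "bilin A A A m" "\<And>x y z. x : el A ==> y : el A ==> z : el A ==> m (m x y) z = m x (m y z)"
   "\<And>x. x : el A ==> m \<one> x = x" "\<And>x. x : el A ==> m x \<one> = x"
  and p: "p : lin A A" "\<And>x y. x : el A ==> y : el A ==> p (m x y) = m (p x) (p y)" "p \<one> = \<one>"
  and f: "f : lin A A" and g: "g : lin A A"
  and fg: "\<And>a L. a : el A ==> L : lin A ground ==> csum A a (%x y. L (m (f x) (g y))) = counit A a * L \<one>"
  and gf: "\<And>a L. a : el A ==> L : lin A ground ==> csum A a (%x y. L (m (g x) (f y))) = counit A a * L \<one>"
  and fix_f: "\<And>a. a : el A ==> p (f a) = f a" and a: "a : el A"
 shows "p (g a) = g a"
proof (rule ev_eqI[OF fdA])
 fix \<phi>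
 let ?f = "ev A \<phi>" and ?D = "%x F. csum A x F"
 note mr = bilin_left[OF m(1)] bilin_right[OF m(1)] bilin_closed[OF m(1)]
 note [simp] = linear trilin_def bilin_def lin_id mr lin_comp[OF p(1)] lin_comp[OF f] lin_comp[OF g]
   f g p(1) lin_closed[OF f] lin_closed[OF g] lin_closed[OF p(1)]
 have "?f (p (g a)) = ?D a (%x y. counit A y * ?f (p (g x)))"
  by (simp add: sum_counit_right a)
 also have "... = ?D a (%x y. ?D y (%u v. ?f (m (p (g x)) (m (f u) (g v)))))"
  using fg[of _ "%z. ?f (m (p (g _)) z)"] a by (simp add: m)
 also have "... = ?D a (%x y. ?D x (%u v. ?f (m (p (g u)) (m (f v) (g y)))))"
  by (rule sum_coassoc[symmetric]) (simp_all add: a)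
 also have "... = ?D a (%x y. ?D x (%u v. ?f (m (p (m (g u) (f v))) (g y))))"
  by (simp add: m(2) p(2) fix_f)
 also have "... = ?D a (%x y. counit A x * ?f (g y))"
  using gf[of _ "%z. ?f (m (p z) (g _))"] a by (simp add: p(3) m(3))
 also have "... = ?f (g a)" by (simp add: sum_counit_left a)
 finally show "?f (p (g a)) = ?f (g a)" .
qed (use a lin_closed[OF p(1)] lin_closed[OF g] in auto)

text \<open>The antipode of a finite-dimensional Hopf algebra is bijective. Let \<open>T = S\<^sup>2\<close>, an algebra
 endomorphism. The Fitting projection \<open>p\<close> onto the stable image of \<open>T\<close> is an algebra map that fixes
 \<open>T\<^sup>n\<close>. If \<open>p\<close> fixes \<open>T\<^sup>k\<^sup>+\<^sup>1\<close>, it fixes its inverse \<open>S T\<^sup>k\<close> for the opposite convolution, and then the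
 convolution inverse \<open>T\<^sup>k\<close> of that. Descending to \<open>k = 0\<close> gives \<open>p = id\<close>, so \<open>T\<^sup>n\<close> is
 invertible.\<close>

theorem antipode_bij: "bij_betw (antipode A) (el A) (el A)"
proof -
 let ?S = "antipode A"
 define T where "T a = ?S (?S a)" for a
 have T: "T : lin A A" unfolding T_def by (intro linear)
 obtain n R where n: "n > 0" and R: "R : lin A A" "\<And>v. v : el A ==> R ((T ^^ n) v) = (T ^^ n) (R v)"
  "\<And>v. v : el A ==> R ((T ^^ n) ((T ^^ n) v)) = (T ^^ n) v"
  using fitting[OF fdA T] by blast
 note Tl = funpow_lin[OF T] and Tc = lin_closed[OF funpow_lin[OF T]] and Rc = lin_closed[OF R(1)]
 have T1: "(T ^^ k) \<one> = \<one>" for k by (induct k) (simp_all add: T_def antipode_one)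
 have Tm: "(T ^^ k) (x \<otimes> y) = (T ^^ k) x \<otimes> (T ^^ k) y" if "x : el A" "y : el A" for k x y
  using that Tc by (induct k) (simp_all add: T_def antipode_mult)
 define p where "p a = R ((T ^^ n) a)" for a
 have p: "p : lin A A" unfolding p_def by (intro lin_comp[OF R(1)] Tl)
 have p1: "p \<one> = \<one>" using R(3)[of \<one>] by (simp add: p_def T1)
 have pm: "p (x \<otimes> y) = p x \<otimes> p y" if "x : el A" "y : el A" for x y
 proof -
  let ?t = "T ^^ n"
  have "p x \<otimes> p y = ?t (R x \<otimes> R y)" using that Rc by (simp add: p_def R(2) Tm)
  also have "... = R (?t (?t (R x \<otimes> R y)))" using that Rc R(3) by simp
  also have "... = R (?t (?t (R x)) \<otimes> ?t (?t (R y)))" using that Rc Tc by (simp add: Tm)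
  also have "... = R (?t x \<otimes> ?t y)" using that Rc Tc R(2) R(3) by (metis)
  also have "... = p (x \<otimes> y)" using that by (simp add: p_def Tm)
  finally show ?thesis by simp
 qed
 have pT: "p ((T ^^ n) a) = (T ^^ n) a" if "a : el A" for a using that R(3) by (simp add: p_def)
 have TS: "(T ^^ k) (?S a) = ?S ((T ^^ k) a)" for k a by (induct k) (simp_all add: T_def)
 have "\<forall>a\<in>el A. p ((T ^^ k) a) = (T ^^ k) a" if "k \<le> n" for k
  using that
 proof (induct k rule: inc_induct)
  case base show ?case using pT by blast
 next
  case (step k)
  let ?T = "T ^^ k"
  have op: "bilin A A A (%x y. y \<otimes> x)" by (intro bilinI linear)
  have lin1: "(%x. L (?T x)) : lin A ground" if "L : lin A ground" for L
   by (rule lin_comp[OF that Tl])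
  have lin2: "(%x. L (?S (?T x))) : lin A ground" if "L : lin A ground" for L
   by (rule lin_comp[OF that]) (intro linear Tl)
  have ST: "(%a. ?S (?T a)) : lin A A" by (intro linear Tl)
  have odd: "p (?S (?T a)) = ?S (?T a)" if "a : el A" for a
  proof (rule convolution_inverse_fixed[OF op _ _ _ p _ p1 _ ST, of "%a. T (?T a)"])
   fix a L assume a: "a : el A" and L: "L : lin A ground"
   show "csum A a (%x y. L (?S (?T y) \<otimes> T (?T x))) = counit A a * L \<one>"
    using sum_antipode_left[OF a lin2[OF L]] Tc by (simp add: Tm antipode_mult T1 antipode_one T_def[of "?T _"] TS)
   show "csum A a (%x y. L (T (?T y) \<otimes> ?S (?T x))) = counit A a * L \<one>"
    using sum_antipode_right[OF a lin2[OF L]] Tc by (simp add: Tm antipode_mult T1 antipode_one T_def[of "?T _"] TS)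
  next
   show "(%a. T (?T a)) : lin A A" by (rule lin_comp[OF T Tl])
   show "p (T (?T a)) = T (?T a)" if "a : el A" for a using step that by simp
  qed (use that pm in \<open>simp_all add: m_assoc\<close>)
  have "p (?T a) = ?T a" if "a : el A" for a
  proof (rule convolution_inverse_fixed[OF mult_bilin _ _ _ p _ p1 ST Tl])
   fix a L assume a: "a : el A" and L: "L : lin A ground"
   show "csum A a (%x y. L (?S (?T x) \<otimes> ?T y)) = counit A a * L \<one>"
    using sum_antipode_left[OF a lin1[OF L]] Tc by (simp add: Tm T1 TS)
   show "csum A a (%x y. L (?T x \<otimes> ?S (?T y))) = counit A a * L \<one>"
    using sum_antipode_right[OF a lin1[OF L]] Tc by (simp add: Tm T1 TS)
  qed (use that pm odd in \<open>simp_all add: m_assoc\<close>)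
  then show ?case by blast
 qed
 from this[of 0] have pid: "p a = a" if "a : el A" for a using that by simp
 obtain m where m: "n = Suc m" using n by (cases n) auto
 show ?thesis
  unfolding bij_betw_def
 proof
  show "inj_on ?S (el A)"
  proof (rule inj_onI)
   fix a b assume ab: "a : el A" "b : el A" "?S a = ?S b"
   then have "T a = T b" by (simp add: T_def)
   then have "(T ^^ n) a = (T ^^ n) b" by (simp add: m funpow_swap1)
   then show "a = b" using pid ab p_def by metis
  qed
  show "?S ` el A = el A"
  proof
   show "?S ` el A \<subseteq> el A" by auto
   show "el A \<subseteq> ?S ` el A"
   proof
    fix a assume a: "a : el A"
    then have "a = ?S (?S ((T ^^ m) (R a)))" using pid[OF a] R(2)[OF a] by (simp add: p_def m T_def)
    then show "a : ?S ` el A" using a Rc Tc by (metis antipode_closed image_eqI)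
   qed
  qed
 qed
qed

lemma antipode_inv_closed [simp, closed]: "a : el A ==> antipode_inv A a : el A"
 unfolding antipode_inv_def using antipode_bij by (metis bij_betw_def inv_into_into)

lemma antipode_antipode_inv: "a : el A ==> antipode A (antipode_inv A a) = a"
 unfolding antipode_inv_def using antipode_bij by (simp add: bij_betw_inv_into_right)

lemma antipode_eqD: "antipode A a = antipode A b ==> a : el A ==> b : el A ==> a = b"
 using antipode_bij by (auto simp: bij_betw_def inj_on_def)

lemma antipode_inv_lin: "antipode_inv A : lin A A"
 by (rule linI; (rule antipode_eqD)?)
  (simp_all add: antipode_antipode_inv lin_add[OF antipode_lin] lin_smult[OF antipode_lin])

lemma antipode_inv_rule [linear]: "f : lin U A ==> (%x. antipode_inv A (f x)) : lin U A"
 by (rule lin_comp[OF antipode_inv_lin])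

text \<open>Sums such as \<open>\<Sum> S\<inverse>(a\<^sub>(\<^sub>2\<^sub>)) a\<^sub>(\<^sub>1\<^sub>) = \<epsilon>(a) 1\<close>, obtained by applying the inverse of the antipode.\<close>

text \<open>The antipode is an injective anti-homomorphism, and its image of the sum is known.\<close>

lemma sum_antipode_inv_left:
 assumes a: "a : el A" and L: "L : lin A ground"
 shows "csum A a (%x y. L (antipode_inv A y \<otimes> x)) = counit A a * L \<one>"
proof -
 have "antipode_inv A (antipode A x \<otimes> y) = antipode_inv A y \<otimes> x" if "x : el A" "y : el A" for x y
  by (rule antipode_eqD) (use that in \<open>simp_all add: antipode_antipode_inv antipode_mult\<close>)
 moreover have "antipode_inv A \<one> = \<one>" by (rule antipode_eqD) (simp_all add: antipode_antipode_inv antipode_one)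
 ultimately show ?thesis using sum_antipode_left[OF a lin_comp[OF L antipode_inv_lin]] by simp
qed

lemma sum_antipode_inv_right:
 assumes a: "a : el A" and L: "L : lin A ground"
 shows "csum A a (%x y. L (y \<otimes> antipode_inv A x)) = counit A a * L \<one>"
proof -
 have "antipode_inv A (x \<otimes> antipode A y) = y \<otimes> antipode_inv A x" if "x : el A" "y : el A" for x y
  by (rule antipode_eqD) (use that in \<open>simp_all add: antipode_antipode_inv antipode_mult\<close>)
 moreover have "antipode_inv A \<one> = \<one>" by (rule antipode_eqD) (simp_all add: antipode_antipode_inv antipode_one)
 ultimately show ?thesis using sum_antipode_right[OF a lin_comp[OF L antipode_inv_lin]] by simp
qed

end

section \<open>Modules and their tensor products\<close>

abbreviation (input) sp where "sp \<equiv> space"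
abbreviation (input) ut where "ut X Y \<equiv> utensor (space X) (space Y)"
abbreviation (input) up where "up X Y \<equiv> upure (space X) (space Y)"

lemma
 assumes "fd_lmodule A X"
 shows lmod_fdvs: "fdvs (sp X)"
  and lmod_vsp: "vsp (sp X)"
  and act_bilin: "bilin A (sp X) (sp X) (act X)"
  and act_closed: "a : el A ==> v : el (sp X) ==> act X a v : el (sp X)"
  and act_lin: "a : el A ==> act X a : lin (sp X) (sp X)"
  and act_one: "v : el (sp X) ==> act X \<one>\<^bsub>A\<^esub> v = v"
  and act_mult: "a : el A ==> b : el A ==> v : el (sp X) ==>
   act X (a \<otimes>\<^bsub>A\<^esub> b) v = act X a (act X b v)"
  and act_rule1: "f : lin U A ==> v : el (sp X) ==> (%x. act X (f x) v) : lin U (sp X)"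
  and act_rule2: "g : lin U (sp X) ==> a : el A ==> (%x. act X a (g x)) : lin U (sp X)"
 using assms bilin_left[of A "space X" "space X" "act X"] bilin_right[of A "space X" "space X" "act X"]
   bilin_lin2[of A "space X" "space X" "act X"]
 unfolding fd_lmodule_def by (auto simp: PiE_def Pi_def)

lemma fd_lmodule_cong: "space X = space X' ==> act X = act X' ==> fd_lmodule A X \<longleftrightarrow> fd_lmodule A X'"
 unfolding fd_lmodule_def by simp

lemma module_mapD: "module_map A X Y f ==> a : el A ==> v : el (sp X) ==> f (act X a v) = act Y a (f v)"
 unfolding module_map_def by simp

lemma lmod_tensor_sel [simp]: "space (lmod_tensor A X Y) = ut X Y"
 by (simp add: lmod_tensor_def Let_def)

context fd_hopf_algebra begin

lemmas H_mod [simp] = lmod_fdvs[where A = A] lmod_vsp[where A = A] act_closed[where A = A]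
lemmas H_act [linear] = act_rule1[where A = A] act_rule2[where A = A]

context
 fixes X :: "('k, 'a, 'u, 'l) lmod_scheme" and Y :: "('k, 'a, 'u, 'l) lmod_scheme"
 assumes X: "fd_lmodule A X" and Y: "fd_lmodule A Y"
begin

lemma pair_bilin: "a : el A ==> b : el A ==> bilin (sp X) (sp Y) (ut X Y)
  (%v w. up X Y (act X a v) (act Y b w))"
 using X Y by (intro bilinI) (simp_all add: linear)

lemma pair_act_bilin: "t : el (ut X Y) ==> bilin A A (ut X Y)
  (%a1 a2. ulift (ut X Y) (%v w. up X Y (act X a1 v) (act Y a2 w)) t)"
 using X Y by (intro bilinI ulift_rule pair_bilin) (auto intro!: linear)

lemma tensor_act_eq: "a : el A ==> t : el (ut X Y) ==> act (lmod_tensor A X Y) a t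
  = sweedler2 A (ut X Y) (%a1 a2.
    ulift (ut X Y) (%v w. up X Y (act X a1 v) (act Y a2 w)) t) a"
 by (simp add: lmod_tensor_def Let_def)

lemma tensor_act_closed [simp, closed]:
 assumes "a : el A" "t : el (ut X Y)"
 shows "act (lmod_tensor A X Y) a t : el (ut X Y)"
 unfolding tensor_act_eq[OF assms] sweedler2_def using assms X Y
 by (intro lin_closed[OF tlift_lin[OF _ _ _ pair_act_bilin]]) auto

lemma tensor_act_push:
 assumes a: "a : el A" and t: "t : el (ut X Y)"
  and L: "L : lin (ut X Y) ground"
 shows "L (act (lmod_tensor A X Y) a t) = csum A a
   (%a1 a2. L (ulift (ut X Y) (%v w. up X Y (act X a1 v) (act Y a2 w)) t))"
 unfolding tensor_act_eq[OF a t]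
 by (rule sweedler2_push) (use a L X Y bilin_closed[OF pair_act_bilin[OF t]] in auto)

lemma tensor_act_bilin: "bilin A (ut X Y) (ut X Y) (act (lmod_tensor A X Y))"
proof (rule bilinI)
 let ?T = "ut X Y"
 fix a assume a: "a : el A"
 have "(%t. sweedler2 A ?T (%a1 a2. ulift ?T (%v w. up X Y (act X a1 v) (act Y a2 w)) t) a) : lin ?T ?T"
  unfolding sweedler2_def tlift_vsum case_prod_unfold
 proof (rule lin_vsum)
  fix i assume "i : set (comult A a)"
  then have "fst i : el A" "snd i : el A"
   using tensor_carrier_lists[OF vsA vsA comult_closed[OF a]] by auto
  then show "(%t. ulift ?T (%v w. up X Y (act X (fst i) v) (act Y (snd i) w)) t) : lin ?T ?T"
   using X Y by (intro ulift_lin pair_bilin) auto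
 qed (use X Y in simp)
 then show "(%t. act (lmod_tensor A X Y) a t) : lin ?T ?T"
  using a X Y by (subst lin_cong) (auto simp: tensor_act_eq)
next
 let ?T = "ut X Y"
 fix t assume t: "t : el ?T"
 have "(%a. sweedler2 A ?T (%a1 a2. ulift ?T (%v w. up X Y (act X a1 v) (act Y a2 w)) t) a) : lin A ?T"
  unfolding sweedler2_def using X Y by (intro lin_comp[OF tlift_lin[OF _ _ _ pair_act_bilin[OF t]] comult_lin]) auto
 then show "(%a. act (lmod_tensor A X Y) a t) : lin A ?T"
  using t X Y by (subst lin_cong) (auto simp: tensor_act_eq)
qed

lemma tensor_act_rule1 [linear]: "f : lin U A ==> t : el (ut X Y) ==> (%x. act (lmod_tensor A X Y) (f x) t) : lin U (ut X Y)"
 and tensor_act_rule2 [linear]: "g : lin U (ut X Y) ==> a : el A ==> (%x. act (lmod_tensor A X Y) a (g x)) : lin U (ut X Y)"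
 by (auto intro: bilin_left[OF tensor_act_bilin] bilin_right[OF tensor_act_bilin])

lemma tensor_act_pure:
 assumes "a : el A" "v : el (sp X)" "w : el (sp Y)"
  and "L : lin (ut X Y) ground"
 shows "L (act (lmod_tensor A X Y) a (up X Y v w)) = csum A a
   (%a1 a2. L (up X Y (act X a1 v) (act Y a2 w)))"
 using assms X Y by (simp add: tensor_act_push pair_bilin ulift_upure)

lemma fd_lmodule_tensor: "fd_lmodule A (lmod_tensor A X Y)"
 unfolding fd_lmodule_def lmod_tensor_sel
proof (intro conjI ballI)
 let ?T = "ut X Y" and ?XY = "lmod_tensor A X Y"
 note [simp] = linear bilin_def X Y
 show "vsp ?T" "vectorspace.fin_dim class_ring ?T" using fdvs_utensor[of "space X" "space Y"] X Y by auto
 show "act ?XY : el A \<rightarrow>\<^sub>E el ?T \<rightarrow>\<^sub>E el ?T"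
  using tensor_act_closed by (auto simp: lmod_tensor_def Let_def PiE_def Pi_def extensional_def)
 show "bilin A ?T ?T (act ?XY)" by (rule tensor_act_bilin)
 note r2 = bilin_lin2[OF tensor_act_bilin]
 show "act ?XY \<one> t = t" if "t : el ?T" for t
 proof (rule utensor_ext[OF _ _ _ r2 lin_id _ that])
  fix v w assume vw: "v : el (sp X)" "w : el (sp Y)"
  show "act ?XY \<one> (up X Y v w) = up X Y v w"
   by (rule ev_eqI[of ?T]) (use vw X Y in \<open>simp_all add: tensor_act_pure sum_comult_one act_one[OF X] act_one[OF Y]\<close>)
 qed simp_all
 show "act ?XY (a \<otimes> b) t = act ?XY a (act ?XY b t)" if ab: "a : el A" "b : el A" and t: "t : el ?T" for a b t
 proof (rule utensor_ext[OF _ _ _ r2 lin_comp[OF r2 r2] _ t])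
  fix v w assume vw: "v : el (sp X)" "w : el (sp Y)"
  show "act ?XY (a \<otimes> b) (up X Y v w) = act ?XY a (act ?XY b (up X Y v w))"
  proof (rule ev_eqI[of ?T])
   fix \<phi>
   have "(%t. ev ?T \<phi> (act ?XY a t)) : lin ?T ground" using ab by simp
   note push = tensor_act_pure[OF ab(2) vw this]
   show "ev ?T \<phi> (act ?XY (a \<otimes> b) (up X Y v w)) = ev ?T \<phi> (act ?XY a (act ?XY b (up X Y v w)))"
    using vw ab by (simp add: push tensor_act_pure sum_comult_mult act_mult[OF X] act_mult[OF Y]) (rule tsum_swap)
  qed (use vw ab in simp_all)
 qed (use ab in simp_all)
qed

end

lemma lmod_unit_sel [simp]: "space (lmod_unit A) = uscalars"
 "a : el A ==> act (lmod_unit A) a (Scalar c) = Scalar (counit A a * c)"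
 by (simp_all add: lmod_unit_def)

lemma fd_lmodule_unit: "fd_lmodule A (lmod_unit A :: ('k, 'a, 'u) lmod)"
 unfolding fd_lmodule_def lmod_unit_sel
proof (intro conjI ballI)
 show "act (lmod_unit A :: ('k, 'a, 'u) lmod) : el A \<rightarrow>\<^sub>E el uscalars \<rightarrow>\<^sub>E el uscalars"
  by (auto simp: lmod_unit_def PiE_def Pi_def extensional_def)
 show "bilin A uscalars uscalars (act (lmod_unit A :: ('k, 'a, 'u) lmod))"
  by (intro bilinI linI) (auto simp: counit_mult lin_add[OF counit_lin] lin_smult[OF counit_lin] algebra_simps)
qed (auto simp: counit_one counit_mult)

lemma module_map_ten:
 assumes X: "fd_lmodule A X" "fd_lmodule A X'" and Y: "fd_lmodule A Y" "fd_lmodule A Y'"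
  and f: "f : lin (sp X) (sp Y)" "module_map A X Y f" and g: "g : lin (sp X') (sp Y')" "module_map A X' Y' g"
 shows "module_map A (lmod_tensor A X X') (lmod_tensor A Y Y') (tmap (sp X) (sp X') (sp Y) (sp Y') f g)"
 unfolding module_map_def lmod_tensor_sel
proof (intro ballI)
 let ?T = "ut X X'" and ?T' = "ut Y Y'"
 let ?h = "tmap (sp X) (sp X') (sp Y) (sp Y') f g"
 fix a t assume a: "a : el A" and t: "t : el ?T"
 note [simp] = linear bilin_def X Y
 have h: "?h : lin ?T ?T'" using f g by simp
 show "?h (act (lmod_tensor A X X') a t) = act (lmod_tensor A Y Y') a (?h t)"
 proof (rule utensor_ext[OF _ _ _ lin_comp[OF h bilin_lin2[OF tensor_act_bilin]] lin_comp[OF bilin_lin2[OF tensor_act_bilin] h] _ t])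
  fix v w assume vw: "v : el (sp X)" "w : el (sp X')"
  note fg = lin_closed[OF f(1) vw(1)] lin_closed[OF g(1) vw(2)]
  show "?h (act (lmod_tensor A X X') a (up X X' v w)) = act (lmod_tensor A Y Y') a (?h (up X X' v w))"
   by (rule ev_eqI[of ?T'])
    (use vw a f g fg lin_closed[OF h] in \<open>simp_all add: tensor_act_pure[where L = "%x. ev ?T' _ (?h x)"] lin_comp[OF ev_lin h]
     tensor_act_pure module_mapD[OF f(2)] module_mapD[OF g(2)]\<close>)
 qed (use a in simp_all)
qed

lemma module_map_assoc:
 assumes X: "fd_lmodule A X" "fd_lmodule A Y" "fd_lmodule A Z"
 shows "module_map A (lmod_tensor A (lmod_tensor A X Y) Z) (lmod_tensor A X (lmod_tensor A Y Z)) (amap (sp X) (sp Y) (sp Z))"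
proof -
 let ?XY = "lmod_tensor A X Y" and ?YZ = "lmod_tensor A Y Z"
 let ?T = "utensor (ut X Y) (sp Z)" and ?T' = "utensor (sp X) (ut Y Z)"
 let ?h = "amap (sp X) (sp Y) (sp Z)"
 note [simp] = linear bilin_def trilin_def X
 note XY = fd_lmodule_tensor[OF X(1,2)] and YZ = fd_lmodule_tensor[OF X(2,3)]
 note b1 = tensor_act_bilin[OF XY X(3)] and b2 = tensor_act_bilin[OF X(1) YZ]
 note p1 = tensor_act_pure[OF XY X(3)] and p2 = tensor_act_pure[OF X(1) YZ]
 have h: "?h : lin ?T ?T'" by simp
 show ?thesis
  unfolding module_map_def lmod_tensor_sel lmod_tensor_sel
 proof (intro ballI)
  fix a t assume a: "a : el A" and t: "t : el ?T"
  show "?h (act (lmod_tensor A ?XY Z) a t) = act (lmod_tensor A X ?YZ) a (?h t)"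
  proof (rule utensor_ext3[OF _ _ _ _ lin_comp[OF h] lin_comp[OF _ h] _ t])
   fix u v w assume uvw: "u : el (sp X)" "v : el (sp Y)" "w : el (sp Z)"
   show "?h (act (lmod_tensor A ?XY Z) a (upure (ut X Y) (sp Z) (up X Y u v) w))
    = act (lmod_tensor A X ?YZ) a (?h (upure (ut X Y) (sp Z) (up X Y u v) w))"
   proof (rule ev_eqI[of ?T'])
    fix \<phi>
    let ?e = "ev ?T' \<phi>"
    have "?e (?h (act (lmod_tensor A ?XY Z) a (upure (ut X Y) (sp Z) (up X Y u v) w)))
     = csum A a (%a1 a2. ?e (?h (upure (ut X Y) (sp Z) (act ?XY a1 (up X Y u v)) (act Z a2 w))))"
     using p1[of a "up X Y u v" w "%x. ?e (?h x)"] a uvw lin_comp[OF ev_lin h] by simp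
    also have "... = csum A a (%a1 a2. csum A a1 (%b1 b2.
       ?e (?h (upure (ut X Y) (sp Z) (up X Y (act X b1 u) (act Y b2 v)) (act Z a2 w)))))"
     using tensor_act_pure[OF X(1,2) _ uvw(1,2), of _ "%x. ?e (?h (upure (ut X Y) (sp Z) x (act Z _ w)))"] a uvw
     by (simp add: lin_comp[OF lin_comp[OF ev_lin h]])
    also have "... = csum A a (%a1 a2. csum A a1 (%b1 b2.
       ?e (upure (sp X) (ut Y Z) (act X b1 u) (up Y Z (act Y b2 v) (act Z a2 w)))))"
     using a uvw by simp
    also have "... = csum A a (%a1 a2. csum A a2 (%b1 b2.
       ?e (upure (sp X) (ut Y Z) (act X a1 u) (up Y Z (act Y b1 v) (act Z b2 w)))))"
     by (rule sum_coassoc[OF a]) (use uvw in simp)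
    also have "... = csum A a (%a1 a2.
       ?e (upure (sp X) (ut Y Z) (act X a1 u) (act ?YZ a2 (up Y Z v w))))"
     using tensor_act_pure[OF X(2,3) _ uvw(2,3), of _ "%x. ?e (upure (sp X) (ut Y Z) (act X _ u) x)"] a uvw by simp
    also have "... = ?e (act (lmod_tensor A X ?YZ) a (?h (upure (ut X Y) (sp Z) (up X Y u v) w)))"
     using p2[of a u "up Y Z v w" ?e] a uvw by simp
    finally show "?e (?h (act (lmod_tensor A ?XY Z) a (upure (ut X Y) (sp Z) (up X Y u v) w)))
     = ?e (act (lmod_tensor A X ?YZ) a (?h (upure (ut X Y) (sp Z) (up X Y u v) w)))" .
   qed (use a uvw lin_closed[OF h] bilin_closed[OF b1] bilin_closed[OF b2] in simp_all)
  qed (use a bilin_lin2[OF b1 a] bilin_lin2[OF b2 a] in simp_all)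
 qed
qed

lemma module_map_lunit:
 fixes X :: "('k, 'a, 'u) lmod"
 assumes X: "fd_lmodule A X"
 shows "module_map A (lmod_tensor A (lmod_unit A) X) X (lmap (sp X))"
  and "module_map A (lmod_tensor A X (lmod_unit A)) X (rmap (sp X))"
proof -
 note [simp] = linear bilin_def X fd_lmodule_unit
 note b = tensor_act_bilin[OF fd_lmodule_unit X] tensor_act_bilin[OF X fd_lmodule_unit]
 note p = tensor_act_pure[OF fd_lmodule_unit X] tensor_act_pure[OF X fd_lmodule_unit]
 have l: "lmap (sp X) : lin (utensor uscalars (sp X)) (sp X)" "rmap (sp X) : lin (utensor (sp X) uscalars) (sp X)" by simp_all
 show "module_map A (lmod_tensor A (lmod_unit A) X) X (lmap (sp X))"
  unfolding module_map_def lmod_tensor_sel lmod_unit_sel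
 proof (intro ballI)
  fix a t assume a: "a : el A" and t: "t : el (utensor uscalars (sp X))"
  show "lmap (sp X) (act (lmod_tensor A (lmod_unit A) X) a t) = act X a (lmap (sp X) t)"
  proof (rule utensor_ext[OF _ _ _ lin_comp[OF l(1) bilin_lin2[OF b(1) a, simplified]] lin_comp[OF act_lin[OF X a] l(1)] _ t])
   fix c v assume c: "c : el (uscalars :: ('k, 'u) space)" and v: "v : el (sp X)"
   then obtain r where r: "c = Scalar r" by auto
   show "lmap (sp X) (act (lmod_tensor A (lmod_unit A) X) a (upure uscalars (sp X) c v)) = act X a (lmap (sp X) (upure uscalars (sp X) c v))"
   proof (rule ev_eqI[of "space X"])
    fix \<phi> show "ev (sp X) \<phi> (lmap (sp X) (act (lmod_tensor A (lmod_unit A) X) a (upure uscalars (sp X) c v)))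
     = ev (sp X) \<phi> (act X a (lmap (sp X) (upure uscalars (sp X) c v)))"
     using p(1)[of a c v "%x. ev (sp X) \<phi> (lmap (sp X) x)"] a v r lin_comp[OF ev_lin l(1)]
      sum_counit_left[of a "%x. r * ev (sp X) \<phi> (act X x v)"]
     by (simp add: lin_smult[OF ev_lin] lin_smult[OF act_lin[OF X a]] mult_ac)
   qed (use a v c lin_closed[OF l(1)] bilin_closed[OF b(1)] in simp_all)
  qed simp_all
 qed
 show "module_map A (lmod_tensor A X (lmod_unit A)) X (rmap (sp X))"
  unfolding module_map_def lmod_tensor_sel lmod_unit_sel
 proof (intro ballI)
  fix a t assume a: "a : el A" and t: "t : el (utensor (sp X) uscalars)"
  show "rmap (sp X) (act (lmod_tensor A X (lmod_unit A)) a t) = act X a (rmap (sp X) t)"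
  proof (rule utensor_ext[OF _ _ _ lin_comp[OF l(2) bilin_lin2[OF b(2) a, simplified]] lin_comp[OF act_lin[OF X a] l(2)] _ t])
   fix c v assume c: "c : el (uscalars :: ('k, 'u) space)" and v: "v : el (sp X)"
   then obtain r where r: "c = Scalar r" by auto
   show "rmap (sp X) (act (lmod_tensor A X (lmod_unit A)) a (upure (sp X) uscalars v c)) = act X a (rmap (sp X) (upure (sp X) uscalars v c))"
   proof (rule ev_eqI[of "space X"])
    fix \<phi> show "ev (sp X) \<phi> (rmap (sp X) (act (lmod_tensor A X (lmod_unit A)) a (upure (sp X) uscalars v c)))
     = ev (sp X) \<phi> (act X a (rmap (sp X) (upure (sp X) uscalars v c)))"
     using p(2)[of a v c "%x. ev (sp X) \<phi> (rmap (sp X) x)"] a v r lin_comp[OF ev_lin l(2)]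
      sum_counit_right[of a "%x. r * ev (sp X) \<phi> (act X x v)"]
     by (simp add: lin_smult[OF ev_lin] lin_smult[OF act_lin[OF X a]] mult_ac)
   qed (use a v c lin_closed[OF l(2)] bilin_closed[OF b(2)] in simp_all)
  qed simp_all
 qed
qed

sublocale Rep: structured_spaces "{X. fd_lmodule A X}" "space :: ('k, 'a, 'u) lmod => _" "module_map A" "lmod_tensor A" "lmod_unit A"
proof (rule structured_spaces.intro)
 fix X Y Z :: "('k, 'a, 'u) lmod" and f g
 assume X: "X : {X. fd_lmodule A X}" and Y: "Y : {X. fd_lmodule A X}" and f: "f : elin (sp X) (sp Y)" "module_map A X Y f"
  and g: "g : elin (sp Y) (sp X)" "\<And>v. v : el (sp X) ==> g (f v) = v" "\<And>w. w : el (sp Y) ==> f (g w) = w"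
 show "module_map A Y X g"
  unfolding module_map_def
 proof (intro ballI)
  fix a v assume a: "a : el A" and v: "v : el (sp Y)"
  then have "g (act Y a v) = g (f (act X a (g v)))" using elin_closed[OF g(1)] module_mapD[OF f(2)] g(3) by simp
  also have "... = act X a (g v)" using X a v elin_closed[OF g(1)] g(2) by simp
  finally show "g (act Y a v) = act X a (g v)" .
 qed
next
 fix X Y :: "('k, 'a, 'u) lmod" and f g a
 assume X: "X : {X. fd_lmodule A X}" and Y: "Y : {X. fd_lmodule A X}"
 then have XY: "fd_lmodule A X" "fd_lmodule A Y" by simp_all
 show "module_map A X Y (\<lambda>v\<in>el (sp X). \<zero>\<^bsub>space Y\<^esub>)"
  using XY lin_zero[OF _ _ act_lin[OF XY(2)]] by (simp add: module_map_def)
 assume f: "f : elin (sp X) (sp Y)" "module_map A X Y f"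
 show "module_map A X Y (\<lambda>v\<in>el (sp X). a \<odot>\<^bsub>space Y\<^esub> f v)"
  using XY module_mapD[OF f(2)] elin_closed[OF f(1)] lin_smult[OF act_lin[OF XY(2)]] by (simp add: module_map_def)
 assume g: "g : elin (sp X) (sp Y)" "module_map A X Y g"
 show "module_map A X Y (\<lambda>v\<in>el (sp X). f v \<oplus>\<^bsub>space Y\<^esub> g v)"
  using XY module_mapD[OF f(2)] elin_closed[OF f(1)] module_mapD[OF g(2)] elin_closed[OF g(1)]
   lin_add[OF act_lin[OF XY(2)]] by (simp add: module_map_def)
next
 fix X Y Z :: "('k, 'a, 'u) lmod" and f g
 assume "X : {X. fd_lmodule A X}" "Y : {X. fd_lmodule A X}" "Z : {X. fd_lmodule A X}"
  and f: "f : elin (sp X) (sp Y)" and g: "g : elin (sp Y) (sp Z)" and "module_map A X Y f" "module_map A Y Z g"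
 then show "module_map A X Z (compose (el (sp X)) g f)"
  using elin_closed[OF f] by (simp add: module_map_def compose_eq)
qed (simp_all add: fd_lmodule_tensor fd_lmodule_unit module_map_ten module_map_assoc module_map_lunit, simp add: module_map_def)

lemma Rep_C: "Rep.C = Rep TYPE('u) A"
 by (simp add: Rep.C_def Rep_def)

end

section \<open>Dual spaces\<close>

lemma tensor_eq_cong:
 fixes V :: "('k::field, 'v, 'm) module_scheme" and V' :: "('k, 'v, 'm2) module_scheme"
  and W :: "('k, 'w, 'n) module_scheme" and W' :: "('k, 'w, 'n2) module_scheme"
 assumes V: "el V = el V'" "\<zero>\<^bsub>V\<^esub> = \<zero>\<^bsub>V'\<^esub>" "add V = add V'" "smult V = smult V'"
  and W: "el W = el W'" "add W = add W'" "smult W = smult W'"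
 shows "tensor_eq V W s t ==> tensor_eq V' W' s t"
proof (induct rule: tensor_eq.induct)
 case (refl t) then show ?case using V W by (intro tensor_eq.refl) simp
next
 case sym then show ?case by (blast intro: tensor_eq.sym)
next
 case trans then show ?case by (blast intro: tensor_eq.trans)
next
 case append then show ?case by (simp add: tensor_eq.append)
next
 case swap then show ?case using V W by (simp add: tensor_eq.swap)
next
 case zero then show ?case using V W by (simp add: tensor_eq.zero)
next
 case add_left then show ?case using V W by (simp add: tensor_eq.add_left)
next
 case add_right then show ?case using V W by (simp add: tensor_eq.add_right)
next
 case balanced then show ?case using V W by (simp add: tensor_eq.balanced)
qed

lemma tensor_cong:
 fixes V :: "('k::field, 'v, 'm) module_scheme" and V' :: "('k, 'v, 'm2) module_scheme"
  and W :: "('k, 'w, 'n) module_scheme" and W' :: "('k, 'w, 'n2) module_scheme"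
 assumes V: "el V = el V'" "\<zero>\<^bsub>V\<^esub> = \<zero>\<^bsub>V'\<^esub>" "add V = add V'" "smult V = smult V'"
  and W: "el W = el W'" "add W = add W'" "smult W = smult W'"
 shows "tensor V W = tensor V' W'" "pure V W = pure V' W'"
proof -
 have "tensor_eq V W s t \<longleftrightarrow> tensor_eq V' W' s t" for s t
  using tensor_eq_cong[OF V W] tensor_eq_cong[OF V[symmetric] W[symmetric]] by blast
 then have "tensor_rep V W = tensor_rep V' W'" unfolding tensor_rep_def by presburger
 then show "tensor V W = tensor V' W'" "pure V W = pure V' W'"
  unfolding tensor_def pure_def using V W by simp_all
qed

lemma vs_cong:
 fixes V :: "('k::field, 'v, 'm) module_scheme" and V' :: "('k, 'v, 'm2) module_scheme"
 assumes V: "el V = el V'" "\<zero>\<^bsub>V\<^esub> = \<zero>\<^bsub>V'\<^esub>" "add V = add V'" "smult V = smult V'" and v: "vsp V"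
 shows "vsp V'"
 by (rule vsI) (use v in \<open>auto simp: V[symmetric] vs_add_assoc vs_add_comm vs_add_left_comm vs_smult_add vs_smult_distr vs_smult_mult vs_neg_right\<close>)

text \<open>A tensor is the sum of the pure tensors that it consists of.\<close>

lemma tensor_functional_expand:
 assumes "vsp V" "vsp W" "M : lin (tensor V W) ground" "t : el (tensor V W)"
 shows "M t = tsum V W t (%a b. M (pure V W a b))"
 using tlift_push[of V W "tensor V W" t M "pure V W"] assms by (simp add: tlift_pure_id)

lemma dual_space_simps [simp]:
 "el (dual_space V) = elin V ground" "\<zero>\<^bsub>dual_space V\<^esub> = (\<lambda>v\<in>el V. 0)"
 "f \<oplus>\<^bsub>dual_space V\<^esub> g = (\<lambda>v\<in>el V. f v + g v)" "c \<odot>\<^bsub>dual_space V\<^esub> f = (\<lambda>v\<in>el V. c * f v)"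
 by (simp_all add: dual_space_def)

lemma dual_hopf_simps [simp]:
 "el (dual_hopf K) = elin K ground" "\<zero>\<^bsub>dual_hopf K\<^esub> = (\<lambda>v\<in>el K. 0)"
 "f \<oplus>\<^bsub>dual_hopf K\<^esub> g = (\<lambda>v\<in>el K. f v + g v)" "c \<odot>\<^bsub>dual_hopf K\<^esub> f = (\<lambda>v\<in>el K. c * f v)"
 by (simp_all add: dual_hopf_def)

lemma tensor_dual_hopf:
 "tensor (dual_hopf K) W = tensor (dual_space K) W" "tensor W (dual_hopf K) = tensor W (dual_space K)"
 "pure (dual_hopf K) W = pure (dual_space K) W"
 by (rule tensor_cong; auto simp: dual_hopf_def)+

lemma ground_lin_cong [simp]: "vsp V ==> (\<lambda>v\<in>el V. f v) : lin V ground \<longleftrightarrow> f : lin V ground"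
 by (rule lin_restrict)

lemma vs_dual [simp, closed]: assumes V: "vsp V" shows "vsp (dual_space V)"
proof (rule vsI)
 fix f g h a b assume f: "f : el (dual_space V)"
 then have f': "f : lin V ground" "f : extensional (el V)" by auto
 show "a \<odot>\<^bsub>dual_space V\<^esub> f : el (dual_space V)" using f' V by (simp add: lin_times)
 show "\<zero>\<^bsub>dual_space V\<^esub> \<oplus>\<^bsub>dual_space V\<^esub> f = f" "1 \<odot>\<^bsub>dual_space V\<^esub> f = f" using f' by (auto intro!: extensionalityI[of _ "el V"])
 show "(- 1) \<odot>\<^bsub>dual_space V\<^esub> f \<oplus>\<^bsub>dual_space V\<^esub> f = \<zero>\<^bsub>dual_space V\<^esub>"
  "(a + b) \<odot>\<^bsub>dual_space V\<^esub> f = a \<odot>\<^bsub>dual_space V\<^esub> f \<oplus>\<^bsub>dual_space V\<^esub> b \<odot>\<^bsub>dual_space V\<^esub> f"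
  "(a * b) \<odot>\<^bsub>dual_space V\<^esub> f = a \<odot>\<^bsub>dual_space V\<^esub> (b \<odot>\<^bsub>dual_space V\<^esub> f)"
  by (auto intro!: restrict_ext simp: algebra_simps)
 assume g: "g : el (dual_space V)"
 then have g': "g : lin V ground" "g : extensional (el V)" by auto
 show "f \<oplus>\<^bsub>dual_space V\<^esub> g : el (dual_space V)" using f' g' V lin_add_rule[of ground f V g] by simp
 show "f \<oplus>\<^bsub>dual_space V\<^esub> g = g \<oplus>\<^bsub>dual_space V\<^esub> f"
  "a \<odot>\<^bsub>dual_space V\<^esub> (f \<oplus>\<^bsub>dual_space V\<^esub> g) = a \<odot>\<^bsub>dual_space V\<^esub> f \<oplus>\<^bsub>dual_space V\<^esub> a \<odot>\<^bsub>dual_space V\<^esub> g"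
  "(f \<oplus>\<^bsub>dual_space V\<^esub> g) \<oplus>\<^bsub>dual_space V\<^esub> h = f \<oplus>\<^bsub>dual_space V\<^esub> (g \<oplus>\<^bsub>dual_space V\<^esub> h)"
  by (auto intro!: restrict_ext simp: algebra_simps)
qed (use V lin_zero_rule[of ground V] in auto)

lemma vs_dual_hopf [simp, closed]: "vsp K ==> vsp (dual_hopf K)"
 by (rule vs_cong[OF _ _ _ _ vs_dual]) (auto simp: dual_hopf_def)

lemma eval_lin [linear]: "x : el K ==> (%f. f x) : lin (dual_hopf K) ground"
 by (rule linI) auto

lemma dual_basis_dual_hopf:
 assumes V: "vsp K" and bs: "dual_basis K bs"
 shows "dual_basis (dual_hopf K) (map (%b. (restrict (snd b) (el K), %f. f (fst b))) bs)"
 unfolding dual_basis_def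
proof (intro conjI ballI)
 have b: "fst b : el K" "snd b : lin K ground" if "b : set bs" for b using bs that by (auto simp: dual_basis_def)
 show "set (map (%b. (restrict (snd b) (el K), %f. f (fst b))) bs) \<subseteq> el (dual_hopf K) \<times> lin (dual_hopf K) ground"
  using b V eval_lin[of _ K] by auto
 fix f assume f: "f : el (dual_hopf K)"
 let ?s = "vsum (dual_hopf K) (%b. snd b f \<odot>\<^bsub>dual_hopf K\<^esub> fst b) (map (%b. (restrict (snd b) (el K), %f. f (fst b))) bs)"
 have "?s : el (dual_hopf K)"
  using b V by (intro vsum_closed vs_smult_closed) (auto simp del: dual_hopf_simps(4))
 moreover have "?s x = f x" if x: "x : el K" for x
 proof -
  have "?s x = sum_list (map (%b. f (fst b) * snd b x) bs)"
   using x by (induct bs) auto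
  also have "... = f (vsum K (%b. snd b x \<odot>\<^bsub>K\<^esub> fst b) bs)"
   using f b V lin_smult[of f K ground]
   by (subst vsum_lin[of K ground f]) (auto simp: vsum_ground mult.commute intro!: arg_cong[where f = sum_list])
  also have "... = f x" using bs x by (simp add: dual_basis_def)
  finally show ?thesis .
 qed
 ultimately show "?s = f" using f by (auto intro!: extensionalityI[of _ "el K"])
qed

context fd_hopf_algebra begin

abbreviation As where "As \<equiv> dual_hopf A"

lemma fdvs_dual [simp]: "fdvs As"
 using dual_basis_exists[OF fdA] dual_basis_dual_hopf[OF vsA] dual_basis_fin_dim[of As] vs_dual_hopf[OF vsA] by blast

lemma restrict_dual: "L : lin A ground ==> restrict L (el A) : el As"
 by simp

lemma dual_tensor_eqI:
 assumes s: "s : el (tensor As As)" and t: "t : el (tensor As As)"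
  and eq: "\<And>x y. x : el A ==> y : el A ==> tsum As As s (%a b. a x * b y) = tsum As As t (%a b. a x * b y)"
 shows "s = t"
proof -
 obtain bs where bs: "dual_basis A bs" using dual_basis_exists[OF fdA] by blast
 then have b: "fst b : el A" if "b : set bs" for b using that by (auto simp: dual_basis_def)
 show ?thesis
 proof (rule tensor_eqI[OF _ _ dual_basis_dual_hopf[OF vsA bs] dual_basis_dual_hopf[OF vsA bs] s t])
  fix c d :: "('a => 'k) \<times> (('a => 'k) => 'k)"
  assume "c : set (map (%b. (restrict (snd b) (el A), %f. f (fst b))) bs)"
   "d : set (map (%b. (restrict (snd b) (el A), %f. f (fst b))) bs)"
  then obtain c' d' where "c' : set bs" "d' : set bs" "snd c = (%f. f (fst c'))" "snd d = (%f. f (fst d'))" by auto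
  then show "tsum As As s (%v w. snd c v * snd d w) = tsum As As t (%v w. snd c v * snd d w)"
   using eq b by simp
 qed simp_all
qed

lemma dual_comult_ex1:
 assumes f: "f : el As"
 shows "\<exists>!t. t : el (tensor As As) \<and> (\<forall>x\<in>el A. \<forall>y\<in>el A. tsum As As t (%a b. a x * b y) = f (x \<otimes> y))"
proof (rule ex_ex1I)
 have f': "f : lin A ground" using f by simp
 obtain bs where bs: "dual_basis A bs" using dual_basis_exists[OF fdA] by blast
 have b: "fst b : el A" "snd b : lin A ground" if "b : set bs" for b using bs that by (auto simp: dual_basis_def)
 define g where "g b = (\<lambda>y\<in>el A. f (fst b \<otimes> y))" for b :: "'a \<times> ('a => 'k)"
 have g: "g b : el As" if "b : set bs" for b
  unfolding g_def using b(1)[OF that] by (intro restrict_dual lin_comp[OF f'] linear) auto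
 define t where "t = vsum (tensor As As) (%b. pure As As (restrict (snd b) (el A)) (g b)) bs"
 have t: "t : el (tensor As As)"
  unfolding t_def using b g restrict_dual by (intro vsum_closed vs_tensor pure_closed) simp_all
 have "tsum As As t (%a b. a x * b y) = f (x \<otimes> y)" if xy: "x : el A" "y : el A" for x y
 proof -
  have bil: "bilin As As ground (%a b. a x * b y)" using xy by (intro bilinI linear) simp_all
  have "tsum As As t (%a b. a x * b y) = sum_list (map (%b. tsum As As (pure As As (restrict (snd b) (el A)) (g b)) (%a b. a x * b y)) bs)"
   unfolding t_def using b g restrict_dual
   by (subst vsum_lin[OF vs_tensor vs_ground tsum_lin[OF _ _ bil]]) (simp_all add: vsum_ground)
  also have "... = sum_list (map (%b. snd b x * f (fst b \<otimes> y)) bs)"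
   using b g restrict_dual xy by (intro arg_cong[where f = sum_list] map_cong[OF HOL.refl], subst tsum_pure[OF _ _ bil]) (simp_all add: g_def)
  also have "... = f (vsum A (%b. snd b x \<odot> fst b) bs \<otimes> y)"
   using b xy lin_comp[OF f' mult_rule1[OF lin_id xy(2)]]
   by (subst vsum_lin[OF vsA vs_ground, of "%z. f (z \<otimes> y)"])
    (auto simp: vsum_ground lin_smult[of "%z. f (z \<otimes> y)" A ground] intro!: arg_cong[where f = sum_list])
  finally show ?thesis using bs xy by (simp add: dual_basis_def)
 qed
 then show "\<exists>t. t : el (tensor As As) \<and> (\<forall>x\<in>el A. \<forall>y\<in>el A. tsum As As t (%a b. a x * b y) = f (x \<otimes> y))"
  using t by blast
qed (rule dual_tensor_eqI, simp_all)

lemma dual_comult_eq: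
 "comult As f = (THE t. t : el (tensor As As) \<and> (\<forall>x\<in>el A. \<forall>y\<in>el A. tsum As As t (%a b. a x * b y) = f (x \<otimes> y)))"
proof -
 have "tsum As As t (%a b. a x * b y) = tlift ground (%a b. a x * b y) t" if "t : el (tensor (dual_space A) (dual_space A))" for t x y
  using tensor_carrier_lists[OF _ _ that] by (intro tsum_tlift) simp
 then show ?thesis unfolding tensor_dual_hopf by (auto simp: dual_hopf_def intro!: arg_cong[where f = The] ext)
qed

lemma dual_comult:
 assumes f: "f : el As"
 shows "comult As f : el (tensor As As)"
  and "x : el A ==> y : el A ==> csum As f (%a b. a x * b y) = f (x \<otimes> y)"
 unfolding dual_comult_eq using theI'[OF dual_comult_ex1[OF f]] by auto

lemma dual_comult_lin: "comult As : lin As (tensor As As)"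
proof -
 have vs': "vsp As" "vsp (tensor As As)" by simp_all
 have tl: "(%t. tsum As As t (%a b. a x * b y)) : lin (tensor As As) ground" if "x : el A" "y : el A" for x y
  using that by (intro tsum_lin bilinI linear) simp_all
 show ?thesis
 proof (rule linI)
  fix f g c assume f: "f : el As"
  note df = dual_comult[OF f]
  show "comult As f : el (tensor As As)" by (rule df)
  have "c \<odot>\<^bsub>As\<^esub> f : el As" using f vs_smult_closed[OF vs'(1)] by blast
  note dc = dual_comult[OF this]
  show "comult As (c \<odot>\<^bsub>As\<^esub> f) = c \<odot>\<^bsub>tensor As As\<^esub> comult As f"
  proof (rule dual_tensor_eqI[OF dc(1) vs_smult_closed[OF vs'(2) df(1)]])
   fix x y assume xy: "x : el A" "y : el A"
   show "csum As (c \<odot>\<^bsub>As\<^esub> f) (%a b. a x * b y) = tsum As As (c \<odot>\<^bsub>tensor As As\<^esub> comult As f) (%a b. a x * b y)"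
    unfolding lin_smult[OF tl[OF xy] df(1)] dc(2)[OF xy] df(2)[OF xy] using xy by simp
  qed
  assume g: "g : el As"
  note dg = dual_comult[OF g]
  have "f \<oplus>\<^bsub>As\<^esub> g : el As" using f g vs_add_closed[OF vs'(1)] by blast
  note dc = dual_comult[OF this]
  show "comult As (f \<oplus>\<^bsub>As\<^esub> g) = comult As f \<oplus>\<^bsub>tensor As As\<^esub> comult As g"
  proof (rule dual_tensor_eqI[OF dc(1) vs_add_closed[OF vs'(2) df(1) dg(1)]])
   fix x y assume xy: "x : el A" "y : el A"
   show "csum As (f \<oplus>\<^bsub>As\<^esub> g) (%a b. a x * b y) = tsum As As (comult As f \<oplus>\<^bsub>tensor As As\<^esub> comult As g) (%a b. a x * b y)"
    unfolding lin_add[OF tl[OF xy] df(1) dg(1)] dc(2)[OF xy] df(2)[OF xy] dg(2)[OF xy] using xy by simp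
  qed
 qed
qed

lemma dual_mult: "x : el A ==> (f \<otimes>\<^bsub>As\<^esub> g) x = csum A x (%x1 x2. f x1 * g x2)"
 using tensor_carrier_lists[OF vsA vsA comult_closed] by (simp add: dual_hopf_def sweedler2_def tsum_tlift)

lemma dual_mult_closed: "f : el As ==> g : el As ==> f \<otimes>\<^bsub>As\<^esub> g : el As"
proof -
 assume f: "f : el As" and g: "g : el As"
 have "(%x. csum A x (%x1 x2. f x1 * g x2)) : lin A ground"
  using f g by (intro linear bilinI comult_rule lin_id vsA) simp_all
 then have "f \<otimes>\<^bsub>As\<^esub> g : lin A ground" by (subst lin_cong) (auto simp: dual_mult)
 then show ?thesis by (simp add: dual_hopf_def)
qed

lemma dual_one: "\<one>\<^bsub>As\<^esub> = restrict (counit A) (el A)" "\<one>\<^bsub>As\<^esub> : el As"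
 using counit_lin by (simp_all add: dual_hopf_def)

end

section \<open>The map from H to K\<close>

locale surjective_pairing = H: fd_hopf_algebra H + K: fd_hopf_algebra K
 for H :: "('k::field, 'h) hopf" and K :: "('k, 'b) hopf" +
 fixes \<sigma> :: "('b => 'k) => 'h => 'k"
 assumes pairing: "hopf_pairing (dual_hopf K) H \<sigma>"
  and surj: "sigma_r K \<sigma> ` el H = el K"
begin

abbreviation p where "p \<equiv> sigma_r K \<sigma>"
abbreviation Ks where "Ks \<equiv> dual_hopf K"

abbreviation (input) multK (infixl "**" 70) where "x ** y \<equiv> x \<otimes>\<^bsub>K\<^esub> y"
abbreviation (input) multH (infixl "*:" 70) where "x *: y \<equiv> x \<otimes>\<^bsub>H\<^esub> y"
abbreviation (input) multKs (infixl "*." 70) where "x *. y \<equiv> x \<otimes>\<^bsub>Ks\<^esub> y"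
abbreviation (input) eK where "eK \<equiv> \<one>\<^bsub>K\<^esub>"
abbreviation (input) eH where "eH \<equiv> \<one>\<^bsub>H\<^esub>"
abbreviation (input) eKs where "eKs \<equiv> \<one>\<^bsub>Ks\<^esub>"

lemma \<sigma>_bilin: "bilin Ks H ground \<sigma>" using pairing by (simp add: hopf_pairing_def)

text \<open>Reflexivity of the finite-dimensional space \<open>K\<close>, with the preimage written in a dual basis.\<close>

lemma p_unique:
 assumes h: "h : el H"
 shows "\<exists>!x. x : el K \<and> (\<forall>f\<in>el Ks. f x = \<sigma> f h)"
proof (rule ex_ex1I)
 obtain bs where bs: "dual_basis K bs" using dual_basis_exists[OF K.fdA] by blast
 have b: "fst b : el K" "snd b : lin K ground" if "b : set bs" for b using bs that by (auto simp: dual_basis_def)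
 note db = dual_basis_dual_hopf[OF K.vsA bs]
 define x where "x = vsum K (%b. \<sigma> (restrict (snd b) (el K)) h \<odot>\<^bsub>K\<^esub> fst b) bs"
 have x: "x : el K" unfolding x_def using b by (intro vsum_closed) auto
 have "f x = \<sigma> f h" if f: "f : el Ks" for f
 proof -
  have fl: "f : lin K ground" using f by simp
  have mp: "vsum Z g (map k ys) = vsum Z (%x. g (k x)) ys" for Z :: "('k, 'b => 'k) hopf" and g k and ys :: "('b \<times> ('b => 'k)) list"
   by (induct ys) auto
  have "\<sigma> f h = \<sigma> (vsum Ks (%b. f (fst b) \<odot>\<^bsub>Ks\<^esub> restrict (snd b) (el K)) bs) h"
   using db f unfolding dual_basis_def mp by simp
  also have "... = sum_list (map (%b. \<sigma> (f (fst b) \<odot>\<^bsub>Ks\<^esub> restrict (snd b) (el K)) h) bs)"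
   using vsum_lin[OF vs_dual_hopf[OF K.vsA] vs_ground bilin_lin1[OF \<sigma>_bilin h], of bs "%b. f (fst b) \<odot>\<^bsub>Ks\<^esub> restrict (snd b) (el K)"]
    b vs_smult_closed[OF vs_dual_hopf[OF K.vsA]] by (simp add: vsum_ground del: dual_hopf_simps(4))
  also have "... = sum_list (map (%b. f (fst b) * \<sigma> (restrict (snd b) (el K)) h) bs)"
   using b lin_smult[OF bilin_lin1[OF \<sigma>_bilin h]]
   by (intro arg_cong[where f = sum_list] map_cong HOL.refl) (simp del: dual_hopf_simps(4))
  also have "... = f x"
   unfolding x_def using b by (subst vsum_lin[OF K.vsA vs_ground fl])
    (auto simp: vsum_ground lin_smult[OF fl] mult.commute intro!: arg_cong[where f = sum_list])
  finally show ?thesis by simp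
 qed
 then show "\<exists>x. x : el K \<and> (\<forall>f\<in>el Ks. f x = \<sigma> f h)" using x by blast
 fix x y assume xy: "x : el K \<and> (\<forall>f\<in>el Ks. f x = \<sigma> f h)" "y : el K \<and> (\<forall>f\<in>el Ks. f y = \<sigma> f h)"
 show "x = y"
 proof (rule ev_eqI[OF K.fdA])
  fix \<phi> show "ev K \<phi> x = ev K \<phi> y"
   using xy K.restrict_dual[OF ev_lin, of \<phi>] by (metis restrict_apply')
 qed (use xy in auto)
qed

lemma p_closed [simp, closed]: "h : el H ==> p h : el K"
 unfolding sigma_r_def using theI'[OF p_unique] by blast

lemma p_dual: "h : el H ==> f : el Ks ==> f (p h) = \<sigma> f h"
 unfolding sigma_r_def using theI'[OF p_unique] by blast

lemma p_functional: "h : el H ==> L : lin K ground ==> L (p h) = \<sigma> (restrict L (el K)) h"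
 using p_dual[OF _ K.restrict_dual[of L]] by simp

lemma p_lin: "p : lin H K"
proof (rule linI)
 fix h h' c assume h: "h : el H"
 show "p h : el K" using h by simp
 show "p (c \<odot>\<^bsub>H\<^esub> h) = c \<odot>\<^bsub>K\<^esub> p h"
  by (rule ev_eqI[OF K.fdA]) (use h lin_smult[OF bilin_lin2[OF \<sigma>_bilin]] in \<open>simp_all add: p_functional lin_smult[OF ev_lin]\<close>)
 assume h': "h' : el H"
 show "p (h \<oplus>\<^bsub>H\<^esub> h') = p h \<oplus>\<^bsub>K\<^esub> p h'"
  by (rule ev_eqI[OF K.fdA]) (use h h' lin_add[OF bilin_lin2[OF \<sigma>_bilin]] in \<open>simp_all add: p_functional lin_add[OF ev_lin]\<close>)
qed

lemma p_rule [linear]: "f : lin U H ==> (%x. p (f x)) : lin U K"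
 by (rule lin_comp[OF p_lin])

lemma p_mult: "h : el H ==> h' : el H ==> p (h *: h') = p h ** p h'"
proof (rule ev_eqI[OF K.fdA])
 fix \<phi> assume h: "h : el H" "h' : el H"
 let ?f = "restrict (ev K \<phi>) (el K)"
 have f: "?f : el Ks" by simp
 have "ev K \<phi> (p (h *: h')) = sweedler2 Ks ground (%f1 f2. \<sigma> f1 h * \<sigma> f2 h') ?f"
  using h pairing f by (simp add: p_functional hopf_pairing_def)
 also have "... = csum Ks ?f (%f1 f2. f1 (p h) * f2 (p h'))"
  using tensor_carrier_lists[OF _ _ K.dual_comult(1)[OF f]] h unfolding sweedler2_def
  by (subst tsum_tlift[of _ Ks Ks, symmetric], simp) (intro tsum_cong HOL.refl arg_cong2[where f = "(*)"] p_dual[symmetric])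
 also have "... = ev K \<phi> (p h ** p h')" using K.dual_comult(2)[OF f, of "p h" "p h'"] h by simp
 finally show "ev K \<phi> (p (h *: h')) = ev K \<phi> (p h ** p h')" .
qed simp_all

lemma p_one: "p eH = eK"
proof (rule ev_eqI[OF K.fdA])
 fix \<phi> show "ev K \<phi> (p eH) = ev K \<phi> eK"
  using pairing K.restrict_dual[OF ev_lin, of \<phi>] by (simp add: p_functional hopf_pairing_def dual_hopf_def[of K])
qed simp_all

lemma p_counit: "h : el H ==> counit K (p h) = counit H h"
 using pairing K.dual_one p_dual[of h "eKs"] by (simp add: hopf_pairing_def)

lemma p_comult:
 assumes h: "h : el H"
 shows "comult K (p h) = tlift (tensor K K) (%x y. pure K K (p x) (p y)) (comult H h)"
proof -
 have b: "bilin H H (tensor K K) (%x y. pure K K (p x) (p y))" by (intro bilinI linear) simp_all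
 note tl = tlift_lin[OF H.vsA H.vsA vs_tensor[OF K.vsA K.vsA] b]
 obtain bs where bs: "dual_basis K bs" using dual_basis_exists[OF K.fdA] by blast
 show ?thesis
 proof (rule tensor_eqI[OF _ _ bs bs])
  fix d e assume "d : set bs" "e : set bs"
  then have de: "snd d : lin K ground" "snd e : lin K ground" using bs by (auto simp: dual_basis_def)
  let ?d = "restrict (snd d) (el K)" and ?e = "restrict (snd e) (el K)"
  have bil: "bilin K K ground (%v w. snd d v * snd e w)" using de by (intro bilinI linear)
  have "csum K (p h) (%v w. snd d v * snd e w) = csum K (p h) (%v w. ?d v * ?e w)" by simp
  also have "... = (?d *. ?e) (p h)" using h by (simp add: K.dual_mult)
  also have "... = \<sigma> (?d *. ?e) h" using h de K.dual_mult_closed[of ?d ?e] by (intro p_dual) simp_all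
  also have "... = csum H h (%x y. \<sigma> ?d x * \<sigma> ?e y)"
   using pairing h de tensor_carrier_lists[OF H.vsA H.vsA H.comult_closed[OF h]]
   by (simp add: hopf_pairing_def sweedler2_def tsum_tlift)
  also have "... = csum H h (%x y. snd d (p x) * snd e (p y))"
   using de by (simp add: p_functional)
  also have "... = tsum K K (tlift (tensor K K) (%x y. pure K K (p x) (p y)) (comult H h)) (%v w. snd d v * snd e w)"
   using tlift_push[of H H "tensor K K" "comult H h" "%t. tsum K K t (%v w. snd d v * snd e w)" "%x y. pure K K (p x) (p y)"] h
    tsum_lin[OF K.vsA K.vsA bil] by (simp add: tsum_pure[OF K.vsA K.vsA bil])
  finally show "csum K (p h) (%v w. snd d v * snd e w)
   = tsum K K (tlift (tensor K K) (%x y. pure K K (p x) (p y)) (comult H h)) (%v w. snd d v * snd e w)" .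
 qed (use h lin_closed[OF tl] in simp_all)
qed

lemma sum_p_comult:
 assumes h: "h : el H" and F: "bilin K K ground F"
 shows "csum K (p h) F = csum H h (%x y. F (p x) (p y))"
 unfolding p_comult[OF h]
 using tlift_push[of H H "tensor K K" "comult H h" "%t. tsum K K t F" "%x y. pure K K (p x) (p y)"] h
  tsum_lin[OF K.vsA K.vsA F] by (simp add: tsum_pure[OF K.vsA K.vsA F])

abbreviation u where "u x \<equiv> antipode_inv K (p x)"
abbreviation q where "q x \<equiv> p (antipode_inv H x)"

text \<open>The maps \<open>u = S\<inverse> p\<close> and \<open>q = p S\<inverse>\<close> are both inverse to \<open>p\<close> for the opposite convolution. The
 first occurs in the Yetter-Drinfeld condition, the second in the quantum double.\<close>

lemma sum_u_left: "h : el H ==> L : lin K ground ==>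
  csum H h (%x y. L (u y ** p x)) = counit H h * L eK"
 using sum_p_comult[of h "%x y. L (antipode_inv K y ** x)"] K.sum_antipode_inv_left[of "p h" L]
 by (simp add: bilin_def lin_comp[of L K ground] linear p_counit)

lemma sum_u_right: "h : el H ==> L : lin K ground ==>
  csum H h (%x y. L (p y ** u x)) = counit H h * L eK"
 using sum_p_comult[of h "%x y. L (y ** antipode_inv K x)"] K.sum_antipode_inv_right[of "p h" L]
 by (simp add: bilin_def lin_comp[of L K ground] linear p_counit)

lemma sum_q_left: "h : el H ==> L : lin K ground ==>
  csum H h (%x y. L (q y ** p x)) = counit H h * L eK"
 using H.sum_antipode_inv_left[of h "%x. L (p x)"] by (simp add: lin_comp[OF _ p_lin] p_mult p_one)

lemma sum_q_right: "h : el H ==> L : lin K ground ==>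
  csum H h (%x y. L (p y ** q x)) = counit H h * L eK"
 using H.sum_antipode_inv_right[of h "%x. L (p x)"] by (simp add: lin_comp[OF _ p_lin] p_mult p_one)

abbreviation (input) rsum where "rsum X v \<equiv> tsum (sp X) K (coact X v)"

section \<open>Comodules and the Yetter-Drinfeld condition\<close>

lemma
 assumes V: "vsp (sp X)" and X: "rcomodule K X"
 shows coact_closed [simp, closed]: "v : el (sp X) ==> coact X v : el (tensor (sp X) K)"
  and coact_lin: "coact X : lin (sp X) (tensor (sp X) K)"
  and coact_rule [linear]: "g : lin U (sp X) ==> (%x. coact X (g x)) : lin U (tensor (sp X) K)"
  and coact_ext: "coact X : extensional (el (sp X))"
 using X lin_comp[of "coact X" "space X" "tensor (sp X) K"] lin_closed[of "coact X" "space X" "tensor (sp X) K"]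
 unfolding rcomodule_def by (auto simp: Let_def)

lemma lin_tensor_rest: "vsp V ==> F : lin (tensor V (tensor K K)) ground ==> v : el V ==> s : el (tensor K K) ==>
  F (pure V (tensor K K) v s) = tsum K K s (%x y. F (pure V (tensor K K) v (pure K K x y)))"
 by (rule tensor_functional_expand[OF _ _ lin_comp[OF _ pure_rule2[OF _ _ lin_id]]]) simp_all

lemma trilin_functional:
 assumes "vsp U" "vsp V" "vsp W" "trilin U V W F"
 obtains L where "L : lin (tensor U (tensor V W)) ground"
  "\<And>x y z. x : el U ==> y : el V ==> z : el W ==> L (pure U (tensor V W) x (pure V W y z)) = F x y z"
proof -
 define L where "L t = tsum U (tensor V W) t (%a s. tsum V W s (F a))" for t
 note b = trilin_sum[OF assms]
 have L: "L : lin (tensor U (tensor V W)) ground" unfolding L_def using assms b(1) by (intro tsum_lin) auto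
 moreover have "L (pure U (tensor V W) x (pure V W y z)) = F x y z" if "x : el U" "y : el V" "z : el W" for x y z
  unfolding L_def using that b assms by (simp add: tsum_pure)
 ultimately show thesis using that by blast
qed

text \<open>The comodule axioms as identities of scalar sums. The two inner factors appear in opposite order
 because the axiom lists the later coaction first.\<close>

lemma rcomodule_iff:
 assumes V: "fdvs (sp X)" and l: "coact X : elin (sp X) (tensor (sp X) K)"
 shows "rcomodule K X \<longleftrightarrow>
  (\<forall>v\<in>el (sp X). \<forall>L\<in>lin (sp X) ground. rsum X v (%v0 x. counit K x * L v0) = L v) \<and>
  (\<forall>v\<in>el (sp X). \<forall>F. trilin (sp X) K K F \<longrightarrow>
   rsum X v (%v0 x. rsum X v0 (%v00 y. F v00 y x))
   = rsum X v (%v0 x. csum K x (%y z. F v0 y z)))"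
  (is "_ \<longleftrightarrow> ?counit \<and> ?coassoc")
proof -
 let ?V = "space X" and ?T = "tensor (sp X) (tensor K K)"
 have vV: "vsp ?V" using V by blast
 have c: "coact X v : el (tensor ?V K)" if "v : el ?V" for v using l that by (rule elin_closed)
 note [simp] = linear vV c bilin_def
 have 1: "L (tlift ?V (%v0 x. counit K x \<odot>\<^bsub>?V\<^esub> v0) (coact X v)) = tsum ?V K (coact X v) (%v0 x. counit K x * L v0)"
  if "v : el ?V" "L : lin ?V ground" for v L
  using tlift_push[of ?V K ?V "coact X v" L "%v0 x. counit K x \<odot>\<^bsub>?V\<^esub> v0"] that by (simp add: lin_smult[OF that(2)])
 have t1: "tlift ?V (%v0 x. counit K x \<odot>\<^bsub>?V\<^esub> v0) (coact X v) : el ?V" if "v : el ?V" for v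
  by (rule lin_closed[OF tlift_lin[of ?V K]]) (use that in simp_all)
 have counit: "(\<forall>v\<in>el ?V. tlift ?V (%v0 x. counit K x \<odot>\<^bsub>?V\<^esub> v0) (coact X v) = v) \<longleftrightarrow> ?counit" (is "?A \<longleftrightarrow> _")
 proof
  assume ?counit
  show ?A
  proof
   fix v assume v: "v : el ?V"
   show "tlift ?V (%v0 x. counit K x \<odot>\<^bsub>?V\<^esub> v0) (coact X v) = v"
    by (rule ev_eqI[OF V t1[OF v] v]) (use \<open>?counit\<close> v in \<open>simp add: 1[OF v ev_lin]\<close>)
  qed
 qed (use 1 in force)
 let ?l = "%v. tlift ?T (%v0 x. tlift ?T (%v00 y. pure ?V (tensor K K) v00 (pure K K y x)) (coact X v0)) (coact X v)"
 let ?r = "%v. tlift ?T (%v0 x. pure ?V (tensor K K) v0 (comult K x)) (coact X v)"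
 have i: "tlift ?T (%v00 y. pure ?V (tensor K K) v00 (pure K K y x)) (coact X v0) : el ?T"
  if "v0 : el ?V" "x : el K" for v0 x
  by (rule lin_closed[OF tlift_lin[of ?V K]]) (use that in simp_all)
 have ll: "L (?l v) = tsum ?V K (coact X v) (%v0 x. tsum ?V K (coact X v0) (%v00 y. L (pure ?V (tensor K K) v00 (pure K K y x))))"
  if "v : el ?V" "L : lin ?T ground" for v L
  using that i by (simp add: tlift_push[of ?V K ?T _ L])
 have lr: "L (?r v) = tsum ?V K (coact X v) (%v0 x. csum K x (%y z. L (pure ?V (tensor K K) v0 (pure K K y z))))"
  if "v : el ?V" "L : lin ?T ground" for v L
  using that by (simp add: tlift_push[of ?V K ?T _ L] lin_tensor_rest[OF vV that(2)])
 have coassoc: "(\<forall>v\<in>el ?V. ?l v = ?r v) \<longleftrightarrow> ?coassoc" (is "?A \<longleftrightarrow> _")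
 proof
  assume a: ?A
  show ?coassoc
  proof (intro ballI allI impI)
   fix v F assume v: "v : el ?V" and F: "trilin ?V K K F"
   obtain L where L: "L : lin ?T ground"
    "\<And>x y z. x : el ?V ==> y : el K ==> z : el K ==> L (pure ?V (tensor K K) x (pure K K y z)) = F x y z"
    using trilin_functional[OF vV K.vsA K.vsA F] by blast
   then show "tsum ?V K (coact X v) (%v0 x. tsum ?V K (coact X v0) (%v00 y. F v00 y x))
    = tsum ?V K (coact X v) (%v0 x. csum K x (%y z. F v0 y z))"
    using ll[OF v L(1)] lr[OF v L(1)] a v L(2) by simp
  qed
 next
  assume a: ?coassoc
  show ?A
  proof
   fix v assume v: "v : el ?V"
   have T: "trilin ?V K K (%x y z. ev ?T \<phi> (pure ?V (tensor K K) x (pure K K y z)))" for \<phi>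
    by (simp add: trilin_def)
   show "?l v = ?r v"
   proof (rule ev_eqI[of ?T])
    show "?l v : el ?T" "?r v : el ?T"
     using i tensor_carrier_lists[OF vV K.vsA c[OF v]]
     by (subst tlift_vsum, intro vsum_closed; auto)+
    fix \<phi> show "ev ?T \<phi> (?l v) = ev ?T \<phi> (?r v)"
     using a v T by (simp only: ll[OF v ev_lin] lr[OF v ev_lin])
   qed (use V in simp)
  qed
 qed
 show ?thesis
  unfolding rcomodule_def Let_def using counit coassoc l by blast
qed

lemma sum_coact_counit:
 "fdvs (sp X) ==> rcomodule K X ==> v : el (sp X) ==> L : lin (sp X) ground ==>
  rsum X v (%v0 x. counit K x * L v0) = L v"
 using rcomodule_iff[of X] coact_lin[of X] coact_ext[of X] by blast

lemma sum_coact_coassoc: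
 "fdvs (sp X) ==> rcomodule K X ==> v : el (sp X) ==> trilin (sp X) K K F ==>
  rsum X v (%v0 x. rsum X v0 (%v00 y. F v00 y x))
  = rsum X v (%v0 x. csum K x (%y z. F v0 y z))"
 using rcomodule_iff[of X] coact_lin[of X] coact_ext[of X] by blast

text \<open>The three forms of the Yetter-Drinfeld condition differ by moving the convolution inverses of
 \<open>p\<close> across: \<open>yd_sum\<close> is the definition, \<open>yd_braided\<close> is free of inverses and says that
 \<open>y \<otimes> x \<mapsto> \<Sum> x\<^sub>0 \<otimes> x\<^sub>1 y\<close> is \<open>H\<close>-linear, and \<open>yd_twisted\<close> is the cross relation of the quantum
 double.\<close>

definition yd_braided :: "('k, 'h, 'b, 'u) ydmod => bool" where
 "yd_braided X \<longleftrightarrow> (\<forall>h\<in>el H. \<forall>v\<in>el (sp X). \<forall>F. bilin (sp X) K ground F \<longrightarrow>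
   csum H h (%h1 h2. rsum X (act X h2 v) (%w k. F w (k ** p h1)))
   = csum H h (%h1 h2. rsum X v (%w k. F (act X h1 w) (p h2 ** k))))"

definition yd_twisted :: "('k, 'h, 'b, 'u) ydmod => bool" where
 "yd_twisted X \<longleftrightarrow> (\<forall>h\<in>el H. \<forall>v\<in>el (sp X). \<forall>F. bilin (sp X) K ground F \<longrightarrow>
   rsum X v (%w k. F (act X h w) k)
   = csum H h (%b h3. csum H b (%h1 h2.
    rsum X (act X h2 v) (%w k. F w (q h3 ** (k ** p h1))))))"

definition yd_sum :: "('k, 'h, 'b, 'u) ydmod => bool" where
 "yd_sum X \<longleftrightarrow> (\<forall>h\<in>el H. \<forall>v\<in>el (sp X). \<forall>F. bilin (sp X) K ground F \<longrightarrow>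
   rsum X (act X h v) F
   = csum H h (%b h3. csum H b (%h1 h2.
    rsum X v (%w k. F (act X h2 w) (p h3 ** (k ** u h1))))))"

context
 fixes X :: "('k, 'h, 'b, 'u) ydmod"
 assumes X: "fd_lmodule H X" and co: "rcomodule K X"
begin

lemma bilin_functional:
 assumes "bilin (sp X) K ground F"
 shows "f : lin U (sp X) ==> k : el K ==> (%x. F (f x) k) : lin U ground"
  "g : lin U K ==> v : el (sp X) ==> (%x. F v (g x)) : lin U ground"
 using assms by (auto intro: bilin_left bilin_right)

lemma yd_condition_iff_sum: "yd_condition H K \<sigma> X \<longleftrightarrow> yd_sum X"
proof -
 let ?V = "space X" let ?T = "tensor ?V K"
 note [simp] = linear bilin_def X co
 let ?in = "%v h1 h2 h3. tlift ?T (%v0 v1. pure ?V K (act X h2 v0) ((p h3 ** v1) ** u h1)) (coact X v)"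
 let ?r = "%h v. sweedler3 H ?T (?in v) h"
 have in_c: "?in v h1 h2 h3 : el ?T" if "v : el ?V" "h1 : el H" "h2 : el H" "h3 : el H" for v h1 h2 h3
  by (rule lin_closed[OF tlift_lin[of ?V K]]) (use that in simp_all)
 have cl: "tlift Z f t : el Z" if "vsp V" "vsp W" "vsp Z" "t : el (tensor V W)" "\<And>a b. a : el V ==> b : el W ==> f a b : el Z"
  for Z :: "('k, 'z) module" and V :: "('k, 'x, 'm) module_scheme" and W :: "('k, 'y, 'n) module_scheme" and t f
  using tensor_carrier_lists[OF that(1,2,4)] that unfolding tlift_vsum by (intro vsum_closed) auto
 have in_c2: "sweedler2 H ?T (%h1 h2. ?in v h1 h2 h3) b : el ?T" if "v : el ?V" "b : el H" "h3 : el H" for v b h3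
  unfolding sweedler2_def using in_c that by (intro cl[of H H]) simp_all
 have r_c: "?r h v : el ?T" if "h : el H" "v : el ?V" for h v
  unfolding sweedler3_def sweedler2_def[of H ?T _ h] using in_c2 that by (intro cl[of H H]) simp_all
 have push: "L (?r h v) = csum H h (%b h3. csum H b (%h1 h2.
    tsum ?V K (coact X v) (%w k. L (pure ?V K (act X h2 w) (p h3 ** (k ** u h1))))))"
  if h: "h : el H" "v : el ?V" "L : lin ?T ground" for h v L
  unfolding sweedler3_def using h in_c in_c2 by (simp add: sweedler2_push[of H ?T _ L] tlift_push[of ?V K ?T _ L] K.m_assoc)
 have "(coact X (act X h v) = ?r h v) \<longleftrightarrow> (\<forall>F. bilin ?V K ground F \<longrightarrow>
   tsum ?V K (coact X (act X h v)) F
   = csum H h (%b h3. csum H b (%h1 h2.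
    tsum ?V K (coact X v) (%w k. F (act X h2 w) (p h3 ** (k ** u h1))))))"
  (is "?A \<longleftrightarrow> ?B") if h: "h : el H" "v : el ?V" for h v
 proof
  assume ?A
  show ?B
  proof (intro allI impI)
   fix F assume F: "bilin ?V K ground F"
   show "tsum ?V K (coact X (act X h v)) F = csum H h (%b h3. csum H b (%h1 h2.
    tsum ?V K (coact X v) (%w k. F (act X h2 w) (p h3 ** (k ** u h1)))))"
    unfolding \<open>?A\<close> push[OF h tsum_lin[OF lmod_vsp[OF X] K.vsA F]] using h F by (simp add: tsum_pure)
  qed
 next
  assume B: ?B
  show ?A
  proof (rule ev_eqI[of ?T])
   fix \<phi>
   have "bilin ?V K ground (%w k. ev ?T \<phi> (pure ?V K w k))" by simp
   then show "ev ?T \<phi> (coact X (act X h v)) = ev ?T \<phi> (?r h v)"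
    using B h tensor_functional_expand[OF _ _ ev_lin[of ?T \<phi>], of "coact X (act X h v)"] by (simp add: push[OF h ev_lin])
  qed (use h r_c in simp_all)
 qed
 then show ?thesis unfolding yd_condition_def yd_sum_def Let_def by blast
qed

lemma yd_sum_iff_braided: "yd_sum X \<longleftrightarrow> yd_braided X"
proof
 let ?V = "space X" and ?D = "%h F. csum H h F" and ?R = "%v F. rsum X v F"
 note [simp] = linear bilin_def trilin_def X co
 assume S: "yd_sum X"
 show "yd_braided X"
  unfolding yd_braided_def
 proof (intro ballI allI impI)
  fix h v F assume h: "h : el H" and v: "v : el ?V" and F: "bilin ?V K ground F"
  note [simp] = bilin_functional[OF F] h v
  have "?D h (%h1 h2. ?R (act X h2 v) (%w k. F w (k ** p h1)))
   = ?D h (%h1 h2. ?D h2 (%b h5. ?D b (%h3 h4. ?R v (%w k. F (act X h4 w) ((p h5 ** (k ** u h3)) ** p h1)))))"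
   using S[unfolded yd_sum_def, rule_format, OF _ v, of _ "%w k. F w (k ** p _)"] by simp
  also have "... = ?D h (%h1 h2. ?D h1 (%a b. ?D b (%h3 h4. ?R v (%w k. F (act X h4 w) ((p h2 ** (k ** u h3)) ** p a)))))"
   by (rule H.sum_coassoc[symmetric]) simp_all
  also have "... = ?D h (%h1 h2. ?D h1 (%b h4. ?D b (%a h3. ?R v (%w k. F (act X h4 w) ((p h2 ** (k ** u h3)) ** p a)))))"
   by (rule tsum_cong[OF HOL.refl], rule H.sum_coassoc[symmetric]) simp_all
  also have "... = ?D h (%h1 h2. ?D h1 (%b h4. ?R v (%w k. ?D b (%a h3. F (act X h4 w) ((p h2 ** k) ** (u h3 ** p a))))))"
   by (simp add: K.m_assoc) (rule tsum_cong[OF HOL.refl], rule tsum_cong[OF HOL.refl], rule tsum_swap)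
  also have "... = ?D h (%h1 h2. ?D h1 (%b h4. ?R v (%w k. counit H b * F (act X h4 w) (p h2 ** k))))"
   using sum_u_left[of _ "%z. F (act X _ _) ((p _ ** _) ** z)"] by simp
  also have "... = ?D h (%h1 h2. ?D h1 (%b h4. counit H b * ?R v (%w k. F (act X h4 w) (p h2 ** k))))"
   by (simp add: tsum_times)
  also have "... = ?D h (%h1 h2. ?R v (%w k. F (act X h1 w) (p h2 ** k)))"
   by (simp add: H.sum_counit_left)
  finally show "?D h (%h1 h2. ?R (act X h2 v) (%w k. F w (k ** p h1)))
   = ?D h (%h1 h2. ?R v (%w k. F (act X h1 w) (p h2 ** k)))" .
 qed
next
 let ?V = "space X" and ?D = "%h F. csum H h F" and ?R = "%v F. rsum X v F"
 note [simp] = linear bilin_def trilin_def X co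
 assume S: "yd_braided X"
 show "yd_sum X"
  unfolding yd_sum_def
 proof (intro ballI allI impI)
  fix h v F assume h: "h : el H" and v: "v : el ?V" and F: "bilin ?V K ground F"
  note [simp] = bilin_functional[OF F] h v
  have "?D h (%b h3. ?D b (%h1 h2. ?R v (%w k. F (act X h2 w) (p h3 ** (k ** u h1)))))
   = ?D h (%h1 b. ?D b (%h2 h3. ?R v (%w k. F (act X h2 w) ((p h3 ** k) ** u h1))))"
   by (subst H.sum_coassoc) (simp_all add: K.m_assoc)
  also have "... = ?D h (%h1 b. ?D b (%h2 h3. ?R (act X h3 v) (%w k. F w ((k ** p h2) ** u h1))))"
   using S[unfolded yd_braided_def, rule_format, OF _ v, of _ "%w k. F w (k ** u _)"] by simp
  also have "... = ?D h (%b h3. ?D b (%h1 h2. ?R (act X h3 v) (%w k. F w (k ** (p h2 ** u h1)))))"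
   by (subst H.sum_coassoc) (simp_all add: K.m_assoc)
  also have "... = ?D h (%b h3. ?R (act X h3 v) (%w k. ?D b (%h1 h2. F w (k ** (p h2 ** u h1)))))"
   by (rule tsum_cong[OF HOL.refl], rule tsum_swap)
  also have "... = ?D h (%b h3. ?R (act X h3 v) (%w k. counit H b * F w k))"
   using sum_u_right[of _ "%z. F _ (_ ** z)"] by simp
  also have "... = ?R (act X h v) F"
   using F by (simp add: tsum_times H.sum_counit_left)
  finally show "?R (act X h v) F = ?D h (%b h3. ?D b (%h1 h2. ?R v (%w k. F (act X h2 w) (p h3 ** (k ** u h1)))))" by simp
 qed
qed

lemma yd_twisted_iff_braided: "yd_twisted X \<longleftrightarrow> yd_braided X"
proof
 let ?V = "space X" and ?D = "%h F. csum H h F" and ?R = "%v F. rsum X v F"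
 note [simp] = linear bilin_def trilin_def X co
 assume S: "yd_twisted X"
 show "yd_braided X"
  unfolding yd_braided_def
 proof (intro ballI allI impI)
  fix h v F assume h: "h : el H" and v: "v : el ?V" and F: "bilin ?V K ground F"
  note [simp] = bilin_functional[OF F] h v
  have "?D h (%h1 h2. ?R v (%w k. F (act X h1 w) (p h2 ** k)))
   = ?D h (%h1 h2. ?D h1 (%b c. ?D b (%d e. ?R (act X e v) (%w k. F w (p h2 ** (q c ** (k ** p d)))))))"
   using S[unfolded yd_twisted_def, rule_format, OF _ v, of _ "%w k. F w (p _ ** k)"] by simp
  also have "... = ?D h (%b g. ?D g (%c h2. ?D b (%d e. ?R (act X e v) (%w k. F w (p h2 ** (q c ** (k ** p d)))))))"
   by (rule H.sum_coassoc) simp_all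
  also have "... = ?D h (%b g. ?D b (%d e. ?D g (%c h2. ?R (act X e v) (%w k. F w (p h2 ** (q c ** (k ** p d)))))))"
   by (rule tsum_cong[OF HOL.refl], rule tsum_swap)
  also have "... = ?D h (%b g. ?D b (%d e. ?R (act X e v) (%w k. ?D g (%c h2. F w ((p h2 ** q c) ** (k ** p d))))))"
   by (simp add: K.m_assoc) (rule tsum_cong[OF HOL.refl], rule tsum_cong[OF HOL.refl], rule tsum_swap)
  also have "... = ?D h (%b g. ?D b (%d e. ?R (act X e v) (%w k. counit H g * F w (k ** p d))))"
   using sum_q_right[of _ "%z. F _ (z ** (_ ** p _))"] by simp
  also have "... = ?D h (%b g. counit H g * ?D b (%d e. ?R (act X e v) (%w k. F w (k ** p d))))"
   by (simp add: tsum_times)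
  also have "... = ?D h (%h1 h2. ?R (act X h2 v) (%w k. F w (k ** p h1)))"
   by (simp add: H.sum_counit_right)
  finally show "?D h (%h1 h2. ?R (act X h2 v) (%w k. F w (k ** p h1)))
   = ?D h (%h1 h2. ?R v (%w k. F (act X h1 w) (p h2 ** k)))" by simp
 qed
next
 let ?V = "space X" and ?D = "%h F. csum H h F" and ?R = "%v F. rsum X v F"
 note [simp] = linear bilin_def trilin_def X co
 assume S: "yd_braided X"
 show "yd_twisted X"
  unfolding yd_twisted_def
 proof (intro ballI allI impI)
  fix h v F assume h: "h : el H" and v: "v : el ?V" and F: "bilin ?V K ground F"
  note [simp] = bilin_functional[OF F] h v
  have "?D h (%b h3. ?D b (%h1 h2. ?R (act X h2 v) (%w k. F w (q h3 ** (k ** p h1)))))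
   = ?D h (%b h3. ?D b (%h1 h2. ?R v (%w k. F (act X h1 w) (q h3 ** (p h2 ** k)))))"
   using S[unfolded yd_braided_def, rule_format, OF _ v, of _ "%w k. F w (q _ ** k)"] by simp
  also have "... = ?D h (%h1 b. ?D b (%h2 h3. ?R v (%w k. F (act X h1 w) ((q h3 ** p h2) ** k))))"
   by (subst H.sum_coassoc) (simp_all add: K.m_assoc)
  also have "... = ?D h (%h1 b. ?R v (%w k. ?D b (%h2 h3. F (act X h1 w) ((q h3 ** p h2) ** k))))"
   by (rule tsum_cong[OF HOL.refl], rule tsum_swap)
  also have "... = ?D h (%h1 b. ?R v (%w k. counit H b * F (act X h1 w) k))"
   using sum_q_left[of _ "%z. F (act X _ _) (z ** _)"] by simp
  also have "... = ?D h (%h1 b. counit H b * ?R v (%w k. F (act X h1 w) k))"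
   by (simp add: tsum_times)
  also have "... = ?R v (%w k. F (act X h w) k)" by (simp add: H.sum_counit_right)
  finally show "?R v (%w k. F (act X h w) k)
   = ?D h (%b h3. ?D b (%h1 h2. ?R (act X h2 v) (%w k. F w (q h3 ** (k ** p h1)))))" by simp
 qed
qed

lemma yd_condition_iff: "yd_condition H K \<sigma> X \<longleftrightarrow> yd_braided X"
 using yd_condition_iff_sum yd_sum_iff_braided by simp

end

end

lemma tlift_closed:
 assumes "vsp V" "vsp W" "vsp Z" "t : el (tensor V W)" "\<And>a b. a : el V ==> b : el W ==> F a b : el Z"
 shows "tlift Z F t : el Z"
 using tensor_carrier_lists[OF assms(1,2,4)] assms unfolding tlift_vsum by (intro vsum_closed) auto

lemma tlift_param:
 assumes "vsp V" "vsp W" "vsp Z" "t : el (tensor V W)"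
  "\<And>a b. a : el V ==> b : el W ==> (%x. F x a b) : lin U Z"
 shows "(%x. tlift Z (F x) t) : lin U Z"
 using tensor_carrier_lists[OF assms(1,2,4)] assms unfolding tlift_vsum case_prod_unfold by (intro lin_vsum) auto

lemma tsum_add: "tsum V W t (%a b. F a b + G a b) = tsum V W t F + tsum V W t G"
 unfolding tsum_def case_prod_unfold by (simp add: sum_list_addf)

lemma trilin_rule:
 assumes "trilin U V W F"
 shows "f : lin Z U ==> v : el V ==> w : el W ==> (%x. F (f x) v w) : lin Z ground"
  and "g : lin Z V ==> u : el U ==> w : el W ==> (%x. F u (g x) w) : lin Z ground"
  and "h : lin Z W ==> u : el U ==> v : el V ==> (%x. F u v (h x)) : lin Z ground"
 using assms lin_comp[of "%u. F u v w" U ground f Z] lin_comp[of "%v. F u v w" V ground g Z]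
  lin_comp[of "%w. F u v w" W ground h Z] unfolding trilin_def by blast+

context surjective_pairing begin

section \<open>Tensor products of Yetter-Drinfeld modules\<close>

abbreviation yd :: "('k, 'h, 'b, 'u) ydmod => bool" where
 "yd X \<equiv> fd_lmodule H X \<and> rcomodule K X \<and> yd_condition H K \<sigma> X"

lemma yd_tensor_sel [simp]: "space (yd_tensor H K X Y) = ut X Y"
 "act (yd_tensor H K X Y) = act (lmod_tensor H X Y)"
 by (simp_all add: yd_tensor_def Let_def)

lemma yd_unit_sel [simp]: "space (yd_unit H K) = uscalars" "act (yd_unit H K) = act (lmod_unit H)"
 "coact (yd_unit H K) (Scalar c) = pure uscalars K (Scalar c) eK"
 by (simp_all add: yd_unit_def)

context
 fixes X Y :: "('k, 'h, 'b, 'u) ydmod"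
 assumes X: "fd_lmodule H X" "rcomodule K X" and Y: "fd_lmodule H Y" "rcomodule K Y"
begin

abbreviation "T \<equiv> ut X Y"
abbreviation "TK \<equiv> tensor (ut X Y) K"
abbreviation "co_inner v0 v1 w \<equiv> tlift TK (%w0 w1. pure T K (up X Y v0 w0) (w1 ** v1)) (coact Y w)"
abbreviation "co_outer v w \<equiv> tlift TK (%v0 v1. co_inner v0 v1 w) (coact X v)"

lemma co_inner_bilin: "v0 : el (sp X) ==> v1 : el K ==>
  bilin (sp Y) K TK (%w0 w1. pure T K (up X Y v0 w0) (w1 ** v1))"
 using X Y by (intro bilinI) (simp_all add: linear)

lemma co_inner_closed: "v0 : el (sp X) ==> v1 : el K ==> w : el (sp Y) ==> co_inner v0 v1 w : el TK"
 using X Y by (intro tlift_closed[of "space Y" K]) simp_all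

lemma co_outer_inner_bilin: "w : el (sp Y) ==> bilin (sp X) K TK (%v0 v1. co_inner v0 v1 w)"
 using X Y by (intro bilinI tlift_param[of "space Y" K]) (simp_all add: linear)

lemma co_outer_bilin: "bilin (sp X) (sp Y) TK co_outer"
proof (rule bilinI)
 fix v assume v: "v : el (sp X)"
 show "(%w. co_outer v w) : lin (sp Y) TK"
 proof (rule tlift_param[of "space X" K])
  fix a b assume "a : el (sp X)" "b : el K"
  then show "(%w. co_inner a b w) : lin (sp Y) TK"
   using X Y by (intro lin_comp[OF tlift_lin coact_lin] co_inner_bilin) simp_all
 qed (use v X Y in simp_all)
next
 fix w assume w: "w : el (sp Y)"
 then show "(%v. co_outer v w) : lin (sp X) TK"
  using X Y by (intro lin_comp[OF tlift_lin coact_lin] co_outer_inner_bilin) simp_all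
qed

lemma tensor_coact_elin: "coact (yd_tensor H K X Y) : elin T TK"
 unfolding yd_tensor_def Let_def using co_outer_bilin X Y by (simp add: ulift_lin)

lemma tensor_coact_pure:
 assumes v: "v : el (sp X)" and w: "w : el (sp Y)" and F: "bilin T K ground F"
 shows "tsum T K (coact (yd_tensor H K X Y) (up X Y v w)) F
  = rsum X v (%v0 v1. rsum Y w (%w0 w1. F (up X Y v0 w0) (w1 ** v1)))"
proof -
 have L: "(%t. tsum T K t F) : lin TK ground" using F X Y by (intro tsum_lin) simp_all
 have e: "coact (yd_tensor H K X Y) (up X Y v w) = co_outer v w"
  unfolding yd_tensor_def Let_def using co_outer_bilin X Y v w by (simp add: ulift_upure)
 have "tsum T K (co_outer v w) F = rsum X v (%v0 v1. tsum T K (co_inner v0 v1 w) F)"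
  using X Y v w co_inner_closed by (intro tlift_push[OF _ _ _ _ L]) simp_all
 also have "... = rsum X v (%v0 v1. rsum Y w (%w0 w1. F (up X Y v0 w0) (w1 ** v1)))"
  using X Y v w F tlift_push[of "space Y" K TK _ "%t. tsum T K t F", OF _ _ _ _ L]
  by (simp add: tsum_pure[OF vs_utensor K.vsA F])
 finally show ?thesis unfolding e .
qed

lemma rcomodule_tensor: "rcomodule K (yd_tensor H K X Y)"
proof -
 let ?c = "coact (yd_tensor H K X Y)" and ?V = "space X" and ?W = "space Y"
 note c = tensor_coact_elin
 note [simp] = linear bilin_def trilin_def X Y lin_comp[OF elin_lin[OF c]] elin_lin[OF c] tensor_coact_pure elin_closed[OF c]
 show ?thesis
 proof (subst rcomodule_iff)
  show "(\<forall>v\<in>el (sp (yd_tensor H K X Y)). \<forall>L\<in>lin (sp (yd_tensor H K X Y)) ground. tsum (sp (yd_tensor H K X Y)) K (?c v) (%v0 x. counit K x * L v0) = L v) \<and>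
  (\<forall>v\<in>el (sp (yd_tensor H K X Y)). \<forall>F. trilin (sp (yd_tensor H K X Y)) K K F \<longrightarrow>
   tsum (sp (yd_tensor H K X Y)) K (?c v) (%v0 x. tsum (sp (yd_tensor H K X Y)) K (?c v0) (%v00 y. F v00 y x))
   = tsum (sp (yd_tensor H K X Y)) K (?c v) (%v0 x. csum K x (%y z. F v0 y z)))"
   unfolding yd_tensor_sel
  proof (intro conjI ballI allI impI)
   fix t L assume t: "t : el T" and L: "L : lin T ground"
   note [simp] = L lin_comp[OF L]
   show "tsum T K (?c t) (%v0 x. counit K x * L v0) = L t"
   proof (rule utensor_ext[OF _ _ vs_ground _ L _ t])
    fix v w assume vw: "v : el ?V" "w : el ?W"
    have "tsum T K (?c (upure ?V ?W v w)) (%v0 x. counit K x * L v0)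
     = tsum ?V K (coact X v) (%v0 v1. tsum ?W K (coact Y w) (%w0 w1. counit K w1 * (counit K v1 * L (upure ?V ?W v0 w0))))"
     using vw by (simp add: K.counit_mult mult_ac)
    also have "... = L (upure ?V ?W v w)"
     using vw sum_coact_counit[of Y w "%z. counit K _ * L (upure ?V ?W _ z)"] sum_coact_counit[of X v "%z. L (upure ?V ?W z w)"]
     by simp
    finally show "tsum T K (?c (upure ?V ?W v w)) (%v0 x. counit K x * L v0) = L (upure ?V ?W v w)" .
   qed simp_all
  next
   fix t F assume t: "t : el T" and F: "trilin T K K F"
   have F': "\<And>f U k l. f : lin U T ==> k : el K ==> l : el K ==> (%x. F (f x) k l) : lin U ground"
    "\<And>f U s l. f : lin U K ==> s : el T ==> l : el K ==> (%x. F s (f x) l) : lin U ground"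
    "\<And>f U s k. f : lin U K ==> s : el T ==> k : el K ==> (%x. F s k (f x)) : lin U ground"
    using trilin_rule[OF F] by blast+
   note [simp] = F'
   show "tsum T K (?c t) (%v0 x. tsum T K (?c v0) (%v00 y. F v00 y x))
    = tsum T K (?c t) (%v0 x. csum K x (%y z. F v0 y z))"
   proof (rule utensor_ext[OF _ _ vs_ground _ _ _ t])
    fix v w assume vw: "v : el ?V" "w : el ?W"
    let ?X = "%v F. tsum ?V K (coact X v) F" and ?Y = "%v F. tsum ?W K (coact Y v) F" and ?D = "%x F. csum K x F"
    note [simp] = vw
    have "tsum T K (?c (upure ?V ?W v w)) (%v0 x. tsum T K (?c v0) (%v00 y. F v00 y x))
     = ?X v (%v0 v1. ?Y w (%w0 w1. ?X v0 (%v00 v01. ?Y w0 (%w00 w01. F (upure ?V ?W v00 w00) (w01 ** v01) (w1 ** v1)))))"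
     by simp
    also have "... = ?X v (%v0 v1. ?X v0 (%v00 v01. ?Y w (%w0 w1. ?Y w0 (%w00 w01. F (upure ?V ?W v00 w00) (w01 ** v01) (w1 ** v1)))))"
     by (rule tsum_cong[OF HOL.refl], rule tsum_swap)
    also have "... = ?X v (%v0 v1. ?D v1 (%c d. ?Y w (%w0 w1. ?Y w0 (%w00 w01. F (upure ?V ?W v0 w00) (w01 ** c) (w1 ** d)))))"
     by (rule sum_coact_coassoc) simp_all
    also have "... = ?X v (%v0 v1. ?D v1 (%c d. ?Y w (%w0 w1. ?D w1 (%a b. F (upure ?V ?W v0 w0) (a ** c) (b ** d)))))"
     by (rule tsum_cong[OF HOL.refl], rule tsum_cong[OF HOL.refl], rule sum_coact_coassoc) simp_all
    also have "... = ?X v (%v0 v1. ?Y w (%w0 w1. ?D v1 (%c d. ?D w1 (%a b. F (upure ?V ?W v0 w0) (a ** c) (b ** d)))))"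
     by (rule tsum_cong[OF HOL.refl], rule tsum_swap)
    also have "... = ?X v (%v0 v1. ?Y w (%w0 w1. ?D (w1 ** v1) (%y z. F (upure ?V ?W v0 w0) y z)))"
     by (simp add: K.sum_comult_mult) (rule tsum_cong[OF HOL.refl], rule tsum_cong[OF HOL.refl], rule tsum_swap)
    also have "... = tsum T K (?c (upure ?V ?W v w)) (%v0 x. ?D x (%y z. F v0 y z))" by simp
    finally show "tsum T K (?c (upure ?V ?W v w)) (%v0 x. tsum T K (?c v0) (%v00 y. F v00 y x))
      = tsum T K (?c (upure ?V ?W v w)) (%v0 x. ?D x (%y z. F v0 y z))" .
   qed simp_all
  qed
 qed (use c fdvs_utensor[of ?V ?W] X Y in auto)
qed

lemma fd_lmodule_yd_tensor: "fd_lmodule H (yd_tensor H K X Y)"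
 using H.fd_lmodule_tensor[OF X(1) Y(1)] fd_lmodule_cong[of "yd_tensor H K X Y" "lmod_tensor H X Y" H]
 unfolding fd_lmodule_def by simp

text \<open>The braided form passes to tensor products: it moves \<open>h\<close> past one factor at a time.\<close>

lemma yd_braided_tensor:
 assumes yX: "yd_braided X" and yY: "yd_braided Y"
 shows "yd_braided (yd_tensor H K X Y)"
 unfolding yd_braided_def yd_tensor_sel
proof (intro ballI allI impI)
 let ?c = "coact (yd_tensor H K X Y)" and ?V = "space X" and ?W = "space Y" and ?a = "act (lmod_tensor H X Y)"
 let ?X = "%v F. tsum ?V K (coact X v) F" and ?Y = "%v F. tsum ?W K (coact Y v) F" and ?D = "%x F. csum H x F"
 note c = tensor_coact_elin
 note [simp] = linear bilin_def trilin_def X Y lin_comp[OF elin_lin[OF c]] elin_lin[OF c] tensor_coact_pure elin_closed[OF c]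
 fix h t F assume h: "h : el H" and t: "t : el T" and F: "bilin T K ground F"
 have F': "\<And>f U k. f : lin U T ==> k : el K ==> (%x. F (f x) k) : lin U ground"
  "\<And>f U s. f : lin U K ==> s : el T ==> (%x. F s (f x)) : lin U ground"
  using bilin_left[OF F] bilin_right[OF F] by blast+
 note [simp] = F' h
 show "?D h (%h1 h2. tsum T K (?c (?a h2 t)) (%w k. F w (k ** p h1)))
  = ?D h (%h1 h2. tsum T K (?c t) (%w k. F (?a h1 w) (p h2 ** k)))"
 proof (rule utensor_ext[OF _ _ vs_ground _ _ _ t])
  fix v w assume vw: "v : el ?V" "w : el ?W"
  note [simp] = vw
  have "?D h (%h1 h2. tsum T K (?c (?a h2 (upure ?V ?W v w))) (%w k. F w (k ** p h1)))
   = ?D h (%h1 h2. ?D h2 (%h3 h4. tsum T K (?c (upure ?V ?W (act X h3 v) (act Y h4 w))) (%w k. F w (k ** p h1))))"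
   using H.tensor_act_pure[OF X(1) Y(1) _ vw, of _ "%t. tsum T K (?c t) (%w k. F w (k ** p _))"] by simp
  also have "... = ?D h (%h1 h2. ?D h2 (%h3 h4. ?X (act X h3 v) (%v0 v1. ?Y (act Y h4 w) (%w0 w1. F (upure ?V ?W v0 w0) ((w1 ** v1) ** p h1)))))"
   by simp
  also have "... = ?D h (%h1 h2. ?D h1 (%h3 h4. ?X (act X h4 v) (%v0 v1. ?Y (act Y h2 w) (%w0 w1. F (upure ?V ?W v0 w0) (w1 ** (v1 ** p h3))))))"
   by (subst H.sum_coassoc[symmetric]) (simp_all add: K.m_assoc)
  also have "... = ?D h (%h1 h2. ?D h1 (%h3 h4. ?X v (%v0 v1. ?Y (act Y h2 w) (%w0 w1. F (upure ?V ?W (act X h3 v0) w0) (w1 ** (p h4 ** v1))))))"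
   using yX[unfolded yd_braided_def, rule_format, OF _ vw(1), of _ "%x k. ?Y (act Y _ w) (%w0 w1. F (upure ?V ?W x w0) (w1 ** k))"] by simp
  also have "... = ?D h (%h1 h2. ?D h2 (%h3 h4. ?X v (%v0 v1. ?Y (act Y h4 w) (%w0 w1. F (upure ?V ?W (act X h1 v0) w0) (w1 ** (p h3 ** v1))))))"
   by (rule H.sum_coassoc) simp_all
  also have "... = ?D h (%h1 h2. ?X v (%v0 v1. ?D h2 (%h3 h4. ?Y (act Y h4 w) (%w0 w1. F (upure ?V ?W (act X h1 v0) w0) ((w1 ** p h3) ** v1)))))"
   by (simp add: K.m_assoc) (rule tsum_cong[OF HOL.refl], rule tsum_swap)
  also have "... = ?D h (%h1 h2. ?X v (%v0 v1. ?D h2 (%h3 h4. ?Y w (%w0 w1. F (upure ?V ?W (act X h1 v0) (act Y h3 w0)) ((p h4 ** w1) ** v1)))))"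
   using yY[unfolded yd_braided_def, rule_format, OF _ vw(2), of _ "%x k. F (upure ?V ?W (act X _ _) x) (k ** _)"] by simp
  also have "... = ?D h (%h1 h2. ?D h2 (%h3 h4. ?X v (%v0 v1. ?Y w (%w0 w1. F (upure ?V ?W (act X h1 v0) (act Y h3 w0)) (p h4 ** (w1 ** v1))))))"
   by (simp add: K.m_assoc) (rule tsum_cong[OF HOL.refl], rule tsum_swap)
  also have "... = ?D h (%h1 h2. ?D h1 (%h3 h4. ?X v (%v0 v1. ?Y w (%w0 w1. F (upure ?V ?W (act X h3 v0) (act Y h4 w0)) (p h2 ** (w1 ** v1))))))"
   by (rule H.sum_coassoc[symmetric]) simp_all
  also have "... = ?D h (%h1 h2. ?X v (%v0 v1. ?Y w (%w0 w1. ?D h1 (%h3 h4. F (upure ?V ?W (act X h3 v0) (act Y h4 w0)) (p h2 ** (w1 ** v1))))))"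
   by (rule tsum_cong[OF HOL.refl], subst tsum_swap, rule tsum_cong[OF HOL.refl], rule tsum_swap)
  also have "... = ?D h (%h1 h2. ?X v (%v0 v1. ?Y w (%w0 w1. F (?a h1 (upure ?V ?W v0 w0)) (p h2 ** (w1 ** v1)))))"
   using H.tensor_act_pure[OF X(1) Y(1), where L = "%t. F t (p _ ** (_ ** _))"] by simp
  also have "... = ?D h (%h1 h2. tsum T K (?c (upure ?V ?W v w)) (%w k. F (?a h1 w) (p h2 ** k)))" by simp
  finally show "?D h (%h1 h2. tsum T K (?c (?a h2 (upure ?V ?W v w))) (%w k. F w (k ** p h1)))
   = ?D h (%h1 h2. tsum T K (?c (upure ?V ?W v w)) (%w k. F (?a h1 w) (p h2 ** k)))" .
 qed simp_all
qed

end

lemma yd_tensor_yd: "yd X ==> yd Y ==> yd (yd_tensor H K X Y)"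
 using rcomodule_tensor[of X Y] fd_lmodule_yd_tensor[of X Y] yd_braided_tensor[of X Y]
  yd_condition_iff[of X] yd_condition_iff[of Y] yd_condition_iff[of "yd_tensor H K X Y"] by blast

lemma yd_unit_yd: "yd (yd_unit H K :: ('k, 'h, 'b, 'u) ydmod)"
proof -
 let ?U = "yd_unit H K :: ('k, 'h, 'b, 'u) ydmod" and ?S = "uscalars :: ('k, 'u) space"
 have a: "fd_lmodule H ?U"
  using H.fd_lmodule_unit unfolding fd_lmodule_def by simp
 have c: "coact ?U : elin ?S (tensor ?S K)"
  unfolding yd_unit_def by (simp add: pure_rule1 lin_id del: uscalars_simps)
 have r: "rcomodule K ?U"
 proof (subst rcomodule_iff)
  show "(\<forall>v\<in>el (sp ?U). \<forall>L\<in>lin (sp ?U) ground. tsum (sp ?U) K (coact ?U v) (%v0 x. counit K x * L v0) = L v) \<and>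
  (\<forall>v\<in>el (sp ?U). \<forall>F. trilin (sp ?U) K K F \<longrightarrow>
   tsum (sp ?U) K (coact ?U v) (%v0 x. tsum (sp ?U) K (coact ?U v0) (%v00 y. F v00 y x))
   = tsum (sp ?U) K (coact ?U v) (%v0 x. csum K x (%y z. F v0 y z)))"
   unfolding yd_unit_sel
  proof (intro conjI ballI allI impI)
   fix s L assume s: "s : el ?S" and L: "L : lin ?S ground"
   then obtain r where r: "s = Scalar r" by auto
   have "bilin ?S K ground (%v0 x. counit K x * L v0)" using L by (intro bilinI linear) (auto intro: lin_id)
   then show "tsum ?S K (coact ?U s) (%v0 x. counit K x * L v0) = L s"
    using tsum_pure[OF vs_uscalars K.vsA, of "%v0 x. counit K x * L v0" "Scalar r" "eK"] by (simp add: r K.counit_one)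
  next
   fix s F assume s: "s : el ?S" and F: "trilin ?S K K F"
   then obtain r where r: "s = Scalar r" by auto
   have b1: "bilin ?S K ground (%v00 y. F v00 y eK)"
    and b4: "bilin K K ground (F (Scalar r))" using F unfolding trilin_def bilin_def by auto
   have e: "tsum ?S K (pure ?S K (Scalar c) eK) (%v00 y. F v00 y k) = F (Scalar c) eK k" if "k : el K" for c k
   proof -
    have "bilin ?S K ground (%v00 y. F v00 y k)" using F that unfolding trilin_def bilin_def by auto
    then show ?thesis by (subst tsum_pure) auto
   qed
   have F': "\<And>f U k l. f : lin U ?S ==> k : el K ==> l : el K ==> (%x. F (f x) k l) : lin U ground"
    using F lin_comp[of "%x. F x _ _" ?S ground] unfolding trilin_def by blast
   have F'': "(%x. F v eK x) : lin K ground" if "v : el ?S" for v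
    using F that unfolding trilin_def by blast
   have b2: "bilin ?S K ground (%v0 x. F v0 eK x)"
    using F unfolding trilin_def bilin_def by auto
   have b3: "bilin ?S K ground (%v0 x. csum K x (%y z. F v0 y z))"
    using F by (intro bilinI linear K.vsA) (auto simp: trilin_def bilin_def)
   have "tsum ?S K (pure ?S K (Scalar r) eK) (%v0 x. tsum ?S K (coact ?U v0) (%v00 y. F v00 y x))
    = tsum ?S K (pure ?S K (Scalar r) eK) (%v0 x. F v0 eK x)"
    using e by (intro tsum_cong[OF HOL.refl]) auto
   also have "... = F (Scalar r) eK eK" using b2 by (subst tsum_pure) auto
   also have "... = tsum ?S K (pure ?S K (Scalar r) eK) (%v0 x. csum K x (%y z. F v0 y z))"
    using b3 b4 by (subst tsum_pure) (auto simp: K.sum_comult_one)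
   finally show "tsum ?S K (coact ?U s) (%v0 x. tsum ?S K (coact ?U v0) (%v00 y. F v00 y x))
    = tsum ?S K (coact ?U s) (%v0 x. csum K x (%y z. F v0 y z))" by (simp add: r)
  qed
 qed (use c fdvs_uscalars in simp_all)
 have "yd_braided ?U"
  unfolding yd_braided_def yd_unit_sel
 proof (intro ballI allI impI)
  fix h s F assume h: "h : el H" and s: "s : el ?S" and F: "bilin ?S K ground F"
  obtain r where r: "s = Scalar r" using s by auto
  have F1: "\<And>f U k. f : lin U ?S ==> k : el K ==> (%x. F (f x) k) : lin U ground"
   "\<And>f U s. f : lin U K ==> s : el ?S ==> (%x. F s (f x)) : lin U ground"
   using bilin_left[OF F] bilin_right[OF F] by blast+
  have sc: "F (Scalar (c * r)) k = c * F (Scalar r) k" if "k : el K" for c k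
   using lin_smult[OF bilin_lin1[OF F that], of "Scalar r" c] by simp
  have l: "(%k. F (Scalar r) (p k)) : lin H ground" using F1(2)[OF p_lin] by simp
  have e1: "tsum ?S K (pure ?S K (Scalar c) eK) (%w k. F w (k ** x)) = F (Scalar c) x" if "x : el K" for c x
  proof -
   have "bilin ?S K ground (%w k. F w (k ** x))"
    by (intro bilinI F1(2)[OF K.mult_rule1[OF lin_id]] F1(1)[OF lin_id]) (use that in simp_all)
   then show ?thesis using that by (subst tsum_pure) auto
  qed
  have e2: "tsum ?S K (pure ?S K (Scalar c) eK) (%w k. F (act (lmod_unit H) g w) (x ** k)) = F (act (lmod_unit H) g (Scalar c)) x"
   if "x : el K" "g : el H" for c g x
  proof -
   have al: "act (lmod_unit H) g : lin ?S ?S" using act_lin[OF H.fd_lmodule_unit that(2)] by simp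
   have "bilin ?S K ground (%w k. F (act (lmod_unit H) g w) (x ** k))"
    by (intro bilinI F1(2)[OF K.mult_rule2[OF lin_id]] F1(1)[OF al]) (use that lin_closed[OF al] in simp_all)
   then show ?thesis using that by (subst tsum_pure) (auto simp del: H.lmod_unit_sel(2))
  qed
  show "csum H h (%h1 h2. tsum ?S K (coact ?U (act (lmod_unit H) h2 s)) (%w k. F w (k ** p h1)))
   = csum H h (%h1 h2. tsum ?S K (coact ?U s) (%w k. F (act (lmod_unit H) h1 w) (p h2 ** k)))"
   using h l by (simp add: r e1 e2 sc H.sum_counit_left H.sum_counit_right)
 qed
 then show ?thesis using yd_condition_iff[OF a r] a r by blast
qed

end

context surjective_pairing begin

section \<open>The monoidal category of Yetter-Drinfeld modules\<close>

lemma comodule_map_iff: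
 fixes X Y :: "('k, 'h, 'b, 'u) ydmod"
 assumes X: "fd_lmodule H X" "rcomodule K X" and Y: "fd_lmodule H Y" "rcomodule K Y" and f: "f : lin (sp X) (sp Y)"
 shows "comodule_map K X Y f \<longleftrightarrow> (\<forall>v\<in>el (sp X). \<forall>F. bilin (sp Y) K ground F \<longrightarrow>
   rsum Y (f v) F = rsum X v (%v0 x. F (f v0) x))"
  (is "_ \<longleftrightarrow> ?R")
proof -
 let ?T = "tensor (sp Y) K"
 let ?t = "%v. tlift ?T (%v0 x. pure (sp Y) K (f v0) x) (coact X v)"
 note [simp] = linear bilin_def X Y
 note fc = lin_closed[OF f]
 have push: "L (?t v) = rsum X v (%v0 x. L (pure (sp Y) K (f v0) x))" if "v : el (sp X)" "L : lin ?T ground" for v L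
  using that fc by (intro tlift_push) simp_all
 have c: "?t v : el ?T" if "v : el (sp X)" for v
  using that fc by (intro tlift_closed[of "space X" K]) simp_all
 show ?thesis
 proof
  assume m: "comodule_map K X Y f"
  show ?R
  proof (intro ballI allI impI)
   fix v F assume v: "v : el (sp X)" and F: "bilin (sp Y) K ground F"
   show "rsum Y (f v) F = rsum X v (%v0 x. F (f v0) x)"
    using m v push[OF v tsum_lin[OF _ _ F]] fc by (simp add: comodule_map_def tsum_pure[OF _ _ F])
  qed
 next
  assume R: ?R
  show "comodule_map K X Y f"
   unfolding comodule_map_def
  proof
   fix v assume v: "v : el (sp X)"
   show "coact Y (f v) = ?t v"
   proof (rule ev_eqI[of ?T])
    fix \<phi>
    have "bilin (sp Y) K ground (%w k. ev ?T \<phi> (pure (sp Y) K w k))" by simp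
    then show "ev ?T \<phi> (coact Y (f v)) = ev ?T \<phi> (?t v)"
     using R v fc[OF v] tensor_functional_expand[OF _ _ ev_lin[of ?T \<phi>], of "coact Y (f v)"] by (simp add: push[OF v ev_lin])
   qed (use v fc c in simp_all)
  qed
 qed
qed

lemma comodule_mapD:
 assumes "fd_lmodule H X" "rcomodule K X" "fd_lmodule H Y" "rcomodule K Y" "f : lin (sp X) (sp Y)"
  "comodule_map K X Y f" "v : el (sp X)" "bilin (sp Y) K ground F"
 shows "rsum Y (f v) F = rsum X v (%v0 x. F (f v0) x)"
 using comodule_map_iff[OF assms(1-5)] assms(6-8) by blast

lemma bilin_comp_left: "bilin V W Z F ==> f : lin U V ==> bilin U W Z (%x y. F (f x) y)"
 by (rule bilinI, rule bilin_lin2, assumption, rule lin_closed, assumption+, rule bilin_left)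

lemma truncate_sel [simp]: "space (lmod.truncate X) = space X" "act (lmod.truncate X) = act X"
 by (simp_all add: lmod.truncate_def)

lemma truncate_tensor: "lmod.truncate (yd_tensor H K X Y) = lmod_tensor H (lmod.truncate X) (lmod.truncate Y)"
 by (simp add: lmod_tensor_def Let_def lmod.truncate_def yd_tensor_def)

lemma truncate_unit: "lmod.truncate (yd_unit H K) = lmod_unit H"
 by (simp add: lmod_unit_def lmod.truncate_def yd_unit_def)

lemma fd_lmodule_truncate: "fd_lmodule H (lmod.truncate X) \<longleftrightarrow> fd_lmodule H X"
 by (simp only: fd_lmodule_def truncate_sel)

lemma module_map_truncate: "module_map H X Y f \<longleftrightarrow> module_map H (lmod.truncate X) (lmod.truncate Y) f"
 by (simp only: module_map_def truncate_sel)

lemma comodule_map_ten: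
 assumes X: "fd_lmodule H X" "rcomodule K X" and X': "fd_lmodule H X'" "rcomodule K X'"
  and Y: "fd_lmodule H Y" "rcomodule K Y" and Y': "fd_lmodule H Y'" "rcomodule K Y'"
  and f: "f : lin (sp X) (sp Y)" "comodule_map K X Y f" and g: "g : lin (sp X') (sp Y')" "comodule_map K X' Y' g"
 shows "comodule_map K (yd_tensor H K X X') (yd_tensor H K Y Y') (tmap (sp X) (sp X') (sp Y) (sp Y') f g)"
proof -
 let ?h = "tmap (sp X) (sp X') (sp Y) (sp Y') f g"
 let ?T = "ut X X'" and ?T' = "ut Y Y'"
 note [simp] = linear X X' Y Y'
 have h: "?h : lin ?T ?T'" using f g by simp
 note c = tensor_coact_elin[OF X X'] tensor_coact_elin[OF Y Y']
 note fc = lin_closed[OF f(1)] and gc = lin_closed[OF g(1)]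
 show ?thesis
 proof (subst comodule_map_iff, unfold yd_tensor_sel)
  show "\<forall>t\<in>el ?T. \<forall>F. bilin ?T' K ground F \<longrightarrow> tsum ?T' K (coact (yd_tensor H K Y Y') (?h t)) F
    = tsum ?T K (coact (yd_tensor H K X X') t) (%v0 x. F (?h v0) x)"
  proof (intro ballI allI impI)
   fix t F assume t: "t : el ?T" and F: "bilin ?T' K ground F"
   note F' = bilin_left[OF F] bilin_right[OF F] bilin_comp_left[OF F h]
   show "tsum ?T' K (coact (yd_tensor H K Y Y') (?h t)) F = tsum ?T K (coact (yd_tensor H K X X') t) (%v0 x. F (?h v0) x)"
   proof (rule utensor_ext[OF _ _ vs_ground _ _ _ t])
    fix v w assume vw: "v : el (sp X)" "w : el (sp X')"
    have 1: "bilin (sp Y) K ground (%v0 v1. tsum (sp Y') K (coact Y' (g w)) (%w0 w1. F (up Y Y' v0 w0) (w1 ** v1)))"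
     using vw gc by (intro bilinI linear) (simp_all add: F')
    have 2: "bilin (sp Y') K ground (%w0 w1. F (up Y Y' v0 w0) (w1 ** v1))"
     if "v0 : el (sp Y)" "v1 : el K" for v0 v1
     using that by (intro bilinI) (simp_all add: F')
    have "tsum ?T' K (coact (yd_tensor H K Y Y') (?h (up X X' v w))) F
     = rsum Y (f v) (%v0 v1. tsum (sp Y') K (coact Y' (g w)) (%w0 w1. F (up Y Y' v0 w0) (w1 ** v1)))"
     using f g vw fc gc by (simp add: tensor_coact_pure[OF Y Y' _ _ F])
    also have "... = rsum X v (%v0 v1. tsum (sp X') K (coact X' w) (%w0 w1. F (up Y Y' (f v0) (g w0)) (w1 ** v1)))"
     using comodule_mapD[OF X Y f vw(1) 1] comodule_mapD[OF X' Y' g vw(2) 2] fc by simp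
    also have "... = tsum ?T K (coact (yd_tensor H K X X') (up X X' v w)) (%v0 x. F (?h v0) x)"
     using f g vw F' by (simp add: tensor_coact_pure[OF X X'])
    finally show "tsum ?T' K (coact (yd_tensor H K Y Y') (?h (up X X' v w))) F
     = tsum ?T K (coact (yd_tensor H K X X') (up X X' v w)) (%v0 x. F (?h v0) x)" .
   qed (use F h in \<open>simp_all add: F' lin_comp[OF elin_lin[OF c(1)]] lin_comp[OF elin_lin[OF c(2)]] elin_lin[OF c(1)] lin_comp[OF h]\<close>)
  qed
 qed (use h in \<open>simp_all add: rcomodule_tensor fd_lmodule_yd_tensor\<close>)
qed

lemma comodule_map_assoc:
 assumes X: "fd_lmodule H X" "rcomodule K X" and Y: "fd_lmodule H Y" "rcomodule K Y" and Z: "fd_lmodule H Z" "rcomodule K Z"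
 shows "comodule_map K (yd_tensor H K (yd_tensor H K X Y) Z) (yd_tensor H K X (yd_tensor H K Y Z)) (amap (sp X) (sp Y) (sp Z))"
proof -
 let ?h = "amap (sp X) (sp Y) (sp Z)" and ?XY = "yd_tensor H K X Y" and ?YZ = "yd_tensor H K Y Z"
 let ?T = "utensor (ut X Y) (sp Z)" and ?T' = "utensor (sp X) (ut Y Z)"
 note XY = fd_lmodule_yd_tensor[OF X Y] rcomodule_tensor[OF X Y] and YZ = fd_lmodule_yd_tensor[OF Y Z] rcomodule_tensor[OF Y Z]
 note [simp] = linear X Y Z XY YZ
 have h: "?h : lin ?T ?T'" by simp
 note c = tensor_coact_elin[OF XY Z, unfolded yd_tensor_sel] tensor_coact_elin[OF X YZ, unfolded yd_tensor_sel]
 note p1 = tensor_coact_pure[OF XY Z, unfolded yd_tensor_sel] and p2 = tensor_coact_pure[OF X YZ, unfolded yd_tensor_sel]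
 show ?thesis
 proof (subst comodule_map_iff, unfold yd_tensor_sel)
  show "\<forall>t\<in>el ?T. \<forall>F. bilin ?T' K ground F \<longrightarrow> tsum ?T' K (coact (yd_tensor H K X ?YZ) (?h t)) F
    = tsum ?T K (coact (yd_tensor H K ?XY Z) t) (%v0 x. F (?h v0) x)"
  proof (intro ballI allI impI)
   fix t F assume t: "t : el ?T" and F: "bilin ?T' K ground F"
   note F' = bilin_left[OF F] bilin_right[OF F]
   have Fh: "bilin ?T K ground (%v0 x. F (?h v0) x)" by (rule bilin_comp_left[OF F h])
   show "tsum ?T' K (coact (yd_tensor H K X ?YZ) (?h t)) F = tsum ?T K (coact (yd_tensor H K ?XY Z) t) (%v0 x. F (?h v0) x)"
   proof (rule utensor_ext3[OF _ _ _ vs_ground _ _ _ t])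
    fix x y z assume xyz: "x : el (sp X)" "y : el (sp Y)" "z : el (sp Z)"
    have 1: "bilin (ut Y Z) K ground (%w0 w1. F (upure (sp X) (ut Y Z) v0 w0) (w1 ** v1))"
     if "v0 : el (sp X)" "v1 : el K" for v0 v1
     using that by (intro bilinI) (simp_all add: F')
    have 2: "bilin (ut X Y) K ground (%s k. rsum Z z (%z0 z1. F (?h (upure (ut X Y) (sp Z) s z0)) (z1 ** k)))"
     using xyz h by (intro bilinI linear) (simp_all add: bilin_left[OF Fh] bilin_right[OF Fh])
    show "tsum ?T' K (coact (yd_tensor H K X ?YZ) (?h (upure (ut X Y) (sp Z) (up X Y x y) z))) F
     = tsum ?T K (coact (yd_tensor H K ?XY Z) (upure (ut X Y) (sp Z) (up X Y x y) z)) (%v0 x. F (?h v0) x)"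
     using xyz by (simp add: p1[OF _ _ Fh] p2[OF _ _ F] tensor_coact_pure[OF Y Z _ _ 1] tensor_coact_pure[OF X Y _ _ 2] K.m_assoc)
   qed (use F Fh h in \<open>simp_all add: elin_lin[OF c(1)] lin_comp[OF elin_lin[OF c(1)]] lin_comp[OF elin_lin[OF c(2)]]\<close>)
  qed
 qed (use h in \<open>simp_all add: rcomodule_tensor fd_lmodule_yd_tensor\<close>)
qed

lemma comodule_map_units:
 fixes X :: "('k, 'h, 'b, 'u) ydmod"
 assumes X: "fd_lmodule H X" "rcomodule K X"
 shows "comodule_map K (yd_tensor H K (yd_unit H K) X) X (lmap (sp X))"
  and "comodule_map K (yd_tensor H K X (yd_unit H K)) X (rmap (sp X))"
proof -
 let ?U = "yd_unit H K :: ('k, 'h, 'b, 'u) ydmod" and ?S = "uscalars :: ('k, 'u) space"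
 have U: "fd_lmodule H ?U" "rcomodule K ?U" using yd_unit_yd by auto
 note [simp] = linear X U
 note c = tensor_coact_elin[OF U X, unfolded yd_unit_sel] tensor_coact_elin[OF X U, unfolded yd_unit_sel]
 note p1 = tensor_coact_pure[OF U X, unfolded yd_unit_sel] and p2 = tensor_coact_pure[OF X U, unfolded yd_unit_sel]
 have l: "lmap (sp X) : lin (utensor ?S (sp X)) (sp X)" "rmap (sp X) : lin (utensor (sp X) ?S) (sp X)" by simp_all
 have cU: "coact ?U : lin ?S (tensor ?S K)" using coact_lin[of ?U] U by simp
 show "comodule_map K (yd_tensor H K (yd_unit H K) X) X (lmap (sp X))"
 proof (subst comodule_map_iff, unfold yd_tensor_sel yd_unit_sel)
  show "\<forall>t\<in>el (utensor ?S (sp X)). \<forall>F. bilin (sp X) K ground F \<longrightarrow> rsum X (lmap (sp X) t) F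
    = tsum (utensor ?S (sp X)) K (coact (yd_tensor H K ?U X) t) (%v0 x. F (lmap (sp X) v0) x)"
  proof (intro ballI allI impI)
   fix t F assume t: "t : el (utensor ?S (sp X))" and F: "bilin (sp X) K ground F"
   note F' = bilin_left[OF F] bilin_right[OF F] bilin_comp_left[OF F l(1)]
   show "rsum X (lmap (sp X) t) F = tsum (utensor ?S (sp X)) K (coact (yd_tensor H K ?U X) t) (%v0 x. F (lmap (sp X) v0) x)"
   proof (rule utensor_ext[OF _ _ vs_ground _ _ _ t])
    fix a v assume a: "a : el ?S" and v: "v : el (sp X)"
    then obtain r where r: "a = Scalar r" by auto
    have s: "rsum X (r \<odot>\<^bsub>space X\<^esub> v) F = r * rsum X v F"
     using lin_smult[OF lin_comp[OF tsum_lin[OF _ _ F] coact_lin] v] by simp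
    have s2: "F (r \<odot>\<^bsub>space X\<^esub> v0) k = r * F v0 k" if "v0 : el (sp X)" "k : el K" for v0 k
     using lin_smult[OF bilin_lin1[OF F that(2)] that(1)] by simp
    have b: "bilin ?S K ground (%v0 v1. rsum X v (%w0 w1. F (lmap (sp X) (upure ?S (sp X) v0 w0)) (w1 ** v1)))"
     using v l(1) by (intro bilinI linear) (simp_all add: bilin_left[OF F'(3)] bilin_right[OF F'(3)])
    show "tsum (sp X) K (coact X (lmap (sp X) (upure ?S (sp X) a v))) F
     = tsum (utensor ?S (sp X)) K (coact (yd_tensor H K ?U X) (upure ?S (sp X) a v)) (%v0 x. F (lmap (sp X) v0) x)"
     using v tsum_pure[OF vs_uscalars K.vsA b, of "Scalar r" "eK"] by (simp add: p1[OF _ _ F'(3)] r s s2 tsum_times)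
   qed (use F l in \<open>simp_all add: F' elin_lin[OF c(1)] lin_comp[OF elin_lin[OF c(1)]]\<close>)
  qed
 qed (use l in \<open>simp_all add: rcomodule_tensor fd_lmodule_yd_tensor\<close>)
 show "comodule_map K (yd_tensor H K X (yd_unit H K)) X (rmap (sp X))"
 proof (subst comodule_map_iff, unfold yd_tensor_sel yd_unit_sel)
  show "\<forall>t\<in>el (utensor (sp X) ?S). \<forall>F. bilin (sp X) K ground F \<longrightarrow> rsum X (rmap (sp X) t) F
    = tsum (utensor (sp X) ?S) K (coact (yd_tensor H K X ?U) t) (%v0 x. F (rmap (sp X) v0) x)"
  proof (intro ballI allI impI)
   fix t F assume t: "t : el (utensor (sp X) ?S)" and F: "bilin (sp X) K ground F"
   note F' = bilin_left[OF F] bilin_right[OF F] bilin_comp_left[OF F l(2)]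
   show "rsum X (rmap (sp X) t) F = tsum (utensor (sp X) ?S) K (coact (yd_tensor H K X ?U) t) (%v0 x. F (rmap (sp X) v0) x)"
   proof (rule utensor_ext[OF _ _ vs_ground _ _ _ t])
    fix a v assume a: "a : el ?S" and v: "v : el (sp X)"
    then obtain r where r: "a = Scalar r" by auto
    have s: "rsum X (r \<odot>\<^bsub>space X\<^esub> v) F = r * rsum X v F"
     using lin_smult[OF lin_comp[OF tsum_lin[OF _ _ F] coact_lin] v] by simp
    have s2: "F (r \<odot>\<^bsub>space X\<^esub> v0) k = r * F v0 k" if "v0 : el (sp X)" "k : el K" for v0 k
     using lin_smult[OF bilin_lin1[OF F that(2)] that(1)] by simp
    have b: "tsum ?S K (pure ?S K (Scalar r) eK) (%w0 w1. F (rmap (sp X) (upure (sp X) ?S v0 w0)) (w1 ** v1))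
      = r * F v0 v1" if v0: "v0 : el (sp X)" "v1 : el K" for v0 v1
    proof -
     have "bilin ?S K ground (%w0 w1. F (rmap (sp X) (upure (sp X) ?S v0 w0)) (w1 ** v1))"
      using v0 l(2) by (intro bilinI) (simp_all add: bilin_left[OF F'(3)] bilin_right[OF F'(3)])
     from tsum_pure[OF vs_uscalars K.vsA this, of "Scalar r" "eK"] show ?thesis using v0 by (simp add: s2)
    qed
    show "tsum (sp X) K (coact X (rmap (sp X) (upure (sp X) ?S v a))) F
     = tsum (utensor (sp X) ?S) K (coact (yd_tensor H K X ?U) (upure (sp X) ?S v a)) (%v0 x. F (rmap (sp X) v0) x)"
     using v by (simp add: p2[OF _ _ F'(3)] r s b tsum_times)
   qed (use F l in \<open>simp_all add: F' elin_lin[OF c(2)] lin_comp[OF elin_lin[OF c(2)]]\<close>)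
  qed
 qed (use l in \<open>simp_all add: rcomodule_tensor fd_lmodule_yd_tensor\<close>)
qed

lemma yd_map_inverse:
 assumes X: "fd_lmodule H X" "rcomodule K X" and Y: "fd_lmodule H Y" "rcomodule K Y"
  and f: "f : elin (sp X) (sp Y)" "module_map H X Y f" "comodule_map K X Y f"
  and g: "g : elin (sp Y) (sp X)"
  and gf: "\<And>v. v : el (sp X) ==> g (f v) = v" "\<And>w. w : el (sp Y) ==> f (g w) = w"
 shows "module_map H Y X g \<and> comodule_map K Y X g"
proof -
 note tr = module_map_truncate[symmetric] truncate_tensor[symmetric] truncate_unit[symmetric] fd_lmodule_truncate
 note cf = comodule_mapD[OF X Y elin_lin[OF f(1)] f(3)]
  have "comodule_map K Y X g"
  proof (subst comodule_map_iff[OF Y X elin_lin[OF g]], intro ballI allI impI)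
   fix w F assume w: "w : el (sp Y)" and F: "bilin (sp X) K ground F"
   show "rsum X (g w) F = rsum Y w (%v0 x. F (g v0) x)"
    using cf[of "g w", OF elin_closed[OF g w] bilin_comp_left[OF F elin_lin[OF g]]] gf w by simp
  qed
  then show "module_map H Y X g \<and> comodule_map K Y X g"
   using H.Rep.P_inv[of "lmod.truncate X" "lmod.truncate Y" f g] X Y f g gf by (simp add: tr)
qed

sublocale YD: structured_spaces "{X. yd X}" "space :: ('k, 'h, 'b, 'u) ydmod => _"
 "%X Y f. module_map H X Y f \<and> comodule_map K X Y f" "yd_tensor H K" "yd_unit H K"
proof (rule structured_spaces.intro)
 note tr = module_map_truncate[symmetric] truncate_tensor[symmetric] truncate_unit[symmetric] fd_lmodule_truncate
 fix X Y :: "('k, 'h, 'b, 'u) ydmod" and f g and a :: 'k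
 assume X': "X : {X. yd X}"
 then have X: "fd_lmodule H X" "rcomodule K X" by auto
 show "vsp (sp X)" using X by simp
 show "module_map H X X (\<lambda>v\<in>el (sp X). v) \<and> comodule_map K X X (\<lambda>v\<in>el (sp X). v)"
  using X H.Rep.P_id[of "lmod.truncate X"] by (simp add: tr comodule_map_iff lin_id)
 show "module_map H (yd_tensor H K (yd_unit H K) X) X (lmap (sp X)) \<and> comodule_map K (yd_tensor H K (yd_unit H K) X) X (lmap (sp X))"
  "module_map H (yd_tensor H K X (yd_unit H K)) X (rmap (sp X)) \<and> comodule_map K (yd_tensor H K X (yd_unit H K)) X (rmap (sp X))"
  using X H.Rep.P_lunit[of "lmod.truncate X"] H.Rep.P_runit[of "lmod.truncate X"] by (simp_all add: tr comodule_map_units)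
 assume Y': "Y : {X. yd X}"
 then have Y: "fd_lmodule H Y" "rcomodule K Y" by auto
 show "yd_tensor H K X Y : {X. yd X}" using yd_tensor_yd X' Y' by auto
 have z: "tsum (sp Y) K (coact Y \<zero>\<^bsub>space Y\<^esub>) F = 0" if "bilin (sp Y) K ground F" for F
  using lin_zero[OF _ _ lin_comp[OF tsum_lin[OF _ _ that] coact_lin]] Y by simp
 have z2: "F \<zero>\<^bsub>space Y\<^esub> k = 0" if "bilin (sp Y) K ground F" "k : el K" for F k
  using lin_zero[OF _ _ bilin_lin1[OF that]] Y by simp
 show "module_map H X Y (\<lambda>v\<in>el (sp X). \<zero>\<^bsub>space Y\<^esub>) \<and> comodule_map K X Y (\<lambda>v\<in>el (sp X). \<zero>\<^bsub>space Y\<^esub>)"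
  using X Y H.Rep.P_zero[of "lmod.truncate X" "lmod.truncate Y"] lin_zero_rule[of "space Y" "space X"]
  by (simp add: tr comodule_map_iff z z2)
 { fix Z :: "('k, 'h, 'b, 'u) ydmod"
 assume Z': "Z : {X. yd X}"
 then have Z: "fd_lmodule H Z" "rcomodule K Z" by auto
 show "module_map H (yd_tensor H K (yd_tensor H K X Y) Z) (yd_tensor H K X (yd_tensor H K Y Z)) (amap (sp X) (sp Y) (sp Z)) \<and>
  comodule_map K (yd_tensor H K (yd_tensor H K X Y) Z) (yd_tensor H K X (yd_tensor H K Y Z)) (amap (sp X) (sp Y) (sp Z))"
  using X Y Z H.Rep.P_assoc[of "lmod.truncate X" "lmod.truncate Y" "lmod.truncate Z"] by (simp add: tr comodule_map_assoc) }
 assume f': "f : elin (sp X) (sp Y)" "module_map H X Y f \<and> comodule_map K X Y f"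
 then have f: "f : lin (sp X) (sp Y)" "module_map H X Y f" "comodule_map K X Y f" by auto
 have l: "(%w. rsum Y w F) : lin (sp Y) ground" if "bilin (sp Y) K ground F" for F
  by (rule lin_comp[OF tsum_lin[OF _ _ that] coact_lin]) (use Y in simp_all)
 note s = lin_smult[OF l, unfolded ground_simps] lin_add[OF l, unfolded ground_simps]
 note s2 = lin_smult[OF bilin_lin1, unfolded ground_simps] lin_add[OF bilin_lin1, unfolded ground_simps]
 note cf = comodule_mapD[OF X Y f(1,3)] and fc = lin_closed[OF f(1)]
 show "module_map H X Y (\<lambda>v\<in>el (sp X). a \<odot>\<^bsub>space Y\<^esub> f v) \<and> comodule_map K X Y (\<lambda>v\<in>el (sp X). a \<odot>\<^bsub>space Y\<^esub> f v)"
  using X Y H.Rep.P_scale[of "lmod.truncate X" "lmod.truncate Y" f a] f' lin_smult_rule[of "space Y" f "space X" a]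
  by (simp add: tr comodule_map_iff s s2 fc cf tsum_times)
 { assume g': "g : elin (sp X) (sp Y)" "module_map H X Y g \<and> comodule_map K X Y g"
  then have g: "g : lin (sp X) (sp Y)" "module_map H X Y g" "comodule_map K X Y g" by auto
  note cg = comodule_mapD[OF X Y g(1,3)] and gc = lin_closed[OF g(1)]
  show "module_map H X Y (\<lambda>v\<in>el (sp X). f v \<oplus>\<^bsub>space Y\<^esub> g v) \<and> comodule_map K X Y (\<lambda>v\<in>el (sp X). f v \<oplus>\<^bsub>space Y\<^esub> g v)"
   using X Y H.Rep.P_add[of "lmod.truncate X" "lmod.truncate Y" f g] f' g' lin_add_rule[of "space Y" f "space X" g]
   by (simp add: tr comodule_map_iff s s2 fc gc cf cg tsum_add) }
 fix Z :: "('k, 'h, 'b, 'u) ydmod"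
 assume Z': "Z : {X. yd X}"
 then have Z: "fd_lmodule H Z" "rcomodule K Z" by auto
 { assume g': "g : elin (sp Y) (sp Z)" "module_map H Y Z g \<and> comodule_map K Y Z g"
  then have g: "g : lin (sp Y) (sp Z)" "module_map H Y Z g" "comodule_map K Y Z g" by auto
  have l: "compose (el (sp X)) g f : lin (sp X) (sp Z)"
   using elin_compose[OF _ f'(1) g'(1)] X by simp
  have "rsum Z (g (f v)) F = rsum X v (%v0 x. F (g (f v0)) x)"
   if v: "v : el (sp X)" and F: "bilin (sp Z) K ground F" for v F
   using comodule_mapD[OF Y Z g(1,3) fc[OF v] F] cf[OF v bilin_comp_left[OF F g(1)]] by simp
  then show "module_map H X Z (compose (el (sp X)) g f) \<and> comodule_map K X Z (compose (el (sp X)) g f)"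
   using X Y Z H.Rep.P_comp[of "lmod.truncate X" "lmod.truncate Y" "lmod.truncate Z" f g] f' g' l
   by (simp add: tr comodule_map_iff compose_eq) }
 fix W :: "('k, 'h, 'b, 'u) ydmod"
 assume W': "W : {X. yd X}"
 then have W: "fd_lmodule H W" "rcomodule K W" by auto
 assume g': "g : elin (sp Z) (sp W)" "module_map H Z W g \<and> comodule_map K Z W g"
 then show "module_map H (yd_tensor H K X Z) (yd_tensor H K Y W) (tmap (sp X) (sp Z) (sp Y) (sp W) f g) \<and>
  comodule_map K (yd_tensor H K X Z) (yd_tensor H K Y W) (tmap (sp X) (sp Z) (sp Y) (sp W) f g)"
  using X Y Z W f' H.Rep.P_ten[of "lmod.truncate X" "lmod.truncate Y" "lmod.truncate Z" "lmod.truncate W" f g] by (simp add: tr comodule_map_ten)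
next
 fix X Y :: "('k, 'h, 'b, 'u) ydmod" and f g
 assume "X : {X. yd X}" "Y : {X. yd X}" and f: "f : elin (sp X) (sp Y)" "g : elin (sp Y) (sp X)"
   "module_map H X Y f \<and> comodule_map K X Y f"
  and gf: "\<And>v. v : el (sp X) ==> g (f v) = v" "\<And>w. w : el (sp Y) ==> f (g w) = w"
 then have X: "fd_lmodule H X" "rcomodule K X" and Y: "fd_lmodule H Y" "rcomodule K Y" by auto
 show "module_map H Y X g \<and> comodule_map K Y X g"
  by (rule yd_map_inverse[OF X Y f(1) _ _ f(2) gf]) (use f(3) in simp_all)
qed (use yd_unit_yd in auto)

lemma YD_C: "YD.C = YD TYPE('u) H K \<sigma>"
 by (simp add: YD.C_def YD_def)

end

declare dual_hopf_simps [simp del]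

context structured_spaces begin

text \<open>Arrows are maps between underlying spaces, so nothing but the objects has to be translated.\<close>

lemma strict_iso_linear_tcat:
 assumes bij: "bij_betw Fo objs objs'" and sp': "\<And>X. X : objs ==> sp' (Fo X) = sp X"
  and P': "\<And>X Y f. X : objs ==> Y : objs ==> f : elin (sp X) (sp Y) ==> P' (Fo X) (Fo Y) f = P X Y f"
  and ten': "\<And>X Y. X : objs ==> Y : objs ==> Fo (ten X Y) = ten' (Fo X) (Fo Y)" and unit': "Fo unit = unit'"
 shows "strict_iso C (linear_tcat objs' sp' P' ten' unit') Fo (%(X, f, Y). (Fo X, f, Fo Y))"
proof -
 note sel = linear_tcat_def tmap_def[symmetric] amap_def[symmetric] lmap_def[symmetric] rmap_def[symmetric]
 have inj: "Fo X = Fo Y ==> X = Y" if "X : objs" "Y : objs" for X Y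
  using bij that by (auto simp: bij_betw_def inj_on_def)
 have img: "\<exists>X\<in>objs. A = Fo X" if "A : objs'" for A using bij that by (auto simp: bij_betw_def)
 have obj: "Fo X : objs'" if "X : objs" for X using bij that by (auto simp: bij_betw_def)
 show ?thesis
 proof (rule strict_iso.intro)
  show "bij_betw Fo (Obj C) (Obj (linear_tcat objs' sp' P' ten' unit'))" using bij by (simp add: C_sel linear_tcat_def)
  show "bij_betw (%(X, f, Y). (Fo X, f, Fo Y)) (Arr C) (Arr (linear_tcat objs' sp' P' ten' unit'))"
   unfolding bij_betw_def
  proof
   show "inj_on (%(X, f, Y). (Fo X, f, Fo Y)) (Arr C)" by (auto simp: inj_on_def C_sel dest: inj)
   show "(%(X, f, Y). (Fo X, f, Fo Y)) ` Arr C = Arr (linear_tcat objs' sp' P' ten' unit')"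
   proof (intro equalityI subsetI)
    fix h assume "h : (%(X, f, Y). (Fo X, f, Fo Y)) ` Arr C"
    then show "h : Arr (linear_tcat objs' sp' P' ten' unit')" by (auto simp: C_sel linear_tcat_def obj sp' P')
   next
    fix h assume h: "h : Arr (linear_tcat objs' sp' P' ten' unit')"
    then obtain A f B where a: "h = (A, f, B)" "A : objs'" "B : objs'" "f : elin (sp' A) (sp' B)" "P' A B f"
     by (auto simp: linear_tcat_def)
    then obtain X Y where XY: "X : objs" "A = Fo X" "Y : objs" "B = Fo Y" using img by meson
    then have "(X, f, Y) : Arr C" using a by (simp add: C_sel sp' P')
    then show "h : (%(X, f, Y). (Fo X, f, Fo Y)) ` Arr C" using a XY by (auto intro!: image_eqI)
   qed
  qed
  show "linear_monoidal_category C" by (rule C_monoidal)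
  fix f assume "f : Arr C"
  then show "Dom (linear_tcat objs' sp' P' ten' unit') ((%(X, f, Y). (Fo X, f, Fo Y)) f) = Fo (Dom C f)"
   "Cod (linear_tcat objs' sp' P' ten' unit') ((%(X, f, Y). (Fo X, f, Fo Y)) f) = Fo (Cod C f)"
   by (auto simp: C_sel linear_tcat_def)
 qed (auto simp: C_sel sel sp' ten'[symmetric] unit'[symmetric] elim!: HomE)
qed

end

context surjective_pairing begin

section \<open>The quantum double\<close>

text \<open>A fixed basis \<open>b\<close> of \<open>K\<close> with dual basis \<open>kd b\<close>.\<close>

definition kb where "kb = (SOME bs. dual_basis K bs)"
abbreviation kd where "kd b \<equiv> restrict (snd b) (el K)"

lemma kb: "dual_basis K kb"
 unfolding kb_def by (rule someI_ex[OF dual_basis_exists]) simp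

lemma kb_closed [simp]: "b : set kb ==> fst b : el K" "b : set kb ==> kd b : el Ks"
 using kb by (auto simp: dual_basis_def dual_hopf_simps)

lemma kb_sum: "L : lin K ground ==> x : el K ==> (\<Sum>b\<leftarrow>kb. kd b x * L (fst b)) = L x"
 using kb vsum_lin[of K ground L kb "%b. snd b x \<odot>\<^bsub>K\<^esub> fst b"]
 by (auto simp: dual_basis_def vsum_ground lin_smult intro!: arg_cong[where f = sum_list])

lemma kd_sum: "L : lin Ks ground ==> f : el Ks ==> (\<Sum>b\<leftarrow>kb. f (fst b) * L (kd b)) = L f"
proof -
 assume L: "L : lin Ks ground" and f: "f : el Ks"
 have "vsum Ks (%b. f (fst b) \<odot>\<^bsub>Ks\<^esub> kd b) kb = f"
  using dual_basis_dual_hopf[OF K.vsA kb] f unfolding dual_basis_def by (simp add: vsum_def foldr_map o_def)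
 then show ?thesis
  using vsum_lin[OF _ vs_ground L, of kb "%b. f (fst b) \<odot>\<^bsub>Ks\<^esub> kd b"] lin_smult[OF L kb_closed(2)]
  by (simp add: vsum_ground cong: map_cong)
qed

lemma tsum_sum_list: "tsum V W t (%a b. \<Sum>x\<leftarrow>xs. F x a b) = (\<Sum>x\<leftarrow>xs. tsum V W t (F x))"
 by (induction xs) (simp_all add: tsum_add)

lemma Ks_lin [linear]: "f : el Ks ==> f : lin K ground"
 by (simp add: dual_hopf_simps)

lemma Ks_rule1 [linear]: "f : el Ks ==> g : lin U K ==> (%x. f (g x)) : lin U ground"
 and Ks_rule2 [linear]: "x : el K ==> h : lin U Ks ==> (%u. h u x) : lin U ground"
 by (rule lin_comp[OF Ks_lin], assumption+) (rule lin_comp[OF eval_lin], assumption+)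

lemma Ks_mult_bilin: "bilin Ks Ks Ks (%f g. f *. g)"
proof (intro bilinI linI K.dual_mult_closed)
 note e = K.dual_mult tsum_add tsum_times[symmetric]
 note c = K.dual_mult_closed
 have ext: "f : extensional (el K)" if "f : el Ks" for f using that by (simp add: dual_hopf_simps)
 have cl: "f \<oplus>\<^bsub>Ks\<^esub> g : el Ks" "a \<odot>\<^bsub>Ks\<^esub> f : el Ks" if "f : el Ks" "g : el Ks" for f g a
  using that by simp_all
 fix f g h a assume f: "f : el Ks" and g: "g : el Ks"
 show "f *. (a \<odot>\<^bsub>Ks\<^esub> g) = a \<odot>\<^bsub>Ks\<^esub> (f *. g)" "(a \<odot>\<^bsub>Ks\<^esub> f) *. g = a \<odot>\<^bsub>Ks\<^esub> (f *. g)"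
  by (rule extensionalityI[OF ext ext]; use f g c cl in \<open>simp add: e dual_hopf_simps(4) algebra_simps\<close>)+
 assume h: "h : el Ks"
 show "f *. (g \<oplus>\<^bsub>Ks\<^esub> h) = (f *. g) \<oplus>\<^bsub>Ks\<^esub> (f *. h)" "(f \<oplus>\<^bsub>Ks\<^esub> g) *. h = (f *. h) \<oplus>\<^bsub>Ks\<^esub> (g *. h)"
  by (rule extensionalityI[OF ext ext]; use f g h c cl in \<open>simp add: e dual_hopf_simps(3) algebra_simps\<close>)+
qed

lemmas Ks_mult_rule [linear] = bilin_left[OF Ks_mult_bilin] bilin_right[OF Ks_mult_bilin]

lemma Ks_simps [simp]: "f : el Ks ==> g : el Ks ==> f *. g : el Ks" "eKs : el Ks" "vsp Ks"
 "f : el Ks ==> comult Ks f : el (tensor Ks Ks)" "x : el K ==> eKs x = counit K x"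
 using K.dual_one(2) by (simp_all add: K.dual_mult_closed K.dual_comult) (simp add: K.dual_one(1))

lemma Ks_mult_one: "f : el Ks ==> f *. eKs = f" "f : el Ks ==> eKs *. f = f"
proof -
 assume f: "f : el Ks"
 have ext: "f : extensional (el K)" if "f : el Ks" for f using that by (simp add: dual_hopf_simps)
 show "f *. eKs = f" "eKs *. f = f"
  by (rule extensionalityI[OF ext ext];
    use f K.sum_counit_left[OF _ Ks_lin] K.sum_counit_right[OF _ Ks_lin] in \<open>simp add: K.dual_mult mult.commute\<close>)+
qed

lemma dual_comult3:
 assumes f: "f : el Ks" and x: "x : el K" "y : el K" "z : el K"
 shows "csum Ks f (%g f3. csum Ks g (%f1 f2. f1 x * (f2 y * f3 z))) = f (x ** (y ** z))"
proof -
 have "csum Ks g (%f1 f2. f1 x * (f2 y * f3 z)) = g (x ** y) * f3 z" if "g : el Ks" for g f3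
  using K.dual_comult(2)[OF that x(1,2)] tsum_times(2)[of Ks Ks "comult Ks g" "%f1 f2. f1 x * f2 y" "f3 z"] by (simp add: mult.assoc)
 then have "csum Ks f (%g f3. csum Ks g (%f1 f2. f1 x * (f2 y * f3 z)))
  = csum Ks f (%g f3. g (x ** y) * f3 z)" by simp
 also have "... = f ((x ** y) ** z)" using K.dual_comult(2)[OF f] x by simp
 finally show ?thesis using x by (simp add: K.m_assoc)
qed

abbreviation DT where "DT \<equiv> tensor Ks H"
abbreviation D where "D \<equiv> quantum_double H K \<sigma>"

lemma D_sel: "el D = el DT" "zero D = zero DT" "add D = add DT" "smult D = smult DT"
 "\<one>\<^bsub>D\<^esub> = pure Ks H eKs eH"
 by (simp_all add: quantum_double_def Let_def)

lemma vs_D [simp]: "vsp D"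
 by (rule vs_cong[of DT]) (simp_all add: D_sel)

lemma lin_D: "f : lin D Z \<longleftrightarrow> f : lin DT Z"
proof
 assume f: "f : lin D Z"
 show "f : lin DT Z" using lin_closed[OF f] lin_add[OF f] lin_smult[OF f] by (intro linI) (simp_all add: D_sel)
next
 assume f: "f : lin DT Z"
 show "f : lin D Z" using lin_closed[OF f] lin_add[OF f] lin_smult[OF f] by (intro linI) (simp_all add: D_sel)
qed

text \<open>Expanding the middle tensor factor of the iterated coproduct of \<open>k'\<close> in a basis turns the
 product of the quantum double into a formula without coproducts in the dual of \<open>K\<close>.\<close>

lemma double_mult:
 assumes s: "s : el DT" and t: "t : el DT" and M: "M : lin DT ground"
 shows "s \<otimes>\<^bsub>D\<^esub> t : el DT"
  and "M (s \<otimes>\<^bsub>D\<^esub> t) = tsum Ks H s (%k h. tsum Ks H t (%k' h'.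
   csum H h (%c h3. csum H c (%h1 h2.
    \<Sum>b\<leftarrow>kb. k' (q h3 ** (fst b ** p h1)) * M (pure Ks H (k *. kd b) (h2 *: h'))))))"
proof -
 let ?S = "%k h k' h'. sweedler3 Ks DT (%k'1 k'2 k'3. sweedler3 H DT (%h1 h2 h3.
      (\<sigma> k'3 h1 * \<sigma> k'1 (antipode_inv H h3)) \<odot>\<^bsub>DT\<^esub> pure Ks H (k *. k'2) (h2 *: h')) h) k'"
 have m: "s \<otimes>\<^bsub>D\<^esub> t = tlift DT (%k h. tlift DT (?S k h) t) s"
  by (simp add: quantum_double_def Let_def)
 note cl = tlift_closed[of Ks Ks] tlift_closed[of H H] tlift_closed[of Ks H]
 have S: "?S k h k' h' : el DT" if "k : el Ks" "h : el H" "k' : el Ks" "h' : el H" for k h k' h'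
  using that unfolding sweedler3_def sweedler2_def by (intro cl) simp_all
 have M_S: "M (?S k h k' h') = csum H h (%c h3. csum H c (%h1 h2.
    \<Sum>b\<leftarrow>kb. k' (q h3 ** (fst b ** p h1)) * M (pure Ks H (k *. kd b) (h2 *: h'))))"
  if k: "k : el Ks" and h: "h : el H" and k': "k' : el Ks" and h': "h' : el H" for k h k' h'
 proof -
  have exp: "\<sigma> k3 h1 * \<sigma> k1 (antipode_inv H h3) * M (pure Ks H (k *. k2) (h2 *: h'))
   = (\<Sum>b\<leftarrow>kb. (k1 (q h3) * (k2 (fst b) * k3 (p h1))) * M (pure Ks H (k *. kd b) (h2 *: h')))"
   if "k1 : el Ks" "k2 : el Ks" "k3 : el Ks" "h1 : el H" "h2 : el H" "h3 : el H" for k1 k2 k3 h1 h2 h3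
  proof -
   have "(%f. M (pure Ks H (k *. f) (h2 *: h'))) : lin Ks ground"
    by (rule lin_comp[OF M]) (use that k h' in \<open>simp add: linear\<close>)
   from kd_sum[OF this that(2)] have "M (pure Ks H (k *. k2) (h2 *: h'))
     = (\<Sum>b\<leftarrow>kb. k2 (fst b) * M (pure Ks H (k *. kd b) (h2 *: h')))" by simp
   then show ?thesis
    using that by (simp add: p_dual mult_ac flip: sum_list_const_mult)
  qed
  have "M (?S k h k' h') = csum Ks k' (%g k3. csum Ks g (%k1 k2.
    csum H h (%c h3. csum H c (%h1 h2.
    \<sigma> k3 h1 * \<sigma> k1 (antipode_inv H h3) * M (pure Ks H (k *. k2) (h2 *: h'))))))"
  proof -
   let ?e = "%k1 k2 k3 h1 h2 h3. (\<sigma> k3 h1 * \<sigma> k1 (antipode_inv H h3)) \<odot>\<^bsub>DT\<^esub> pure Ks H (k *. k2) (h2 *: h')"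
   let ?e1 = "%k1 k2 k3 c h3. tlift DT (%h1 h2. ?e k1 k2 k3 h1 h2 h3) (comult H c)"
   let ?e2 = "%k1 k2 k3. tlift DT (?e1 k1 k2 k3) (comult H h)"
   let ?e3 = "%g k3. tlift DT (%k1 k2. ?e2 k1 k2 k3) (comult Ks g)"
   have e: "?e k1 k2 k3 h1 h2 h3 : el DT" if "k2 : el Ks" "h2 : el H" for k1 k2 k3 h1 h2 h3
    using that k h' by simp
   have e1: "?e1 k1 k2 k3 c h3 : el DT" if "k2 : el Ks" "c : el H" for k1 k2 k3 c h3
    by (rule cl) (use that e h k' in simp_all)
   have e2: "?e2 k1 k2 k3 : el DT" if "k2 : el Ks" for k1 k2 k3
    by (rule cl) (use that e1 h k' in simp_all)
   have e3: "?e3 g k3 : el DT" if "g : el Ks" for g k3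
    by (rule cl) (use that e2 h k' in simp_all)
   have s: "M (?e k1 k2 k3 h1 h2 h3) = \<sigma> k3 h1 * \<sigma> k1 (antipode_inv H h3) * M (pure Ks H (k *. k2) (h2 *: h'))"
    if "k2 : el Ks" "h2 : el H" for k1 k2 k3 h1 h2 h3
    using that k h' by (simp add: lin_smult[OF M])
   have s1: "M (?e1 k1 k2 k3 c h3) = csum H c (%h1 h2. M (?e k1 k2 k3 h1 h2 h3))"
    if "k2 : el Ks" "c : el H" for k1 k2 k3 c h3
    by (rule tlift_push) (use that e M h in simp_all)
   have s2: "M (?e2 k1 k2 k3) = csum H h (%c h3. M (?e1 k1 k2 k3 c h3))"
    if "k2 : el Ks" for k1 k2 k3
    by (rule tlift_push) (use that e1 M h in simp_all)
   have s3: "M (?e3 g k3) = csum Ks g (%k1 k2. M (?e2 k1 k2 k3))"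
    if "g : el Ks" for g k3
    by (rule tlift_push) (use that e2 M h in simp_all)
   have "M (tlift DT ?e3 (comult Ks k')) = csum Ks k' (%g k3. M (?e3 g k3))"
    by (rule tlift_push) (use e3 M k' in simp_all)
   then show ?thesis unfolding sweedler3_def sweedler2_def by (simp add: s s1 s2 s3)
  qed
  also have "... = csum Ks k' (%g k3. csum Ks g (%k1 k2.
    csum H h (%c h3. csum H c (%h1 h2.
    (\<Sum>b\<leftarrow>kb. (k1 (q h3) * (k2 (fst b) * k3 (p h1))) * M (pure Ks H (k *. kd b) (h2 *: h')))))))"
   by (simp add: exp)
  also have "... = csum H h (%c h3. csum H c (%h1 h2.
    csum Ks k' (%g k3. csum Ks g (%k1 k2.
    (\<Sum>b\<leftarrow>kb. (k1 (q h3) * (k2 (fst b) * k3 (p h1))) * M (pure Ks H (k *. kd b) (h2 *: h')))))))"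
   unfolding tsum_swap[of Ks Ks _ H H] ..
  also have "... = csum H h (%c h3. csum H c (%h1 h2.
    \<Sum>b\<leftarrow>kb. k' (q h3 ** (fst b ** p h1)) * M (pure Ks H (k *. kd b) (h2 *: h'))))"
   by (simp add: tsum_sum_list tsum_times(2) dual_comult3[OF k'] cong: map_cong)
  finally show ?thesis .
 qed
 show "s \<otimes>\<^bsub>D\<^esub> t : el DT" unfolding m using s t S by (intro cl) simp_all
 show "M (s \<otimes>\<^bsub>D\<^esub> t) = tsum Ks H s (%k h. tsum Ks H t (%k' h'.
   csum H h (%c h3. csum H c (%h1 h2.
    \<Sum>b\<leftarrow>kb. k' (q h3 ** (fst b ** p h1)) * M (pure Ks H (k *. kd b) (h2 *: h'))))))"
  unfolding m using s t M by (simp add: tlift_push[of Ks H DT _ M] cl(3) S M_S)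
qed

end

context surjective_pairing begin

text \<open>The action of \<open>K\<^sup>*\<close> that corresponds to the coaction.\<close>

definition kact :: "('k, 'h, 'b, 'u) ydmod => ('b => 'k) => ('k, 'u) univ => ('k, 'u) univ" where
 "kact X f v = tlift (sp X) (%w x. f x \<odot>\<^bsub>space X\<^esub> w) (coact X v)"

context
 fixes X :: "('k, 'h, 'b, 'u) ydmod"
 assumes V: "fdvs (sp X)" and X: "rcomodule K X"
begin

lemma kact_closed: "f : el Ks ==> v : el (sp X) ==> kact X f v : el (sp X)"
 unfolding kact_def by (rule tlift_closed[of "space X" K]) (use V X in simp_all)

lemma kact_push: "L : lin (sp X) ground ==> f : el Ks ==> v : el (sp X) ==>
  L (kact X f v) = rsum X v (%w x. f x * L w)"
 unfolding kact_def by (subst tlift_push[of "space X" K "space X" _ L]) (use V X in \<open>simp_all add: lin_smult\<close>)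

lemma kact_bilin: "bilin Ks (sp X) (sp X) (kact X)"
proof (rule bilinI)
 fix f assume f: "f : el Ks"
 have "bilin (sp X) K (sp X) (%w x. f x \<odot>\<^bsub>space X\<^esub> w)"
  using V f by (intro bilinI) (simp_all add: linear)
 then show "kact X f : lin (sp X) (sp X)"
  unfolding kact_def by (rule lin_comp[OF tlift_lin coact_lin, rotated 3]) (use V X in simp_all)
next
 fix v assume "v : el (sp X)"
 then show "(%f. kact X f v) : lin Ks (sp X)"
  unfolding kact_def by (intro tlift_param[of "space X" K]) (use V X in \<open>simp_all add: linear\<close>)
qed

lemmas kact_rule = bilin_left[OF kact_bilin] bilin_right[OF kact_bilin]

lemma kact_one: "v : el (sp X) ==> kact X eKs v = v"
 by (rule ev_eqI[of "space X"]) (use V X sum_coact_counit[OF V X] in \<open>simp_all add: kact_closed kact_push\<close>)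

lemma kact_mult:
 assumes f: "f : el Ks" "g : el Ks" and v: "v : el (sp X)"
 shows "kact X (f *. g) v = kact X f (kact X g v)"
proof (rule ev_eqI[of "space X"])
 fix \<phi>
 have t: "trilin (sp X) K K (%w y z. f y * g z * ev (sp X) \<phi> w)"
  unfolding trilin_def using f V by (simp add: linear)
 have "ev (sp X) \<phi> (kact X f (kact X g v))
  = rsum X v (%w x. rsum X w (%w' y. f y * g x * ev (sp X) \<phi> w'))"
  using f v kact_push[OF lin_comp[OF ev_lin bilin_lin2[OF kact_bilin f(1)]], of g v \<phi>]
  by (simp add: kact_closed kact_push mult_ac tsum_times(1)[symmetric])
 also have "... = rsum X v (%w x. csum K x (%y z. f y * g z * ev (sp X) \<phi> w))"
  by (rule sum_coact_coassoc[OF V X v t])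
 also have "... = ev (sp X) \<phi> (kact X (f *. g) v)"
  using f v by (simp add: kact_push K.dual_mult tsum_times(2))
 finally show "ev (sp X) \<phi> (kact X (f *. g) v) = ev (sp X) \<phi> (kact X f (kact X g v))" by simp
qed (use V f v in \<open>simp_all add: kact_closed\<close>)

text \<open>The coaction is recovered from the action of the dual basis.\<close>

lemma coact_expand:
 assumes v: "v : el (sp X)" and F: "bilin (sp X) K ground F"
 shows "rsum X v F = (\<Sum>b\<leftarrow>kb. F (kact X (kd b) v) (fst b))"
proof -
 have "rsum X v F = rsum X v (%w x. \<Sum>b\<leftarrow>kb. kd b x * F w (fst b))"
  using kb_sum[OF bilin_lin2[OF F]] by simp
 also have "... = (\<Sum>b\<leftarrow>kb. rsum X v (%w x. kd b x * F w (fst b)))"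
  by (rule tsum_sum_list)
 also have "... = (\<Sum>b\<leftarrow>kb. F (kact X (kd b) v) (fst b))"
  using kact_push[OF bilin_lin1[OF F]] v by (simp cong: map_cong)
 finally show ?thesis .
qed

end

definition double_module :: "('k, 'h, 'b, 'u) ydmod => ('k, (('b => 'k) \<times> 'h) list, 'u) lmod" where
 "double_module X = \<lparr>space = space X,
   act = \<lambda>t\<in>el DT. \<lambda>v\<in>el (sp X). tlift (sp X) (%f h. kact X f (act X h v)) t\<rparr>"

lemma double_module_space [simp]: "space (double_module X) = space X" by (simp add: double_module_def)

context
 fixes X :: "('k, 'h, 'b, 'u) ydmod"
 assumes X: "fd_lmodule H X" and co: "rcomodule K X"
begin

lemma double_inner_bilin: "v : el (sp X) ==> bilin Ks H (sp X) (%f h. kact X f (act X h v))"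
 using X co by (intro bilinI) (simp_all add: linear kact_rule)

lemma double_act_eq: "t : el DT ==> v : el (sp X) ==>
  act (double_module X) t v = tlift (sp X) (%f h. kact X f (act X h v)) t"
 by (simp add: double_module_def)

lemma double_act_push: "t : el DT ==> v : el (sp X) ==> L : lin (sp X) ground ==>
  L (act (double_module X) t v) = tsum Ks H t (%f h. L (kact X f (act X h v)))"
 by (subst double_act_eq, simp_all, rule tlift_push) (use X co in \<open>simp_all add: kact_closed\<close>)

lemma double_act_bilin: "bilin D (sp X) (sp X) (act (double_module X))"
proof (rule bilinI)
 fix t assume t: "t : el D"
 have "(%v. tlift (sp X) (%f h. kact X f (act X h v)) t) : lin (sp X) (sp X)"
  by (rule tlift_param[of Ks H]) (use X co t in \<open>simp_all add: D_sel linear kact_rule\<close>)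
 then show "act (double_module X) t : lin (sp X) (sp X)"
  using t X by (simp add: double_module_def D_sel)
next
 fix v assume v: "v : el (sp X)"
 have "tlift (sp X) (%f h. kact X f (act X h v)) : lin DT (sp X)"
  by (rule tlift_lin) (use X double_inner_bilin[OF v] in simp_all)
 then have "(\<lambda>t\<in>el DT. tlift (sp X) (%f h. kact X f (act X h v)) t) : lin DT (sp X)" by simp
 moreover have "act (double_module X) t v = (\<lambda>t\<in>el DT. tlift (sp X) (%f h. kact X f (act X h v)) t) t"
  if "t : el DT" for t using that v by (simp add: double_act_eq)
 ultimately show "(%t. act (double_module X) t v) : lin D (sp X)"
  unfolding lin_D using lin_cong[of DT "%t. act (double_module X) t v" _ "space X"] by simp
qed

lemma double_act_closed: "t : el DT ==> v : el (sp X) ==> act (double_module X) t v : el (sp X)"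
 using bilin_closed[OF double_act_bilin] by (simp add: D_sel)

lemma double_act_pure: "f : el Ks ==> h : el H ==> v : el (sp X) ==>
  act (double_module X) (pure Ks H f h) v = kact X f (act X h v)"
 using X by (subst double_act_eq) (simp_all add: tlift_pure[OF _ _ _ double_inner_bilin])

text \<open>This is the product rule of the quantum double: apply the twisted form of the
 Yetter-Drinfeld condition, and then combine the two functionals by coassociativity.\<close>

lemma act_kact:
 assumes yd: "yd_condition H K \<sigma> X" and k: "k : el Ks" "k' : el Ks" and h: "h : el H" and v: "v : el (sp X)"
  and L: "L : lin (sp X) ground"
 shows "L (kact X k (act X h (kact X k' v))) = csum H h (%c h3. csum H c (%h1 h2.
    \<Sum>b\<leftarrow>kb. k' (q h3 ** (fst b ** p h1)) * L (kact X (k *. kd b) (act X h2 v))))"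
proof -
 let ?V = "space X"
 have V: "fdvs ?V" using X by simp
 note kr = kact_rule[OF V co] and kc = kact_closed[OF V co]
 have Lk: "(%w. L (kact X k w)) : lin ?V ground" by (rule lin_comp[OF L]) (simp add: kr k lin_id)
 have F: "bilin ?V K ground (%w y. k' y * L (kact X k w))"
  using k Lk by (intro bilinI) (simp_all add: linear)
 have Lkh: "(%w. L (kact X k (act X h w))) : lin ?V ground"
  by (rule lin_comp[OF Lk]) (use X h in \<open>simp add: linear\<close>)
 have tw: "yd_twisted X" using yd yd_condition_iff[OF X co] yd_twisted_iff_braided[OF X co] by simp
 have inner: "tsum ?V K (coact X w) (%w0 y. k' (q h3 ** (y ** p h1)) * L (kact X k w0))
   = (\<Sum>b\<leftarrow>kb. k' (q h3 ** (fst b ** p h1)) * L (kact X (k *. kd b) w))"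
  if "w : el ?V" "h1 : el H" "h3 : el H" for w h1 h3
 proof -
  define g where "g = (\<lambda>y\<in>el K. k' (q h3 ** (y ** p h1)))"
  have g: "g : el Ks" unfolding g_def
   by (intro K.restrict_dual Ks_rule1[OF k(2)]) (use that in \<open>simp add: linear\<close>)
  have "tsum ?V K (coact X w) (%w0 y. k' (q h3 ** (y ** p h1)) * L (kact X k w0)) = L (kact X (k *. g) w)"
   using kact_push[OF V co Lk g that(1)] kact_mult[OF V co k(1) g that(1)] by (simp add: g_def)
  also have "... = (\<Sum>b\<leftarrow>kb. g (fst b) * L (kact X (k *. kd b) w))"
   by (rule kd_sum[symmetric, OF lin_comp[OF L] g]) (use k that in \<open>simp add: kr linear\<close>)
  finally show ?thesis by (simp add: g_def cong: map_cong)
 qed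
 have "L (kact X k (act X h (kact X k' v))) = tsum ?V K (coact X v) (%w y. k' y * L (kact X k (act X h w)))"
  by (rule kact_push[OF V co Lkh k(2) v])
 also have "... = csum H h (%b h3. csum H b (%h1 h2.
    tsum ?V K (coact X (act X h2 v)) (%w y. k' (q h3 ** (y ** p h1)) * L (kact X k w))))"
  using tw h v F unfolding yd_twisted_def by fast
 finally show ?thesis using X v by (simp add: inner)
qed

lemma fd_lmodule_double: assumes yd: "yd_condition H K \<sigma> X" shows "fd_lmodule D (double_module X)"
 unfolding fd_lmodule_def
proof (intro conjI ballI)
 note V = lmod_fdvs[OF X] and vV = lmod_vsp[OF X]
 note kc = kact_closed[OF V co]
 show "vsp (sp (double_module X))" "vectorspace.fin_dim class_ring (sp (double_module X))" using V by simp_all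
 show "act (double_module X) : el D \<rightarrow>\<^sub>E el (sp (double_module X)) \<rightarrow>\<^sub>E el (sp (double_module X))"
 proof (intro PiE_I)
  fix t v assume "t : el D" "v : el (sp (double_module X))"
  then show "act (double_module X) t v : el (sp (double_module X))" by (simp add: D_sel double_act_closed)
 qed (auto simp: double_module_def D_sel)
 show "bilin D (sp (double_module X)) (sp (double_module X)) (act (double_module X))"
  using double_act_bilin by simp
 fix v assume "v : el (sp (double_module X))"
 then have v: "v : el (sp X)" by simp
 show "act (double_module X) \<one>\<^bsub>D\<^esub> v = v"
  using v X by (simp add: D_sel double_act_pure kact_one[OF V co] act_one[OF X])
 fix s t assume "s : el D" "t : el D"
 then have s: "s : el DT" and t: "t : el DT" by (simp_all add: D_sel)
 have st: "s \<otimes>\<^bsub>D\<^esub> t : el DT" using double_mult(1)[OF s t lin_zero_rule[OF vs_ground]] .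
 show "act (double_module X) (s \<otimes>\<^bsub>D\<^esub> t) v = act (double_module X) s (act (double_module X) t v)"
 proof (rule ev_eqI[OF V double_act_closed[OF st v] double_act_closed[OF s double_act_closed[OF t v]]])
  fix \<phi> let ?L = "ev (sp X) \<phi>"
  let ?M = "%t. ?L (act (double_module X) t v)"
  have M: "?M : lin DT ground"
   by (rule iffD1[OF lin_D lin_comp[OF ev_lin bilin_lin1[OF double_act_bilin v]]])
  have Ls: "(%w. ?L (kact X k (act X h w))) : lin (sp X) ground" if "k : el Ks" "h : el H" for k h
   using lin_comp[OF ev_lin lin_comp[OF bilin_lin2[OF kact_bilin[OF V co] that(1)] act_lin[OF X that(2)]]] by simp
  have "?M (s \<otimes>\<^bsub>D\<^esub> t) = tsum Ks H s (%k h. tsum Ks H t (%k' h'. ?L (kact X k (act X h (kact X k' (act X h' v))))))"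
   unfolding double_mult(2)[OF s t M] using X v act_kact[OF yd _ _ _ _ ev_lin]
   by (simp add: double_act_pure act_mult[OF X] cong: map_cong)
  also have "... = tsum Ks H s (%k h. ?L (kact X k (act X h (act (double_module X) t v))))"
   using double_act_push[OF t v Ls] by simp
  also have "... = ?L (act (double_module X) s (act (double_module X) t v))"
   by (rule double_act_push[symmetric]) (use s t v double_act_closed in simp_all)
  finally show "?M (s \<otimes>\<^bsub>D\<^esub> t) = ?L (act (double_module X) s (act (double_module X) t v))" .
 qed
qed

end

lemma double_module_map_iff:
 assumes X: "fd_lmodule H X" "rcomodule K X" and Y: "fd_lmodule H Y" "rcomodule K Y" and f: "f : lin (sp X) (sp Y)"
 shows "module_map D (double_module X) (double_module Y) f \<longleftrightarrow> module_map H X Y f \<and> comodule_map K X Y f"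
proof
 note VX = lmod_fdvs[OF X(1)] and VY = lmod_fdvs[OF Y(1)]
 note one = kact_one[OF VX X(2)] kact_one[OF VY Y(2)] act_one[OF X(1)] act_one[OF Y(1)]
 note fc = lin_closed[OF f]
 assume m: "module_map D (double_module X) (double_module Y) f"
 have e: "f (kact X k (act X h v)) = kact Y k (act Y h (f v))"
  if "k : el Ks" "h : el H" "v : el (sp X)" for k h v
  using module_mapD[OF m, of "pure Ks H k h" v] that double_act_pure[OF X] double_act_pure[OF Y] fc by (simp add: D_sel)
 have "module_map H X Y f" unfolding module_map_def using e[of "eKs"] one X Y fc by simp
 moreover have ek: "f (kact X k v) = kact Y k (f v)" if "k : el Ks" "v : el (sp X)" for k v
  using e[of k "eH" v] that one fc by simp
 then have "comodule_map K X Y f"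
  using coact_expand[OF VX X(2) _ bilin_comp_left[OF _ f]] coact_expand[OF VY Y(2)] fc
  by (simp add: comodule_map_iff[OF X Y f] cong: map_cong)
 ultimately show "module_map H X Y f \<and> comodule_map K X Y f" by blast
next
 note VX = lmod_fdvs[OF X(1)] and VY = lmod_fdvs[OF Y(1)]
 note fc = lin_closed[OF f]
 assume m: "module_map H X Y f \<and> comodule_map K X Y f"
 have ek: "f (kact X k v) = kact Y k (f v)" if k: "k : el Ks" and v: "v : el (sp X)" for k v
 proof (rule ev_eqI[of "space Y"])
  fix \<phi>
  have "bilin (sp Y) K ground (%w x. k x * ev (sp Y) \<phi> w)" using Y k by (intro bilinI) (simp_all add: linear)
  from comodule_mapD[OF X Y f conjunct2[OF m] v this]
  show "ev (sp Y) \<phi> (f (kact X k v)) = ev (sp Y) \<phi> (kact Y k (f v))"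
   using kact_push[OF VX X(2) lin_comp[OF ev_lin f] k v] kact_push[OF VY Y(2) ev_lin k fc[OF v]] by simp
 qed (use X Y k v fc in \<open>simp_all add: kact_closed[OF VX X(2)] kact_closed[OF VY Y(2)]\<close>)
 show "module_map D (double_module X) (double_module Y) f"
  unfolding module_map_def
 proof (intro ballI)
  fix t v assume "t : el D" "v : el (sp (double_module X))"
  then have t: "t : el DT" and v: "v : el (sp X)" by (simp_all add: D_sel)
  show "f (act (double_module X) t v) = act (double_module Y) t (f v)"
  proof (rule ev_eqI[of "space Y"])
   fix \<phi> show "ev (sp Y) \<phi> (f (act (double_module X) t v)) = ev (sp Y) \<phi> (act (double_module Y) t (f v))"
    using double_act_push[OF X t v lin_comp[OF ev_lin f]] double_act_push[OF Y t fc[OF v] ev_lin] X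
    by (simp add: ek module_mapD[OF conjunct1[OF m]] v)
  qed (use X Y t v fc in \<open>simp_all add: double_act_closed[OF X] double_act_closed[OF Y]\<close>)
 qed
qed

end

context fd_hopf_algebra begin

lemma antipode_inv_one: "antipode_inv A \<one> = \<one>"
 by (rule antipode_eqD) (simp_all add: antipode_antipode_inv antipode_one)

lemma counit_antipode_inv: "a : el A ==> counit A (antipode_inv A a) = counit A a"
 using sum_antipode_inv_left[OF _ counit_lin, of a] sum_counit_left[of a "%x. counit A (antipode_inv A x)"]
 by (simp add: counit_mult counit_one linear mult.commute)

end

context surjective_pairing begin

lemma sum_list_tsum: "(\<Sum>x\<leftarrow>xs. tsum V W t (F x)) = tsum V W t (%a b. \<Sum>x\<leftarrow>xs. F x a b)"
 by (simp add: tsum_sum_list)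

lemma double_inner_bilins:
 assumes k: "k : el Ks" "k' : el Ks" and h': "h' : el H" and M: "M : lin DT ground"
 shows "h3 : el H ==> bilin H H ground (%h1 h2. \<Sum>b\<leftarrow>kb. k' (q h3 ** (fst b ** p h1)) * M (pure Ks H (k *. kd b) (h2 *: h')))"
  and "bilin H H ground (%c h3. csum H c (%h1 h2.
    \<Sum>b\<leftarrow>kb. k' (q h3 ** (fst b ** p h1)) * M (pure Ks H (k *. kd b) (h2 *: h'))))"
proof -
 note Ml = lin_comp[OF M]
 show b: "bilin H H ground (%h1 h2. \<Sum>b\<leftarrow>kb. k' (q h3 ** (fst b ** p h1)) * M (pure Ks H (k *. kd b) (h2 *: h')))"
  if "h3 : el H" for h3
  using k h' that by (intro bilinI lin_sum_list lin_times Ml Ks_rule1) (simp_all add: linear)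
 show "bilin H H ground (%c h3. csum H c (%h1 h2.
    \<Sum>b\<leftarrow>kb. k' (q h3 ** (fst b ** p h1)) * M (pure Ks H (k *. kd b) (h2 *: h'))))"
 proof (rule bilinI)
  fix c assume "c : el H"
  then show "(%h3. csum H c (%h1 h2. \<Sum>b\<leftarrow>kb. k' (q h3 ** (fst b ** p h1)) * M (pure Ks H (k *. kd b) (h2 *: h')))) : lin H ground"
   using k h' by (intro tsum_rule2 lin_sum_list lin_times(2) Ks_rule1) (simp_all add: linear)
 next
  fix h3 assume "h3 : el H"
  then show "(%c. csum H c (%h1 h2. \<Sum>b\<leftarrow>kb. k' (q h3 ** (fst b ** p h1)) * M (pure Ks H (k *. kd b) (h2 *: h')))) : lin H ground"
   by (intro tsum_rule b) (simp_all add: linear)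
 qed
qed

lemma double_mult_pure:
 assumes k: "k : el Ks" "k' : el Ks" and h: "h : el H" "h' : el H" and M: "M : lin DT ground"
 shows "M (pure Ks H k h \<otimes>\<^bsub>D\<^esub> pure Ks H k' h') = csum H h (%c h3. csum H c (%h1 h2.
    \<Sum>b\<leftarrow>kb. k' (q h3 ** (fst b ** p h1)) * M (pure Ks H (k *. kd b) (h2 *: h'))))"
proof -
 note Ml [linear] = lin_comp[OF M]
 let ?F = "%k h k' h'. csum H h (%c h3. csum H c (%h1 h2.
    \<Sum>b\<leftarrow>kb. k' (q h3 ** (fst b ** p h1)) * M (pure Ks H (k *. kd b) (h2 *: h'))))"
 have b1: "bilin Ks H ground (?F k h)" if "k : el Ks" "h : el H" for k h
 proof (rule bilinI)
  fix k' assume "k' : el Ks"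
  then show "(%h'. ?F k h k' h') : lin H ground"
   using that by (intro tsum_rule2 lin_sum_list lin_times Ml) (simp_all add: linear)
 next
  fix h' assume "h' : el H"
  then show "(%k'. ?F k h k' h') : lin Ks ground"
   using that by (intro tsum_rule2 lin_sum_list lin_times Ks_rule2) (simp_all add: linear)
 qed
 have b2: "bilin Ks H ground (%k h. ?F k h k' h')"
 proof (rule bilinI)
  fix k assume kk: "k : el Ks"
  from double_inner_bilins(2)[OF kk k(2) h(2) M]
  show "(%h. ?F k h k' h') : lin H ground" by (simp add: linear)
 next
  fix h assume "h : el H"
  then show "(%k. ?F k h k' h') : lin Ks ground"
   using k assms(3,4) by (intro tsum_rule2 lin_sum_list lin_times Ml) (simp_all add: linear)
 qed
 have "M (pure Ks H k h \<otimes>\<^bsub>D\<^esub> pure Ks H k' h') = tsum Ks H (pure Ks H k h) (%k h. tsum Ks H (pure Ks H k' h') (?F k h))"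
  using double_mult(2)[OF _ _ M] k h by simp
 also have "... = tsum Ks H (pure Ks H k h) (%k h. ?F k h k' h')"
  using k h b1 by (simp add: tsum_pure)
 also have "... = ?F k h k' h'" using k h by (simp add: tsum_pure[OF _ _ b2])
 finally show ?thesis .
qed

text \<open>Together with \<open>double_mult_right\<close>: \<open>K\<^sup>*\<close> and \<open>H\<close> are subalgebras, and every pure tensor is the
 product of its two factors.\<close>

lemma double_mult_left:
 assumes k: "k : el Ks" "k' : el Ks" and h': "h' : el H"
 shows "pure Ks H k eH \<otimes>\<^bsub>D\<^esub> pure Ks H k' h' = pure Ks H (k *. k') h'"
proof (rule ev_eqI[of DT])
 fix \<phi> let ?M = "ev DT \<phi>"
 have l: "(%f. ?M (pure Ks H (k *. f) g)) : lin Ks ground" if "g : el H" for g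
  using k that by (simp add: linear)
 note b = double_inner_bilins(1)[OF k h' ev_lin] and b' = double_inner_bilins(2)[OF k h' ev_lin]
 show "?M (pure Ks H k eH \<otimes>\<^bsub>D\<^esub> pure Ks H k' h') = ?M (pure Ks H (k *. k') h')"
  using k h' kd_sum[OF l[OF h'] k(2)]
  unfolding double_mult_pure[OF k H.one_closed h' ev_lin] H.sum_comult_one[OF b'] H.sum_comult_one[OF b[OF H.one_closed]]
  by (simp add: H.antipode_inv_one p_one cong: map_cong)
qed (use k h' double_mult(1)[OF _ _ lin_zero_rule[OF vs_ground]] in simp_all)

lemma double_mult_right:
 assumes h: "h : el H" "h' : el H"
 shows "pure Ks H eKs h \<otimes>\<^bsub>D\<^esub> pure Ks H eKs h' = pure Ks H eKs (h *: h')"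
proof (rule ev_eqI[of DT])
 fix \<phi> let ?M = "ev DT \<phi>"
 have l: "(%f. ?M (pure Ks H (eKs *. f) g)) : lin Ks ground" if "g : el H" for g
  using that by (simp add: linear)
 have l2: "(%g. ?M (pure Ks H eKs (g *: h'))) : lin H ground" using h by (simp add: linear)
 have e: "(\<Sum>b\<leftarrow>kb. eKs (q h3 ** (fst b ** p h1)) * ?M (pure Ks H (eKs *. kd b) (h2 *: h')))
  = counit H h3 * (counit H h1 * ?M (pure Ks H eKs (h2 *: h')))"
  if "h1 : el H" "h2 : el H" "h3 : el H" for h1 h2 h3
 proof -
  have "(\<Sum>b\<leftarrow>kb. eKs (q h3 ** (fst b ** p h1)) * ?M (pure Ks H (eKs *. kd b) (h2 *: h')))
   = (\<Sum>b\<leftarrow>kb. (counit H h3 * counit H h1) * (eKs (fst b) * ?M (pure Ks H (eKs *. kd b) (h2 *: h'))))"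
   using that by (simp add: K.counit_mult p_counit H.counit_antipode_inv mult_ac cong: map_cong)
  also have "... = (counit H h3 * counit H h1) * ?M (pure Ks H (eKs *. eKs) (h2 *: h'))"
   unfolding sum_list_const_mult by (subst kd_sum[OF l]) (use that h in simp_all)
  finally show ?thesis by (simp add: Ks_mult_one mult.assoc)
 qed
 show "?M (pure Ks H eKs h \<otimes>\<^bsub>D\<^esub> pure Ks H eKs h') = ?M (pure Ks H eKs (h *: h'))"
  using h by (simp add: double_mult_pure e tsum_times H.sum_counit_left[OF _ l2] H.sum_counit_right[OF _ l2])
qed (use h double_mult(1)[OF _ _ lin_zero_rule[OF vs_ground]] in simp_all)

definition double_yd :: "('k, (('b => 'k) \<times> 'h) list, 'u) lmod => ('k, 'h, 'b, 'u) ydmod" where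
 "double_yd Z = \<lparr>space = space Z,
   act = \<lambda>h\<in>el H. \<lambda>v\<in>el (sp Z). act Z (pure Ks H eKs h) v,
   coact = \<lambda>v\<in>el (sp Z). vsum (tensor (sp Z) K)
    (%b. pure (sp Z) K (act Z (pure Ks H (kd b) eH) v) (fst b)) kb\<rparr>"

context
 fixes Z :: "('k, (('b => 'k) \<times> 'h) list, 'u) lmod"
 assumes Z: "fd_lmodule D Z"
begin

abbreviation "hz h v \<equiv> act Z (pure Ks H eKs h) v"
abbreviation "kz k v \<equiv> act Z (pure Ks H k eH) v"

lemma Z_closed: "t : el DT ==> v : el (sp Z) ==> act Z t v : el (sp Z)"
 using act_closed[OF Z] by (simp add: D_sel)

lemma Z_rules: "f : lin U DT ==> v : el (sp Z) ==> (%x. act Z (f x) v) : lin U (sp Z)"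
 "g : lin U (sp Z) ==> t : el DT ==> (%x. act Z t (g x)) : lin U (sp Z)"
 using lin_comp[OF iffD1[OF lin_D bilin_lin1[OF act_bilin[OF Z]]]] act_rule2[OF Z] by (auto simp: D_sel)

lemma Z_split: "k : el Ks ==> h : el H ==> v : el (sp Z) ==> kz k (hz h v) = act Z (pure Ks H k h) v"
 using act_mult[OF Z, of "pure Ks H k eH" "pure Ks H eKs h" v]
 by (simp add: D_sel double_mult_left Ks_mult_one)

lemma kz_mult: "k : el Ks ==> k' : el Ks ==> v : el (sp Z) ==> kz (k *. k') v = kz k (kz k' v)"
 using act_mult[OF Z, of "pure Ks H k eH" "pure Ks H k' eH" v] by (simp add: D_sel double_mult_left)

lemma hz_mult: "h : el H ==> h' : el H ==> v : el (sp Z) ==> hz (h *: h') v = hz h (hz h' v)"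
 using act_mult[OF Z, of "pure Ks H eKs h" "pure Ks H eKs h'" v] by (simp add: D_sel double_mult_right)

lemma z_one: "v : el (sp Z) ==> act Z (pure Ks H eKs eH) v = v"
 using act_one[OF Z] by (simp add: D_sel)

text \<open>The cross relation, which becomes the twisted form of the Yetter-Drinfeld condition.\<close>

lemma hz_kz:
 assumes h: "h : el H" and k: "k : el Ks" and v: "v : el (sp Z)" and L: "L : lin (sp Z) ground"
 shows "L (hz h (kz k v)) = csum H h (%c h3. csum H c (%h1 h2.
    \<Sum>b\<leftarrow>kb. k (q h3 ** (fst b ** p h1)) * L (kz (kd b) (hz h2 v))))"
proof -
 have M: "(%t. L (act Z t v)) : lin DT ground"
  by (rule lin_comp[OF L Z_rules(1)]) (use v in \<open>simp_all add: lin_id\<close>)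
 have "hz h (kz k v) = act Z (pure Ks H eKs h \<otimes>\<^bsub>D\<^esub> pure Ks H k eH) v"
  using act_mult[OF Z, of "pure Ks H eKs h" "pure Ks H k eH" v] h k v by (simp add: D_sel)
 then show ?thesis
  using double_mult_pure[OF _ k h _ M, of "eKs" "eH"] v by (simp add: Z_split Ks_mult_one cong: map_cong)
qed

abbreviation "Yz \<equiv> double_yd Z"

lemma Yz_sel: "space Yz = space Z" "h : el H ==> v : el (sp Z) ==> act Yz h v = hz h v"
 "v : el (sp Z) ==> coact Yz v = vsum (tensor (sp Z) K) (%b. pure (sp Z) K (kz (kd b) v) (fst b)) kb"
 by (simp_all add: double_yd_def)

lemma Yz_coact_sum:
 assumes v: "v : el (sp Z)" and F: "bilin (sp Z) K ground F"
 shows "tsum (sp Z) K (coact Yz v) F = (\<Sum>b\<leftarrow>kb. F (kz (kd b) v) (fst b))"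
proof -
 have V: "vsp (sp Z)" by (rule lmod_vsp[OF Z])
 show ?thesis
  unfolding Yz_sel(3)[OF v] using v F V
  by (subst vsum_lin[OF _ _ tsum_lin[OF V _ F]])
   (auto simp: Z_closed vsum_ground tsum_pure intro!: arg_cong[where f = sum_list])
qed

lemma Yz_coact_kz:
 assumes v: "v : el (sp Z)" and f: "f : el Ks" and L: "L : lin (sp Z) ground"
 shows "tsum (sp Z) K (coact Yz v) (%w x. f x * L w) = L (kz f v)"
proof -
 have V: "vsp (sp Z)" by (rule lmod_vsp[OF Z])
 have "bilin (sp Z) K ground (%w x. f x * L w)"
  using f L by (intro bilinI) (simp_all add: linear)
 from Yz_coact_sum[OF v this] show ?thesis
  using kd_sum[OF lin_comp[OF L Z_rules(1)] f, of "%f. pure Ks H f eH" v] v by (simp add: linear)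
qed

lemma Yz_module: "fd_lmodule H Yz"
 unfolding fd_lmodule_def
proof (intro conjI ballI)
 have V: "vsp (sp Z)" by (rule lmod_vsp[OF Z])
 show "vsp (sp Yz)" "vectorspace.fin_dim class_ring (sp Yz)" using lmod_fdvs[OF Z] by (simp_all add: Yz_sel)
 show "act Yz : el H \<rightarrow>\<^sub>E el (sp Yz) \<rightarrow>\<^sub>E el (sp Yz)"
  by (auto simp: double_yd_def Z_closed)
 show "bilin H (sp Yz) (sp Yz) (act Yz)"
 proof (rule bilinI)
  fix h assume h: "h : el H"
  have "(%v. hz h v) : lin (sp Z) (sp Z)" by (rule Z_rules(2)) (use h in \<open>simp_all add: lin_id\<close>)
  then show "act Yz h : lin (sp Yz) (sp Yz)" using h V by (simp add: double_yd_def)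
 next
  fix v assume v: "v : el (sp Yz)"
  have "(%h. hz h v) : lin H (sp Z)" by (rule Z_rules(1)) (use v in \<open>simp_all add: linear Yz_sel\<close>)
  then show "(%h. act Yz h v) : lin H (sp Yz)"
   using v lin_cong[of H "%h. act Yz h v" "%h. hz h v" "space Z"] by (simp add: Yz_sel)
 qed
qed (simp_all add: Yz_sel Z_closed z_one hz_mult)

lemma Yz_comodule: "rcomodule K Yz"
proof -
 have V: "fdvs (sp Yz)" using lmod_fdvs[OF Z] by (simp add: Yz_sel)
 have V': "vsp (sp Z)" by (rule lmod_vsp[OF Z])
 have "(%v. vsum (tensor (sp Z) K) (%b. pure (sp Z) K (kz (kd b) v) (fst b)) kb) : lin (sp Z) (tensor (sp Z) K)"
  by (intro lin_vsum pure_rule1 Z_rules(2)) (use V' in \<open>simp_all add: lin_id\<close>)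
 then have l: "coact Yz : elin (sp Yz) (tensor (sp Yz) K)"
  using V' by (simp add: double_yd_def)
 show ?thesis
  unfolding rcomodule_iff[OF V l] Yz_sel(1)
 proof (intro conjI ballI allI impI)
  fix v assume v: "v : el (sp Z)"
  show "tsum (sp Z) K (coact Yz v) (%v0 x. counit K x * L v0) = L v" if L: "L : lin (sp Z) ground" for L
   using Yz_coact_kz[OF v _ L, of "eKs"] v by (simp add: z_one)
  fix F assume F: "trilin (sp Z) K K F"
  note Fr = trilin_rule[OF F]
  have F1: "bilin (sp Z) K ground (%w y. F w y x)" if "x : el K" for x
   using that by (intro bilinI) (simp_all add: Fr lin_id)
  have F2: "bilin (sp Z) K ground (%w x. \<Sum>c\<leftarrow>kb. F (kz (kd c) w) (fst c) x)"
   by (intro bilinI lin_sum_list Fr Z_rules) (simp_all add: Z_closed lin_id Fr)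
  have exp: "csum K x (%y z. F w y z) = (\<Sum>b\<leftarrow>kb. \<Sum>c\<leftarrow>kb. (kd c *. kd b) x * F w (fst c) (fst b))"
   if "w : el (sp Z)" "x : el K" for w x
  proof -
   have "F w y z = (\<Sum>b\<leftarrow>kb. \<Sum>c\<leftarrow>kb. kd c y * kd b z * F w (fst c) (fst b))" if "y : el K" "z : el K" for y z
   proof -
    have "F w y z = (\<Sum>b\<leftarrow>kb. kd b z * F w y (fst b))"
     by (rule kb_sum[symmetric]) (use that \<open>w : _\<close> in \<open>simp_all add: Fr lin_id\<close>)
    also have "... = (\<Sum>b\<leftarrow>kb. kd b z * (\<Sum>c\<leftarrow>kb. kd c y * F w (fst c) (fst b)))"
     by (rule arg_cong[where f = sum_list], rule map_cong, simp, subst kb_sum) (use that \<open>w : _\<close> in \<open>simp_all add: Fr lin_id\<close>)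
    finally show ?thesis by (simp add: sum_list_const_mult[symmetric] mult_ac)
   qed
   then have "csum K x (%y z. F w y z)
    = csum K x (%y z. \<Sum>b\<leftarrow>kb. \<Sum>c\<leftarrow>kb. kd c y * kd b z * F w (fst c) (fst b))" by simp
   also have "... = (\<Sum>b\<leftarrow>kb. \<Sum>c\<leftarrow>kb. (kd c *. kd b) x * F w (fst c) (fst b))"
    using that by (simp add: tsum_sum_list tsum_times(2) K.dual_mult)
   finally show ?thesis .
  qed
  have "tsum (sp Z) K (coact Yz v) (%v0 x. tsum (sp Z) K (coact Yz v0) (%v00 y. F v00 y x))
   = tsum (sp Z) K (coact Yz v) (%v0 x. \<Sum>c\<leftarrow>kb. F (kz (kd c) v0) (fst c) x)"
   using Yz_coact_sum[OF _ F1] by simp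
  also have "... = (\<Sum>b\<leftarrow>kb. \<Sum>c\<leftarrow>kb. F (kz (kd c) (kz (kd b) v)) (fst c) (fst b))"
   by (rule Yz_coact_sum[OF v F2])
  also have "... = (\<Sum>b\<leftarrow>kb. \<Sum>c\<leftarrow>kb. tsum (sp Z) K (coact Yz v) (%w x. (kd c *. kd b) x * F w (fst c) (fst b)))"
   using v by (simp add: Yz_coact_kz Fr lin_id kz_mult cong: map_cong)
  also have "... = tsum (sp Z) K (coact Yz v) (%v0 x. csum K x (%y z. F v0 y z))"
   by (simp add: exp tsum_sum_list)
  finally show "tsum (sp Z) K (coact Yz v) (%v0 x. tsum (sp Z) K (coact Yz v0) (%v00 y. F v00 y x))
   = tsum (sp Z) K (coact Yz v) (%v0 x. csum K x (%y z. F v0 y z))" .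
 qed
qed

lemma Yz_yd: "yd Yz"
proof -
 have V: "vsp (sp Z)" by (rule lmod_vsp[OF Z])
 have "yd_twisted Yz"
  unfolding yd_twisted_def Yz_sel(1)
 proof (intro ballI allI impI)
  fix h v F assume h: "h : el H" and v: "v : el (sp Z)" and F: "bilin (sp Z) K ground F"
  have F1: "bilin (sp Z) K ground (%w x. F (hz h w) x)"
   by (rule bilin_comp_left[OF F Z_rules(2)]) (use h in \<open>simp_all add: lin_id\<close>)
  have F2: "bilin (sp Z) K ground (%w k. F w (q h3 ** (k ** p h1)))" if "h1 : el H" "h3 : el H" for h1 h3
   using that by (intro bilinI) (simp_all add: bilin_left[OF F] bilin_right[OF F] linear)
  have exp: "(\<Sum>c\<leftarrow>kb. \<Sum>b\<leftarrow>kb. kd c (q h3 ** (fst b ** p h1)) * F (kz (kd b) (hz h2 v)) (fst c))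
   = (\<Sum>b\<leftarrow>kb. F (kz (kd b) (hz h2 v)) (q h3 ** (fst b ** p h1)))"
   if "h1 : el H" "h2 : el H" "h3 : el H" for h1 h2 h3
   using kb_sum[OF bilin_lin2[OF F]] that v by (subst sum_list_swap) (simp add: Z_closed del: restrict_apply cong: map_cong)
  have "tsum (sp Z) K (coact Yz v) (%w x. F (act Yz h w) x) = tsum (sp Z) K (coact Yz v) (%w x. F (hz h w) x)"
   using h by (simp add: Yz_sel)
  also have "... = (\<Sum>c\<leftarrow>kb. F (hz h (kz (kd c) v)) (fst c))"
   by (rule Yz_coact_sum[OF v F1])
  also have "... = (\<Sum>c\<leftarrow>kb. csum H h (%d h3. csum H d (%h1 h2.
    \<Sum>b\<leftarrow>kb. kd c (q h3 ** (fst b ** p h1)) * F (kz (kd b) (hz h2 v)) (fst c))))"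
   using hz_kz[OF h _ v bilin_lin1[OF F]] by (simp cong: map_cong)
  also have "... = csum H h (%d h3. csum H d (%h1 h2.
    \<Sum>c\<leftarrow>kb. \<Sum>b\<leftarrow>kb. kd c (q h3 ** (fst b ** p h1)) * F (kz (kd b) (hz h2 v)) (fst c)))"
   unfolding sum_list_tsum ..
  also have "... = csum H h (%d h3. csum H d (%h1 h2.
    tsum (sp Z) K (coact Yz (act Yz h2 v)) (%w k. F w (q h3 ** (k ** p h1)))))"
   using v by (simp add: exp Yz_sel(2) Yz_coact_sum[OF Z_closed F2] del: restrict_apply)
  finally show "tsum (sp Z) K (coact Yz v) (%w k. F (act Yz h w) k)
   = csum H h (%b h3. csum H b (%h1 h2.
    tsum (sp Z) K (coact Yz (act Yz h2 v)) (%w k. F w (q h3 ** (k ** p h1)))))" .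
 qed
 then show ?thesis
  using yd_condition_iff[OF Yz_module Yz_comodule] yd_twisted_iff_braided[OF Yz_module Yz_comodule] Yz_module Yz_comodule by simp
qed

lemma double_module_Yz: "double_module Yz = Z"
proof -
 have V: "fdvs (sp Yz)" using lmod_fdvs[OF Z] by (simp add: Yz_sel)
 have V': "vsp (sp Z)" by (rule lmod_vsp[OF Z])
 have kz: "kact Yz f v = kz f v" if f: "f : el Ks" and v: "v : el (sp Z)" for f v
 proof (rule ev_eqI[OF V])
  fix \<phi> show "ev (sp Yz) \<phi> (kact Yz f v) = ev (sp Yz) \<phi> (kz f v)"
   using kact_push[OF V Yz_comodule ev_lin f, unfolded Yz_sel(1), OF v] Yz_coact_kz[OF v f ev_lin] by (simp add: Yz_sel(1))
 qed (use f v kact_closed[OF V Yz_comodule] in \<open>simp_all add: Yz_sel Z_closed\<close>)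
 have a: "act (double_module Yz) t v = act Z t v" if t: "t : el DT" and v: "v : el (sp Z)" for t v
 proof (rule tensor_ext[of Ks H "space Z" "%t. act (double_module Yz) t v" "%t. act Z t v"])
  show "(%t. act (double_module Yz) t v) : lin DT (sp Z)"
   using bilin_lin1[OF double_act_bilin[OF Yz_module Yz_comodule]] v by (simp add: Yz_sel lin_D)
  show "(%t. act Z t v) : lin DT (sp Z)" by (rule Z_rules(1)) (use v in \<open>simp_all add: lin_id\<close>)
  fix k h assume "k : el Ks" "h : el H"
  then show "act (double_module Yz) (pure Ks H k h) v = act Z (pure Ks H k h) v"
   using v by (simp add: double_act_pure[OF Yz_module Yz_comodule] Yz_sel kz Z_closed Z_split)
 qed (use t V' in simp_all)
 have ZE: "act Z : el DT \<rightarrow>\<^sub>E el (sp Z) \<rightarrow>\<^sub>E el (sp Z)"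
  using Z unfolding fd_lmodule_def by (simp add: D_sel)
 have "act (double_module Yz) = act Z"
 proof (rule extensionalityI)
  show "act Z : extensional (el DT)" using ZE by (simp add: PiE_def)
  show "act (double_module Yz) : extensional (el DT)" by (simp add: double_module_def)
  fix t assume t: "t : el DT"
  show "act (double_module Yz) t = act Z t"
  proof (rule extensionalityI)
   show "act Z t : extensional (el (sp Z))" using ZE t by (auto simp: PiE_def)
   show "act (double_module Yz) t : extensional (el (sp Z))" using t by (simp add: double_module_def Yz_sel)
  qed (rule a[OF t])
 qed
 then show ?thesis by (intro lmod.equality) (simp_all add: Yz_sel)
qed

end

end

context surjective_pairing begin

lemma double_module_inj:
 fixes X X' :: "('k, 'h, 'b, 'u) ydmod"
 assumes X: "fd_lmodule H X" "rcomodule K X" and X': "fd_lmodule H X'" "rcomodule K X'"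
  and eq: "double_module X = double_module X'"
 shows "X = X'"
proof -
 note V = lmod_fdvs[OF X(1)] and V' = lmod_fdvs[OF X'(1)]
 have sp: "space X' = space X" using eq double_module_space[of X] double_module_space[of X'] by simp
 have a: "kact X k (act X h v) = kact X' k (act X' h v)" if "k : el Ks" "h : el H" "v : el (sp X)" for k h v
  using that double_act_pure[OF X that] double_act_pure[OF X', of k h v] by (simp add: eq sp)
 have act: "act X h v = act X' h v" if "h : el H" "v : el (sp X)" for h v
  using a[of "eKs"] that X X' act_closed[OF X'(1), of h v] by (simp add: kact_one[OF V X(2)] kact_one[OF V' X'(2)] sp)
 have kact: "kact X k v = kact X' k v" if "k : el Ks" "v : el (sp X)" for k v
  using a[of k "eH" v] that by (simp add: act_one[OF X(1)] act_one[OF X'(1)] sp)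
 have coact: "coact X v = coact X' v" if v: "v : el (sp X)" for v
 proof (rule ev_eqI[of "tensor (sp X) K"])
  fix \<phi> let ?L = "ev (tensor (sp X) K) \<phi>"
  have F: "bilin (sp X) K ground (%w x. ?L (pure (sp X) K w x))"
   using V by (intro bilinI) (simp_all add: linear)
  show "?L (coact X v) = ?L (coact X' v)"
   using tensor_functional_expand[of "space X" K ?L "coact X v"] tensor_functional_expand[of "space X" K ?L "coact X' v"]
    coact_expand[OF V X(2) v F] coact_expand[OF V' X'(2), unfolded sp, OF v F] V X X' v
    coact_closed[of X' v] by (simp add: kact sp cong: map_cong)
 qed (use V X X' v coact_closed[of X' v] in \<open>simp_all add: sp\<close>)
 have E: "act X : el H \<rightarrow>\<^sub>E el (sp X) \<rightarrow>\<^sub>E el (sp X)"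
  "act X' : el H \<rightarrow>\<^sub>E el (sp X) \<rightarrow>\<^sub>E el (sp X)"
  using X X' unfolding fd_lmodule_def by (simp_all add: sp)
 have "act X = act X'"
  by (rule PiE_ext[OF E], rule PiE_ext[of _ "el (sp X)" "%_. el (sp X)"])
   (use E act in auto)
 moreover have "coact X = coact X'"
  by (rule extensionalityI[of _ "el (sp X)"]) (use coact_ext[of X] coact_ext[of X'] X X' V V' sp coact in simp_all)
 ultimately show ?thesis by (intro ydmod.equality) (simp_all add: sp)
qed

lemma double_comult:
 assumes t: "t : el DT"
 shows "comult D t : el (tensor D D)"
  and "bilin D D ground N ==> csum D t N = tsum Ks H t (%k h. csum Ks k (%k1 k2.
   csum H h (%h1 h2. N (pure Ks H k2 h1) (pure Ks H k1 h2))))"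
proof -
 let ?DD = "tensor D D"
 have DD: "tensor DT DT = ?DD" "pure DT DT = pure D D"
  by (rule tensor_cong; simp only: D_sel)+
 let ?e = "%k1 k2 h1 h2. pure D D (pure Ks H k2 h1) (pure Ks H k1 h2)"
 let ?e1 = "%h k1 k2. tlift ?DD (%h1 h2. ?e k1 k2 h1 h2) (comult H h)"
 let ?e2 = "%k h. tlift ?DD (%k1 k2. ?e1 h k1 k2) (comult Ks k)"
 have c: "comult D t = tlift ?DD ?e2 t"
  unfolding DD[symmetric] by (simp add: quantum_double_def Let_def sweedler2_def)
 have e: "?e k1 k2 h1 h2 : el ?DD" if "k1 : el Ks" "k2 : el Ks" "h1 : el H" "h2 : el H" for k1 k2 h1 h2
  by (rule pure_closed) (use that in \<open>simp_all add: D_sel\<close>)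
 have e1: "?e1 h k1 k2 : el ?DD" if "k1 : el Ks" "k2 : el Ks" "h : el H" for k1 k2 h
  by (rule tlift_closed[of H H]) (use e that in simp_all)
 have e2: "?e2 k h : el ?DD" if "k : el Ks" "h : el H" for k h
  by (rule tlift_closed[of Ks Ks]) (use e1 that in simp_all)
 show "comult D t : el ?DD" unfolding c by (rule tlift_closed[of Ks H]) (use e2 t in simp_all)
 assume N: "bilin D D ground N"
 let ?M = "%s. tsum D D s N"
 have M: "?M : lin ?DD ground" by (rule tsum_lin) (simp_all add: N)
 have s: "?M (?e k1 k2 h1 h2) = N (pure Ks H k2 h1) (pure Ks H k1 h2)"
  if "k1 : el Ks" "k2 : el Ks" "h1 : el H" "h2 : el H" for k1 k2 h1 h2
  by (rule tsum_pure) (use that N in \<open>simp_all add: D_sel\<close>)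
 have s1: "?M (?e1 h k1 k2) = csum H h (%h1 h2. ?M (?e k1 k2 h1 h2))"
  if "k1 : el Ks" "k2 : el Ks" "h : el H" for k1 k2 h
  by (rule tlift_push[where L = ?M and Z = ?DD]) (use e M that in simp_all)
 have s2: "?M (?e2 k h) = csum Ks k (%k1 k2. ?M (?e1 h k1 k2))"
  if "k : el Ks" "h : el H" for k h
  by (rule tlift_push[where L = ?M and Z = ?DD]) (use e1 M that in simp_all)
 have "?M (comult D t) = tsum Ks H t (%k h. ?M (?e2 k h))"
  unfolding c by (rule tlift_push[where L = ?M and Z = ?DD]) (use e2 M t in simp_all)
 then show "?M (comult D t) = tsum Ks H t (%k h. csum Ks k (%k1 k2.
   csum H h (%h1 h2. N (pure Ks H k2 h1) (pure Ks H k1 h2))))"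
  by (simp only: s s1 s2 cong: tsum_cong)
qed

context
 fixes X Y :: "('k, 'h, 'b, 'u) ydmod"
 assumes X: "fd_lmodule H X" "rcomodule K X" and Y: "fd_lmodule H Y" "rcomodule K Y"
begin

text \<open>The product \<open>w\<^sub>1 v\<^sub>1\<close> in the coaction of a tensor product is opposite to the order of the factors;
 this is why \<open>K\<^sup>*\<close> enters the double with its opposite coproduct.\<close>

lemma kact_tensor:
 assumes k: "k : el Ks" and v: "v : el (sp X)" and w: "w : el (sp Y)"
  and L: "L : lin (ut X Y) ground"
 shows "L (kact (yd_tensor H K X Y) k (up X Y v w))
  = csum Ks k (%k1 k2. L (up X Y (kact X k2 v) (kact Y k1 w)))"
proof -
 let ?U = "up X Y" and ?XY = "yd_tensor H K X Y"
 note VX = lmod_fdvs[OF X(1)] and VY = lmod_fdvs[OF Y(1)]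
 have co: "rcomodule K ?XY" by (rule rcomodule_tensor[OF X Y])
 have F: "bilin (ut X Y) K ground (%u x. k x * L u)"
  using k L by (intro bilinI) (simp_all add: linear)
 have l1: "(%v. L (?U v w)) : lin (sp X) ground" if "w : el (sp Y)" for w
  by (rule lin_comp[OF L upure_rule1]) (use VX VY that in \<open>simp_all add: lin_id\<close>)
 have l2: "(%w. L (?U v w)) : lin (sp Y) ground" if "v : el (sp X)" for v
  by (rule lin_comp[OF L upure_rule2]) (use VX VY that in \<open>simp_all add: lin_id\<close>)
 have e: "L (?U (kact X k2 v) (kact Y k1 w)) = rsum X v (%v0 v1.
   rsum Y w (%w0 w1. k1 w1 * k2 v1 * L (?U v0 w0)))"
  if "k1 : el Ks" "k2 : el Ks" for k1 k2
  using that v w VX VY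
  by (simp add: kact_push[OF VX X(2) l1] kact_push[OF VY Y(2) l2] kact_closed[OF VY Y(2)] tsum_times(1)[symmetric] mult_ac)
 have "L (kact ?XY k (?U v w)) = tsum (ut X Y) K (coact ?XY (?U v w)) (%u x. k x * L u)"
  using kact_push[OF _ co, of L k "?U v w", unfolded yd_tensor_sel] VX VY v w k L by simp
 also have "... = rsum X v (%v0 v1. rsum Y w (%w0 w1. k (w1 ** v1) * L (?U v0 w0)))"
  using tensor_coact_pure[OF X Y v w F] by simp
 also have "... = rsum X v (%v0 v1. rsum Y w (%w0 w1.
   csum Ks k (%k1 k2. k1 w1 * k2 v1 * L (?U v0 w0))))"
  using k by (simp add: K.dual_comult(2) tsum_times(2))
 also have "... = csum Ks k (%k1 k2. rsum X v (%v0 v1.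
   rsum Y w (%w0 w1. k1 w1 * k2 v1 * L (?U v0 w0))))"
  unfolding tsum_swap[of _ _ _ Ks Ks] ..
 finally show ?thesis by (simp add: e)
qed

lemma double_module_tensor:
 assumes yd: "yd_condition H K \<sigma> X" "yd_condition H K \<sigma> Y"
 shows "double_module (yd_tensor H K X Y) = lmod_tensor D (double_module X) (double_module Y)"
proof -
 let ?T = "ut X Y" and ?U = "up X Y" and ?XY = "yd_tensor H K X Y"
 note VX = lmod_fdvs[OF X(1)] and VY = lmod_fdvs[OF Y(1)]
 have co: "rcomodule K ?XY" by (rule rcomodule_tensor[OF X Y])
 have mo: "fd_lmodule H ?XY" by (rule fd_lmodule_yd_tensor[OF X Y])
 have V: "fdvs ?T" using VX VY by simp
 note dX = bilin_left[OF double_act_bilin[OF X]] bilin_right[OF double_act_bilin[OF X]]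
  and dY = bilin_left[OF double_act_bilin[OF Y]] bilin_right[OF double_act_bilin[OF Y]]
 note cl = double_act_closed[OF X] double_act_closed[OF Y]
 let ?G = "%z a1 a2. ulift ?T (%v w. ?U (act (double_module X) a1 v) (act (double_module Y) a2 w)) z"
 have G1: "bilin (sp X) (sp Y) ?T (%v w. ?U (act (double_module X) a1 v) (act (double_module Y) a2 w))"
  if "a1 : el DT" "a2 : el DT" for a1 a2
  using that VX VY by (intro bilinI upure_rule1 upure_rule2 dX dY) (simp_all add: cl D_sel lin_id)
 have G2: "bilin D D ?T (?G z)" if "z : el ?T" for z
  using that VX VY G1 by (intro bilinI ulift_rule) (simp_all add: D_sel cl upure_rule1 upure_rule2 dX dY lin_id)
 have main: "ev ?T \<phi> (kact ?XY k (act ?XY h z)) = csum Ks k (%k1 k2. csum H h (%h1 h2.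
   ev ?T \<phi> (?G z (pure Ks H k2 h1) (pure Ks H k1 h2))))"
  if k: "k : el Ks" and h: "h : el H" and z: "z : el ?T" for k h z \<phi>
 proof (rule utensor_ext[of "space X" "space Y" ground "%z. ev ?T \<phi> (kact ?XY k (act ?XY h z))"])
  have Lk: "(%u. ev ?T \<phi> (kact ?XY k u)) : lin ?T ground"
   using lin_comp[OF ev_lin bilin_lin2[OF kact_bilin[OF _ co] k]] V by simp
  show "(%z. ev ?T \<phi> (kact ?XY k (act ?XY h z))) : lin ?T ground"
   using lin_comp[OF Lk, of "act ?XY h" ?T] act_lin[OF mo h] by simp
  have Gl: "(%z. ?G z a1 a2) : lin ?T ?T" if "a1 : el DT" "a2 : el DT" for a1 a2
   by (rule ulift_lin) (use VX VY G1[OF that] in simp_all)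
  show "(%z. csum Ks k (%k1 k2. csum H h (%h1 h2.
   ev ?T \<phi> (?G z (pure Ks H k2 h1) (pure Ks H k1 h2))))) : lin ?T ground"
   by (intro tsum_rule2 ev_rule Gl) simp_all
  fix v w assume v: "v : el (sp X)" and w: "w : el (sp Y)"
  have "ev ?T \<phi> (kact ?XY k (act ?XY h (?U v w))) = csum H h (%h1 h2. ev ?T \<phi> (kact ?XY k (?U (act X h1 v) (act Y h2 w))))"
   using H.tensor_act_pure[OF X(1) Y(1) h v w Lk] by simp
  also have "... = csum H h (%h1 h2. csum Ks k (%k1 k2.
    ev ?T \<phi> (?U (kact X k2 (act X h1 v)) (kact Y k1 (act Y h2 w)))))"
   using X Y v w by (simp add: kact_tensor[OF k _ _ ev_lin])
  also have "... = csum Ks k (%k1 k2. csum H h (%h1 h2.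
    ev ?T \<phi> (?U (kact X k2 (act X h1 v)) (kact Y k1 (act Y h2 w)))))"
   by (rule tsum_swap)
  finally show "ev ?T \<phi> (kact ?XY k (act ?XY h (?U v w))) = csum Ks k (%k1 k2. csum H h (%h1 h2.
   ev ?T \<phi> (?G (?U v w) (pure Ks H k2 h1) (pure Ks H k1 h2))))"
   using VX VY v w by (simp add: ulift_upure[OF _ _ _ G1] double_act_pure[OF X] double_act_pure[OF Y])
 qed (use VX VY z in simp_all)
 have eq: "act (double_module ?XY) t z = sweedler2 D ?T (?G z) t" if t: "t : el DT" and z: "z : el ?T" for t z
 proof (rule ev_eqI[OF V])
  have Gc: "?G z a b : el ?T" if "a : el D" "b : el D" for a b
   using bilin_closed[OF G2[OF z]] that by simp
  show "sweedler2 D ?T (?G z) t : el ?T"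
   unfolding sweedler2_def by (rule tlift_closed[of D D]) (use double_comult(1)[OF t] V Gc in simp_all)
  show "act (double_module ?XY) t z : el ?T" using double_act_closed[OF mo co] t z by simp
  fix \<phi>
  have N: "bilin D D ground (%a b. ev ?T \<phi> (?G z a b))"
   using G2[OF z] by (intro bilinI ev_rule) (auto simp: bilin_def)
  have "ev ?T \<phi> (sweedler2 D ?T (?G z) t) = csum D t (%a b. ev ?T \<phi> (?G z a b))"
   by (rule sweedler2_push) (use V Gc double_comult(1)[OF t] in simp_all)
  also have "... = tsum Ks H t (%k h. ev ?T \<phi> (kact ?XY k (act ?XY h z)))"
   unfolding double_comult(2)[OF t N] using z by (simp add: main[unfolded yd_tensor_sel])
  also have "... = ev ?T \<phi> (act (double_module ?XY) t z)"
   using double_act_push[OF mo co t, of z] z by simp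
  finally show "ev ?T \<phi> (act (double_module ?XY) t z) = ev ?T \<phi> (sweedler2 D ?T (?G z) t)" by simp
 qed
 have "act (double_module ?XY) = act (lmod_tensor D (double_module X) (double_module Y))"
  using double_act_eq[OF mo co]
  by (simp add: lmod_tensor_def Let_def double_module_def[of ?XY] D_sel eq[symmetric, unfolded double_module_space] cong: restrict_cong)
 then show ?thesis by (intro lmod.equality) simp_all
qed

end

lemma double_module_unit: "double_module (yd_unit H K :: ('k, 'h, 'b, 'u) ydmod) = lmod_unit D"
proof -
 let ?I = "yd_unit H K :: ('k, 'h, 'b, 'u) ydmod" and ?S = "uscalars :: ('k, 'u) space"
 have I: "fd_lmodule H ?I" "rcomodule K ?I" using yd_unit_yd by auto
 have a: "act (double_module ?I) t z = counit D t \<odot>\<^bsub>?S\<^esub> z" if t: "t : el DT" and z: "z : el ?S" for t z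
 proof (rule ev_eqI[of ?S])
  obtain c where c: "z = Scalar c" using z by auto
  show "act (double_module ?I) t z : el ?S" using double_act_closed[OF I t] z by simp
  fix \<phi> let ?L = "ev ?S \<phi>"
  have F: "bilin ?S K ground (%w x. k x * ?L w)" if "k : el Ks" for k
   using that by (intro bilinI) (simp_all add: linear del: uscalars_simps)
  have s: "?L (Scalar (a * c)) = a * ?L z" for a
   using lin_smult[OF ev_lin, of z ?S \<phi> a] z c by simp
  have k: "?L (kact ?I k (Scalar a)) = k eK * ?L (Scalar a)" if "k : el Ks" for k a
   using kact_push[OF _ I(2) _ that, of ?L "Scalar a", unfolded yd_unit_sel] tsum_pure[OF _ _ F[OF that], of "Scalar a" "eK"] by simp
  have cu: "counit D t = tsum Ks H t (%k h. k eK * counit H h)"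
   using tensor_carrier_lists[of Ks H t] t by (simp add: quantum_double_def Let_def tsum_tlift)
  show "?L (act (double_module ?I) t z) = ?L (counit D t \<odot>\<^bsub>?S\<^esub> z)"
   using double_act_push[OF I t, of z ?L] z
   by (simp add: c k s cu tsum_times(2) mult.assoc[symmetric])
 qed (use z in auto)
 have "act (double_module ?I) = act (lmod_unit D)"
  by (simp add: lmod_unit_def double_module_def[of ?I] D_sel a[symmetric] double_act_eq[OF I, symmetric] del: uscalars_simps cong: restrict_cong)
 then show ?thesis by (intro lmod.equality) (simp_all add: lmod_unit_def)
qed

theorem yd_iso_double:
 "strict_iso (YD TYPE('u) H K \<sigma>) (Rep TYPE('u) D) double_module (%(X, f, Y). (double_module X, f, double_module Y))"
 unfolding YD_C[symmetric] Rep_def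
proof (rule YD.strict_iso_linear_tcat)
 show "bij_betw double_module {X :: ('k, 'h, 'b, 'u) ydmod. yd X} {Z. fd_lmodule D Z}"
  unfolding bij_betw_def
 proof
  show "inj_on double_module {X :: ('k, 'h, 'b, 'u) ydmod. yd X}"
   by (rule inj_onI) (auto intro: double_module_inj)
  show "double_module ` {X :: ('k, 'h, 'b, 'u) ydmod. yd X} = {Z. fd_lmodule D Z}"
  proof (intro equalityI subsetI)
   fix Z assume "Z : double_module ` {X :: ('k, 'h, 'b, 'u) ydmod. yd X}"
   then show "Z : {Z. fd_lmodule D Z}" by (auto intro: fd_lmodule_double)
  next
   fix Z :: "('k, (('b => 'k) \<times> 'h) list, 'u) lmod"
   assume "Z : {Z. fd_lmodule D Z}"
   then have Z: "fd_lmodule D Z" by simp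
   show "Z : double_module ` {X :: ('k, 'h, 'b, 'u) ydmod. yd X}"
    using Yz_yd[OF Z] double_module_Yz[OF Z] by (intro image_eqI[of _ _ "double_yd Z"]) simp_all
  qed
 qed
 fix X Y :: "('k, 'h, 'b, 'u) ydmod" and f
 assume "X : {X. yd X}" "Y : {X. yd X}"
 then have X: "fd_lmodule H X" "rcomodule K X" "yd_condition H K \<sigma> X" and Y: "fd_lmodule H Y" "rcomodule K Y" "yd_condition H K \<sigma> Y" by auto
 show "double_module (yd_tensor H K X Y) = lmod_tensor D (double_module X) (double_module Y)"
  by (rule double_module_tensor[OF X(1,2) Y(1,2) X(3) Y(3)])
 assume "f : elin (sp X) (sp Y)"
 then show "module_map D (double_module X) (double_module Y) f = (module_map H X Y f \<and> comodule_map K X Y f)"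
  using double_module_map_iff[OF X(1,2) Y(1,2)] by simp
qed (simp_all add: double_module_unit)

end

section \<open>Restriction along the map from H to K\<close>

lemma tmap_inverse:
 assumes V: "vsp V" "vsp V'" "vsp W" "vsp W'" and f: "f : lin V W" "f' : lin W V" "\<And>v. v : el V ==> f' (f v) = v"
  and g: "g : lin V' W'" "g' : lin W' V'" "\<And>v. v : el V' ==> g' (g v) = v" and t: "t : el (utensor V V')"
 shows "tmap W W' V V' f' g' (tmap V V' W W' f g t) = t"
 by (rule utensor_ext[OF V(1,2) _ lin_comp[OF tmap_lin tmap_lin] lin_id _ t])
  (use V f g in \<open>simp_all add: lin_closed\<close>)

lemma amap_inverse:
 assumes V: "vsp U" "vsp V" "vsp W"
 shows "t : el (utensor (utensor U V) W) ==> ainv U V W (amap U V W t) = t"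
  and "s : el (utensor U (utensor V W)) ==> amap U V W (ainv U V W s) = s"
proof -
 show "ainv U V W (amap U V W t) = t" if "t : el (utensor (utensor U V) W)"
  by (rule utensor_ext3[OF V _ lin_comp[OF ainv_lin amap_lin] lin_id _ that]) (use V in simp_all)
 show "amap U V W (ainv U V W s) = s" if "s : el (utensor U (utensor V W))"
  by (rule utensor_ext3'[OF V _ lin_comp[OF amap_lin ainv_lin] lin_id _ that]) (use V in simp_all)
qed

context surjective_pairing begin

abbreviation rs where "rs \<equiv> restrict_mod H p"

lemma rs_sel [simp]: "space (rs Y) = space Y" "h : el H ==> act (rs Y) h = act Y (p h)"
 by (simp_all add: restrict_mod_def)

lemma act_PiE: "fd_lmodule A Y ==> act Y : el A \<rightarrow>\<^sub>E el (sp Y) \<rightarrow>\<^sub>E el (sp Y)"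
 unfolding fd_lmodule_def by blast

lemma lmod_eqI:
 fixes Y Y' :: "('k, 'a, 'u) lmod"
 assumes "space Y = space Y'" and "act Y : S \<rightarrow>\<^sub>E el (sp Y) \<rightarrow>\<^sub>E el (sp Y)"
  "act Y' : S \<rightarrow>\<^sub>E el (sp Y) \<rightarrow>\<^sub>E el (sp Y)"
  and "\<And>a v. a : S ==> v : el (sp Y) ==> act Y a v = act Y' a v"
 shows "Y = Y'"
proof -
 have "act Y = act Y'"
  by (rule PiE_ext[OF assms(2,3)], rule PiE_ext[of _ "el (sp Y)" "%_. el (sp Y)"]) (use assms in auto)
 then show ?thesis using assms(1) by (intro lmod.equality) simp_all
qed

lemma fd_lmodule_rs: assumes Y: "fd_lmodule K Y" shows "fd_lmodule H (rs Y)"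
 unfolding fd_lmodule_def
proof (intro conjI ballI)
 show "vsp (sp (rs Y))" "vectorspace.fin_dim class_ring (sp (rs Y))" using Y by simp_all
 show "act (rs Y) : el H \<rightarrow>\<^sub>E el (sp (rs Y)) \<rightarrow>\<^sub>E el (sp (rs Y))"
  using act_PiE[OF Y] by (auto simp: restrict_mod_def PiE_def Pi_def)
 show "bilin H (sp (rs Y)) (sp (rs Y)) (act (rs Y))"
 proof (rule bilinI)
  fix v assume v: "v : el (sp (rs Y))"
  have "(%h. act Y (p h) v) : lin H (sp Y)" using Y v by (simp add: linear)
  then show "(%h. act (rs Y) h v) : lin H (sp (rs Y))"
   using lin_cong[of H "%h. act (rs Y) h v" "%h. act Y (p h) v" "space Y"] by simp
 qed (use act_lin[OF Y] in simp)
qed (use Y in \<open>simp_all add: p_one p_mult act_one[OF Y] act_mult[OF Y]\<close>)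

lemma rs_tensor:
 fixes Y Y' :: "('k, 'b, 'u) lmod"
 assumes Y: "fd_lmodule K Y" and Y': "fd_lmodule K Y'"
 shows "lmod_tensor H (rs Y) (rs Y') = rs (lmod_tensor K Y Y')"
proof (rule lmod_eqI[where S = "el H"])
 note rY = fd_lmodule_rs[OF Y] and rY' = fd_lmodule_rs[OF Y']
 show "act (lmod_tensor H (rs Y) (rs Y')) : el H \<rightarrow>\<^sub>E el (sp (lmod_tensor H (rs Y) (rs Y'))) \<rightarrow>\<^sub>E el (sp (lmod_tensor H (rs Y) (rs Y')))"
  by (rule act_PiE[OF H.fd_lmodule_tensor[OF rY rY']])
 show "act (rs (lmod_tensor K Y Y')) : el H \<rightarrow>\<^sub>E el (sp (lmod_tensor H (rs Y) (rs Y'))) \<rightarrow>\<^sub>E el (sp (lmod_tensor H (rs Y) (rs Y')))"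
  using act_PiE[OF fd_lmodule_rs[OF K.fd_lmodule_tensor[OF Y Y']]] by simp
 fix h t assume h: "h : el H" and "t : el (sp (lmod_tensor H (rs Y) (rs Y')))"
 then have t: "t : el (ut Y Y')" by simp
 have "act (lmod_tensor H (rs Y) (rs Y')) h t = act (lmod_tensor K Y Y') (p h) t"
 proof (rule utensor_ext[of "space Y" "space Y'" "ut Y Y'" "act (lmod_tensor H (rs Y) (rs Y')) h" "act (lmod_tensor K Y Y') (p h)"])
  show "act (lmod_tensor H (rs Y) (rs Y')) h : lin (ut Y Y') (ut Y Y')"
   using act_lin[OF H.fd_lmodule_tensor[OF rY rY'] h] by simp
  show "act (lmod_tensor K Y Y') (p h) : lin (ut Y Y') (ut Y Y')"
   using act_lin[OF K.fd_lmodule_tensor[OF Y Y'], of "p h"] h by simp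
  fix v w assume v: "v : el (sp Y)" and w: "w : el (sp Y')"
  show "act (lmod_tensor H (rs Y) (rs Y')) h (up Y Y' v w) = act (lmod_tensor K Y Y') (p h) (up Y Y' v w)"
  proof (rule ev_eqI[of "ut Y Y'"])
   fix \<phi> let ?L = "ev (ut Y Y') \<phi>"
   have F: "bilin K K ground (%x y. ?L (up Y Y' (act Y x v) (act Y' y w)))"
    using Y Y' v w by (intro bilinI) (simp_all add: linear)
   show "?L (act (lmod_tensor H (rs Y) (rs Y')) h (up Y Y' v w)) = ?L (act (lmod_tensor K Y Y') (p h) (up Y Y' v w))"
    using H.tensor_act_pure[OF rY rY' h, of v w ?L] K.tensor_act_pure[OF Y Y' p_closed[OF h] v w, of ?L] v w sum_p_comult[OF h F] by simp
  qed (use Y Y' rY rY' h v w H.tensor_act_closed[OF rY rY' h, of "up Y Y' v w"] in simp_all)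
 qed (use Y Y' t in simp_all)
 then show "act (lmod_tensor H (rs Y) (rs Y')) h t = act (rs (lmod_tensor K Y Y')) h t" using h by simp
qed simp

text \<open>Half braidings are indexed by \<open>H\<close>-modules. As \<open>p\<close> is surjective, the \<open>K\<close>-module structure can be
 read off from the restricted one.\<close>

definition lift_mod :: "('k, 'h, 'u) lmod => ('k, 'b, 'u) lmod" where
 "lift_mod Z = \<lparr>space = space Z, act = \<lambda>k\<in>el K. act Z (inv_into (el H) p k)\<rparr>"

lemma lift_rs: assumes Y: "fd_lmodule K Y" shows "lift_mod (rs Y) = Y"
proof (rule lmod_eqI[where S = "el K"])
 have p: "inv_into (el H) p k : el H" "p (inv_into (el H) p k) = k" if "k : el K" for k
  using that surj inv_into_into[of k p "el H"] f_inv_into_f[of k p "el H"] by simp_all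
 have sp: "space (lift_mod (rs Y)) = space Y" by (simp add: lift_mod_def)
 have e: "act (lift_mod (rs Y)) k v = act Y k v" if "k : el K" for k v
  using that p by (simp add: lift_mod_def)
 then show "act (lift_mod (rs Y)) k v = act Y k v" if "k : el K" for k v using that .
 have e': "act (lift_mod (rs Y)) k = act Y k" if "k : el K" for k using e[OF that] by blast
 show "act (lift_mod (rs Y)) : el K \<rightarrow>\<^sub>E el (sp (lift_mod (rs Y))) \<rightarrow>\<^sub>E el (sp (lift_mod (rs Y)))"
 proof (rule PiE_I)
  fix k assume k: "k : el K"
  show "act (lift_mod (rs Y)) k : el (sp (lift_mod (rs Y))) \<rightarrow>\<^sub>E el (sp (lift_mod (rs Y)))"
   unfolding e'[OF k] sp by (rule PiE_mem[OF act_PiE[OF Y] k])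
 qed (simp add: lift_mod_def)
 show "space (lift_mod (rs Y)) = space Y" by (rule sp)
 show "act Y : el K \<rightarrow>\<^sub>E el (sp (lift_mod (rs Y))) \<rightarrow>\<^sub>E el (sp (lift_mod (rs Y)))"
  unfolding sp by (rule act_PiE[OF Y])
qed

section \<open>The half braiding of a Yetter-Drinfeld module\<close>

text \<open>\<open>bmap\<close> is \<open>y \<otimes> x \<mapsto> \<Sum> x\<^sub>0 \<otimes> x\<^sub>1 y\<close>, and its inverse \<open>cmap\<close> is the half braiding
 \<open>x \<otimes> y \<mapsto> \<Sum> S(x\<^sub>1) y \<otimes> x\<^sub>0\<close>.\<close>

definition bmap :: "('k, 'h, 'b, 'u) ydmod => ('k, 'b, 'u) lmod => ('k, 'u) univ => ('k, 'u) univ" where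
 "bmap X Y = (\<lambda>t\<in>el (ut Y X). ulift (ut X Y)
   (%y x. tlift (ut X Y) (%x0 x1. up X Y x0 (act Y x1 y)) (coact X x)) t)"

definition cmap :: "('k, 'h, 'b, 'u) ydmod => ('k, 'b, 'u) lmod => ('k, 'u) univ => ('k, 'u) univ" where
 "cmap X Y = (\<lambda>t\<in>el (ut X Y). ulift (ut Y X)
   (%x y. tlift (ut Y X) (%x0 x1. up Y X (act Y (antipode K x1) y) x0) (coact X x)) t)"

context
 fixes X :: "('k, 'h, 'b, 'u) ydmod" and Y :: "('k, 'b, 'u) lmod"
 assumes V: "fdvs (sp X)" and co: "coact X : lin (sp X) (tensor (sp X) K)" and Y: "fd_lmodule K Y"
begin

lemma bmap_bilin: "bilin (sp Y) (sp X) (ut X Y)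
 (%y x. tlift (ut X Y) (%x0 x1. up X Y x0 (act Y x1 y)) (coact X x))"
proof (rule bilinI)
 fix y assume y: "y : el (sp Y)"
 have "bilin (sp X) K (ut X Y) (%x0 x1. up X Y x0 (act Y x1 y))"
  using V Y y by (intro bilinI) (simp_all add: linear)
 then show "(%x. tlift (ut X Y) (%x0 x1. up X Y x0 (act Y x1 y)) (coact X x))
   : lin (sp X) (ut X Y)"
  by (intro lin_comp[OF tlift_lin co]) (use V Y in simp_all)
next
 fix x assume x: "x : el (sp X)"
 show "(%y. tlift (ut X Y) (%x0 x1. up X Y x0 (act Y x1 y)) (coact X x))
   : lin (sp Y) (ut X Y)"
  by (rule tlift_param[of "space X" K]) (use V Y lin_closed[OF co x] in \<open>simp_all add: linear\<close>)
qed

lemma bmap_elin: "bmap X Y : elin (ut Y X) (ut X Y)"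
 unfolding bmap_def using V Y ulift_lin[OF _ _ _ bmap_bilin] by simp

lemma bmap_push:
 assumes y: "y : el (sp Y)" and x: "x : el (sp X)" and L: "L : lin (ut X Y) ground"
 shows "L (bmap X Y (up Y X y x)) = rsum X x (%x0 x1. L (up X Y x0 (act Y x1 y)))"
proof -
 have "bmap X Y (up Y X y x) = tlift (ut X Y) (%x0 x1. up X Y x0 (act Y x1 y)) (coact X x)"
  unfolding bmap_def using V Y y x ulift_upure[OF _ _ _ bmap_bilin] by simp
 then show ?thesis
  using tlift_push[OF _ _ _ lin_closed[OF co x] L, of "%x0 x1. up X Y x0 (act Y x1 y)"] V Y y by simp
qed

lemma cmap_bilin: "bilin (sp X) (sp Y) (ut Y X)
 (%x y. tlift (ut Y X) (%x0 x1. up Y X (act Y (antipode K x1) y) x0) (coact X x))"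
proof (rule bilinI)
 fix y assume y: "y : el (sp Y)"
 have "bilin (sp X) K (ut Y X) (%x0 x1. up Y X (act Y (antipode K x1) y) x0)"
  using V Y y by (intro bilinI) (simp_all add: linear)
 then show "(%x. tlift (ut Y X) (%x0 x1. up Y X (act Y (antipode K x1) y) x0) (coact X x))
   : lin (sp X) (ut Y X)"
  by (intro lin_comp[OF tlift_lin co]) (use V Y in simp_all)
next
 fix x assume x: "x : el (sp X)"
 show "(%y. tlift (ut Y X) (%x0 x1. up Y X (act Y (antipode K x1) y) x0) (coact X x))
   : lin (sp Y) (ut Y X)"
  by (rule tlift_param[of "space X" K]) (use V Y lin_closed[OF co x] in \<open>simp_all add: linear\<close>)
qed

lemma cmap_elin: "cmap X Y : elin (ut X Y) (ut Y X)"
 unfolding cmap_def using V Y ulift_lin[OF _ _ _ cmap_bilin] by simp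

lemma cmap_push:
 assumes y: "y : el (sp Y)" and x: "x : el (sp X)" and L: "L : lin (ut Y X) ground"
 shows "L (cmap X Y (up X Y x y)) = rsum X x (%x0 x1. L (up Y X (act Y (antipode K x1) y) x0))"
proof -
 have "cmap X Y (up X Y x y) = tlift (ut Y X) (%x0 x1. up Y X (act Y (antipode K x1) y) x0) (coact X x)"
  unfolding cmap_def using V Y y x ulift_upure[OF _ _ _ cmap_bilin] by simp
 then show ?thesis
  using tlift_push[OF _ _ _ lin_closed[OF co x] L, of "%x0 x1. up Y X (act Y (antipode K x1) y) x0"] V Y y by simp
qed

end

context
 fixes X :: "('k, 'h, 'b, 'u) ydmod" and Y :: "('k, 'b, 'u) lmod"
 assumes V: "fdvs (sp X)" and X: "rcomodule K X" and Y: "fd_lmodule K Y"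
begin

lemma co_lin: "coact X : lin (sp X) (tensor (sp X) K)"
 using V X coact_lin by blast

lemma cmap_bmap: assumes t: "t : el (ut Y X)" shows "cmap X Y (bmap X Y t) = t"
proof (rule utensor_ext[OF _ _ _ lin_comp[OF elin_lin[OF cmap_elin[OF V co_lin Y]] elin_lin[OF bmap_elin[OF V co_lin Y]]] lin_id _ t])
 fix y x assume y: "y : el (sp Y)" and x: "x : el (sp X)"
 let ?XY = "ut X Y" and ?YX = "ut Y X"
 show "cmap X Y (bmap X Y (up Y X y x)) = up Y X y x"
 proof (rule ev_eqI[of ?YX])
  fix \<phi> let ?L = "ev ?YX \<phi>"
  have Lc: "(%t. ?L (cmap X Y t)) : lin ?XY ground" by (rule lin_comp[OF ev_lin elin_lin[OF cmap_elin[OF V co_lin Y]]])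
  have F: "trilin (sp X) K K (%w k l. ?L (up Y X (act Y (antipode K k ** l) y) w))"
   unfolding trilin_def using V Y y by (simp add: linear)
  have "?L (cmap X Y (bmap X Y (up Y X y x)))
   = rsum X x (%x0 x1. rsum X x0 (%x00 x01. ?L (up Y X (act Y (antipode K x01 ** x1) y) x00)))"
   using bmap_push[OF V co_lin Y y x Lc] Y y cmap_push[OF V co_lin Y _ _ ev_lin] by (simp add: act_mult[OF Y])
  also have "... = rsum X x (%x0 x1. csum K x1 (%k l. ?L (up Y X (act Y (antipode K k ** l) y) x0)))"
   by (rule sum_coact_coassoc[OF V X x F])
  also have "... = rsum X x (%x0 x1. counit K x1 * ?L (up Y X y x0))"
  proof (rule tsum_cong[OF HOL.refl])
   fix x0 x1 assume *: "x0 : el (sp X)" "x1 : el K"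
   have "(%k. ?L (up Y X (act Y k y) x0)) : lin K ground" using V Y y * by (simp add: linear)
   from K.sum_antipode_left[OF *(2) this] show "csum K x1 (%k l. ?L (up Y X (act Y (antipode K k ** l) y) x0)) = counit K x1 * ?L (up Y X y x0)"
    using y by (simp add: act_one[OF Y])
  qed
  also have "... = ?L (up Y X y x)"
   by (rule sum_coact_counit[OF V X x]) (use V Y y in \<open>simp add: linear\<close>)
  finally show "?L (cmap X Y (bmap X Y (up Y X y x))) = ?L (up Y X y x)" .
 qed (use V Y y x elin_closed[OF cmap_elin[OF V co_lin Y]] elin_closed[OF bmap_elin[OF V co_lin Y]] in simp_all)
qed (use V Y in simp_all)

lemma bmap_cmap: assumes t: "t : el (ut X Y)" shows "bmap X Y (cmap X Y t) = t"
proof (rule utensor_ext[OF _ _ _ lin_comp[OF elin_lin[OF bmap_elin[OF V co_lin Y]] elin_lin[OF cmap_elin[OF V co_lin Y]]] lin_id _ t])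
 fix y x assume y: "y : el (sp Y)" and x: "x : el (sp X)"
 let ?XY = "ut X Y" and ?YX = "ut Y X"
 show "bmap X Y (cmap X Y (up X Y x y)) = up X Y x y"
 proof (rule ev_eqI[of ?XY])
  fix \<phi> let ?L = "ev ?XY \<phi>"
  have Lc: "(%t. ?L (bmap X Y t)) : lin ?YX ground" by (rule lin_comp[OF ev_lin elin_lin[OF bmap_elin[OF V co_lin Y]]])
  have F: "trilin (sp X) K K (%w k l. ?L (up X Y w (act Y (k ** antipode K l) y)))"
   unfolding trilin_def using V Y y by (simp add: linear)
  have "?L (bmap X Y (cmap X Y (up X Y x y)))
   = rsum X x (%x0 x1. rsum X x0 (%x00 x01. ?L (up X Y x00 (act Y (x01 ** antipode K x1) y))))"
   using cmap_push[OF V co_lin Y y x Lc] Y y bmap_push[OF V co_lin Y _ _ ev_lin] by (simp add: act_mult[OF Y])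
  also have "... = rsum X x (%x0 x1. csum K x1 (%k l. ?L (up X Y x0 (act Y (k ** antipode K l) y))))"
   by (rule sum_coact_coassoc[OF V X x F])
  also have "... = rsum X x (%x0 x1. counit K x1 * ?L (up X Y x0 y))"
  proof (rule tsum_cong[OF HOL.refl])
   fix x0 x1 assume *: "x0 : el (sp X)" "x1 : el K"
   have "(%k. ?L (up X Y x0 (act Y k y))) : lin K ground" using V Y y * by (simp add: linear)
   from K.sum_antipode_right[OF *(2) this] show "csum K x1 (%k l. ?L (up X Y x0 (act Y (k ** antipode K l) y))) = counit K x1 * ?L (up X Y x0 y)"
    using y by (simp add: act_one[OF Y])
  qed
  also have "... = ?L (up X Y x y)"
   by (rule sum_coact_counit[OF V X x]) (use V Y y in \<open>simp add: linear\<close>)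
  finally show "?L (bmap X Y (cmap X Y (up X Y x y))) = ?L (up X Y x y)" .
 qed (use V Y y x elin_closed[OF cmap_elin[OF V co_lin Y]] elin_closed[OF bmap_elin[OF V co_lin Y]] in simp_all)
qed (use V Y in simp_all)

end

end

lemma compose_eq_iff: "compose S g f = compose S g' f' \<longleftrightarrow> (\<forall>x\<in>S. g (f x) = g' (f' x))"
 by (auto simp: compose_def fun_eq_iff restrict_def)

context surjective_pairing begin

abbreviation RC :: "('k, ('k, 'h, 'u) lmod, ('k, 'h, 'u) rep_arr) tcat" where "RC \<equiv> H.Rep.C"
abbreviation RD :: "('k, ('k, 'h, 'u) lmod, ('k, 'h, 'u) rep_arr) tcat" where "RD \<equiv> Rep_restricted TYPE('u) H K p"

lemma RD_sel:
 "Obj RD = rs ` {Y. fd_lmodule K Y}"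
 "Arr RD = {(rs Y, f, rs Y') | Y f Y'. fd_lmodule K Y \<and> fd_lmodule K Y' \<and> f : elin (sp Y) (sp Y') \<and> module_map K Y Y' f}"
proof -
 show "Obj RD = rs ` {Y. fd_lmodule K Y}" by (simp add: Rep_restricted_def K.Rep_C[symmetric] K.Rep.C_sel)
 have "Arr RD = (%(X, f, Y). (rs X, f, rs Y)) ` {(X, f, Y). X : {X. fd_lmodule K X} \<and> Y : {X. fd_lmodule K X} \<and> f : elin (sp X) (sp Y) \<and> module_map K X Y f}"
  by (simp add: Rep_restricted_def K.Rep_C[symmetric] K.Rep.C_sel)
 also have "... = {(rs Y, f, rs Y') | Y f Y'. fd_lmodule K Y \<and> fd_lmodule K Y' \<and> f : elin (sp Y) (sp Y') \<and> module_map K Y Y' f}"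
  by (auto simp: image_iff) blast
 finally show "Arr RD = {(rs Y, f, rs Y') | Y f Y'. fd_lmodule K Y \<and> fd_lmodule K Y' \<and> f : elin (sp Y) (sp Y') \<and> module_map K Y Y' f}" .
qed

text \<open>A half braiding \<open>\<gamma>\<close> with inverse \<open>\<delta>\<close>, on the level of maps. The conditions are imposed on \<open>\<delta>\<close> and
 on pure tensors, in the form in which they are checked and used.\<close>

definition hb_maps :: "('k, 'h, 'u) lmod => (('k, 'b, 'u) lmod => ('k, 'u) univ => ('k, 'u) univ)
  => (('k, 'b, 'u) lmod => ('k, 'u) univ => ('k, 'u) univ) => bool" where
 "hb_maps M \<gamma> \<delta> \<longleftrightarrow>
   (\<forall>Y. fd_lmodule K Y \<longrightarrow> \<gamma> Y : elin (ut M Y) (ut Y M) \<and>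
    \<delta> Y : elin (ut Y M) (ut M Y) \<and>
    (\<forall>t\<in>el (ut M Y). \<delta> Y (\<gamma> Y t) = t) \<and>
    (\<forall>s\<in>el (ut Y M). \<gamma> Y (\<delta> Y s) = s) \<and>
    module_map H (lmod_tensor H (rs Y) M) (lmod_tensor H M (rs Y)) (\<delta> Y)) \<and>
   (\<forall>Y Y' g. fd_lmodule K Y \<longrightarrow> fd_lmodule K Y' \<longrightarrow> g : elin (sp Y) (sp Y') \<longrightarrow> module_map K Y Y' g \<longrightarrow>
    (\<forall>y\<in>el (sp Y). \<forall>x\<in>el (sp M).
     tmap (sp M) (sp Y) (sp M) (sp Y') (\<lambda>v\<in>el (sp M). v) g (\<delta> Y (up Y M y x))
     = \<delta> Y' (up Y' M (g y) x))) \<and>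
   (\<forall>Y Y'. fd_lmodule K Y \<longrightarrow> fd_lmodule K Y' \<longrightarrow>
    (\<forall>y\<in>el (sp Y). \<forall>y'\<in>el (sp Y'). \<forall>x\<in>el (sp M).
     tmap (ut Y M) (sp Y') (ut M Y) (sp Y') (\<delta> Y) (\<lambda>v\<in>el (sp Y'). v)
      (ainv (sp Y) (sp M) (sp Y') (upure (sp Y) (ut M Y') y (\<delta> Y' (up Y' M y' x))))
     = ainv (sp M) (sp Y) (sp Y') (\<delta> (lmod_tensor K Y Y') (upure (ut Y Y') (sp M) (up Y Y' y y') x))))"

lemma hb_mapsD:
 assumes b: "hb_maps M \<gamma> \<delta>" and Y: "fd_lmodule K Y"
 shows "\<gamma> Y : elin (ut M Y) (ut Y M)"
  and "\<delta> Y : elin (ut Y M) (ut M Y)"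
  and "t : el (ut M Y) ==> \<delta> Y (\<gamma> Y t) = t"
  and "s : el (ut Y M) ==> \<gamma> Y (\<delta> Y s) = s"
  and "module_map H (lmod_tensor H (rs Y) M) (lmod_tensor H M (rs Y)) (\<delta> Y)"
proof -
 note c = b[unfolded hb_maps_def, THEN conjunct1, rule_format, OF Y]
 show "\<gamma> Y : elin (ut M Y) (ut Y M)" by (rule conjunct1[OF c])
 note c = conjunct2[OF c]
 show "\<delta> Y : elin (ut Y M) (ut M Y)" by (rule conjunct1[OF c])
 note c = conjunct2[OF c]
 show "\<delta> Y (\<gamma> Y t) = t" if "t : el (ut M Y)" by (rule bspec[OF conjunct1[OF c] that])
 note c = conjunct2[OF c]
 show "\<gamma> Y (\<delta> Y s) = s" if "s : el (ut Y M)" by (rule bspec[OF conjunct1[OF c] that])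
 show "module_map H (lmod_tensor H (rs Y) M) (lmod_tensor H M (rs Y)) (\<delta> Y)" by (rule conjunct2[OF c])
qed

lemma hb_maps_natural:
 assumes "hb_maps M \<gamma> \<delta>" "fd_lmodule K Y" "fd_lmodule K Y'" "g : elin (sp Y) (sp Y')" "module_map K Y Y' g"
  "y : el (sp Y)" "x : el (sp M)"
 shows "tmap (sp M) (sp Y) (sp M) (sp Y') (\<lambda>v\<in>el (sp M). v) g (\<delta> Y (up Y M y x))
     = \<delta> Y' (up Y' M (g y) x)"
 by (rule assms(1)[unfolded hb_maps_def, THEN conjunct2, THEN conjunct1, rule_format, OF assms(2-7)])

lemma hb_maps_hexagon:
 assumes "hb_maps M \<gamma> \<delta>" "fd_lmodule K Y" "fd_lmodule K Y'"
  "y : el (sp Y)" "y' : el (sp Y')" "x : el (sp M)"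
 shows "tmap (ut Y M) (sp Y') (ut M Y) (sp Y') (\<delta> Y) (\<lambda>v\<in>el (sp Y'). v)
      (ainv (sp Y) (sp M) (sp Y') (upure (sp Y) (ut M Y') y (\<delta> Y' (up Y' M y' x))))
     = ainv (sp M) (sp Y) (sp Y') (\<delta> (lmod_tensor K Y Y') (upure (ut Y Y') (sp M) (up Y Y' y y') x))"
 by (rule assms(1)[unfolded hb_maps_def, THEN conjunct2, THEN conjunct2, rule_format, OF assms(2-6)])

definition hb :: "('k, 'h, 'u) lmod => (('k, 'b, 'u) lmod => ('k, 'u) univ => ('k, 'u) univ) => ('k, 'h, 'u) lmod => ('k, 'h, 'u) rep_arr" where
 "hb M \<gamma> = (\<lambda>Z\<in>Obj RD. (lmod_tensor H M Z, \<gamma> (lift_mod Z), lmod_tensor H Z M))"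

lemma hb_rs: "fd_lmodule K Y ==> hb M \<gamma> (rs Y) = (lmod_tensor H M (rs Y), \<gamma> Y, lmod_tensor H (rs Y) M)"
 by (simp add: hb_def RD_sel lift_rs)

text \<open>Both hexagons compare isomorphisms, so they may be checked for the inverse maps, where no
 antipode occurs.\<close>

lemma half_braidingI:
 fixes M :: "('k, 'h, 'u) lmod"
 assumes M: "fd_lmodule H M" and b: "hb_maps M \<gamma> \<delta>"
 shows "half_braiding RC RD M (hb M \<gamma>)"
 unfolding half_braiding_def
proof (intro conjI ballI)
 let ?V = "space M"
 note V = lmod_vsp[OF M]
 note [simp] = lin_id
 note g = hb_mapsD[OF b]
 note gl = elin_lin[OF g(1)] elin_lin[OF g(2)] and gc = elin_closed[OF g(1)] elin_closed[OF g(2)]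
 have Hten: "fd_lmodule H (lmod_tensor H M (rs Y))" "fd_lmodule H (lmod_tensor H (rs Y) M)" if "fd_lmodule K Y" for Y
  using H.fd_lmodule_tensor M fd_lmodule_rs[OF that] by blast+
 show "hb M \<gamma> : extensional (Obj RD)" by (simp add: hb_def)
 fix Z :: "('k, 'h, 'u) lmod" assume "Z : Obj RD"
 then obtain Y where Z: "Z = rs Y" and Y: "fd_lmodule K Y" by (auto simp: RD_sel)
 have P: "module_map H (lmod_tensor H M (rs Y)) (lmod_tensor H (rs Y) M) (\<gamma> Y)"
  by (rule H.Rep.P_inv[of "lmod_tensor H (rs Y) M" "lmod_tensor H M (rs Y)" "\<delta> Y"]) (use Hten[OF Y] g[OF Y] in simp_all)
 show "hb M \<gamma> Z : Hom RC (TenO RC M Z) (TenO RC Z M)"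
  using P Hten[OF Y] g(1)[OF Y] by (simp add: Z hb_rs[OF Y] H.Rep.Hom_iff H.Rep.C_sel)
 show "iso_arr RC (hb M \<gamma> Z)"
  unfolding Z hb_rs[OF Y]
  by (rule H.Rep.iso_arrI, rule H.Rep.inverse_arrI[where g = "\<delta> Y"]) (use P Hten[OF Y] g[OF Y] in simp_all)
 fix Z' :: "('k, 'h, 'u) lmod" assume "Z' : Obj RD"
 then obtain Y' where Z': "Z' = rs Y'" and Y': "fd_lmodule K Y'" by (auto simp: RD_sel)
 let ?Y = "space Y" and ?Y' = "space Y'" and ?YY = "lmod_tensor K Y Y'"
 have YY: "fd_lmodule K ?YY" by (rule K.fd_lmodule_tensor[OF Y Y'])
 note vs = V lmod_vsp[OF Y] lmod_vsp[OF Y']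
 let ?l = "%t. tmap ?Y (utensor ?V ?Y') ?Y (utensor ?Y' ?V) (\<lambda>v\<in>el ?Y. v) (\<gamma> Y') (amap ?Y ?V ?Y' (tmap (utensor ?V ?Y) ?Y' (utensor ?Y ?V) ?Y' (\<gamma> Y) (\<lambda>v\<in>el ?Y'. v) t))"
 let ?r = "%t. amap ?Y ?Y' ?V (\<gamma> ?YY (amap ?V ?Y ?Y' t))"
 let ?l' = "%s. tmap (utensor ?Y ?V) ?Y' (utensor ?V ?Y) ?Y' (\<delta> Y) (\<lambda>v\<in>el ?Y'. v) (ainv ?Y ?V ?Y' (tmap ?Y (utensor ?Y' ?V) ?Y (utensor ?V ?Y') (\<lambda>v\<in>el ?Y. v) (\<delta> Y') s))"
 let ?r' = "%s. ainv ?V ?Y ?Y' (\<delta> ?YY (ainv ?Y ?Y' ?V s))"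
 have gYY: "\<gamma> ?YY : lin (utensor ?V (utensor ?Y ?Y')) (utensor (utensor ?Y ?Y') ?V)" "\<delta> ?YY : lin (utensor (utensor ?Y ?Y') ?V) (utensor ?V (utensor ?Y ?Y'))"
  "\<And>t. t : el (utensor ?V (utensor ?Y ?Y')) ==> \<delta> ?YY (\<gamma> ?YY t) = t"
  using gl[OF YY] g(3)[OF YY] by simp_all
 have lr': "?l' s = ?r' s" if "s : el (utensor ?Y (utensor ?Y' ?V))" for s
 proof (rule utensor_ext3'[OF _ _ _ _ _ _ _ that, where f = ?l' and g = ?r'])
  show "?l' : lin (utensor ?Y (utensor ?Y' ?V)) (utensor (utensor ?V ?Y) ?Y')"
   by (rule lin_comp[OF tmap_lin lin_comp[OF ainv_lin tmap_lin]]) (use vs gl[OF Y] gl[OF Y'] in simp_all)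
  show "?r' : lin (utensor ?Y (utensor ?Y' ?V)) (utensor (utensor ?V ?Y) ?Y')"
   by (rule lin_comp[OF ainv_lin lin_comp[OF gYY(2) ainv_lin]]) (use vs in simp_all)
  fix y y' x assume y: "y : el ?Y" "y' : el ?Y'" "x : el ?V"
  then show "?l' (upure ?Y (utensor ?Y' ?V) y (upure ?Y' ?V y' x)) = ?r' (upure ?Y (utensor ?Y' ?V) y (upure ?Y' ?V y' x))"
   using hb_maps_hexagon[OF b Y Y' y] vs gl[OF Y'] by simp
 qed (use vs in simp_all)
 have "?l t = ?r t" if t: "t : el (utensor (utensor ?V ?Y) ?Y')" for t
 proof -
  have a: "amap ?V ?Y ?Y' t : el (utensor ?V (utensor ?Y ?Y'))" using lin_closed[OF amap_lin t] vs by simp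
  have ga: "\<gamma> ?YY (amap ?V ?Y ?Y' t) : el (utensor (utensor ?Y ?Y') ?V)" by (rule lin_closed[OF gYY(1) a])
  have r: "?r t : el (utensor ?Y (utensor ?Y' ?V))" using lin_closed[OF amap_lin ga] vs by simp
  have "?r' (?r t) = t" using amap_inverse[of ?Y ?Y' ?V] amap_inverse[of ?V ?Y ?Y'] vs ga gYY(3)[OF a] t by simp
  then have l'r: "?l' (?r t) = t" using lr'[OF r] by simp
  let ?m = "tmap ?Y (utensor ?Y' ?V) ?Y (utensor ?V ?Y') (\<lambda>v\<in>el ?Y. v) (\<delta> Y') (?r t)"
  have m: "?m : el (utensor ?Y (utensor ?V ?Y'))"
   by (rule lin_closed[OF tmap_lin r]) (use vs gl[OF Y'] in simp_all)
  have m': "ainv ?Y ?V ?Y' ?m : el (utensor (utensor ?Y ?V) ?Y')"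
   by (rule lin_closed[OF ainv_lin m]) (use vs in simp_all)
  have "tmap (utensor ?V ?Y) ?Y' (utensor ?Y ?V) ?Y' (\<gamma> Y) (\<lambda>v\<in>el ?Y'. v) (?l' (?r t)) = ainv ?Y ?V ?Y' ?m"
   by (rule tmap_inverse[OF _ _ _ _ _ _ _ _ _ _ m']) (use vs gl[OF Y] g(4)[OF Y] in simp_all)
  moreover have "amap ?Y ?V ?Y' (ainv ?Y ?V ?Y' ?m) = ?m" by (rule amap_inverse(2)) (use vs m in simp_all)
  moreover have "tmap ?Y (utensor ?V ?Y') ?Y (utensor ?Y' ?V) (\<lambda>v\<in>el ?Y. v) (\<gamma> Y') ?m = ?r t"
   by (rule tmap_inverse[OF _ _ _ _ _ _ _ _ _ _ r]) (use vs gl[OF Y'] g(4)[OF Y'] in simp_all)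
  ultimately have "?l (?l' (?r t)) = ?r t" by simp
  then show ?thesis unfolding l'r .
 qed
 then show "Comp RC (TenA RC (Id RC Z) (hb M \<gamma> Z')) (Comp RC (Assoc RC Z M Z') (TenA RC (hb M \<gamma> Z) (Id RC Z')))
  = Comp RC (Assoc RC Z Z' M) (Comp RC (hb M \<gamma> (TenO RC Z Z')) (Assoc RC M Z Z'))"
  using vs by (simp add: Z Z' H.Rep.C_sel hb_rs[OF Y] hb_rs[OF Y'] rs_tensor[OF Y Y'] hb_rs[OF YY] compose_eq_iff compose_eq)
next
 let ?V = "space M"
 note V = lmod_vsp[OF M]
 note [simp] = lin_id
 note g = hb_mapsD[OF b]
 fix h :: "('k, 'h, 'u) rep_arr" assume "h : Arr RD"
 then obtain Y f Y' where h: "h = (rs Y, f, rs Y')" and Y: "fd_lmodule K Y" "fd_lmodule K Y'" and f: "f : elin (sp Y) (sp Y')" "module_map K Y Y' f"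
  by (auto simp: RD_sel)
 let ?Y = "space Y" and ?Y' = "space Y'"
 note vs = V lmod_vsp[OF Y(1)] lmod_vsp[OF Y(2)]
 have nat: "tmap ?V ?Y ?V ?Y' (\<lambda>v\<in>el ?V. v) f (\<delta> Y s) = \<delta> Y' (tmap ?Y ?V ?Y' ?V f (\<lambda>v\<in>el ?V. v) s)"
  if "s : el (utensor ?Y ?V)" for s
  by (rule utensor_ext[OF _ _ _ lin_comp[OF tmap_lin elin_lin[OF g(2)[OF Y(1)]]] lin_comp[OF elin_lin[OF g(2)[OF Y(2)]] tmap_lin] _ that])
   (use vs f hb_maps_natural[OF b Y f] in simp_all)
 have "tmap ?Y ?V ?Y' ?V f (\<lambda>v\<in>el ?V. v) (\<gamma> Y t) = \<gamma> Y' (tmap ?V ?Y ?V ?Y' (\<lambda>v\<in>el ?V. v) f t)"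
  if t: "t : el (utensor ?V ?Y)" for t
 proof -
  have s: "\<gamma> Y t : el (utensor ?Y ?V)" by (rule elin_closed[OF g(1)[OF Y(1)] t])
  have "tmap ?Y ?V ?Y' ?V f (\<lambda>v\<in>el ?V. v) (\<gamma> Y t) : el (utensor ?Y' ?V)"
   by (rule lin_closed[OF tmap_lin s]) (use vs f in simp_all)
  then show ?thesis using nat[OF s] g(3)[OF Y(1) t] g(4)[OF Y(2)] by simp
 qed
 then show "Comp RC (TenA RC h (Id RC M)) (hb M \<gamma> (Dom RC h)) = Comp RC (hb M \<gamma> (Cod RC h)) (TenA RC (Id RC M) h)"
  using vs by (simp add: h H.Rep.C_sel hb_rs[OF Y(1)] hb_rs[OF Y(2)] compose_eq_iff compose_eq )
qed

end

context surjective_pairing begin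

text \<open>The converse of \<open>half_braidingI\<close>, with the two sides of the hexagon inverted again.\<close>

lemma half_braidingE:
 fixes M :: "('k, 'h, 'u) lmod"
 assumes M: "fd_lmodule H M" and c: "half_braiding RC RD M c"
 obtains \<gamma> \<delta> where "hb_maps M \<gamma> \<delta>" "c = hb M \<gamma>"
proof -
 let ?V = "space M"
 note V = lmod_vsp[OF M]
 note [simp] = lin_id
 note hb = c[unfolded half_braiding_def]
 let ?Q = "%Y gd. c (rs Y) = (lmod_tensor H M (rs Y), fst gd, lmod_tensor H (rs Y) M) \<and>
  fst gd : elin (utensor ?V (sp Y)) (utensor (sp Y) ?V) \<and> snd gd : elin (utensor (sp Y) ?V) (utensor ?V (sp Y)) \<and>
  (\<forall>t\<in>el (utensor ?V (sp Y)). snd gd (fst gd t) = t) \<and> (\<forall>s\<in>el (utensor (sp Y) ?V). fst gd (snd gd s) = s) \<and>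
  module_map H (lmod_tensor H (rs Y) M) (lmod_tensor H M (rs Y)) (snd gd)"
 define G where "G Y = (SOME gd. ?Q Y gd)" for Y
 define \<gamma> \<delta> where "\<gamma> Y = fst (G Y)" and "\<delta> Y = snd (G Y)" for Y
 have G: "?Q Y (G Y)" if Y: "fd_lmodule K Y" for Y
  unfolding G_def
 proof (rule someI_ex)
  have Z: "rs Y : Obj RD" using Y by (auto simp: RD_sel)
  have "c (rs Y) : Hom RC (lmod_tensor H M (rs Y)) (lmod_tensor H (rs Y) M)" and iso: "iso_arr RC (c (rs Y))"
   using hb Z by (simp_all add: H.Rep.C_sel)
  then obtain g where g: "c (rs Y) = (lmod_tensor H M (rs Y), g, lmod_tensor H (rs Y) M)"
    "g : elin (sp (lmod_tensor H M (rs Y))) (sp (lmod_tensor H (rs Y) M))"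
   by (elim H.Rep.HomE)
  obtain h where "inverse_arr RC (lmod_tensor H M (rs Y), g, lmod_tensor H (rs Y) M) h" using iso g(1) unfolding iso_arr_def by auto
  then obtain d where "h = (lmod_tensor H (rs Y) M, d, lmod_tensor H M (rs Y))" "d : elin (sp (lmod_tensor H (rs Y) M)) (sp (lmod_tensor H M (rs Y)))" "module_map H (lmod_tensor H (rs Y) M) (lmod_tensor H M (rs Y)) d"
   "\<And>v. v : el (sp (lmod_tensor H M (rs Y))) ==> d (g v) = v" "\<And>w. w : el (sp (lmod_tensor H (rs Y) M)) ==> g (d w) = w"
   by (rule H.Rep.inverse_arrE) (rule that)
  then show "\<exists>gd. ?Q Y gd" using g by (intro exI[of _ "(g, d)"]) simp
 qed
 have g: "c (rs Y) = (lmod_tensor H M (rs Y), \<gamma> Y, lmod_tensor H (rs Y) M)"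
  "\<gamma> Y : elin (utensor ?V (sp Y)) (utensor (sp Y) ?V)" "\<delta> Y : elin (utensor (sp Y) ?V) (utensor ?V (sp Y))"
  "t : el (utensor ?V (sp Y)) ==> \<delta> Y (\<gamma> Y t) = t" "s : el (utensor (sp Y) ?V) ==> \<gamma> Y (\<delta> Y s) = s"
  "module_map H (lmod_tensor H (rs Y) M) (lmod_tensor H M (rs Y)) (\<delta> Y)" if "fd_lmodule K Y" for Y t s
  using G[OF that] unfolding \<gamma>_def \<delta>_def by simp_all
 note gl = elin_lin[OF g(2)] elin_lin[OF g(3)]
 have ceq: "c = hb M \<gamma>"
 proof (rule extensionalityI[of _ "Obj RD"])
  show "c : extensional (Obj RD)" using hb by blast
  show "hb M \<gamma> : extensional (Obj RD)" by (simp add: hb_def)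
  fix Z :: "('k, 'h, 'u) lmod" assume "Z : Obj RD"
  then obtain Y where Z: "Z = rs Y" and Y: "fd_lmodule K Y" by (auto simp: RD_sel)
  show "c Z = hb M \<gamma> Z" unfolding Z hb_rs[OF Y] by (rule g(1)[OF Y])
 qed
 have nat: "tmap ?V (sp Y) ?V (sp Y') (\<lambda>v\<in>el ?V. v) f (\<delta> Y (upure (sp Y) ?V y x)) = \<delta> Y' (upure (sp Y') ?V (f y) x)"
  if Y: "fd_lmodule K Y" "fd_lmodule K Y'" and f: "f : elin (sp Y) (sp Y')" "module_map K Y Y' f"
   and y: "y : el (sp Y)" and x: "x : el ?V" for Y Y' f y x
 proof -
  let ?Y = "space Y" and ?Y' = "space Y'"
  note vs = V lmod_vsp[OF Y(1)] lmod_vsp[OF Y(2)]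
  have "(rs Y, f, rs Y') : Arr RD" unfolding RD_sel using Y f by blast
  then have "Comp RC (TenA RC (rs Y, f, rs Y') (Id RC M)) (hb M \<gamma> (Dom RC (rs Y, f, rs Y')))
   = Comp RC (hb M \<gamma> (Cod RC (rs Y, f, rs Y'))) (TenA RC (Id RC M) (rs Y, f, rs Y'))"
   using hb unfolding ceq by blast
  then have n: "tmap ?Y ?V ?Y' ?V f (\<lambda>v\<in>el ?V. v) (\<gamma> Y t) = \<gamma> Y' (tmap ?V ?Y ?V ?Y' (\<lambda>v\<in>el ?V. v) f t)"
   if "t : el (utensor ?V ?Y)" for t
   using that vs by (simp add: H.Rep.C_sel hb_rs[OF Y(1)] hb_rs[OF Y(2)] compose_eq_iff)
  let ?s = "upure ?Y ?V y x"
  have s: "?s : el (utensor ?Y ?V)" using vs x y by simp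
  have d: "\<delta> Y ?s : el (utensor ?V ?Y)" by (rule elin_closed[OF g(3)[OF Y(1)] s])
  have d': "tmap ?V ?Y ?V ?Y' (\<lambda>v\<in>el ?V. v) f (\<delta> Y ?s) : el (utensor ?V ?Y')"
   by (rule lin_closed[OF tmap_lin d]) (use vs f in simp_all)
  have "\<delta> Y' (tmap ?Y ?V ?Y' ?V f (\<lambda>v\<in>el ?V. v) ?s) = tmap ?V ?Y ?V ?Y' (\<lambda>v\<in>el ?V. v) f (\<delta> Y ?s)"
   using n[OF d] g(4)[OF Y(2) d'] g(5)[OF Y(1) s] by simp
  then show ?thesis using vs f y x by simp
 qed
 have hex: "tmap (utensor (sp Y) ?V) (sp Y') (utensor ?V (sp Y)) (sp Y') (\<delta> Y) (\<lambda>v\<in>el (sp Y'). v)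
      (ainv (sp Y) ?V (sp Y') (upure (sp Y) (utensor ?V (sp Y')) y (\<delta> Y' (upure (sp Y') ?V y' x))))
     = ainv ?V (sp Y) (sp Y') (\<delta> (lmod_tensor K Y Y') (upure (ut Y Y') ?V (up Y Y' y y') x))"
  if Y: "fd_lmodule K Y" and Y': "fd_lmodule K Y'" and y: "y : el (sp Y)" "y' : el (sp Y')" "x : el ?V" for Y Y' y y' x
 proof -
  let ?Y = "space Y" and ?Y' = "space Y'" and ?YY = "lmod_tensor K Y Y'"
  have YY: "fd_lmodule K ?YY" by (rule K.fd_lmodule_tensor[OF Y Y'])
  note vs = V lmod_vsp[OF Y] lmod_vsp[OF Y']
  let ?l = "%t. tmap ?Y (utensor ?V ?Y') ?Y (utensor ?Y' ?V) (\<lambda>v\<in>el ?Y. v) (\<gamma> Y') (amap ?Y ?V ?Y' (tmap (utensor ?V ?Y) ?Y' (utensor ?Y ?V) ?Y' (\<gamma> Y) (\<lambda>v\<in>el ?Y'. v) t))"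
  let ?r = "%t. amap ?Y ?Y' ?V (\<gamma> ?YY (amap ?V ?Y ?Y' t))"
  let ?l' = "%s. tmap (utensor ?Y ?V) ?Y' (utensor ?V ?Y) ?Y' (\<delta> Y) (\<lambda>v\<in>el ?Y'. v) (ainv ?Y ?V ?Y' (tmap ?Y (utensor ?Y' ?V) ?Y (utensor ?V ?Y') (\<lambda>v\<in>el ?Y. v) (\<delta> Y') s))"
  let ?r' = "%s. ainv ?V ?Y ?Y' (\<delta> ?YY (ainv ?Y ?Y' ?V s))"
  have gYY: "\<delta> ?YY : lin (utensor (utensor ?Y ?Y') ?V) (utensor ?V (utensor ?Y ?Y'))"
   "\<And>s. s : el (utensor (utensor ?Y ?Y') ?V) ==> \<gamma> ?YY (\<delta> ?YY s) = s"
   using gl[OF YY] g(5)[OF YY] by simp_all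
  have Z: "rs Y : Obj RD" "rs Y' : Obj RD" using Y Y' by (auto simp: RD_sel)
  have "Comp RC (TenA RC (Id RC (rs Y)) (hb M \<gamma> (rs Y'))) (Comp RC (Assoc RC (rs Y) M (rs Y')) (TenA RC (hb M \<gamma> (rs Y)) (Id RC (rs Y'))))
   = Comp RC (Assoc RC (rs Y) (rs Y') M) (Comp RC (hb M \<gamma> (TenO RC (rs Y) (rs Y'))) (Assoc RC M (rs Y) (rs Y')))"
   using hb Z unfolding ceq by blast
  then have lr: "?l t = ?r t" if "t : el (utensor (utensor ?V ?Y) ?Y')" for t
   using that vs by (simp add: H.Rep.C_sel hb_rs[OF Y] hb_rs[OF Y'] rs_tensor[OF Y Y'] hb_rs[OF YY] compose_eq_iff compose_eq)
  let ?s = "upure ?Y (utensor ?Y' ?V) y (upure ?Y' ?V y' x)"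
  have s: "?s : el (utensor ?Y (utensor ?Y' ?V))" using vs y by simp
  have a: "ainv ?Y ?Y' ?V ?s : el (utensor (utensor ?Y ?Y') ?V)" by (rule lin_closed[OF ainv_lin s]) (use vs in simp_all)
  have b: "\<delta> ?YY (ainv ?Y ?Y' ?V ?s) : el (utensor ?V (utensor ?Y ?Y'))" by (rule lin_closed[OF gYY(1) a])
  have r': "?r' ?s : el (utensor (utensor ?V ?Y) ?Y')" by (rule lin_closed[OF ainv_lin b]) (use vs in simp_all)
  have "?r (?r' ?s) = ?s"
   using amap_inverse(2)[of ?V ?Y ?Y', OF _ _ _ b] amap_inverse(2)[of ?Y ?Y' ?V, OF _ _ _ s] gYY(2)[OF a] vs by simp
  then have l: "?l (?r' ?s) = ?s" using lr[OF r'] by simp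
  let ?m = "tmap (utensor ?V ?Y) ?Y' (utensor ?Y ?V) ?Y' (\<gamma> Y) (\<lambda>v\<in>el ?Y'. v) (?r' ?s)"
  have m: "?m : el (utensor (utensor ?Y ?V) ?Y')"
   by (rule lin_closed[OF tmap_lin r']) (use vs gl[OF Y] in simp_all)
  have m': "amap ?Y ?V ?Y' ?m : el (utensor ?Y (utensor ?V ?Y'))"
   by (rule lin_closed[OF amap_lin m]) (use vs in simp_all)
  have "tmap ?Y (utensor ?Y' ?V) ?Y (utensor ?V ?Y') (\<lambda>v\<in>el ?Y. v) (\<delta> Y') (?l (?r' ?s)) = amap ?Y ?V ?Y' ?m"
   by (rule tmap_inverse[OF _ _ _ _ _ _ _ _ _ _ m']) (use vs gl[OF Y'] g(4)[OF Y'] in simp_all)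
  moreover have "ainv ?Y ?V ?Y' (amap ?Y ?V ?Y' ?m) = ?m" by (rule amap_inverse(1)) (use vs m in simp_all)
  moreover have "tmap (utensor ?Y ?V) ?Y' (utensor ?V ?Y) ?Y' (\<delta> Y) (\<lambda>v\<in>el ?Y'. v) ?m = ?r' ?s"
   by (rule tmap_inverse[OF _ _ _ _ _ _ _ _ _ _ r']) (use vs gl[OF Y] g(4)[OF Y] in simp_all)
  ultimately have "?l' (?l (?r' ?s)) = ?r' ?s" by simp
  then have "?l' ?s = ?r' ?s" unfolding l .
  then show ?thesis using vs y gl[OF Y'] by simp
 qed
 have "hb_maps M \<gamma> \<delta>"
  unfolding hb_maps_def using g nat hex by (intro conjI allI impI ballI) simp_all
 then show thesis using ceq by (rule that)
qed

context
 fixes X :: "('k, 'h, 'b, 'u) ydmod"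
 assumes X: "fd_lmodule H X" and co: "coact X : lin (sp X) (tensor (sp X) K)"
begin

lemma bmap_lin: "fd_lmodule K Y ==> bmap X Y : lin (ut Y X) (ut X Y)"
 using bmap_elin[OF lmod_fdvs[OF X] co] by simp

text \<open>The next four lemmas compute both sides of linearity and of the hexagon without the comodule
 axioms, as they serve to deduce these axioms from a half braiding as well.\<close>

lemma bmap_act_left:
 assumes Y: "fd_lmodule K Y" and h: "h : el H" and y: "y : el (sp Y)" and x: "x : el (sp X)"
  and L: "L : lin (ut X Y) ground"
 shows "L (bmap X Y (act (lmod_tensor H (rs Y) (lmod.truncate X)) h (up Y X y x)))
  = csum H h (%h1 h2. rsum X (act X h2 x) (%w k. L (up X Y w (act Y (k ** p h1) y))))"
proof -
 let ?M = "lmod.truncate X"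
 have M: "fd_lmodule H ?M" using X by (simp add: fd_lmodule_truncate)
 have Lb: "(%s. L (bmap X Y s)) : lin (ut Y X) ground" by (rule lin_comp[OF L bmap_lin[OF Y]])
 have "L (bmap X Y (act (lmod_tensor H (rs Y) ?M) h (up Y X y x)))
  = csum H h (%h1 h2. L (bmap X Y (up Y X (act Y (p h1) y) (act X h2 x))))"
  using H.tensor_act_pure[OF fd_lmodule_rs[OF Y] M h, of y x "%s. L (bmap X Y s)"] y x Lb by simp
 then show ?thesis
  using X Y y x by (simp add: bmap_push[OF lmod_fdvs[OF X] co Y _ _ L] act_mult[OF Y])
qed

lemma bmap_act_right:
 assumes Y: "fd_lmodule K Y" and h: "h : el H" and y: "y : el (sp Y)" and x: "x : el (sp X)"
  and L: "L : lin (ut X Y) ground"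
 shows "L (act (lmod_tensor H (lmod.truncate X) (rs Y)) h (bmap X Y (up Y X y x)))
  = csum H h (%h1 h2. rsum X x (%w k. L (up X Y (act X h1 w) (act Y (p h2 ** k) y))))"
proof -
 let ?M = "lmod.truncate X"
 have M: "fd_lmodule H ?M" using X by (simp add: fd_lmodule_truncate)
 have "act (lmod_tensor H ?M (rs Y)) h : lin (ut X Y) (ut X Y)"
  using act_lin[OF H.fd_lmodule_tensor[OF M fd_lmodule_rs[OF Y]] h] by simp
 then have La: "(%s. L (act (lmod_tensor H ?M (rs Y)) h s)) : lin (ut X Y) ground" by (rule lin_comp[OF L])
 have "L (act (lmod_tensor H ?M (rs Y)) h (bmap X Y (up Y X y x)))
  = rsum X x (%w k. L (act (lmod_tensor H ?M (rs Y)) h (up X Y w (act Y k y))))"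
  by (rule bmap_push[OF lmod_fdvs[OF X] co Y y x La])
 also have "... = rsum X x (%w k. csum H h (%h1 h2. L (up X Y (act X h1 w) (act Y (p h2 ** k) y))))"
  using H.tensor_act_pure[OF M fd_lmodule_rs[OF Y] h, of _ _ L] L Y y by (simp add: act_mult[OF Y])
 also have "... = csum H h (%h1 h2. rsum X x (%w k. L (up X Y (act X h1 w) (act Y (p h2 ** k) y))))"
  by (rule tsum_swap)
 finally show ?thesis .
qed

lemma bmap_hexagon_left:
 assumes Y: "fd_lmodule K Y" and Y': "fd_lmodule K Y'" and y: "y : el (sp Y)" "y' : el (sp Y')" and x: "x : el (sp X)"
  and L: "L : lin (utensor (ut X Y) (sp Y')) ground"
 shows "L (tmap (ut Y X) (sp Y') (ut X Y) (sp Y') (bmap X Y) (\<lambda>v\<in>el (sp Y'). v)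
   (ainv (sp Y) (sp X) (sp Y') (upure (sp Y) (ut X Y') y (bmap X Y' (up Y' X y' x)))))
  = rsum X x (%x0 x1. rsum X x0 (%x00 x01.
    L (upure (ut X Y) (sp Y') (up X Y x00 (act Y x01 y)) (act Y' x1 y'))))"
proof -
 let ?V = "space X" and ?Y = "space Y" and ?Y' = "space Y'"
 let ?f = "%u. tmap (utensor ?Y ?V) ?Y' (utensor ?V ?Y) ?Y' (bmap X Y) (\<lambda>v\<in>el ?Y'. v) (ainv ?Y ?V ?Y' (upure ?Y (utensor ?V ?Y') y u))"
 note vs = lmod_vsp[OF X] lmod_vsp[OF Y] lmod_vsp[OF Y']
 have f: "?f : lin (utensor ?V ?Y') (utensor (utensor ?V ?Y) ?Y')"
  by (rule lin_comp[OF tmap_lin lin_comp[OF ainv_lin upure_rule2]]) (use vs bmap_lin[OF Y] y in \<open>simp_all add: lin_id\<close>)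
 have "L (?f (bmap X Y' (upure ?Y' ?V y' x))) = tsum ?V K (coact X x) (%x0 x1. L (?f (upure ?V ?Y' x0 (act Y' x1 y'))))"
  by (rule bmap_push[OF lmod_fdvs[OF X] co Y' y(2) x lin_comp[OF L f]])
 also have "... = tsum ?V K (coact X x) (%x0 x1. L (upure (utensor ?V ?Y) ?Y' (bmap X Y (upure ?Y ?V y x0)) (act Y' x1 y')))"
  using vs Y' y bmap_lin[OF Y] by (simp add: lin_id)
 also have "... = tsum ?V K (coact X x) (%x0 x1. tsum ?V K (coact X x0) (%x00 x01. L (upure (utensor ?V ?Y) ?Y' (upure ?V ?Y x00 (act Y x01 y)) (act Y' x1 y'))))"
 proof (rule tsum_cong[OF HOL.refl])
  fix x0 x1 assume *: "x0 : el ?V" "x1 : el K"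
  have "(%u. L (upure (utensor ?V ?Y) ?Y' u (act Y' x1 y'))) : lin (utensor ?V ?Y) ground"
   by (rule lin_comp[OF L upure_rule1]) (use vs Y' y * in \<open>simp_all add: lin_id\<close>)
  from bmap_push[OF lmod_fdvs[OF X] co Y y(1) *(1) this]
  show "L (upure (utensor ?V ?Y) ?Y' (bmap X Y (upure ?Y ?V y x0)) (act Y' x1 y')) = tsum ?V K (coact X x0) (%x00 x01. L (upure (utensor ?V ?Y) ?Y' (upure ?V ?Y x00 (act Y x01 y)) (act Y' x1 y')))" .
 qed
 finally show ?thesis .
qed

lemma bmap_hexagon_right:
 assumes Y: "fd_lmodule K Y" and Y': "fd_lmodule K Y'" and y: "y : el (sp Y)" "y' : el (sp Y')" and x: "x : el (sp X)"
  and L: "L : lin (utensor (ut X Y) (sp Y')) ground"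
 shows "L (ainv (sp X) (sp Y) (sp Y') (bmap X (lmod_tensor K Y Y') (upure (ut Y Y') (sp X) (up Y Y' y y') x)))
  = rsum X x (%x0 x1. csum K x1 (%k l.
    L (upure (ut X Y) (sp Y') (up X Y x0 (act Y k y)) (act Y' l y'))))"
proof -
 let ?V = "space X" and ?Y = "space Y" and ?Y' = "space Y'" and ?YY = "lmod_tensor K Y Y'"
 have YY: "fd_lmodule K ?YY" by (rule K.fd_lmodule_tensor[OF Y Y'])
 note vs = lmod_vsp[OF X] lmod_vsp[OF Y] lmod_vsp[OF Y']
 have La: "(%s. L (ainv ?V ?Y ?Y' s)) : lin (utensor ?V (utensor ?Y ?Y')) ground"
  by (rule lin_comp[OF L ainv_lin]) (use vs in simp_all)
 have "L (ainv ?V ?Y ?Y' (bmap X ?YY (upure (utensor ?Y ?Y') ?V (upure ?Y ?Y' y y') x)))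
  = tsum ?V K (coact X x) (%x0 x1. L (ainv ?V ?Y ?Y' (upure ?V (utensor ?Y ?Y') x0 (act ?YY x1 (upure ?Y ?Y' y y')))))"
  using bmap_push[OF lmod_fdvs[OF X] co YY _ x, of "upure ?Y ?Y' y y'" "%s. L (ainv ?V ?Y ?Y' s)"] La vs y by simp
 also have "... = tsum ?V K (coact X x) (%x0 x1. csum K x1 (%k l. L (upure (utensor ?V ?Y) ?Y' (upure ?V ?Y x0 (act Y k y)) (act Y' l y'))))"
 proof (rule tsum_cong[OF HOL.refl])
  fix x0 x1 assume *: "x0 : el ?V" "x1 : el K"
  have "(%u. L (ainv ?V ?Y ?Y' (upure ?V (utensor ?Y ?Y') x0 u))) : lin (utensor ?Y ?Y') ground"
   by (rule lin_comp[OF La upure_rule2]) (use vs * in \<open>simp_all add: lin_id\<close>)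
  from K.tensor_act_pure[OF Y Y' *(2) y this]
  show "L (ainv ?V ?Y ?Y' (upure ?V (utensor ?Y ?Y') x0 (act ?YY x1 (upure ?Y ?Y' y y')))) = csum K x1 (%k l. L (upure (utensor ?V ?Y) ?Y' (upure ?V ?Y x0 (act Y k y)) (act Y' l y')))"
   using vs Y Y' y * by simp
 qed
 finally show ?thesis .
qed

end

lemma yd_hb_maps:
 fixes X :: "('k, 'h, 'b, 'u) ydmod"
 assumes X: "fd_lmodule H X" "rcomodule K X" "yd_condition H K \<sigma> X"
 shows "hb_maps (lmod.truncate X) (cmap X) (bmap X)"
proof -
 let ?V = "space X" and ?M = "lmod.truncate X"
 note V = lmod_fdvs[OF X(1)] and V' = lmod_vsp[OF X(1)]
 have co: "coact X : lin ?V (tensor ?V K)" by (rule coact_lin[OF V' X(2)])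
 have M: "fd_lmodule H ?M" using X by (simp add: fd_lmodule_truncate)
 note [simp] = lin_id
 have br: "yd_braided X" using X(3) yd_condition_iff[OF X(1,2)] by simp
 note bl = bmap_lin[OF X(1) co]
 have lin_map: "module_map H (lmod_tensor H (rs Y) ?M) (lmod_tensor H ?M (rs Y)) (bmap X Y)" if Y: "fd_lmodule K Y" for Y
  unfolding module_map_def
 proof (intro ballI)
  let ?Y = "space Y"
  note rY = fd_lmodule_rs[OF Y]
  note vs = V' lmod_vsp[OF Y]
  fix h s assume h: "h : el H" and "s : el (sp (lmod_tensor H (rs Y) ?M))"
  then have s: "s : el (utensor ?Y ?V)" by simp
  have a1: "act (lmod_tensor H (rs Y) ?M) h : lin (utensor ?Y ?V) (utensor ?Y ?V)"
   using act_lin[OF H.fd_lmodule_tensor[OF rY M] h] by simp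
  have a2: "act (lmod_tensor H ?M (rs Y)) h : lin (utensor ?V ?Y) (utensor ?V ?Y)"
   using act_lin[OF H.fd_lmodule_tensor[OF M rY] h] by simp
  show "bmap X Y (act (lmod_tensor H (rs Y) ?M) h s) = act (lmod_tensor H ?M (rs Y)) h (bmap X Y s)"
  proof (rule utensor_ext[OF _ _ _ lin_comp[OF bl[OF Y] a1] lin_comp[OF a2 bl[OF Y]] _ s])
   fix y x assume y: "y : el ?Y" and x: "x : el ?V"
   show "bmap X Y (act (lmod_tensor H (rs Y) ?M) h (upure ?Y ?V y x)) = act (lmod_tensor H ?M (rs Y)) h (bmap X Y (upure ?Y ?V y x))"
   proof (rule ev_eqI[of "utensor ?V ?Y"])
    fix \<phi> let ?L = "ev (utensor ?V ?Y) \<phi>"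
    have F: "bilin ?V K ground (%w k. ?L (upure ?V ?Y w (act Y k y)))"
     using vs Y y by (intro bilinI) (simp_all add: linear)
    show "?L (bmap X Y (act (lmod_tensor H (rs Y) ?M) h (upure ?Y ?V y x))) = ?L (act (lmod_tensor H ?M (rs Y)) h (bmap X Y (upure ?Y ?V y x)))"
     unfolding bmap_act_left[OF X(1) co Y h y x ev_lin] bmap_act_right[OF X(1) co Y h y x ev_lin]
     using br h x F unfolding yd_braided_def by fast
   qed (use V vs Y y x lin_closed[OF a1] lin_closed[OF a2] lin_closed[OF bl[OF Y]] in simp_all)
  qed (use vs in simp_all)
 qed
 have nat: "tmap ?V (sp Y) ?V (sp Y') (\<lambda>v\<in>el ?V. v) g (bmap X Y (upure (sp Y) ?V y x)) = bmap X Y' (upure (sp Y') ?V (g y) x)"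
  if Y: "fd_lmodule K Y" "fd_lmodule K Y'" and g: "g : elin (sp Y) (sp Y')" "module_map K Y Y' g"
   and y: "y : el (sp Y)" and x: "x : el ?V" for Y Y' g y x
 proof (rule ev_eqI[of "utensor ?V (sp Y')"])
  note vs = V' lmod_vsp[OF Y(1)] lmod_vsp[OF Y(2)]
  note gy = elin_closed[OF g(1) y]
  have t: "tmap ?V (sp Y) ?V (sp Y') (\<lambda>v\<in>el ?V. v) g : lin (utensor ?V (sp Y)) (utensor ?V (sp Y'))"
   by (rule tmap_lin) (use vs g in simp_all)
  fix \<phi>
  show "ev (utensor ?V (sp Y')) \<phi> (tmap ?V (sp Y) ?V (sp Y') (\<lambda>v\<in>el ?V. v) g (bmap X Y (upure (sp Y) ?V y x)))
    = ev (utensor ?V (sp Y')) \<phi> (bmap X Y' (upure (sp Y') ?V (g y) x))"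
   using vs g Y y unfolding bmap_push[OF V co Y(2) gy x ev_lin] bmap_push[OF V co Y(1) y x lin_comp[OF ev_lin t]]
   by (simp add: module_mapD[OF g(2)])
  show "tmap ?V (sp Y) ?V (sp Y') (\<lambda>v\<in>el ?V. v) g (bmap X Y (upure (sp Y) ?V y x)) : el (utensor ?V (sp Y'))"
   by (rule lin_closed[OF t lin_closed[OF bl[OF Y(1)]]]) (use vs y x in simp)
  show "bmap X Y' (upure (sp Y') ?V (g y) x) : el (utensor ?V (sp Y'))"
   by (rule lin_closed[OF bl[OF Y(2)]]) (use vs gy x in simp)
 qed (use V Y in simp)
 have hex: "tmap (utensor (sp Y) ?V) (sp Y') (utensor ?V (sp Y)) (sp Y') (bmap X Y) (\<lambda>v\<in>el (sp Y'). v)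
      (ainv (sp Y) ?V (sp Y') (upure (sp Y) (utensor ?V (sp Y')) y (bmap X Y' (upure (sp Y') ?V y' x))))
     = ainv ?V (sp Y) (sp Y') (bmap X (lmod_tensor K Y Y') (upure (ut Y Y') ?V (up Y Y' y y') x))"
  if Y: "fd_lmodule K Y" and Y': "fd_lmodule K Y'" and y: "y : el (sp Y)" "y' : el (sp Y')" and x: "x : el ?V" for Y Y' y y' x
 proof -
  let ?Y = "space Y" and ?Y' = "space Y'" and ?YY = "lmod_tensor K Y Y'"
  let ?T = "utensor (utensor ?V ?Y) ?Y'"
  note vs = V' lmod_vsp[OF Y] lmod_vsp[OF Y']
  have bYY: "bmap X ?YY : lin (utensor (utensor ?Y ?Y') ?V) (utensor ?V (utensor ?Y ?Y'))"
   using bl[OF K.fd_lmodule_tensor[OF Y Y']] by simp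
  have b': "bmap X Y' (upure ?Y' ?V y' x) : el (utensor ?V ?Y')" by (rule lin_closed[OF bl[OF Y']]) (use vs y x in simp)
  have "upure ?Y (utensor ?V ?Y') y (bmap X Y' (upure ?Y' ?V y' x)) : el (utensor ?Y (utensor ?V ?Y'))"
   using vs y b' by simp
  note a = lin_closed[OF ainv_lin this]
  show ?thesis
  proof (rule ev_eqI[of ?T])
   fix \<phi>
   have "trilin ?V K K (%w k l. ev ?T \<phi> (upure (utensor ?V ?Y) ?Y' (upure ?V ?Y w (act Y k y)) (act Y' l y')))"
    unfolding trilin_def using vs Y Y' y by (simp add: linear)
   from sum_coact_coassoc[OF V X(2) x this]
   show "ev ?T \<phi> (tmap (utensor ?Y ?V) ?Y' (utensor ?V ?Y) ?Y' (bmap X Y) (\<lambda>v\<in>el ?Y'. v) (ainv ?Y ?V ?Y' (upure ?Y (utensor ?V ?Y') y (bmap X Y' (upure ?Y' ?V y' x)))))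
    = ev ?T \<phi> (ainv ?V ?Y ?Y' (bmap X ?YY (upure (utensor ?Y ?Y') ?V (upure ?Y ?Y' y y') x)))"
    unfolding bmap_hexagon_left[OF X(1) co Y Y' y x ev_lin] bmap_hexagon_right[OF X(1) co Y Y' y x ev_lin] .
   show "tmap (utensor ?Y ?V) ?Y' (utensor ?V ?Y) ?Y' (bmap X Y) (\<lambda>v\<in>el ?Y'. v) (ainv ?Y ?V ?Y' (upure ?Y (utensor ?V ?Y') y (bmap X Y' (upure ?Y' ?V y' x)))) : el ?T"
    by (rule lin_closed[OF tmap_lin a]) (use vs bl[OF Y] in simp_all)
   show "ainv ?V ?Y ?Y' (bmap X ?YY (upure (utensor ?Y ?Y') ?V (upure ?Y ?Y' y y') x)) : el ?T"
    by (rule lin_closed[OF ainv_lin lin_closed[OF bYY]]) (use vs y x in simp_all)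
  qed (use V Y Y' in simp)
 qed
 show ?thesis
  unfolding hb_maps_def
  using cmap_elin[OF V co] bmap_elin[OF V co] cmap_bmap[OF V X(2)] bmap_cmap[OF V X(2)] lin_map nat hex by simp
qed

end

context surjective_pairing begin

section \<open>A copy of the regular module\<close>

text \<open>Objects live in the type \<open>univ\<close>, so the regular module of \<open>K\<close> has to be copied into it. The
 coordinate vector embeds \<open>K\<close>; it is stored as a list of pairs with dummy second entries.\<close>

definition kemb :: "'b => ('k, 'u) univ" where
 "kemb x = Tensor (map (%b. (Scalar (kd b x), Scalar 0)) kb)"

definition kinv :: "('k, 'u) univ => 'b" where
 "kinv = inv_into (el K) kemb"

lemma kemb_inj: "inj_on (kemb :: 'b => ('k, 'u) univ) (el K)"
proof (rule inj_onI, rule ev_eqI[OF K.fdA])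
 fix x y \<phi> assume x: "x : el K" and y: "y : el K" and eq: "(kemb x :: ('k, 'u) univ) = kemb y"
 then have kd: "kd b x = kd b y" if "b : set kb" for b using that by (simp add: kemb_def)
 have "(\<Sum>b\<leftarrow>kb. kd b x * ev K \<phi> (fst b)) = (\<Sum>b\<leftarrow>kb. kd b y * ev K \<phi> (fst b))"
  by (rule arg_cong[where f = sum_list], rule map_cong) (simp_all only: kd)
 then show "ev K \<phi> x = ev K \<phi> y" using kb_sum[OF ev_lin x, of \<phi>] kb_sum[OF ev_lin y, of \<phi>] by simp
qed

lemma kinv_kemb [simp]: "x : el K ==> kinv (kemb x :: ('k, 'u) univ) = x"
 unfolding kinv_def by (rule inv_into_f_f[OF kemb_inj])

definition regular :: "('k, 'b, 'u) lmod" where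
 "regular = \<lparr>space = \<lparr>carrier = kemb ` el K, mult = undefined, one = undefined, zero = kemb \<zero>\<^bsub>K\<^esub>,
   add = %a b. kemb (kinv a \<oplus>\<^bsub>K\<^esub> kinv b), smult = %c a. kemb (c \<odot>\<^bsub>K\<^esub> kinv a)\<rparr>,
  act = \<lambda>k\<in>el K. \<lambda>v\<in>kemb ` el K. kemb (k ** kinv v)\<rparr>"

abbreviation R where "R \<equiv> space regular"

lemma regular_simps: "el R = kemb ` el K" "\<zero>\<^bsub>R\<^esub> = kemb \<zero>\<^bsub>K\<^esub>" "a \<oplus>\<^bsub>R\<^esub> b = kemb (kinv a \<oplus>\<^bsub>K\<^esub> kinv b)"
  "c \<odot>\<^bsub>R\<^esub> a = kemb (c \<odot>\<^bsub>K\<^esub> kinv a)"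
 by (simp_all add: regular_def)

lemma kemb_lin: "kemb : lin K (R :: ('k, 'u) space)"
 by (rule linI) (simp_all add: regular_simps)

lemma vs_regular [simp]: "vsp (R :: ('k, 'u) space)"
 by (rule vs_transfer[OF K.vsA kemb_lin]) (simp_all add: regular_simps)

lemma fdvs_regular: "fdvs (R :: ('k, 'u) space)"
 by (rule fdvs_image[OF K.fdA vs_regular kemb_lin]) (simp add: regular_simps)

lemma kinv_lin: "kinv : lin (R :: ('k, 'u) space) K"
 by (rule linI) (auto simp: regular_simps)

lemma kemb_closed [simp]: "x : el K ==> kemb x : el R"
 by (simp add: regular_simps)

lemma kinv_closed [simp]: "v : el (R :: ('k, 'u) space) ==> kinv v : el K"
 by (rule lin_closed[OF kinv_lin])

lemma kemb_kinv: "v : el (R :: ('k, 'u) space) ==> kemb (kinv v) = v"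
 by (auto simp: regular_simps)

lemma regular_act: "k : el K ==> v : el (R :: ('k, 'u) space) ==> act regular k v = kemb (k ** kinv v)"
 by (simp add: regular_def)

lemma fd_lmodule_regular: "fd_lmodule K (regular :: ('k, 'b, 'u) lmod)"
 unfolding fd_lmodule_def
proof (intro conjI ballI)
 let ?R = "R :: ('k, 'u) space"
 show "vsp ?R" "vectorspace.fin_dim class_ring ?R" using fdvs_regular by blast+
 show "act regular : el K \<rightarrow>\<^sub>E el ?R \<rightarrow>\<^sub>E el ?R"
  by (intro PiE_I) (simp_all add: regular_act, simp_all add: regular_def)
 show "bilin K ?R ?R (act regular)"
 proof (rule bilinI)
  fix k assume k: "k : el K"
  have "(%v. kemb (k ** kinv v)) : lin ?R ?R"
   by (intro lin_comp[OF kemb_lin K.mult_rule2] kinv_lin k)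
  then show "act regular k : lin ?R ?R"
   using lin_cong[of ?R "act regular k" "%v. kemb (k ** kinv v)" ?R] k by (simp add: regular_act)
 next
  fix v assume v: "v : el ?R"
  have "(%k. kemb (k ** kinv v)) : lin K ?R"
   by (intro lin_comp[OF kemb_lin K.mult_rule1] lin_id kinv_closed v)
  then show "(%k. act regular k v) : lin K ?R"
   using lin_cong[of K "%k. act regular k v" "%k. kemb (k ** kinv v)" ?R] v by (simp add: regular_act)
 qed
qed (simp_all add: regular_act kemb_kinv K.m_assoc)

section \<open>The coaction determined by a half braiding\<close>

definition hb_yd :: "('k, 'h, 'u) lmod => (('k, 'b, 'u) lmod => ('k, 'u) univ => ('k, 'u) univ) => ('k, 'h, 'b, 'u) ydmod" where
 "hb_yd M \<delta> = \<lparr>space = space M, act = act M,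
   coact = \<lambda>x\<in>el (sp M). ulift (tensor (sp M) K) (%v s. pure (sp M) K v (kinv s))
    (\<delta> regular (upure R (sp M) (kemb eK) x))\<rparr>"

lemma hb_yd_sel [simp]: "space (hb_yd M \<delta>) = space M" "act (hb_yd M \<delta>) = act M" "lmod.truncate (hb_yd M \<delta>) = M"
 by (simp_all add: hb_yd_def lmod.truncate_def)

context
 fixes M :: "('k, 'h, 'u) lmod" and \<gamma> \<delta>
 assumes M: "fd_lmodule H M" and hb: "hb_maps M \<gamma> \<delta>"
begin

abbreviation "Xh \<equiv> hb_yd M \<delta>"

lemma vsM: "vsp (sp M)" by (rule lmod_vsp[OF M])

lemma Xh_module: "fd_lmodule H Xh"
 using M fd_lmodule_cong[of Xh M H] unfolding fd_lmodule_def by simp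

lemma \<delta>_lin: "fd_lmodule K Y ==> \<delta> Y : lin (ut Y M) (ut M Y)"
 using hb_mapsD(2)[OF hb] by simp

lemma \<delta>R_lin: "x : el (sp M) ==> \<delta> regular (upure R (sp M) (kemb eK) x) : el (utensor (sp M) R)"
 by (rule lin_closed[OF \<delta>_lin[OF fd_lmodule_regular]]) (simp add: vsM)

lemma kinv_bilin: "bilin (sp M) (R :: ('k, 'u) space) (tensor (sp M) K) (%v s. pure (sp M) K v (kinv s))"
 using vsM by (intro bilinI pure_rule1 pure_rule2 kinv_lin) (simp_all add: lin_id)

lemma Xh_coact: "coact Xh : elin (sp M) (tensor (sp M) K)"
proof -
 have "(%x. ulift (tensor (sp M) K) (%v s. pure (sp M) K v (kinv s)) (\<delta> regular (upure R (sp M) (kemb eK) x))) : lin (sp M) (tensor (sp M) K)"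
  by (rule lin_comp[OF ulift_lin lin_comp[OF \<delta>_lin[OF fd_lmodule_regular] upure_rule2]]) (simp_all add: vsM kinv_bilin lin_id)
 then show ?thesis using vsM by (simp add: hb_yd_def)
qed

lemma Xh_coact_sum:
 assumes x: "x : el (sp M)" and F: "bilin (sp M) K ground F"
 shows "tsum (sp M) K (coact Xh x) F = ulift ground (%v s. F v (kinv s)) (\<delta> regular (upure R (sp M) (kemb eK) x))"
proof -
 let ?u = "\<delta> regular (upure R (sp M) (kemb eK) x)"
 have Fk: "bilin (sp M) (R :: ('k, 'u) space) ground (%v s. F v (kinv s))"
  by (intro bilinI bilin_left[OF F] bilin_right[OF F] kinv_lin lin_id) simp_all
 have "tsum (sp M) K (ulift (tensor (sp M) K) (%v s. pure (sp M) K v (kinv s)) t) F = ulift ground (%v s. F v (kinv s)) t"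
  if "t : el (utensor (sp M) R)" for t
  by (rule utensor_ext[OF _ _ _ lin_comp[OF tsum_lin ulift_lin] ulift_lin _ that])
   (simp_all add: vsM F Fk kinv_bilin ulift_upure[OF _ _ _ kinv_bilin] ulift_upure[OF _ _ _ Fk] tsum_pure)
 from this[OF \<delta>R_lin[OF x]] show ?thesis using x by (simp add: hb_yd_def)
qed

text \<open>Every vector of a module is the image of the unit under a map from the regular module, so
 by naturality a half braiding is determined by its value at the unit of the regular module.\<close>

lemma \<delta>_eq_bmap:
 assumes Y: "fd_lmodule K Y" shows "\<delta> Y = bmap Xh Y"
proof -
 note vY = lmod_vsp[OF Y]
 have V: "fdvs (sp Xh)" using lmod_fdvs[OF M] by simp
 have co: "coact Xh : lin (sp Xh) (tensor (sp Xh) K)" using Xh_coact by simp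
 show ?thesis
 proof (rule utensor_elin_eqI[of "space Y" "space M" "ut M Y"])
  show "\<delta> Y : elin (ut Y M) (ut M Y)" by (rule hb_mapsD(2)[OF hb Y])
  show b: "bmap Xh Y : elin (ut Y M) (ut M Y)" using bmap_elin[OF V co Y] by simp
  fix y x assume y: "y : el (sp Y)" and x: "x : el (sp M)"
  define g where "g = (\<lambda>s\<in>el (R :: ('k, 'u) space). act Y (kinv s) y)"
  have gl: "g : elin R (sp Y)"
   unfolding g_def using lin_comp[OF bilin_lin1[OF act_bilin[OF Y] y] kinv_lin] by simp
  have gm: "module_map K regular Y g"
   unfolding module_map_def g_def using y by (auto simp: regular_act act_mult[OF Y] regular_simps)
  let ?t = "tmap (sp M) R (sp M) (sp Y) (\<lambda>v\<in>el (sp M). v) g"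
  let ?u = "\<delta> regular (upure R (sp M) (kemb eK) x)"
  have n: "?t ?u = \<delta> Y (up Y M y x)"
   using hb_maps_natural[OF hb fd_lmodule_regular Y gl gm kemb_closed[OF K.one_closed] x] y by (simp add: g_def act_one[OF Y])
  have t: "?t : lin (utensor (sp M) R) (ut M Y)"
   using gl by (intro tmap_lin) (simp_all add: vsM vY lin_id)
  show "\<delta> Y (up Y M y x) = bmap Xh Y (up Y M y x)"
  proof (rule ev_eqI[of "ut M Y"])
   fix \<phi> let ?L = "ev (ut M Y) \<phi>"
   have F: "bilin (sp M) K ground (%v k. ?L (up M Y v (act Y k y)))"
    using vsM Y y by (intro bilinI) (simp_all add: linear)
   have Fk: "bilin (sp M) (R :: ('k, 'u) space) ground (%v s. ?L (up M Y v (act Y (kinv s) y)))"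
    by (intro bilinI bilin_left[OF F] bilin_right[OF F] kinv_lin lin_id) simp_all
   have "?L (?t s) = ulift ground (%v s. ?L (up M Y v (act Y (kinv s) y))) s"
    if "s : el (utensor (sp M) R)" for s
    by (rule utensor_ext[OF _ _ _ lin_comp[OF ev_lin t] ulift_lin _ that])
     (use gl in \<open>simp_all add: vsM vY Fk ulift_upure[OF _ _ _ Fk] lin_id g_def\<close>)
   from this[OF \<delta>R_lin[OF x]]
   show "?L (\<delta> Y (up Y M y x)) = ?L (bmap Xh Y (up Y M y x))"
    using bmap_push[OF V co Y y, of x ?L, unfolded hb_yd_sel] x Xh_coact_sum[OF x F] by (simp add: n)
  qed (use lmod_fdvs[OF M] lmod_fdvs[OF Y] y x elin_closed[OF b] lin_closed[OF \<delta>_lin[OF Y]] in simp_all)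
 qed (simp_all add: vsM vY)
qed

text \<open>On a pair of copies of the regular module the hexagon is coassociativity; on the unit object
 it makes \<open>x \<mapsto> \<Sum> \<epsilon>(x\<^sub>\<langle>\<^sub>1\<^sub>\<rangle>) x\<^sub>\<langle>\<^sub>0\<^sub>\<rangle>\<close> idempotent, and this map is injective because the half braiding is
 invertible there.\<close>

lemma Xh_comodule: "rcomodule K Xh"
proof -
 let ?V = "space M" and ?R = "R :: ('k, 'u) space" and ?e = "kemb eK :: ('k, 'u) univ"
 have V: "fdvs (sp Xh)" using lmod_fdvs[OF M] by simp
 have co: "coact Xh : lin (sp Xh) (tensor (sp Xh) K)" using Xh_coact by simp
 note Rm = fd_lmodule_regular
 note \<delta>R = \<delta>_eq_bmap[OF Rm]
 have coassoc: "tsum ?V K (coact Xh x) (%v0 k. tsum ?V K (coact Xh v0) (%v00 l. F v00 l k))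
  = tsum ?V K (coact Xh x) (%v0 k. csum K k (%l m. F v0 l m))"
  if x: "x : el ?V" and F: "trilin ?V K K F" for x F
 proof -
  define L where "L = ulift ground (%u s. ulift ground (%v r. F v (kinv r) (kinv s)) u) "
  have i: "bilin ?V ?R ground (%v r. F v (kinv r) k)" if "k : el K" for k
   using that by (intro bilinI trilin_rule[OF F] kinv_lin lin_id) simp_all
  have o: "bilin (utensor ?V ?R) ?R ground (%u s. ulift ground (%v r. F v (kinv r) (kinv s)) u)"
  proof (rule bilinI)
   fix u assume u: "u : el (utensor ?V ?R)"
   show "(%s. ulift ground (%v r. F v (kinv r) (kinv s)) u) : lin ?R ground"
    by (rule ulift_rule[OF _ _ _ _ _ u]) (simp_all add: vsM i trilin_rule(3)[OF F] kinv_lin)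
  qed (simp add: ulift_lin[OF vsM vs_regular vs_ground i])
  have L: "L : lin (utensor (utensor ?V ?R) ?R) ground"
   unfolding L_def by (rule ulift_lin[OF _ _ _ o]) (simp_all add: vsM)
  have Lp: "L (upure (utensor ?V ?R) ?R (upure ?V ?R v r) s) = F v (kinv r) (kinv s)"
   if "v : el ?V" "r : el ?R" "s : el ?R" for v r s
   using that by (simp add: L_def ulift_upure[OF _ _ _ o] ulift_upure[OF _ _ _ i] vsM)
  have e: "?e : el ?R" by simp
  have l: "L (tmap (utensor ?R ?V) ?R (utensor ?V ?R) ?R (bmap Xh regular) (\<lambda>v\<in>el ?R. v)
    (ainv ?R ?V ?R (upure ?R (utensor ?V ?R) ?e (bmap Xh regular (upure ?R ?V ?e x)))))
   = tsum ?V K (coact Xh x) (%v0 k. tsum ?V K (coact Xh v0) (%v00 l. F v00 l k))"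
   using bmap_hexagon_left[OF Xh_module co Rm Rm e e _, of x L, unfolded hb_yd_sel] x L by (simp add: Lp regular_act)
  have r: "L (ainv ?V ?R ?R (bmap Xh (lmod_tensor K regular regular) (upure (utensor ?R ?R) ?V (upure ?R ?R ?e ?e) x)))
   = tsum ?V K (coact Xh x) (%v0 k. csum K k (%l m. F v0 l m))"
   using bmap_hexagon_right[OF Xh_module co Rm Rm e e _, of x L, unfolded hb_yd_sel] x L by (simp add: Lp regular_act)
  show ?thesis
   using hb_maps_hexagon[OF hb Rm Rm e e x] l r by (simp add: \<delta>R \<delta>_eq_bmap[OF K.fd_lmodule_tensor[OF Rm Rm]])
 qed
 define \<pi> where "\<pi> x = tlift ?V (%v k. counit K k \<odot>\<^bsub>?V\<^esub> v) (coact Xh x)" for x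
 have cc: "coact Xh x : el (tensor ?V K)" if "x : el ?V" for x using lin_closed[OF co] that by simp
 have \<pi>c: "\<pi> x : el ?V" if "x : el ?V" for x
  unfolding \<pi>_def by (rule tlift_closed[of ?V K]) (use vsM cc that in simp_all)
 have \<pi>_push: "L (\<pi> x) = tsum ?V K (coact Xh x) (%v k. counit K k * L v)" if "x : el ?V" "L : lin ?V ground" for x L
  unfolding \<pi>_def by (subst tlift_push[of ?V K ?V _ L]) (use vsM cc that in \<open>simp_all add: lin_smult[OF that(2)]\<close>)
 have \<pi>_lin: "\<pi> : lin ?V ?V"
 proof -
  have "bilin ?V K ?V (%v k. counit K k \<odot>\<^bsub>?V\<^esub> v)" using vsM by (intro bilinI) (simp_all add: linear)
  then have "(%x. tlift ?V (%v k. counit K k \<odot>\<^bsub>?V\<^esub> v) (coact Xh x)) : lin ?V ?V"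
   by (intro lin_comp[OF tlift_lin co[unfolded hb_yd_sel]]) (simp_all add: vsM)
  then show ?thesis unfolding \<pi>_def .
 qed
 have idem: "\<pi> (\<pi> x) = \<pi> x" if x: "x : el ?V" for x
 proof (rule ev_eqI[of ?V])
  fix \<phi> let ?L = "ev ?V \<phi>"
  have F: "trilin ?V K K (%v k l. counit K k * counit K l * ?L v)" unfolding trilin_def using vsM by (simp add: linear)
  have "?L (\<pi> (\<pi> x)) = tsum ?V K (coact Xh x) (%v0 k. tsum ?V K (coact Xh v0) (%v00 l. counit K l * counit K k * ?L v00))"
   using \<pi>_push[OF x lin_comp[OF ev_lin \<pi>_lin]] by (simp add: \<pi>_push tsum_times(1)[symmetric] mult_ac)
  also have "... = tsum ?V K (coact Xh x) (%v0 k. csum K k (%l m. counit K l * counit K m * ?L v0))"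
   by (rule coassoc[OF x F])
  also have "... = ?L (\<pi> x)"
   using K.sum_counit_left[OF _ K.counit_lin] x by (simp add: \<pi>_push tsum_times(2))
  finally show "?L (\<pi> (\<pi> x)) = ?L (\<pi> x)" .
 qed (use lmod_fdvs[OF M] \<pi>c x in simp_all)
 have \<pi>_id: "\<pi> x = x" if x: "x : el ?V" for x
 proof -
  let ?I = "lmod_unit K :: ('k, 'b, 'u) lmod" and ?S = "uscalars :: ('k, 'u) space"
  have I: "fd_lmodule K ?I" by (rule K.fd_lmodule_unit)
  have \<gamma>\<delta>: "\<gamma> ?I (\<delta> ?I s) = s" if "s : el (utensor ?S ?V)" for s using hb_mapsD(4)[OF hb I, of s] that by simp
  have one: "Scalar 1 : el ?S" by simp
  have d: "\<delta> ?I (upure ?S ?V (Scalar 1) x) = upure ?V ?S (\<pi> x) (Scalar 1)" if x: "x : el ?V" for x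
  proof (rule ev_eqI[of "utensor ?V ?S"])
   fix \<phi> let ?L = "ev (utensor ?V ?S) \<phi>"
   have l: "(%v. ?L (upure ?V ?S v (Scalar 1))) : lin ?V ground"
    by (rule lin_comp[OF ev_lin upure_rule1]) (simp_all add: vsM lin_id)
   have s: "?L (upure ?V ?S v (Scalar (counit K k))) = counit K k * ?L (upure ?V ?S v (Scalar 1))" if "v : el ?V" for v k
    using lin_smult[OF lin_comp[OF ev_lin bilin_lin2[OF bilin_upure]], of ?V ?S v "Scalar 1" \<phi> "counit K k"] that by (simp add: vsM)
   show "?L (\<delta> ?I (upure ?S ?V (Scalar 1) x)) = ?L (upure ?V ?S (\<pi> x) (Scalar 1))"
    using bmap_push[OF V co I, of "Scalar 1" x ?L, unfolded hb_yd_sel] x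
    by (simp add: \<delta>_eq_bmap[OF I] \<pi>_push[OF x l] s)
   show "\<delta> ?I (upure ?S ?V (Scalar 1) x) : el (utensor ?V ?S)"
    using lin_closed[OF \<delta>_lin[OF I]] upure_closed[OF vs_uscalars vsM one x] by simp
  qed (use lmod_fdvs[OF M] \<pi>c x vsM in simp_all)
  have s: "upure ?S ?V (Scalar 1) x : el (utensor ?S ?V)" if "x : el ?V" for x by (rule upure_closed[OF vs_uscalars vsM one that])
  have "\<delta> ?I (upure ?S ?V (Scalar 1) (\<pi> x)) = \<delta> ?I (upure ?S ?V (Scalar 1) x)"
   using d[OF x] d[OF \<pi>c[OF x]] idem[OF x] by simp
  then have "\<gamma> ?I (\<delta> ?I (upure ?S ?V (Scalar 1) (\<pi> x))) = \<gamma> ?I (\<delta> ?I (upure ?S ?V (Scalar 1) x))" by (rule arg_cong)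
  then have "upure ?S ?V (Scalar 1) (\<pi> x) = upure ?S ?V (Scalar 1) x"
   unfolding \<gamma>\<delta>[OF s[OF x]] \<gamma>\<delta>[OF s[OF \<pi>c[OF x]]] .
  then have "lmap ?V (upure ?S ?V (Scalar 1) (\<pi> x)) = lmap ?V (upure ?S ?V (Scalar 1) x)" by simp
  then show ?thesis using x \<pi>c by (simp add: vsM)
 qed
 have "tsum ?V K (coact Xh x) (%v k. counit K k * L v) = L x" if "x : el ?V" "L : lin ?V ground" for x L
  using \<pi>_push[OF that] by (simp only: \<pi>_id[OF that(1)])
 with coassoc show ?thesis
  unfolding rcomodule_iff[OF V, unfolded hb_yd_sel, OF Xh_coact] by blast
qed

lemma Xh_yd: "yd Xh"
proof -
 let ?V = "space M" and ?R = "R :: ('k, 'u) space" and ?e = "kemb eK :: ('k, 'u) univ"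
 have co: "coact Xh : lin (sp Xh) (tensor (sp Xh) K)" using Xh_coact by simp
 note Rm = fd_lmodule_regular and \<delta>R = \<delta>_eq_bmap[OF fd_lmodule_regular]
 have "yd_braided Xh"
  unfolding yd_braided_def hb_yd_sel
 proof (intro ballI allI impI)
  fix h x F assume h: "h : el H" and x: "x : el ?V" and F: "bilin ?V K ground F"
  have Fk: "bilin ?V ?R ground (%v s. F v (kinv s))"
   by (intro bilinI bilin_left[OF F] bilin_right[OF F] kinv_lin lin_id) simp_all
  define L where "L = ulift ground (%v s. F v (kinv s :: 'b))"
  have L: "L : lin (utensor ?V ?R) ground" unfolding L_def by (rule ulift_lin[OF vsM vs_regular vs_ground Fk])
  have Lp: "L (upure ?V ?R v s) = F v (kinv s)" if "v : el ?V" "s : el ?R" for v s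
   using that by (simp add: L_def ulift_upure[OF _ _ _ Fk] vsM)
  have e: "?e : el ?R" by simp
  have s: "upure ?R ?V ?e x : el (utensor ?R ?V)" using x by (simp add: vsM)
  have "bmap Xh regular (act (lmod_tensor H (rs regular) M) h (upure ?R ?V ?e x)) = act (lmod_tensor H M (rs regular)) h (bmap Xh regular (upure ?R ?V ?e x))"
   using module_mapD[OF hb_mapsD(5)[OF hb Rm] h, of "upure ?R ?V ?e x"] s by (simp add: \<delta>R)
  then show "csum H h (%h1 h2. tsum ?V K (coact Xh (act M h2 x)) (%w k. F w (k ** p h1)))
   = csum H h (%h1 h2. tsum ?V K (coact Xh x) (%w k. F (act M h1 w) (p h2 ** k)))"
   using bmap_act_left[OF Xh_module co Rm h e, unfolded hb_yd_sel, OF x L] bmap_act_right[OF Xh_module co Rm h e, unfolded hb_yd_sel, OF x L] M x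
   by (simp add: Lp regular_act act_closed[OF M])
 qed
 then show ?thesis using Xh_module Xh_comodule yd_condition_iff[OF Xh_module Xh_comodule] by simp
qed

lemma \<gamma>_eq_cmap: assumes Y: "fd_lmodule K Y" shows "\<gamma> Y = cmap Xh Y"
proof (rule elin_eqI)
 have V: "fdvs (sp Xh)" using lmod_fdvs[OF M] by simp
 have co: "coact Xh : lin (sp Xh) (tensor (sp Xh) K)" using Xh_coact by simp
 show g: "\<gamma> Y : elin (ut M Y) (ut Y M)" by (rule hb_mapsD(1)[OF hb Y])
 show c: "cmap Xh Y : elin (ut M Y) (ut Y M)" using cmap_elin[OF V co Y] by simp
 fix t assume t: "t : el (ut M Y)"
 have "cmap Xh Y (bmap Xh Y (\<gamma> Y t)) = \<gamma> Y t" by (rule cmap_bmap[OF V Xh_comodule Y]) (use elin_closed[OF g t] in simp)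
 then show "\<gamma> Y t = cmap Xh Y t" using hb_mapsD(3)[OF hb Y t] by (simp add: \<delta>_eq_bmap[OF Y])
qed

end

end

context surjective_pairing begin

section \<open>Yetter-Drinfeld modules and the relative center\<close>

abbreviation ZC :: "('k, ('k, 'h, 'u) lmod \<times> (('k, 'h, 'u) lmod => ('k, 'h, 'u) rep_arr), _) tcat" where
 "ZC \<equiv> relative_center RC RD"

lemma ZC_sel:
 "Obj ZC = {(M, c). fd_lmodule H M \<and> half_braiding RC RD M c}"
 "Arr ZC = {((M, c), f, (M', c')) | M c f M' c'. fd_lmodule H M \<and> half_braiding RC RD M c \<and> fd_lmodule H M' \<and> half_braiding RC RD M' c' \<and>
   f : Hom RC M M' \<and> (\<forall>Y\<in>Obj RD. Comp RC (TenA RC (Id RC Y) f) (c Y) = Comp RC (c' Y) (TenA RC f (Id RC Y)))}"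
 "Dom ZC (P, g, Q) = P" "Cod ZC (P, g, Q) = Q" "Id ZC P = (P, Id RC (fst P), P)" "Comp ZC (P', g', Q') (P, g, Q) = (P, Comp RC g' g, Q')"
 "Zero ZC P Q = (P, Zero RC (fst P) (fst Q), Q)" "Add ZC (P, g, Q) (P', g', Q') = (P, Add RC g g', Q)"
 "Scale ZC a (P, g, Q) = (P, Scale RC a g, Q)" "TenO ZC = center_tensor RC RD"
 "TenA ZC (P, g, Q) (P', g', Q') = (center_tensor RC RD P P', TenA RC g g', center_tensor RC RD Q Q')"
 "Unit ZC = center_unit RC RD"
 "Assoc ZC P Q S = (center_tensor RC RD (center_tensor RC RD P Q) S, Assoc RC (fst P) (fst Q) (fst S), center_tensor RC RD P (center_tensor RC RD Q S))"
 "LUnit ZC P = (center_tensor RC RD (center_unit RC RD) P, LUnit RC (fst P), P)"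
 "RUnit ZC P = (center_tensor RC RD P (center_unit RC RD), RUnit RC (fst P), P)"
 by (auto simp: relative_center_def Let_def H.Rep.C_sel(1))

definition center_obj :: "('k, 'h, 'b, 'u) ydmod => ('k, 'h, 'u) lmod \<times> (('k, 'h, 'u) lmod => ('k, 'h, 'u) rep_arr)" where
 "center_obj X = (lmod.truncate X, hb (lmod.truncate X) (cmap X))"

lemma hb_cong: "(\<And>Y. fd_lmodule K Y ==> \<gamma> Y = \<gamma>' Y) ==> hb M \<gamma> = hb M \<gamma>'"
 unfolding hb_def by (rule restrict_ext) (auto simp: RD_sel lift_rs)

text \<open>Functionals on \<open>V \<otimes> R\<close> recover all bilinear forms on \<open>V \<times> K\<close>; so evaluating a half
 braiding at the unit of the regular module loses no information.\<close>

lemma functional_regular: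
 fixes V :: "('k, 'u) space"
 assumes V: "vsp V" and F: "bilin V K ground F"
 obtains L where "L : lin (utensor V (R :: ('k, 'u) space)) ground"
  "\<And>v k. v : el V ==> k : el K ==> L (upure V R v (act regular k (kemb eK))) = F v k"
proof -
 have Fk: "bilin V (R :: ('k, 'u) space) ground (%v s. F v (kinv s))"
  by (intro bilinI bilin_left[OF F] bilin_right[OF F] kinv_lin lin_id) simp_all
 show thesis
  by (rule that[of "ulift ground (%v s. F v (kinv s))"])
   (simp_all add: ulift_lin[OF V vs_regular vs_ground Fk] ulift_upure[OF V vs_regular vs_ground Fk] regular_act)
qed

lemma hb_yd_bmap:
 fixes X :: "('k, 'h, 'b, 'u) ydmod"
 assumes X: "fd_lmodule H X" "rcomodule K X" "yd_condition H K \<sigma> X"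
 shows "hb_yd (lmod.truncate X) (bmap X) = X"
proof -
 let ?V = "space X" and ?R = "R :: ('k, 'u) space"
 note V = lmod_fdvs[OF X(1)] and V' = lmod_vsp[OF X(1)]
 have co: "coact X : lin ?V (tensor ?V K)" by (rule coact_lin[OF V' X(2)])
 have M: "fd_lmodule H (lmod.truncate X)" using X by (simp add: fd_lmodule_truncate)
 note hbm = yd_hb_maps[OF X]
 let ?X = "hb_yd (lmod.truncate X) (bmap X)"
 have e: "kemb eK : el ?R" by simp
 have c: "coact ?X : elin ?V (tensor ?V K)" using Xh_coact[OF M hbm] by simp
 have "coact ?X = coact X"
 proof (rule elin_eqI[OF c])
  show "coact X : elin ?V (tensor ?V K)" using co coact_ext[OF V' X(2)] by simp
  fix x assume x: "x : el ?V"
  show "coact ?X x = coact X x"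
  proof (rule ev_eqI[of "tensor ?V K"])
   fix \<phi> let ?L = "ev (tensor ?V K) \<phi>" and ?F = "%v k. ev (tensor ?V K) \<phi> (pure ?V K v k)"
   have F: "bilin ?V K ground ?F" using V by (intro bilinI) (simp_all add: linear)
   obtain L where L: "L : lin (utensor ?V ?R) ground" "\<And>v k. v : el ?V ==> k : el K ==> L (upure ?V ?R v (act regular k (kemb eK))) = ?F v k"
    by (rule functional_regular[OF V' F]) (rule that)
   have cX: "coact ?X : lin (sp ?X) (tensor (sp ?X) K)" using c by simp
   have "tsum ?V K (coact ?X x) ?F = L (bmap ?X regular (upure ?R ?V (kemb eK) x))"
    using bmap_push[OF _ cX fd_lmodule_regular e, of x L, unfolded hb_yd_sel truncate_sel] V x L by simp
   also have "... = L (bmap X regular (upure ?R ?V (kemb eK) x))"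
    by (simp add: \<delta>_eq_bmap[OF M hbm fd_lmodule_regular])
   also have "... = tsum ?V K (coact X x) ?F"
    using bmap_push[OF V co fd_lmodule_regular e x L(1)] L(2) by simp
   finally have "tsum ?V K (coact ?X x) ?F = tsum ?V K (coact X x) ?F" .
   then show "?L (coact ?X x) = ?L (coact X x)"
    using tensor_functional_expand[of ?V K ?L "coact ?X x"] tensor_functional_expand[of ?V K ?L "coact X x"] V x elin_closed[OF c x] lin_closed[OF co x] by simp
  qed (use V x elin_closed[OF c x] lin_closed[OF co x] in simp_all)
 qed
 then show ?thesis by (intro ydmod.equality) simp_all
qed

lemma center_obj_bij: "bij_betw center_obj {X :: ('k, 'h, 'b, 'u) ydmod. yd X} (Obj ZC)"
 unfolding bij_betw_def
proof
 show "inj_on center_obj {X :: ('k, 'h, 'b, 'u) ydmod. yd X}"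
 proof (rule inj_onI)
  fix X X' :: "('k, 'h, 'b, 'u) ydmod"
  assume "X : {X. yd X}" "X' : {X. yd X}" and eq: "center_obj X = center_obj X'"
  then have X: "fd_lmodule H X" "rcomodule K X" "yd_condition H K \<sigma> X" and X': "fd_lmodule H X'" "rcomodule K X'" "yd_condition H K \<sigma> X'" by auto
  let ?b = "bmap X regular" and ?b' = "bmap X' regular" and ?c = "cmap X regular" and ?R = "R :: ('k, 'u) space"
  have M: "lmod.truncate X = lmod.truncate X'" using eq by (simp add: center_obj_def)
  have sp: "space X' = space X" using arg_cong[OF M, of space] by simp
  note V = lmod_fdvs[OF X(1)] and V' = lmod_fdvs[OF X'(1)]
  note b = bmap_elin[OF V coact_lin[OF lmod_vsp[OF X(1)] X(2)] fd_lmodule_regular]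
   and b' = bmap_elin[OF V' coact_lin[OF lmod_vsp[OF X'(1)] X'(2)] fd_lmodule_regular, unfolded sp]
  have "hb (lmod.truncate X) (cmap X) = hb (lmod.truncate X') (cmap X')" using eq unfolding center_obj_def by blast
  from fun_cong[OF this, of "rs regular"] have c: "cmap X' regular = ?c" by (simp add: hb_rs[OF fd_lmodule_regular])
  have "?b = ?b'"
  proof (rule elin_eqI[OF b b'])
   fix s assume s: "s : el (utensor ?R (sp X))"
   have "?b' (?c (?b s)) = ?b s"
    using bmap_cmap[OF V' X'(2) fd_lmodule_regular, of "?b s"] elin_closed[OF b s] by (simp add: c sp)
   then show "?b s = ?b' s" using cmap_bmap[OF V X(2) fd_lmodule_regular s] by simp
  qed
  then have "hb_yd (lmod.truncate X) (bmap X) = hb_yd (lmod.truncate X') (bmap X')" by (simp add: hb_yd_def M)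
  then show "X = X'" by (simp only: hb_yd_bmap[OF X] hb_yd_bmap[OF X'])
 qed
 show "center_obj ` {X :: ('k, 'h, 'b, 'u) ydmod. yd X} = Obj ZC"
 proof (intro equalityI subsetI)
  fix P assume "P : center_obj ` {X :: ('k, 'h, 'b, 'u) ydmod. yd X}"
  then obtain X :: "('k, 'h, 'b, 'u) ydmod" where X: "fd_lmodule H X" "rcomodule K X" "yd_condition H K \<sigma> X" "P = center_obj X" by auto
  have M: "fd_lmodule H (lmod.truncate X)" using X by (simp add: fd_lmodule_truncate)
  show "P : Obj ZC" using half_braidingI[OF M yd_hb_maps[OF X(1-3)]] M by (simp add: ZC_sel X(4) center_obj_def)
 next
  fix P :: "('k, 'h, 'u) lmod \<times> (('k, 'h, 'u) lmod => ('k, 'h, 'u) rep_arr)" assume "P : Obj ZC"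
  then obtain M c where P: "P = (M, c)" and M: "fd_lmodule H M" and c: "half_braiding RC RD M c" by (auto simp: ZC_sel)
  obtain \<gamma> \<delta> where g: "hb_maps M \<gamma> \<delta>" "c = hb M \<gamma>" by (rule half_braidingE[OF M c])
  have "center_obj (hb_yd M \<delta>) = P"
   using hb_cong[of \<gamma> "cmap (hb_yd M \<delta>)" M] \<gamma>_eq_cmap[OF M g(1)] by (simp add: center_obj_def P g(2))
  then show "P : center_obj ` {X :: ('k, 'h, 'b, 'u) ydmod. yd X}" using Xh_yd[OF M g(1)] by (intro image_eqI[of _ _ "hb_yd M \<delta>"]) simp_all
 qed
qed

lemma center_arr_iff:
 fixes X X' :: "('k, 'h, 'b, 'u) ydmod"
 assumes X: "fd_lmodule H X" "rcomodule K X" and X': "fd_lmodule H X'" "rcomodule K X'" and f: "f : elin (sp X) (sp X')"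
 shows "(\<forall>Z\<in>Obj RD. Comp RC (TenA RC (Id RC Z) (lmod.truncate X, f, lmod.truncate X')) (snd (center_obj X) Z)
   = Comp RC (snd (center_obj X') Z) (TenA RC (lmod.truncate X, f, lmod.truncate X') (Id RC Z)))
  \<longleftrightarrow> comodule_map K X X' f" (is "?c \<longleftrightarrow> _")
proof -
 let ?V = "space X" and ?V' = "space X'"
 note [simp] = lin_id
 note vs = lmod_vsp[OF X(1)] lmod_vsp[OF X'(1)] and fl = elin_lin[OF f] and fc = elin_closed[OF f]
 note V = lmod_fdvs[OF X(1)] and V' = lmod_fdvs[OF X'(1)]
 note co = coact_lin[OF vs(1) X(2)] and co' = coact_lin[OF vs(2) X'(2)]
 note b = bmap_elin[OF V co] and b' = bmap_elin[OF V' co'] and c = cmap_elin[OF V co] and c' = cmap_elin[OF V' co']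
 have pt: "Comp RC (TenA RC (Id RC (rs Y)) (lmod.truncate X, f, lmod.truncate X')) (snd (center_obj X) (rs Y))
   = Comp RC (snd (center_obj X') (rs Y)) (TenA RC (lmod.truncate X, f, lmod.truncate X') (Id RC (rs Y)))
  \<longleftrightarrow> (\<forall>t\<in>el (utensor ?V (sp Y)).
   tmap (sp Y) ?V (sp Y) ?V' (\<lambda>v\<in>el (sp Y). v) f (cmap X Y t) = cmap X' Y (tmap ?V (sp Y) ?V' (sp Y) f (\<lambda>v\<in>el (sp Y). v) t))"
  if Y: "fd_lmodule K Y" for Y
  by (simp add: center_obj_def H.Rep.C_sel hb_rs[OF Y] compose_eq_iff)
 have el: "?c \<longleftrightarrow> (\<forall>Y. fd_lmodule K Y \<longrightarrow> (\<forall>t\<in>el (utensor ?V (sp Y)).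
   tmap (sp Y) ?V (sp Y) ?V' (\<lambda>v\<in>el (sp Y). v) f (cmap X Y t) = cmap X' Y (tmap ?V (sp Y) ?V' (sp Y) f (\<lambda>v\<in>el (sp Y). v) t)))"
  unfolding RD_sel ball_simps(9) Ball_Collect[symmetric] using pt by blast
 show ?thesis
 proof
  let ?R = "R :: ('k, 'u) space" and ?e = "kemb eK :: ('k, 'u) univ"
  assume ?c
  then have n': "\<forall>t\<in>el (utensor ?V ?R).
   tmap ?R ?V ?R ?V' (\<lambda>v\<in>el ?R. v) f (cmap X regular t) = cmap X' regular (tmap ?V ?R ?V' ?R f (\<lambda>v\<in>el ?R. v) t)"
   using el fd_lmodule_regular by blast
  note n = bspec[OF n']
  have e: "?e : el ?R" by simp
  show "comodule_map K X X' f"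
   unfolding comodule_map_iff[OF X X' fl]
  proof (intro ballI allI impI)
   fix x F assume x: "x : el ?V" and F: "bilin ?V' K ground F"
   obtain L where L: "L : lin (utensor ?V' ?R) ground" "\<And>v k. v : el ?V' ==> k : el K ==> L (upure ?V' ?R v (act regular k ?e)) = F v k"
    by (rule functional_regular[OF vs(2) F]) (rule that)
   let ?t = "bmap X regular (upure ?R ?V ?e x)"
   have s: "upure ?R ?V ?e x : el (utensor ?R ?V)" using vs x by simp
   have t: "?t : el (utensor ?V ?R)" by (rule elin_closed[OF b[OF fd_lmodule_regular] s])
   have tl: "tmap ?V ?R ?V' ?R f (\<lambda>v\<in>el ?R. v) : lin (utensor ?V ?R) (utensor ?V' ?R)" by (rule tmap_lin) (use vs fl in simp_all)
   have "upure ?R ?V' ?e (f x) = cmap X' regular (tmap ?V ?R ?V' ?R f (\<lambda>v\<in>el ?R. v) ?t)"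
    using n[OF t] cmap_bmap[OF V X(2) fd_lmodule_regular s] vs fl x by simp
   then have "bmap X' regular (upure ?R ?V' ?e (f x)) = tmap ?V ?R ?V' ?R f (\<lambda>v\<in>el ?R. v) ?t"
    using bmap_cmap[OF V' X'(2) fd_lmodule_regular lin_closed[OF tl t]] by simp
   then have "tsum ?V' K (coact X' (f x)) F = L (tmap ?V ?R ?V' ?R f (\<lambda>v\<in>el ?R. v) ?t)"
    using bmap_push[OF V' co' fd_lmodule_regular e fc[OF x] L(1)] L(2) by simp
   also have "... = tsum ?V K (coact X x) (%v k. F (f v) k)"
    using bmap_push[OF V co fd_lmodule_regular e x lin_comp[OF L(1) tl]] L(2) vs fl fc by (simp add: act_closed[OF fd_lmodule_regular])
   finally show "tsum ?V' K (coact X' (f x)) F = tsum ?V K (coact X x) (%v k. F (f v) k)" .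
  qed
 next
  assume m: "comodule_map K X X' f"
  show ?c
   unfolding el
  proof (intro allI impI ballI)
   fix Y :: "('k, 'b, 'u) lmod" and t
   assume Y: "fd_lmodule K Y" and t: "t : el (utensor ?V (sp Y))"
   let ?Y = "space Y"
   note vY = lmod_vsp[OF Y]
   have t1: "tmap ?Y ?V ?Y ?V' (\<lambda>v\<in>el ?Y. v) f : lin (utensor ?Y ?V) (utensor ?Y ?V')" by (rule tmap_lin) (use vs vY fl in simp_all)
   have t2: "tmap ?V ?Y ?V' ?Y f (\<lambda>v\<in>el ?Y. v) : lin (utensor ?V ?Y) (utensor ?V' ?Y)" by (rule tmap_lin) (use vs vY fl in simp_all)
   show "tmap ?Y ?V ?Y ?V' (\<lambda>v\<in>el ?Y. v) f (cmap X Y t) = cmap X' Y (tmap ?V ?Y ?V' ?Y f (\<lambda>v\<in>el ?Y. v) t)"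
   proof (rule utensor_ext[OF _ _ _ lin_comp[OF t1 elin_lin[OF c[OF Y]]] lin_comp[OF elin_lin[OF c'[OF Y]] t2] _ t])
    fix x y assume x: "x : el ?V" and y: "y : el ?Y"
    have xy: "upure ?V ?Y x y : el (utensor ?V ?Y)" using vs vY x y by simp
    show "tmap ?Y ?V ?Y ?V' (\<lambda>v\<in>el ?Y. v) f (cmap X Y (upure ?V ?Y x y)) = cmap X' Y (tmap ?V ?Y ?V' ?Y f (\<lambda>v\<in>el ?Y. v) (upure ?V ?Y x y))"
    proof (rule ev_eqI[of "utensor ?Y ?V'"])
     fix \<phi> let ?L = "ev (utensor ?Y ?V') \<phi>"
     have F: "bilin ?V' K ground (%w k. ?L (upure ?Y ?V' (act Y (antipode K k) y) w))"
      using vs vY Y y by (intro bilinI) (simp_all add: linear)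
     show "?L (tmap ?Y ?V ?Y ?V' (\<lambda>v\<in>el ?Y. v) f (cmap X Y (upure ?V ?Y x y))) = ?L (cmap X' Y (tmap ?V ?Y ?V' ?Y f (\<lambda>v\<in>el ?Y. v) (upure ?V ?Y x y)))"
      using cmap_push[OF V co Y y x lin_comp[OF ev_lin t1]] cmap_push[OF V' co' Y y fc[OF x] ev_lin]
       comodule_mapD[OF X X' fl m x F] vs vY fl x y Y by simp
    qed (use V V' Y lmod_fdvs[OF Y] lin_closed[OF t1 elin_closed[OF c[OF Y] xy]] elin_closed[OF c'[OF Y] lin_closed[OF t2 xy]] in simp_all)
   qed (use vs vY in simp_all)
  qed
 qed
qed

end

context surjective_pairing begin

text \<open>The tensor product in the center braids past the second factor first, which gives
 \<open>S(x\<^sub>1) S(x'\<^sub>1) = S(x'\<^sub>1 x\<^sub>1)\<close>, in accordance with the coaction of the tensor product.\<close>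

lemma center_obj_tensor:
 fixes X X' :: "('k, 'h, 'b, 'u) ydmod"
 assumes X: "fd_lmodule H X" "rcomodule K X" and X': "fd_lmodule H X'" "rcomodule K X'"
 shows "center_obj (yd_tensor H K X X') = center_tensor RC RD (center_obj X) (center_obj X')"
proof -
 let ?V = "space X" and ?V' = "space X'" and ?M = "lmod.truncate X" and ?M' = "lmod.truncate X'" and ?XX = "yd_tensor H K X X'"
 let ?T = "utensor ?V ?V'"
 note [simp] = lin_id
 note vs = lmod_vsp[OF X(1)] lmod_vsp[OF X'(1)] and V = lmod_fdvs[OF X(1)] and V' = lmod_fdvs[OF X'(1)]
 note co = coact_lin[OF vs(1) X(2)] and co' = coact_lin[OF vs(2) X'(2)]
 have M: "fd_lmodule H ?M" "fd_lmodule H ?M'" using X X' by (simp_all add: fd_lmodule_truncate)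
 have VT: "fdvs (sp ?XX)" using V V' by simp
 have coT: "coact ?XX : lin (sp ?XX) (tensor (sp ?XX) K)" using tensor_coact_elin[OF X X'] by simp
 have main: "cmap ?XX Y t = amap (sp Y) ?V ?V' (tmap (utensor ?V (sp Y)) ?V' (utensor (sp Y) ?V) ?V' (cmap X Y) (\<lambda>v\<in>el ?V'. v)
   (ainv ?V (sp Y) ?V' (tmap ?V (utensor ?V' (sp Y)) ?V (utensor (sp Y) ?V') (\<lambda>v\<in>el ?V. v) (cmap X' Y) (amap ?V ?V' (sp Y) t))))"
  if Y: "fd_lmodule K Y" and t: "t : el (utensor ?T (sp Y))" for Y t
 proof -
  let ?Y = "space Y"
  note vY = lmod_vsp[OF Y]
  note c = cmap_elin[OF V co Y] and c' = cmap_elin[OF V' co' Y]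
  have cT: "cmap ?XX Y : lin (utensor ?T ?Y) (utensor ?Y ?T)" using cmap_elin[OF VT coT Y] by simp
  let ?f = "%s. amap ?Y ?V ?V' (tmap (utensor ?V ?Y) ?V' (utensor ?Y ?V) ?V' (cmap X Y) (\<lambda>v\<in>el ?V'. v) (ainv ?V ?Y ?V' s))"
  have f: "?f : lin (utensor ?V (utensor ?Y ?V')) (utensor ?Y ?T)"
   by (rule lin_comp[OF amap_lin lin_comp[OF tmap_lin ainv_lin]]) (use vs vY elin_lin[OF c] in simp_all)
  have g: "(%t. tmap ?V (utensor ?V' ?Y) ?V (utensor ?Y ?V') (\<lambda>v\<in>el ?V. v) (cmap X' Y) (amap ?V ?V' ?Y t)) : lin (utensor ?T ?Y) (utensor ?V (utensor ?Y ?V'))"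
   by (rule lin_comp[OF tmap_lin amap_lin]) (use vs vY elin_lin[OF c'] in simp_all)
  show ?thesis
  proof (rule utensor_ext3[OF vs vY _ cT lin_comp[OF f g] _ t])
   fix x x' y assume x: "x : el ?V" and x': "x' : el ?V'" and y: "y : el ?Y"
   have u: "cmap X' Y (upure ?V' ?Y x' y) : el (utensor ?Y ?V')" by (rule elin_closed[OF c']) (use vs vY x' y in simp)
   have fu: "?f (upure ?V (utensor ?Y ?V') x (cmap X' Y (upure ?V' ?Y x' y))) : el (utensor ?Y ?T)"
    by (rule lin_closed[OF f]) (use vs vY x u in simp)
   have r: "tmap ?V (utensor ?V' ?Y) ?V (utensor ?Y ?V') (\<lambda>v\<in>el ?V. v) (cmap X' Y) (amap ?V ?V' ?Y (upure ?T ?Y (upure ?V ?V' x x') y))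
    = upure ?V (utensor ?Y ?V') x (cmap X' Y (upure ?V' ?Y x' y))"
    using vs vY x x' y elin_lin[OF c'] by simp
   have "cmap ?XX Y (upure ?T ?Y (upure ?V ?V' x x') y) = ?f (upure ?V (utensor ?Y ?V') x (cmap X' Y (upure ?V' ?Y x' y)))"
   proof (rule ev_eqI[of "utensor ?Y ?T"])
    fix \<phi> let ?L = "ev (utensor ?Y ?T) \<phi>"
    let ?E = "%v0 v1 w0 w1. ?L (upure ?Y ?T (act Y (antipode K (w1 ** v1)) y) (upure ?V ?V' v0 w0))"
    have F: "bilin ?T K ground (%u k. ?L (upure ?Y ?T (act Y (antipode K k) y) u))"
     using vs vY Y y by (intro bilinI) (simp_all add: linear)
    have "?L (cmap ?XX Y (upure ?T ?Y (upure ?V ?V' x x') y)) = tsum ?V K (coact X x) (%v0 v1. tsum ?V' K (coact X' x') (%w0 w1. ?E v0 v1 w0 w1))"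
     using cmap_push[OF VT coT Y y, of "upure ?V ?V' x x'" ?L, unfolded yd_tensor_sel] tensor_coact_pure[OF X X' x x' F] vs x x' by simp
    also have "... = tsum ?V' K (coact X' x') (%w0 w1. tsum ?V K (coact X x) (%v0 v1. ?E v0 v1 w0 w1))" by (rule tsum_swap)
    also have "... = tsum ?V' K (coact X' x') (%w0 w1. ?L (?f (upure ?V (utensor ?Y ?V') x (upure ?Y ?V' (act Y (antipode K w1) y) w0))))"
    proof (rule tsum_cong[OF HOL.refl])
     fix w0 w1 assume w: "w0 : el ?V'" "w1 : el K"
     have ay: "act Y (antipode K w1) y : el ?Y" using Y y w by simp
     have "(%u. ?L (amap ?Y ?V ?V' (upure (utensor ?Y ?V) ?V' u w0))) : lin (utensor ?Y ?V) ground"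
      by (rule lin_comp[OF lin_comp[OF ev_lin amap_lin] upure_rule1]) (use vs vY w in simp_all)
     from cmap_push[OF V co Y ay x this]
     show "tsum ?V K (coact X x) (%v0 v1. ?E v0 v1 w0 w1) = ?L (?f (upure ?V (utensor ?Y ?V') x (upure ?Y ?V' (act Y (antipode K w1) y) w0)))"
      using vs vY Y y x w elin_lin[OF c] by (simp add: K.antipode_mult act_mult[OF Y])
    qed
    also have "... = ?L (?f (upure ?V (utensor ?Y ?V') x (cmap X' Y (upure ?V' ?Y x' y))))"
     by (rule cmap_push[OF V' co' Y y x', symmetric, OF lin_comp[OF ev_lin lin_comp[OF f upure_rule2]]]) (use vs vY x in simp_all)
    finally show "?L (cmap ?XX Y (upure ?T ?Y (upure ?V ?V' x x') y)) = ?L (?f (upure ?V (utensor ?Y ?V') x (cmap X' Y (upure ?V' ?Y x' y))))" .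
   qed (use V V' lmod_fdvs[OF Y] fu lin_closed[OF cT] vs vY x x' y in simp_all)
   then show "cmap ?XX Y (upure ?T ?Y (upure ?V ?V' x x') y) = ?f (tmap ?V (utensor ?V' ?Y) ?V (utensor ?Y ?V') (\<lambda>v\<in>el ?V. v) (cmap X' Y) (amap ?V ?V' ?Y (upure ?T ?Y (upure ?V ?V' x x') y)))"
    unfolding r .
  qed (use vs vY in simp_all)
 qed
 have snd_eq: "hb (lmod_tensor H ?M ?M') (cmap ?XX) = (\<lambda>Z\<in>Obj RD. Comp RC (Assoc RC Z ?M ?M') (Comp RC (TenA RC (hb ?M (cmap X) Z) (Id RC ?M'))
   (Comp RC (inv_arr RC (Assoc RC ?M Z ?M')) (Comp RC (TenA RC (Id RC ?M) (hb ?M' (cmap X') Z)) (Assoc RC ?M ?M' Z)))))"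
 proof (rule extensionalityI[of _ "Obj RD"])
  fix Z :: "('k, 'h, 'u) lmod" assume Z': "Z : Obj RD"
  then obtain Y where Z: "Z = rs Y" and Y: "fd_lmodule K Y" by (auto simp: RD_sel)
  have inv: "inv_arr RC (Assoc RC ?M (rs Y) ?M') = (lmod_tensor H ?M (lmod_tensor H (rs Y) ?M'), ainv ?V (sp Y) ?V', lmod_tensor H (lmod_tensor H ?M (rs Y)) ?M')"
   using H.Rep.inv_arr_eq[OF H.Rep.assoc_inverse[of ?M "rs Y" ?M']] M fd_lmodule_rs[OF Y] by simp
  let ?Y = "space Y"
  have cT: "cmap ?XX Y : elin (utensor ?T ?Y) (utensor ?Y ?T)" using cmap_elin[OF VT coT Y] by simp
  show "hb (lmod_tensor H ?M ?M') (cmap ?XX) Z = (\<lambda>Z\<in>Obj RD. Comp RC (Assoc RC Z ?M ?M') (Comp RC (TenA RC (hb ?M (cmap X) Z) (Id RC ?M'))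
   (Comp RC (inv_arr RC (Assoc RC ?M Z ?M')) (Comp RC (TenA RC (Id RC ?M) (hb ?M' (cmap X') Z)) (Assoc RC ?M ?M' Z))))) Z"
   using Z' main[OF Y] cT unfolding Z
   by (auto simp: hb_rs[OF Y] inv H.Rep.C_sel(5,6,11) H.Rep.C_sel(13)[of "rs Y"] H.Rep.C_sel(13)[of ?M ?M'] compose_eq intro!: extensionalityI[of _ "el (utensor ?T ?Y)"])
 qed (simp_all add: hb_def)
 show ?thesis
  unfolding center_obj_def center_tensor_def using snd_eq by (simp add: truncate_tensor H.Rep.C_sel(10))
qed

lemma center_obj_unit: "center_obj (yd_unit H K :: ('k, 'h, 'b, 'u) ydmod) = center_unit RC RD"
proof -
 let ?I = "yd_unit H K :: ('k, 'h, 'b, 'u) ydmod" and ?S = "uscalars :: ('k, 'u) space"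
 have I: "fd_lmodule H ?I" "rcomodule K ?I" using yd_unit_yd by auto
 have V: "fdvs (sp ?I)" by simp
 have co: "coact ?I : lin (sp ?I) (tensor (sp ?I) K)" using coact_lin[OF _ I(2)] by simp
 have main: "cmap ?I Y t = upure (sp Y) ?S (lmap (sp Y) t) (Scalar 1)" if Y: "fd_lmodule K Y" and t: "t : el (utensor ?S (sp Y))" for Y t
 proof -
  let ?Y = "space Y"
  note vY = lmod_vsp[OF Y]
  have one: "Scalar 1 : el ?S" by simp
  have c: "cmap ?I Y : lin (utensor ?S ?Y) (utensor ?Y ?S)" using cmap_elin[OF V co Y] by simp
  have r: "(%t. upure ?Y ?S (lmap ?Y t) (Scalar 1)) : lin (utensor ?S ?Y) (utensor ?Y ?S)"
   by (rule upure_rule1[OF vY vs_uscalars _ one]) (use vY in simp)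
  show ?thesis
  proof (rule utensor_ext[OF vs_uscalars vY _ c r _ t])
   fix a y assume a: "a : el ?S" and y: "y : el ?Y"
   obtain d where d: "a = Scalar d" using a by auto
   show "cmap ?I Y (upure ?S ?Y a y) = upure ?Y ?S (lmap ?Y (upure ?S ?Y a y)) (Scalar 1)"
   proof (rule ev_eqI[of "utensor ?Y ?S"])
    fix \<phi> let ?L = "ev (utensor ?Y ?S) \<phi>"
    have F: "bilin ?S K ground (%w k. ?L (upure ?Y ?S (act Y (antipode K k) y) w))"
     using vY Y y by (intro bilinI) (simp_all add: linear del: uscalars_simps)
    have "?L (cmap ?I Y (upure ?S ?Y a y)) = ?L (upure ?Y ?S y a)"
     using cmap_push[OF V co Y y, of a ?L, unfolded yd_unit_sel] a y tsum_pure[OF vs_uscalars K.vsA F a K.one_closed]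
     by (simp add: d K.antipode_one act_one[OF Y])
    moreover have "?L (upure ?Y ?S y a) = d * ?L (upure ?Y ?S y (Scalar 1))"
     using lin_smult[OF lin_comp[OF ev_lin bilin_lin2[OF bilin_upure[OF vY vs_uscalars] y]] one, of \<phi> d] by (simp add: d)
    moreover have "?L (upure ?Y ?S (d \<odot>\<^bsub>?Y\<^esub> y) (Scalar 1)) = d * ?L (upure ?Y ?S y (Scalar 1))"
     using lin_smult[OF lin_comp[OF ev_lin bilin_lin1[OF bilin_upure[OF vY vs_uscalars] one]] y, of \<phi> d] by simp
    ultimately show "?L (cmap ?I Y (upure ?S ?Y a y)) = ?L (upure ?Y ?S (lmap ?Y (upure ?S ?Y a y)) (Scalar 1))"
     using vY y by (simp add: d)
   qed (use lmod_fdvs[OF Y] lin_closed[OF c] lin_closed[OF r] upure_closed[OF vs_uscalars vY a y] in simp_all)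
  qed (use vY in simp)
 qed
 have "hb (lmod_unit H) (cmap ?I) = (\<lambda>Z\<in>Obj RD. Comp RC (inv_arr RC (RUnit RC Z)) (LUnit RC Z))"
 proof (rule extensionalityI[of _ "Obj RD"])
  fix Z :: "('k, 'h, 'u) lmod" assume Z': "Z : Obj RD"
  then obtain Y where Z: "Z = rs Y" and Y: "fd_lmodule K Y" by (auto simp: RD_sel)
  let ?Y = "space Y"
  have c: "cmap ?I Y : elin (utensor ?S ?Y) (utensor ?Y ?S)" using cmap_elin[OF V co Y] by simp
  have inv: "inv_arr RC (RUnit RC (rs Y)) = (rs Y, \<lambda>v\<in>el ?Y. upure ?Y ?S v (Scalar 1), lmod_tensor H (rs Y) (lmod_unit H))"
   using H.Rep.inv_arr_eq[OF H.Rep.runit_inverse[of "rs Y"]] fd_lmodule_rs[OF Y] by simp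
  have "cmap ?I Y = compose (el (utensor ?S ?Y)) (\<lambda>v\<in>el ?Y. upure ?Y ?S v (Scalar 1)) (lmap ?Y)"
   by (rule extensionalityI[of _ "el (utensor ?S ?Y)"])
    (use c main[OF Y] lin_closed[OF lmap_lin[OF lmod_vsp[OF Y]]] in \<open>simp_all add: compose_eq\<close>)
  then show "hb (lmod_unit H) (cmap ?I) Z = (\<lambda>Z\<in>Obj RD. Comp RC (inv_arr RC (RUnit RC Z)) (LUnit RC Z)) Z"
   using Z' unfolding Z by (simp add: hb_rs[OF Y] inv H.Rep.C_sel(6,14))
 qed (simp_all add: hb_def)
 then show ?thesis unfolding center_obj_def center_unit_def by (simp add: truncate_unit H.Rep.C_sel(12))
qed

end

context surjective_pairing begin

theorem yd_iso_center:
 "strict_iso (YD TYPE('u) H K \<sigma>) (relative_center (Rep TYPE('u) H) (Rep_restricted TYPE('u) H K p)) center_obj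
  (%(X, f, Y). (center_obj X, (lmod.truncate X, f, lmod.truncate Y), center_obj Y))"
 unfolding YD_C[symmetric] H.Rep_C[symmetric]
proof (rule strict_iso.intro)
 let ?Fa = "%(X, f, Y). (center_obj X, (lmod.truncate X, f, lmod.truncate Y), center_obj (Y :: ('k, 'h, 'b, 'u) ydmod))"
 have tr: "fst (center_obj X) = lmod.truncate X" for X :: "('k, 'h, 'b, 'u) ydmod" by (simp add: center_obj_def)
 have co: "center_obj X = (lmod.truncate X, snd (center_obj X))" for X :: "('k, 'h, 'b, 'u) ydmod" by (simp add: center_obj_def)
 have inj: "X = Y" if "yd X" "yd Y" "center_obj X = center_obj Y" for X Y :: "('k, 'h, 'b, 'u) ydmod"
  using center_obj_bij that unfolding bij_betw_def inj_on_def by blast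
 have hbr: "fd_lmodule H (lmod.truncate X) \<and> half_braiding RC RD (lmod.truncate X) (snd (center_obj X))" if "yd X" for X :: "('k, 'h, 'b, 'u) ydmod"
 proof -
  have "center_obj X : Obj ZC" using center_obj_bij that unfolding bij_betw_def by blast
  then show ?thesis using co[of X] by (simp add: ZC_sel(1) split: prod.splits)
 qed
 have surj: "\<exists>X :: ('k, 'h, 'b, 'u) ydmod. yd X \<and> (M, c) = center_obj X" if "fd_lmodule H M" "half_braiding RC RD M c" for M :: "('k, 'h, 'u) lmod" and c
 proof -
  have "(M, c) : Obj ZC" using that by (simp add: ZC_sel(1))
  then show ?thesis using center_obj_bij unfolding bij_betw_def by blast
 qed
 show "bij_betw center_obj (Obj YD.C) (Obj ZC)" using center_obj_bij by (simp add: YD.C_sel(1))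
 show "bij_betw ?Fa (Arr YD.C) (Arr ZC)"
  unfolding bij_betw_def
 proof
  show "inj_on ?Fa (Arr YD.C)" unfolding YD.C_sel(2) by (rule inj_onI) (auto intro!: inj)
  show "?Fa ` Arr YD.C = Arr ZC"
  proof (intro equalityI subsetI)
   fix h assume "h : ?Fa ` Arr YD.C"
   then obtain X f Y where h: "h = ?Fa (X, f, Y)" and X: "yd X" and Y: "yd Y" and f: "f : elin (sp X) (sp Y)" "module_map H X Y f" "comodule_map K X Y f"
    unfolding YD.C_sel(2) by auto
   have "(lmod.truncate X, f, lmod.truncate Y) : Hom RC (lmod.truncate X) (lmod.truncate Y)"
    using X Y f by (simp add: H.Rep.Hom_iff fd_lmodule_truncate module_map_truncate[symmetric])
   moreover have "\<forall>Z\<in>Obj RD. Comp RC (TenA RC (Id RC Z) (lmod.truncate X, f, lmod.truncate Y)) (snd (center_obj X) Z)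
     = Comp RC (snd (center_obj Y) Z) (TenA RC (lmod.truncate X, f, lmod.truncate Y) (Id RC Z))"
    using center_arr_iff[of X Y f] X Y f by simp
   ultimately show "h : Arr ZC"
    unfolding h ZC_sel(2) prod.case using hbr[OF X] hbr[OF Y] co[of X] co[of Y] by blast
  next
   fix h assume "h : Arr (ZC :: ('k, ('k, 'h, 'u) lmod \<times> _, _) tcat)"
   then obtain M M' :: "('k, 'h, 'u) lmod" and c g c' where h: "h = ((M, c), g, (M', c'))" and M: "fd_lmodule H M" "half_braiding RC RD M c" and M': "fd_lmodule H M'" "half_braiding RC RD M' c'"
    and g: "g : Hom RC M M'" "\<forall>Y\<in>Obj RD. Comp RC (TenA RC (Id RC Y) g) (c Y) = Comp RC (c' Y) (TenA RC g (Id RC Y))"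
    unfolding ZC_sel(2) by blast
   obtain X :: "('k, 'h, 'b, 'u) ydmod" where X: "yd X" "(M, c) = center_obj X" using surj[OF M] by blast
   obtain Y :: "('k, 'h, 'b, 'u) ydmod" where Y: "yd Y" "(M', c') = center_obj Y" using surj[OF M'] by blast
   have MM: "M = lmod.truncate X" "c = snd (center_obj X)" "M' = lmod.truncate Y" "c' = snd (center_obj Y)"
    using X(2) Y(2) by (simp_all add: center_obj_def)
   obtain f where f: "g = (lmod.truncate X, f, lmod.truncate Y)" "f : elin (sp X) (sp Y)" "module_map H X Y f"
    using g(1) unfolding MM by (auto simp: H.Rep.Hom_iff module_map_truncate[symmetric])
   have "comodule_map K X Y f"
    using center_arr_iff[of X Y f] X Y f(2) g(2) unfolding MM f(1) by blast
   then have "(X, f, Y) : Arr YD.C" using X Y f by (simp add: YD.C_sel(2))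
   then show "h : ?Fa ` Arr YD.C" by (rule rev_image_eqI) (use h X Y f in simp)
  qed
 qed
 show "linear_monoidal_category YD.C" by (rule YD.C_monoidal)
 have ten: "center_obj (yd_tensor H K X Y) = center_tensor RC RD (center_obj X) (center_obj Y)"
  if "yd X" "yd Y" for X Y :: "('k, 'h, 'b, 'u) ydmod" using center_obj_tensor that by blast
 have un: "yd (yd_unit H K :: ('k, 'h, 'b, 'u) ydmod)" by (rule yd_unit_yd)
 have tt: "yd (yd_tensor H K X Y)" if "yd X" "yd Y" for X Y :: "('k, 'h, 'b, 'u) ydmod"
  using yd_tensor_yd that by blast
 note sel = YD.C_sel(3-) ZC_sel(3-) H.Rep.C_sel(3-) ten[symmetric] center_obj_unit[symmetric] tr truncate_tensor truncate_unit
 fix X Y Z W :: "('k, 'h, 'b, 'u) ydmod" and a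
 { fix f :: "('k, 'h, 'b, 'u) yd_arr" assume f: "f : Arr YD.C"
  show "Dom ZC (?Fa f) = center_obj (Dom YD.C f)" "Cod ZC (?Fa f) = center_obj (Cod YD.C f)"
   by (cases f, simp add: sel)+ }
 { fix f g :: "('k, 'h, 'b, 'u) yd_arr" assume "f : Hom YD.C X Y"
  then obtain f' where f: "f = (X, f', Y)" "yd X" "yd Y" by (auto elim: YD.HomE)
  show "?Fa (Scale YD.C a f) = Scale ZC a (?Fa f)" by (simp add: f sel)
  { assume "g : Hom YD.C Y Z"
   then obtain g' where g: "g = (Y, g', Z)" by (auto elim: YD.HomE)
   show "?Fa (Comp YD.C g f) = Comp ZC (?Fa g) (?Fa f)" by (simp add: f g sel) }
  { assume "g : Hom YD.C X Y"
   then obtain g' where g: "g = (X, g', Y)" by (auto elim: YD.HomE)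
   show "?Fa (Add YD.C f g) = Add ZC (?Fa f) (?Fa g)" by (simp add: f g sel) }
  { assume "g : Hom YD.C Z W"
   then obtain g' where g: "g = (Z, g', W)" "yd Z" "yd W" by (auto elim: YD.HomE)
   show "?Fa (TenA YD.C f g) = TenA ZC (?Fa f) (?Fa g)" using f g by (simp add: sel) } }
 show "center_obj (Unit YD.C) = Unit ZC" by (simp add: sel)
 assume "X : Obj YD.C"
 then have X: "yd X" by (simp add: YD.C_sel(1))
 show "?Fa (Id YD.C X) = Id ZC (center_obj X)" by (simp add: sel)
 show "?Fa (LUnit YD.C X) = LUnit ZC (center_obj X)" "?Fa (RUnit YD.C X) = RUnit ZC (center_obj X)"
  using X un by (simp_all add: sel)
 assume "Y : Obj YD.C"
 then have Y: "yd Y" by (simp add: YD.C_sel(1))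
 show "?Fa (Zero YD.C X Y) = Zero ZC (center_obj X) (center_obj Y)" by (simp add: sel)
 show "center_obj (TenO YD.C X Y) = TenO ZC (center_obj X) (center_obj Y)" using X Y by (simp add: sel)
 assume "Z : Obj YD.C"
 then have Z: "yd Z" by (simp add: YD.C_sel(1))
 show "?Fa (Assoc YD.C X Y Z) = Assoc ZC (center_obj X) (center_obj Y) (center_obj Z)"
  using X Y Z tt[OF X Y] tt[OF Y Z] by (simp add: sel)
qed

end

theorem proposition3p16:
  fixes H :: "('k::field, 'h) hopf" and K :: "('k, 'b) hopf"
    and \<sigma> :: "('b \<Rightarrow> 'k) \<Rightarrow> 'h \<Rightarrow> 'k"
  assumes "fd_hopf_algebra H" and "fd_hopf_algebra K"
    and "hopf_pairing (dual_hopf K) H \<sigma>"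
    and "sigma_r K \<sigma> ` carrier H = carrier K"
  shows "tensor_equivalent
           (relative_center (Rep TYPE('u) H) (Rep_restricted TYPE('u) H K (sigma_r K \<sigma>)))
           (Rep TYPE('u) (quantum_double H K \<sigma>)) \<and>
         tensor_equivalent
           (Rep TYPE('u) (quantum_double H K \<sigma>))
           (YD TYPE('u) H K \<sigma>)"
proof -
 interpret surjective_pairing H K \<sigma>
  using assms by (intro surjective_pairing.intro surjective_pairing_axioms.intro)
 show ?thesis
  using strict_iso_tensor_equivalent[OF strict_iso_trans[OF strict_iso_sym[OF yd_iso_center] yd_iso_double]]
   strict_iso_tensor_equivalent[OF strict_iso_sym[OF yd_iso_double]] by blast
qed

end
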